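(* Let $A_1\in\mathbb C^{n_1\times n_1}$, $A_2\in\mathbb C^{n_2\times n_2}$, $C\in\mathbb C^{m\times n}$, $n=n_1+n_2$, and let $M,N$ be as in the context. Assume that $\sigma(A_1)\cup\sigma(A_2)\subset\mathbb D$; that $P\in\mathbb C^{n\times n}$ is a Hermitian solution of $M^*PM-N^*PN=C^*j_{pq}C$; that the pairs $(C_{12},A_2)$ and $(C_{21},A_1)$ are observable; and that $X\in\mathbb C^{n\times n}$ is a Hermitian matrix with $XPX=X$, $PXP=P$ and $\operatorname{ran}X$ invariant under $M$ and $N$. Let $\kappa_1=\nu_-(P)$, let $W,b_1,b_2,\widetilde\varphi_{11},\widetilde\varphi_{12},\varphi_{21},\varphi_{22}$ be as in the context, and let $\varepsilon\in\mathcal S_{\kappa_2}^{p\times q}$ admit the Kreĭn–Langer factorizations $\varepsilon=\theta_\ell^{-1}\varepsilon_\ell=\varepsilon_r\theta_r^{-1}$. Then $$M_\zeta(\varphi_{21}\varepsilon_r+\varphi_{22}\theta_r,\mathbb D)=M_\zeta(\theta_\ell\widetilde\varphi_{11}^\#+\varepsilon_\ell\widetilde\varphi_{12}^\#,\mathbb D)=\kappa_1+\kappa_2.$$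
   Context: Notation. $p,q\ge1$, $m=p+q$, $j_{pq}=\begin{bmatrix}I_p&0\\ 0&-I_q\end{bmatrix}$, $\mathbb D=\{|\lambda|<1\}$, $\mathbb T=\partial\mathbb D$, $\Omega_-=\{|\lambda|>1\}$ (with the point $\infty$ included), "mvf" = matrix valued function, $f^\#(\lambda)=f(1/\overline\lambda)^*$. $\nu_-(P)$ is the number of negative eigenvalues of $P$ with multiplicities. A pair $(C_0,A_0)$ is observable if $\bigcap_{j\ge0}\ker C_0A_0^j=\{0\}$. Generalized Schur class. $\mathcal S_\kappa^{p\times q}$ is the set of $p\times q$ mvf's $s$ meromorphic in $\mathbb D$ for which the kernel $\frac{I_p-s(\lambda)s(\omega)^*}{1-\lambda\overline\omega}$ has $\kappa$ negative squares on the domain of holomorphy of $s$ in $\mathbb D$ (all the associated finite Hermitian Gram matrices have at most $\kappa$ negative eigenvalues, and some has exactly $\kappa$). $\mathcal S^{p\times q}=\mathcal S_0^{p\times q}$ is the Schur class. A Blaschke–Potapov product of degree $\kappa$ is, up to a constant unitary factor, a product of $\kappa$ factors $I-\Pi+\frac{\lambda-\alpha}{1-\overline\alpha\lambda}\Pi$ with $\alpha\in\mathbb D$, $\Pi$ a rank one orthogonal projection. Kreĭn–Langer factorizations of $\varepsilon\in\mathcal S_\kappa^{p\times q}$ are factorizations $\varepsilon=\theta_\ell^{-1}\varepsilon_\ell=\varepsilon_r\theta_r^{-1}$ with $\theta_\ell$ ($p\times p$), $\theta_r$ ($q\times q$) Blaschke–Potapov products of degree $\kappa$, $\varepsilon_\ell,\varepsilon_r\in\mathcal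 S^{p\times q}$, $\operatorname{rank}[\theta_\ell\ \varepsilon_\ell]=p$ and $\operatorname{rank}[\theta_r^*\ \varepsilon_r^*]=q$ at every point of $\mathbb D$. Data. $n_1,n_2\ge0$, $n=n_1+n_2\ge1$, $M=\begin{bmatrix}A_1&0\\ 0&I_{n_2}\end{bmatrix}$, $N=\begin{bmatrix}I_{n_1}&0\\ 0&A_2\end{bmatrix}$, $C=\begin{bmatrix}C_{11}&C_{12}\\ C_{21}&C_{22}\end{bmatrix}$ with $C_{1j}\in\mathbb C^{p\times n_j}$, $C_{2j}\in\mathbb C^{q\times n_j}$, $F(\lambda)=C(M-\lambda N)^{-1}$, $X=[X_{ij}]$ with $X_{ij}\in\mathbb C^{n_i\times n_j}$. (If $n_1=0$ or $n_2=0$ the corresponding blocks, and conditions on them, are absent.) Fix $\mu\in\mathbb T$; $W(\lambda)=I_m-(1-\lambda\overline\mu)F(\lambda)XF(\mu)^*j_{pq}=\begin{bmatrix}w_{11}&w_{12}\\ w_{21}&w_{22}\end{bmatrix}$ ($w_{11}$: $p\times p$, $w_{22}$: $q\times q$). $b_1$ ($p\times p$) and $b_2$ ($q\times q$) are the Blaschke–Potapov products defined (up to a constant unitary factor) by the coprime factorizations $\lambda C_{12}(I_{n_2}-\lambda A_2)^{-1}[X_{21}\ X_{22}]=b_1(\lambda)\varphi_1(\lambda)=(b_1^\#(\lambda))^{-1}\varphi_1(\lambda)$ with $\varphi_1$ rational and bounded holomorphic in $\Omega_-$ and $[b_1^\#\ \varphi_1]$ of full row rank at every point of $\Omega_-$,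 and $C_{21}(A_1-\lambda I_{n_1})^{-1}[X_{11}\ X_{12}]=b_2(\lambda)^{-1}\varphi_2(\lambda)$ with $\varphi_2$ rational and bounded holomorphic in $\mathbb D$ and $[b_2\ \varphi_2]$ of full row rank at every point of $\mathbb D$. The mvf's $\widetilde\varphi_{11},\widetilde\varphi_{12}$ (rational, bounded holomorphic in $\Omega_-$) and $\varphi_{21},\varphi_{22}$ (rational, bounded holomorphic in $\mathbb D$) are defined by $[w_{11}\ w_{12}]=b_1[\widetilde\varphi_{11}\ \widetilde\varphi_{12}]$ and $[w_{21}\ w_{22}]=b_2^{-1}[\varphi_{21}\ \varphi_{22}]$. Multiplicities. If $G(\lambda)=\sum_{j\ge-k}(\lambda-\lambda_0)^jG_j$ is the Laurent expansion of a meromorphic mvf at a pole $\lambda_0\in\mathbb D$, its pole multiplicity $M_\pi(G,\lambda_0)$ is the rank of the lower block triangular block Toeplitz matrix $\begin{bmatrix}G_{-k}&&0\\ \vdots&\ddots&\\ G_{-1}&\cdots&G_{-k}\end{bmatrix}$; $M_\pi(G,\mathbb D)=\sum_{\lambda\in\mathbb D}M_\pi(G,\lambda)$. For square $G$ with $\det G\not\equiv0$, the zero multiplicity is $M_\zeta(G,\mathbb D)=M_\pi(G^{-1},\mathbb D)$. *)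

theory Defs
  imports
    "HOL-Complex_Analysis.Complex_Analysis"
    "Jordan_Normal_Form.Matrix"
    "Jordan_Normal_Form.Determinant"
    "Jordan_Normal_Form.Gauss_Jordan_Elimination"
    "Jordan_Normal_Form.Char_Poly"
    "Jordan_Normal_Form.Schur_Decomposition"
    "Jordan_Normal_Form.Spectral_Radius"
    "Jordan_Normal_Form.DL_Rank"
    "Jordan_Normal_Form.Matrix_Kernel"
begin

text \<open>
  Matrices are those of Jordan_Normal_Form, so that sizes are natural numbers and may be zero.
  A matrix valued function (mvf) is a function from the complex numbers to complex matrices;
  its values at poles are irrelevant. An identity between meromorphic mvf's is required at all
  points off a set without accumulation points in the region (the filter \<open>cosparse\<close>).
\<close>

definition mat_inv :: "complex mat \<Rightarrow> complex mat" where
  "mat_inv A = (case mat_inverse A of Some B \<Rightarrow> B | None \<Rightarrow> 0\<^sub>m (dim_row A) (dim_row A))"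

definition mat_rank :: "complex mat \<Rightarrow> nat" where
  "mat_rank A = vec_space.rank (dim_row A) A"

definition hcat :: "complex mat \<Rightarrow> complex mat \<Rightarrow> complex mat" where
  "hcat A B = mat_of_cols (dim_row A) (cols A @ cols B)"

definition mat_range :: "complex mat \<Rightarrow> complex vec set" where
  "mat_range A = (\<lambda>v. A *\<^sub>v v) ` carrier_vec (dim_col A)"

definition hermitian_mat :: "nat \<Rightarrow> complex mat \<Rightarrow> bool" where
  "hermitian_mat n A \<longleftrightarrow> A \<in> carrier_mat n n \<and> mat_adjoint A = A"

definition unitary_mat :: "nat \<Rightarrow> complex mat \<Rightarrow> bool" where
  "unitary_mat n U \<longleftrightarrow> U \<in> carrier_mat n n \<and> mat_adjoint U * U = 1\<^sub>m n \<and> U * mat_adjoint U = 1\<^sub>m n"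

text \<open>The number of negative eigenvalues, counted with (algebraic) multiplicities; it is used
  for Hermitian matrices only.\<close>

definition neg_eigs :: "complex mat \<Rightarrow> nat" where
  "neg_eigs P =
     (\<Sum>e\<in>{e. eigenvalue P e \<and> e \<in> \<real> \<and> Re e < 0}. Polynomial.order e (char_poly P))"

definition observable :: "nat \<Rightarrow> complex mat \<Rightarrow> complex mat \<Rightarrow> bool" where
  "observable n C0 A0 \<longleftrightarrow> (\<Inter>j. mat_kernel (C0 * A0 ^\<^sub>m j)) = {0\<^sub>v n}"

definition jpq :: "nat \<Rightarrow> nat \<Rightarrow> complex mat" where
  "jpq p q = four_block_mat (1\<^sub>m p) (0\<^sub>m p q) (0\<^sub>m q p) (- 1\<^sub>m q)"

text \<open>The region \<open>\<Omega>\<^sub>-\<close> is the following set together with the point at infinity.\<close>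

definition Omega_minus :: "complex set" where
  "Omega_minus = {z. 1 < cmod z}"

definition rational_mvf :: "nat \<Rightarrow> nat \<Rightarrow> (complex \<Rightarrow> complex mat) \<Rightarrow> bool" where
  "rational_mvf r c \<Phi> \<longleftrightarrow>
     (\<exists>(num :: nat \<Rightarrow> nat \<Rightarrow> complex poly) (den :: complex poly). den \<noteq> 0 \<and>
        (\<forall>z. poly den z \<noteq> 0 \<longrightarrow> \<Phi> z = mat r c (\<lambda>(i, j). poly (num i j) z / poly den z)))"

text \<open>On \<open>Omega_minus\<close>, boundedness includes holomorphy at infinity (removable singularity).\<close>

definition bounded_holomorphic_mvf ::
    "nat \<Rightarrow> nat \<Rightarrow> complex set \<Rightarrow> (complex \<Rightarrow> complex mat) \<Rightarrow> bool" where
  "bounded_holomorphic_mvf r c S \<Phi> \<longleftrightarrow>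
     (\<forall>z\<in>S. \<Phi> z \<in> carrier_mat r c) \<and>
     (\<forall>i<r. \<forall>j<c. (\<lambda>z. \<Phi> z $$ (i, j)) holomorphic_on S \<and> bounded ((\<lambda>z. \<Phi> z $$ (i, j)) ` S))"

definition mvf_infinity :: "nat \<Rightarrow> nat \<Rightarrow> (complex \<Rightarrow> complex mat) \<Rightarrow> complex mat" where
  "mvf_infinity r c \<Phi> = mat r c (\<lambda>(i, j). Lim at_infinity (\<lambda>z. \<Phi> z $$ (i, j)))"

text \<open>\<open>\<Phi>\<^sup>#(z) = \<Phi>(1 / cnj z)\<^sup>*\<close> for an \<open>r\<close> by \<open>c\<close> mvf; at \<open>0\<close> the value of \<open>\<Phi>\<close> at infinity is used.\<close>

definition mvf_sharp :: "nat \<Rightarrow> nat \<Rightarrow> (complex \<Rightarrow> complex mat) \<Rightarrow> complex \<Rightarrow> complex mat" where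
  "mvf_sharp r c \<Phi> z = mat_adjoint (if z = 0 then mvf_infinity r c \<Phi> else \<Phi> (1 / cnj z))"

definition bp_factor :: "nat \<Rightarrow> complex \<Rightarrow> complex mat \<Rightarrow> complex \<Rightarrow> complex mat" where
  "bp_factor n \<alpha> E z = 1\<^sub>m n - E + ((z - \<alpha>) / (1 - cnj \<alpha> * z)) \<cdot>\<^sub>m E"

definition rank_one_projection :: "nat \<Rightarrow> complex mat \<Rightarrow> bool" where
  "rank_one_projection n E \<longleftrightarrow> hermitian_mat n E \<and> E * E = E \<and> mat_rank E = 1"

text \<open>A constant unitary factor can be moved through the elementary factors (conjugating the
  projections), so it suffices to allow it on the left.\<close>

definition blaschke_potapov :: "nat \<Rightarrow> nat \<Rightarrow> (complex \<Rightarrow> complex mat) \<Rightarrow> bool" where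
  "blaschke_potapov n \<kappa> B \<longleftrightarrow>
     (\<exists>U fs. unitary_mat n U \<and> length fs = \<kappa> \<and>
        (\<forall>(\<alpha>, E)\<in>set fs. \<alpha> \<in> ball 0 1 \<and> rank_one_projection n E) \<and>
        (\<forall>z. B z = U * foldr (\<lambda>(\<alpha>, E) R. bp_factor n \<alpha> E z * R) fs (1\<^sub>m n)))"

definition schur_kernel :: "nat \<Rightarrow> (complex \<Rightarrow> complex mat) \<Rightarrow> complex \<Rightarrow> complex \<Rightarrow> complex mat" where
  "schur_kernel p s z \<omega> = (1 / (1 - z * cnj \<omega>)) \<cdot>\<^sub>m (1\<^sub>m p - s z * mat_adjoint (s \<omega>))"

text \<open>The Gram matrix with entries \<open>u\<^sub>i\<^sup>* K(\<omega>\<^sub>i, \<omega>\<^sub>j) u\<^sub>j\<close>.\<close>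

definition gram_mat ::
    "(complex \<Rightarrow> complex \<Rightarrow> complex mat) \<Rightarrow> nat \<Rightarrow> (nat \<Rightarrow> complex) \<Rightarrow> (nat \<Rightarrow> complex vec) \<Rightarrow> complex mat"
  where
  "gram_mat K k \<omega> u = mat k k (\<lambda>(i, j). (K (\<omega> i) (\<omega> j) *\<^sub>v u j) \<bullet>c u i)"

definition has_negative_squares ::
    "nat \<Rightarrow> complex set \<Rightarrow> (complex \<Rightarrow> complex \<Rightarrow> complex mat) \<Rightarrow> nat \<Rightarrow> bool" where
  "has_negative_squares p S K \<kappa> \<longleftrightarrow>
     (\<forall>k \<omega> u. (\<forall>i<k. \<omega> i \<in> S \<and> u i \<in> carrier_vec p) \<longrightarrow> neg_eigs (gram_mat K k \<omega> u) \<le> \<kappa>) \<and>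
     (\<exists>k \<omega> u. (\<forall>i<k. \<omega> i \<in> S \<and> u i \<in> carrier_vec p) \<and> neg_eigs (gram_mat K k \<omega> u) = \<kappa>)"

definition holomorphy_domain ::
    "nat \<Rightarrow> nat \<Rightarrow> complex set \<Rightarrow> (complex \<Rightarrow> complex mat) \<Rightarrow> complex set" where
  "holomorphy_domain p q S s =
     {z\<in>S. \<forall>i<p. \<forall>j<q. (\<lambda>w. s w $$ (i, j)) analytic_on {z}}"

text \<open>Meromorphic mvf's are represented with their removable singularities removed
  (\<open>nicely_meromorphic_on\<close>; an entry has the value \<open>0\<close> at its poles).\<close>

definition gen_schur :: "nat \<Rightarrow> nat \<Rightarrow> nat \<Rightarrow> (complex \<Rightarrow> complex mat) \<Rightarrow> bool" where
  "gen_schur p q \<kappa> s \<longleftrightarrow>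
     (\<forall>z\<in>ball 0 1. s z \<in> carrier_mat p q) \<and>
     (\<forall>i<p. \<forall>j<q. (\<lambda>z. s z $$ (i, j)) nicely_meromorphic_on ball 0 1) \<and>
     has_negative_squares p (holomorphy_domain p q (ball 0 1) s) (schur_kernel p s) \<kappa>"

abbreviation schur :: "nat \<Rightarrow> nat \<Rightarrow> (complex \<Rightarrow> complex mat) \<Rightarrow> bool" where
  "schur p q \<equiv> gen_schur p q 0"

definition left_krein_langer ::
    "nat \<Rightarrow> nat \<Rightarrow> nat \<Rightarrow> (complex \<Rightarrow> complex mat) \<Rightarrow> (complex \<Rightarrow> complex mat) \<Rightarrow>
     (complex \<Rightarrow> complex mat) \<Rightarrow> bool" where
  "left_krein_langer p q \<kappa> \<epsilon> \<theta> \<epsilon>l \<longleftrightarrow>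
     blaschke_potapov p \<kappa> \<theta> \<and> schur p q \<epsilon>l \<and>
     (\<forall>\<^sub>\<approx>z\<in>ball 0 1. \<epsilon> z = mat_inv (\<theta> z) * \<epsilon>l z) \<and>
     (\<forall>z\<in>ball 0 1. mat_rank (hcat (\<theta> z) (\<epsilon>l z)) = p)"

definition right_krein_langer ::
    "nat \<Rightarrow> nat \<Rightarrow> nat \<Rightarrow> (complex \<Rightarrow> complex mat) \<Rightarrow> (complex \<Rightarrow> complex mat) \<Rightarrow>
     (complex \<Rightarrow> complex mat) \<Rightarrow> bool" where
  "right_krein_langer p q \<kappa> \<epsilon> \<epsilon>r \<theta> \<longleftrightarrow>
     blaschke_potapov q \<kappa> \<theta> \<and> schur p q \<epsilon>r \<and>
     (\<forall>\<^sub>\<approx>z\<in>ball 0 1. \<epsilon> z = \<epsilon>r z * mat_inv (\<theta> z)) \<and>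
     (\<forall>z\<in>ball 0 1. mat_rank (hcat (mat_adjoint (\<theta> z)) (mat_adjoint (\<epsilon>r z))) = q)"

definition F_mvf :: "complex mat \<Rightarrow> complex mat \<Rightarrow> complex mat \<Rightarrow> complex \<Rightarrow> complex mat" where
  "F_mvf C M N z = C * mat_inv (M - z \<cdot>\<^sub>m N)"

definition W_mvf ::
    "nat \<Rightarrow> nat \<Rightarrow> complex mat \<Rightarrow> complex mat \<Rightarrow> complex mat \<Rightarrow> complex mat \<Rightarrow> complex \<Rightarrow>
     complex \<Rightarrow> complex mat" where
  "W_mvf p q C M N X \<mu> z =
     1\<^sub>m (p + q) -
     (1 - z * cnj \<mu>) \<cdot>\<^sub>m (F_mvf C M N z * X * mat_adjoint (F_mvf C M N \<mu>) * jpq p q)"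

text \<open>The factorization is \<open>H = b \<phi> = (b\<^sup>#)\<^sup>-\<^sup>1 \<phi>\<close>; the two forms agree because \<open>b b\<^sup># = I\<close> for a
  Blaschke--Potapov product. Coprimeness is required on \<open>\<Omega>\<^sub>-\<close>, the last conjunct being the
  point at infinity. The degree \<open>d\<close> of \<open>b\<close> is not prescribed.\<close>

definition exterior_coprime_factor ::
    "nat \<Rightarrow> nat \<Rightarrow> (complex \<Rightarrow> complex mat) \<Rightarrow> (complex \<Rightarrow> complex mat) \<Rightarrow> bool" where
  "exterior_coprime_factor p n H b \<longleftrightarrow>
     (\<exists>d \<phi>. blaschke_potapov p d b \<and> rational_mvf p n \<phi> \<and>
        bounded_holomorphic_mvf p n Omega_minus \<phi> \<and>
        (\<forall>\<^sub>\<approx>z. H z = b z * \<phi> z) \<and>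
        (\<forall>z\<in>Omega_minus. mat_rank (hcat (mvf_sharp p p b z) (\<phi> z)) = p) \<and>
        mat_rank (hcat (mvf_infinity p p (mvf_sharp p p b)) (mvf_infinity p n \<phi>)) = p)"

definition disc_coprime_factor ::
    "nat \<Rightarrow> nat \<Rightarrow> (complex \<Rightarrow> complex mat) \<Rightarrow> (complex \<Rightarrow> complex mat) \<Rightarrow> bool" where
  "disc_coprime_factor q n H b \<longleftrightarrow>
     (\<exists>d \<phi>. blaschke_potapov q d b \<and> rational_mvf q n \<phi> \<and>
        bounded_holomorphic_mvf q n (ball 0 1) \<phi> \<and>
        (\<forall>\<^sub>\<approx>z. H z = mat_inv (b z) * \<phi> z) \<and>
        (\<forall>z\<in>ball 0 1. mat_rank (hcat (b z) (\<phi> z)) = q))"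

definition laurent_coeff ::
    "nat \<Rightarrow> nat \<Rightarrow> (complex \<Rightarrow> complex mat) \<Rightarrow> complex \<Rightarrow> int \<Rightarrow> complex mat" where
  "laurent_coeff r c G z0 k =
     mat r c (\<lambda>(i, j). fls_nth (laurent_expansion (\<lambda>z. G z $$ (i, j)) z0) k)"

text \<open>The order of the pole; \<open>0\<close> at points where there is no pole.\<close>

definition mvf_pole_order :: "nat \<Rightarrow> nat \<Rightarrow> (complex \<Rightarrow> complex mat) \<Rightarrow> complex \<Rightarrow> nat" where
  "mvf_pole_order r c G z0 = (LEAST k. \<forall>l < - int k. laurent_coeff r c G z0 l = 0\<^sub>m r c)"

text \<open>Rank of the lower block triangular block Toeplitz matrix whose \<open>(a, b)\<close> block is the Laurent
  coefficient of index \<open>a - b - k\<close> for \<open>b \<le> a < k\<close>, where \<open>k\<close> is the order of the pole.\<close>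

definition pole_mult_at :: "nat \<Rightarrow> nat \<Rightarrow> (complex \<Rightarrow> complex mat) \<Rightarrow> complex \<Rightarrow> nat" where
  "pole_mult_at r c G z0 =
     (let k = mvf_pole_order r c G z0 in
      mat_rank (mat (k * r) (k * c) (\<lambda>(i, j).
        let a = i div r; b = j div c in
        if b \<le> a
        then laurent_coeff r c G z0 (int a - int b - int k) $$ (i mod r, j mod c)
        else 0)))"

text \<open>The sum is taken in \<open>enat\<close>, so that infinitely many poles give the value \<open>\<infinity>\<close>.\<close>

definition pole_mult :: "nat \<Rightarrow> nat \<Rightarrow> (complex \<Rightarrow> complex mat) \<Rightarrow> complex set \<Rightarrow> enat" where
  "pole_mult r c G S = (\<Sum>\<^sub>\<infinity>z\<in>S. enat (pole_mult_at r c G z))"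

text \<open>Meaningful for \<open>r\<close> by \<open>r\<close> mvf's whose determinant does not vanish identically.\<close>

definition zero_mult :: "nat \<Rightarrow> (complex \<Rightarrow> complex mat) \<Rightarrow> complex set \<Rightarrow> enat" where
  "zero_mult r G S = pole_mult r r (\<lambda>z. mat_inv (G z)) S"

end

theory Submission
  imports Defs
begin

text \<open>
  The zero multiplicity of a square mvf \<open>G\<close> in the disc is the number of zeros of \<open>det G\<close>: the block
  Toeplitz rank that defines the pole multiplicity of \<open>G\<^sup>-\<^sup>1\<close> at a point is the order of the zero of
  \<open>det G\<close> there (\<open>pole_mult_at_mat_inv\<close>). Both multiplicities of the theorem can therefore be computed
  by the argument principle, and two homotopies of the image of a circle give their value.

  Let \<open>G1 = \<phi>21 \<epsilon>r + \<phi>22 \<theta>r\<close>. The Lyapunov equation is an energy balance; on the unit circle it says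
  \<open>w22 w22\<^sup>* - w21 w21\<^sup>* = I\<close> (\<open>circle_identity\<close>). As \<open>b2\<close> and \<open>\<theta>r\<close> are unitary there, the matrix
  \<open>(\<phi>22 \<theta>r) (\<phi>22 \<theta>r)\<^sup>* - \<phi>21 \<phi>21\<^sup>*\<close> is positive near the circle. The values of \<open>\<epsilon>r\<close> being contractions,
  \<open>t \<phi>21 \<epsilon>r + \<phi>22 \<theta>r\<close> is invertible near the circle for \<open>0 \<le> t \<le> 1\<close>, and \<open>G1\<close> has as many zeros as
  \<open>\<phi>22 \<theta>r\<close>, that is, \<open>\<kappa>2\<close> more than \<open>\<phi>22\<close> (\<open>linear_fractional_zero_count\<close>).

  It remains to see that \<open>\<phi>22 = b2 w22\<close> has \<open>\<kappa>1\<close> zeros. On the range of \<open>X\<close> the form \<open>P\<close> is nondegenerate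
  and becomes a signature matrix \<open>J\<close> with \<open>\<kappa>1\<close> entries \<open>-1\<close> (\<open>invariant_range\<close>). For the restriction \<open>D\<close>
  of the pencil \<open>M - z N\<close> to this range, \<open>det w22 = det L / det D\<close>, where \<open>L\<close> is a feedback
  perturbation of \<open>D\<close> (\<open>det_w22\<close>). Coprimeness of the factorization defining \<open>b2\<close> together with observability
  says that \<open>b2\<^sup>-\<^sup>1 \<psi> = C D\<^sup>-\<^sup>1\<close> are two coprime factorizations of one function, so that \<open>det b2\<close> and \<open>det D\<close>
  have the same zeros in the disc (\<open>coprime_zorder_eq\<close>). Hence \<open>\<phi>22\<close> has the zeros of \<open>L\<close>. The feedback
  makes the right-hand side of the Lyapunov equation of \<open>L\<close> positive semidefinite (\<open>feedback_positive\<close>), and a second homotopy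
  deforms \<open>det L\<close> into a constant multiple of \<open>z\<close> to the power \<open>\<kappa>1\<close> (\<open>zero_count_L\<close>).

  The second multiplicity is the first one for another pencil. Exchanging \<open>M\<close> with \<open>N\<close> and the upper with the
  lower row of \<open>C\<close>, and replacing \<open>\<mu>\<close> by its conjugate, preserves all hypotheses with the same \<open>P\<close>, while
  the lower row of the new \<open>W\<close> at \<open>z\<close> is the upper row of the old one at \<open>1/z\<close>, with its two blocks exchanged (\<open>transfer_block_swap\<close>).
  The matrix \<open>\<theta>l \<phi>t11\<^sup># + \<epsilon>l \<phi>t12\<^sup>#\<close> is the conjugate reflection of the matrix \<open>G1\<close> of the new pencil.
\<close>

(* The symbols $ and \<bullet> denote entries and scalar products of finite-dimensional vectors. *)
unbundle no vec_syntax
unbundle no inner_syntax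
unbundle no Formal_Power_Series.fps_syntax

section \<open>Adjoints, inverses and determinants of complex matrices\<close>

lemma index_mat_adjoint [simp]:
  assumes "i < dim_col A" "j < dim_row A"
  shows "mat_adjoint A $$ (i, j) = cnj (A $$ (j, i))"
  using assms unfolding mat_adjoint_def by (simp add: mat_of_rows_index)

lemma dim_mat_adjoint [simp]:
  "dim_row (mat_adjoint A) = dim_col A" "dim_col (mat_adjoint A) = dim_row A"
  unfolding mat_adjoint_def by auto

lemma mat_adjoint_carrier [simp]:
  "A \<in> carrier_mat n m \<Longrightarrow> mat_adjoint A \<in> carrier_mat m n"
  by (intro carrier_matI) simp_all

lemma mat_adjoint_adjoint [simp]: "mat_adjoint (mat_adjoint A) = (A :: complex mat)"
  by (intro eq_matI) auto

lemma mat_adjoint_one [simp]: "mat_adjoint (1\<^sub>m n) = (1\<^sub>m n :: complex mat)"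
  by (intro eq_matI) auto

lemma mat_adjoint_mult:
  assumes "A \<in> carrier_mat n m" "B \<in> carrier_mat m k"
  shows "mat_adjoint (A * B) = mat_adjoint B * mat_adjoint (A :: complex mat)"
  using assms by (intro eq_matI) (auto simp: scalar_prod_def sum_conjugate mult.commute intro!: sum.cong)

lemma mat_adjoint_add:
  assumes "A \<in> carrier_mat n m" "B \<in> carrier_mat n m"
  shows "mat_adjoint (A + B) = mat_adjoint A + mat_adjoint (B :: complex mat)"
  using assms by (intro eq_matI) auto

lemma mat_adjoint_smult: "mat_adjoint (c \<cdot>\<^sub>m A) = cnj c \<cdot>\<^sub>m mat_adjoint (A :: complex mat)"
  by (intro eq_matI) auto

lemma cscalar_adjoint:
  fixes A :: "complex mat"
  assumes A: "A \<in> carrier_mat n m" and u: "u \<in> carrier_vec m" and v: "v \<in> carrier_vec n"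
  shows "(A *\<^sub>v u) \<bullet>c v = u \<bullet>c (mat_adjoint A *\<^sub>v v)"
proof -
  have "(A *\<^sub>v u) \<bullet>c v = (\<Sum>i<n. (\<Sum>j<m. A $$ (i,j) * u $ j) * cnj (v $ i))"
    using A u v by (simp add: scalar_prod_def atLeast0LessThan)
  also have "\<dots> = (\<Sum>i<n. \<Sum>j<m. A $$ (i,j) * u $ j * cnj (v $ i))"
    by (simp only: sum_distrib_right)
  also have "\<dots> = (\<Sum>j<m. \<Sum>i<n. A $$ (i,j) * u $ j * cnj (v $ i))"
    by (rule sum.swap)
  also have "\<dots> = (\<Sum>j<m. u $ j * cnj (\<Sum>i<n. cnj (A $$ (i,j)) * v $ i))"
    by (intro sum.cong refl) (simp add: sum_distrib_left mult_ac)
  also have "\<dots> = u \<bullet>c (mat_adjoint A *\<^sub>v v)"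
    using A u v by (simp add: scalar_prod_def atLeast0LessThan)
  finally show ?thesis .
qed

lemma cscalar_adjoint':
  fixes A :: "complex mat"
  assumes "A \<in> carrier_mat n m" and "u \<in> carrier_vec n" and "v \<in> carrier_vec m"
  shows "u \<bullet>c (A *\<^sub>v v) = (mat_adjoint A *\<^sub>v u) \<bullet>c v"
  using cscalar_adjoint[of "mat_adjoint A" m n u v] assms by simp

lemma cscalar_cnj:
  fixes u :: "complex vec"
  assumes "u \<in> carrier_vec n" "v \<in> carrier_vec n"
  shows "cnj (u \<bullet>c v) = v \<bullet>c u"
  using assms by (auto simp: scalar_prod_def mult.commute)

lemma cscalar_add_left:
  fixes u :: "complex vec"
  assumes "u \<in> carrier_vec n" "v \<in> carrier_vec n" "w \<in> carrier_vec n"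
  shows "(u + v) \<bullet>c w = u \<bullet>c w + v \<bullet>c w"
  using assms by (simp add: add_scalar_prod_distrib[of _ n])

lemma cscalar_add_right:
  fixes u :: "complex vec"
  assumes "u \<in> carrier_vec n" "v \<in> carrier_vec n" "w \<in> carrier_vec n"
  shows "u \<bullet>c (v + w) = u \<bullet>c v + u \<bullet>c w"
  using assms by (auto simp: scalar_prod_def algebra_simps sum.distrib)

lemma cscalar_minus_left:
  fixes u :: "complex vec"
  assumes "u \<in> carrier_vec n" "v \<in> carrier_vec n" "w \<in> carrier_vec n"
  shows "(u - v) \<bullet>c w = u \<bullet>c w - v \<bullet>c w"
  using assms by (auto simp: scalar_prod_def algebra_simps sum_subtractf)

lemma cscalar_minus_right:
  fixes u :: "complex vec"
  assumes "u \<in> carrier_vec n" "v \<in> carrier_vec n" "w \<in> carrier_vec n"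
  shows "u \<bullet>c (v - w) = u \<bullet>c v - u \<bullet>c w"
  using assms by (auto simp: scalar_prod_def algebra_simps sum_subtractf)

lemma cscalar_smult_left:
  fixes u :: "complex vec"
  assumes "u \<in> carrier_vec n" "v \<in> carrier_vec n"
  shows "(c \<cdot>\<^sub>v u) \<bullet>c v = c * (u \<bullet>c v)"
  using assms by (auto simp: scalar_prod_def sum_distrib_left mult_ac)

lemma cscalar_smult_right:
  fixes u :: "complex vec"
  assumes "u \<in> carrier_vec n" "v \<in> carrier_vec n"
  shows "u \<bullet>c (c \<cdot>\<^sub>v v) = cnj c * (u \<bullet>c v)"
  using assms by (auto simp: scalar_prod_def sum_distrib_left mult_ac)

lemmas cscalar_simps = cscalar_add_left cscalar_add_right cscalar_minus_left cscalar_minus_right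
  cscalar_smult_left cscalar_smult_right

definition nsq :: "complex vec \<Rightarrow> real" where
  "nsq u = (\<Sum>i<dim_vec u. (cmod (u $ i))\<^sup>2)"

lemma cscalar_self: "u \<bullet>c u = complex_of_real (nsq u)"
  by (auto simp: nsq_def scalar_prod_def atLeast0LessThan complex_norm_square simp flip: of_real_power)

lemma nsq_nonneg: "0 \<le> nsq u" by (simp add: nsq_def sum_nonneg)

lemma nsq_eq_0: "u \<in> carrier_vec n \<Longrightarrow> nsq u = 0 \<longleftrightarrow> u = 0\<^sub>v n"
  by (auto simp: nsq_def sum_nonneg_eq_0_iff intro!: eq_vecI)

lemma nsq_smult: "nsq (c \<cdot>\<^sub>v u) = (cmod c)\<^sup>2 * nsq u"
  by (simp add: nsq_def norm_mult power_mult_distrib sum_distrib_left)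

lemma nsq_pos: "u \<in> carrier_vec n \<Longrightarrow> u \<noteq> 0\<^sub>v n \<Longrightarrow> 0 < nsq u"
  using nsq_eq_0[of u n] nsq_nonneg[of u] by force

lemma mat_eqI_cscalar:
  fixes A B :: "complex mat"
  assumes A: "A \<in> carrier_mat n n" and B: "B \<in> carrier_mat n n"
    and eq: "\<And>u v. u \<in> carrier_vec n \<Longrightarrow> v \<in> carrier_vec n \<Longrightarrow> (A *\<^sub>v u) \<bullet>c v = (B *\<^sub>v u) \<bullet>c v"
  shows "A = B"
proof (rule eq_matI)
  fix i j assume "i < dim_row B" "j < dim_col B"
  hence ij: "i < n" "j < n" using B by auto
  have *: "(X *\<^sub>v unit_vec n j) \<bullet>c unit_vec n i = X $$ (i,j)" if X: "X \<in> carrier_mat n n" for X :: "complex mat"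
  proof -
    have "conjugate (unit_vec n i) = (unit_vec n i :: complex vec)"
      by (intro eq_vecI) (auto simp: unit_vec_def)
    thus ?thesis using X ij by simp
  qed
  show "A $$ (i,j) = B $$ (i,j)" using eq[of "unit_vec n j" "unit_vec n i"] *[OF A] *[OF B] by simp
qed (use A B in auto)

lemma mat_inv_props:
  assumes A: "A \<in> carrier_mat n n" and d: "det A \<noteq> 0"
  shows "mat_inv A \<in> carrier_mat n n" "A * mat_inv A = 1\<^sub>m n" "mat_inv A * A = 1\<^sub>m n"
proof -
  have "\<exists>B. mat_inverse A = Some B"
  proof (rule ccontr)
    assume "\<nexists>B. mat_inverse A = Some B"
    hence "mat_inverse A = None" by auto
    from mat_inverse(1)[OF A this, of undefined] det_non_zero_imp_unit[OF A d, of undefined] show False by blast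
  qed
  then obtain B where B: "mat_inverse A = Some B" by auto
  from mat_inverse(2)[OF A B] show "mat_inv A \<in> carrier_mat n n" "A * mat_inv A = 1\<^sub>m n" "mat_inv A * A = 1\<^sub>m n"
    unfolding mat_inv_def B by auto
qed

lemma mat_inv_unique:
  assumes A: "A \<in> carrier_mat n n" and B: "B \<in> carrier_mat n n" and AB: "B * A = 1\<^sub>m n"
  shows "det A \<noteq> 0" "mat_inv A = B"
proof -
  show d: "det A \<noteq> 0"
    using det_mult[OF B A] AB by (metis det_one mult_zero_right zero_neq_one)
  have "mat_inv A = (B * A) * mat_inv A" using mat_inv_props[OF A d] AB by simp
  also have "\<dots> = B * (A * mat_inv A)" using mat_inv_props[OF A d] A B by (intro assoc_mult_mat) auto
  finally show "mat_inv A = B" using mat_inv_props[OF A d] B by simp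
qed

lemma mat_inv_adj:
  assumes A: "A \<in> carrier_mat n n" and d: "det A \<noteq> 0"
  shows "mat_inv A = (1 / det A) \<cdot>\<^sub>m adj_mat A"
proof (rule mat_inv_unique(2)[OF A])
  show "1 / det A \<cdot>\<^sub>m adj_mat A \<in> carrier_mat n n" using adj_mat[OF A] by auto
  have "1 / det A \<cdot>\<^sub>m adj_mat A * A = 1 / det A \<cdot>\<^sub>m (adj_mat A * A)"
    using adj_mat[OF A] A by (intro mult_smult_assoc_mat) auto
  also have "\<dots> = 1\<^sub>m n" using adj_mat[OF A] d by (intro eq_matI) auto
  finally show "1 / det A \<cdot>\<^sub>m adj_mat A * A = 1\<^sub>m n" .
qed

lemma det_nonzero_iff_inj:
  assumes A: "(A :: complex mat) \<in> carrier_mat n n"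
  shows "det A \<noteq> 0 \<longleftrightarrow> (\<forall>v\<in>carrier_vec n. A *\<^sub>v v = 0\<^sub>v n \<longrightarrow> v = 0\<^sub>v n)"
  using det_0_iff_vec_prod_zero_field[OF A] by auto

lemma det_mat_adjoint:
  assumes A: "(A :: complex mat) \<in> carrier_mat n n"
  shows "det (mat_adjoint A) = cnj (det A)"
proof -
  interpret c: comm_ring_hom cnj by standard auto
  have "mat_adjoint A = transpose_mat (map_mat cnj A)" by (intro eq_matI) auto
  thus ?thesis using det_transpose[of "map_mat cnj A" n] A by simp
qed

lemma det_one_plus_comm:
  fixes A B :: "complex mat"
  assumes A: "A \<in> carrier_mat n m" and B: "B \<in> carrier_mat m n"
  shows "det (1\<^sub>m n + A * B) = det (1\<^sub>m m + B * A)"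
proof -
  let ?E = "four_block_mat (1\<^sub>m n) (- A) B (1\<^sub>m m)"
  let ?L = "four_block_mat (1\<^sub>m n) (0\<^sub>m n m) (- B) (1\<^sub>m m)"
  have c: "?E \<in> carrier_mat (n+m) (n+m)" "?L \<in> carrier_mat (n+m) (n+m)" using A B by auto
  have "?L * ?E = four_block_mat (1\<^sub>m n) (- A) (0\<^sub>m m n) (1\<^sub>m m + B * A)"
    using A B by (subst mult_four_block_mat[of _ n n _ m _ m _ _ n _ m]) (auto simp: uminus_l_inv_mat[of _ m n] comm_add_mat[of _ m m])
  hence "det (?L * ?E) = det (1\<^sub>m m + B * A)"
    using A B by (simp add: det_four_block_mat_lower_left_zero[of _ n _ m])
  moreover have "?E * ?L = four_block_mat (1\<^sub>m n + A * B) (- A) (0\<^sub>m m n) (1\<^sub>m m)"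
    using A B by (subst mult_four_block_mat[of _ n n _ m _ m _ _ n _ m]) (auto simp: add_uminus_minus_mat[of _ m n] minus_r_inv_mat[of _ m n])
  hence "det (?E * ?L) = det (1\<^sub>m n + A * B)"
    using A B by (simp add: det_four_block_mat_lower_left_zero[of _ n _ m])
  ultimately show ?thesis using c by (simp add: det_mult[of _ "n+m"] mult.commute)
qed

section \<open>Spectral theorem and inertia of Hermitian matrices\<close>

definition dmat :: "nat \<Rightarrow> (nat \<Rightarrow> complex) \<Rightarrow> complex mat" where
  "dmat n f = mat n n (\<lambda>(i, j). if i = j then f i else 0)"

lemma dmat_carrier [simp]: "dmat n f \<in> carrier_mat n n"
  and dim_dmat [simp]: "dim_row (dmat n f) = n" "dim_col (dmat n f) = n"
  by (auto simp: dmat_def)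

lemma index_dmat [simp]: "i < n \<Longrightarrow> j < n \<Longrightarrow> dmat n f $$ (i, j) = (if i = j then f i else 0)"
  by (simp add: dmat_def)

lemma dmat_mult_left:
  assumes "A \<in> carrier_mat n m"
  shows "dmat n f * A = mat n m (\<lambda>(i, j). f i * A $$ (i, j))"
proof (intro eq_matI)
  fix i j assume "i < dim_row (mat n m (\<lambda>(i, j). f i * A $$ (i, j)))" "j < dim_col (mat n m (\<lambda>(i, j). f i * A $$ (i, j)))"
  hence ij: "i < n" "j < m" by auto
  have "(dmat n f * A) $$ (i, j) = (\<Sum>k<n. (if i = k then f i else 0) * A $$ (k, j))"
    using ij assms by (simp add: scalar_prod_def atLeast0LessThan)
  also have "\<dots> = (\<Sum>k<n. if i = k then f i * A $$ (k, j) else 0)" by (intro sum.cong) auto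
  also have "\<dots> = f i * A $$ (i, j)" using ij by simp
  finally show "(dmat n f * A) $$ (i, j) = mat n m (\<lambda>(i, j). f i * A $$ (i, j)) $$ (i, j)" using ij by simp
qed (use assms in auto)

lemma dmat_mult_right:
  assumes "A \<in> carrier_mat m n"
  shows "A * dmat n f = mat m n (\<lambda>(i, j). A $$ (i, j) * f j)"
proof (intro eq_matI)
  fix i j assume "i < dim_row (mat m n (\<lambda>(i, j). A $$ (i, j) * f j))" "j < dim_col (mat m n (\<lambda>(i, j). A $$ (i, j) * f j))"
  hence ij: "i < m" "j < n" by auto
  have "(A * dmat n f) $$ (i, j) = (\<Sum>k<n. A $$ (i, k) * (if k = j then f k else 0))"
    using ij assms by (simp add: scalar_prod_def atLeast0LessThan)
  also have "\<dots> = (\<Sum>k<n. if k = j then A $$ (i, k) * f j else 0)" by (intro sum.cong) auto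
  also have "\<dots> = A $$ (i, j) * f j" using ij by simp
  finally show "(A * dmat n f) $$ (i, j) = mat m n (\<lambda>(i, j). A $$ (i, j) * f j) $$ (i, j)" using ij by simp
qed (use assms in auto)

lemma dmat_adjoint: "(\<And>i. i < n \<Longrightarrow> cnj (f i) = f i) \<Longrightarrow> mat_adjoint (dmat n f) = dmat n f"
  by (intro eq_matI) auto

lemma dmat_mult_dmat: "dmat n f * dmat n g = dmat n (\<lambda>i. f i * g i)"
  by (subst dmat_mult_left[of _ n n]) (auto intro!: eq_matI)

lemma dmat_one: "(\<And>i. i < n \<Longrightarrow> f i = 1) \<Longrightarrow> dmat n f = 1\<^sub>m n"
  by (intro eq_matI) auto

lemma det_dmat: "det (dmat n f) = (\<Prod>i<n. f i)"
  by (subst det_upper_triangular[of _ n])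
     (auto simp: upper_triangular_def diag_mat_def prod.list_conv_set_nth atLeast0LessThan)

lemma mult_carrier_sq: "A \<in> carrier_mat n n \<Longrightarrow> B \<in> carrier_mat n n \<Longrightarrow> A * B \<in> carrier_mat n n"
  by (rule mult_carrier_mat)

lemma mat_adjoint_carrier_sq: "A \<in> carrier_mat n n \<Longrightarrow> mat_adjoint A \<in> carrier_mat n n"
  by (rule mat_adjoint_carrier)

text \<open>Gram--Schmidt orthogonalization of a basis that starts with \<open>v\<close>, followed by normalization of the columns.\<close>

lemma unitary_completion:
  assumes v: "v \<in> carrier_vec n" "v \<noteq> 0\<^sub>v n"
  obtains U c where "unitary_mat n U" "col U 0 = c \<cdot>\<^sub>v (v :: complex vec)" "0 < n"
proof -
  interpret cof_vec_space n "TYPE(complex)" .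
  have n: "0 < n" using v by (metis carrier_vecD eq_vecI index_zero_vec(2) less_nat_zero_code not_gr_zero)
  define b where "b = basis_completion v"
  note bc = basis_completion[OF v, folded b_def]
  define ws where "ws = gram_schmidt n b"
  note gs = gram_schmidt_result[OF bc(2,4,5) ws_def]
  obtain vs where bv: "b = v # vs" using bc(6,7) n by (cases b) auto
  have ws0: "ws ! 0 = v" using gram_schmidt_hd[OF v(1), of vs, folded bv, folded ws_def] gs(4) bc(6) n
    by (cases ws) auto
  have len: "length ws = n" using gs(4) bc(6) by simp
  have wsc: "ws ! j \<in> carrier_vec n" if "j < n" for j using gs(3) len that by auto
  define U where "U = mat n n (\<lambda>(i, j). (ws ! j) $ i / complex_of_real (sqrt (nsq (ws ! j))))"
  have U: "U \<in> carrier_mat n n" by (simp add: U_def)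
  have nz: "nsq (ws ! j) > 0" if "j < n" for j
  proof -
    have "ws ! j \<bullet>c ws ! j \<noteq> 0" using corthogonalD[OF gs(2), of j j] len that by auto
    thus ?thesis using nsq_nonneg[of "ws ! j"] by (simp add: cscalar_self)
  qed
  have UU: "mat_adjoint U * U = 1\<^sub>m n"
  proof (rule eq_matI)
    fix i j assume "i < dim_row (1\<^sub>m n :: complex mat)" "j < dim_col (1\<^sub>m n :: complex mat)"
    hence ij: "i < n" "j < n" by auto
    have "(mat_adjoint U * U) $$ (i, j) = (\<Sum>k<n. cnj (U $$ (k, i)) * U $$ (k, j))"
      using ij U by (simp add: scalar_prod_def atLeast0LessThan)
    also have "\<dots> = (\<Sum>k<n. (ws ! j) $ k * cnj ((ws ! i) $ k)) / (sqrt (nsq (ws ! i)) * sqrt (nsq (ws ! j)))"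
      using ij by (simp add: U_def sum_divide_distrib mult_ac)
    also have "(\<Sum>k<n. (ws ! j) $ k * cnj ((ws ! i) $ k)) = ws ! j \<bullet>c ws ! i"
      using wsc[of i] wsc[of j] ij by (simp add: scalar_prod_def atLeast0LessThan)
    also have "\<dots> / (sqrt (nsq (ws ! i)) * sqrt (nsq (ws ! j))) = (if i = j then 1 else 0)"
    proof (cases "i = j")
      case True
      thus ?thesis using nz[of i] ij by (simp add: cscalar_self flip: of_real_mult)
    next
      case False
      thus ?thesis using corthogonalD[OF gs(2), of j i] len ij by auto
    qed
    finally show "(mat_adjoint U * U) $$ (i, j) = 1\<^sub>m n $$ (i, j)" using ij by simp
  qed (use U in auto)
  have UU': "U * mat_adjoint U = 1\<^sub>m n"
    by (rule mat_mult_left_right_inverse[OF _ U UU]) (use U in simp)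
  have "col U 0 = (1 / complex_of_real (sqrt (nsq v))) \<cdot>\<^sub>v v"
    using n v U ws0 by (intro eq_vecI) (auto simp: U_def)
  with UU UU' U n show ?thesis by (intro that[of U]) (auto simp: unitary_mat_def)
qed

lemma hermitian_unitary_conj:
  assumes A: "hermitian_mat n A" and U: "U \<in> carrier_mat n m"
  shows "hermitian_mat m (mat_adjoint U * A * U)"
proof -
  have c: "A \<in> carrier_mat n n" "mat_adjoint A = A" using A by (auto simp: hermitian_mat_def)
  have "mat_adjoint (mat_adjoint U * A * U) = mat_adjoint U * (A * U)"
    using c U mult_carrier_mat[of "mat_adjoint U" m n A n]
    by (simp add: mat_adjoint_mult[of _ m n _ m] mat_adjoint_mult[of _ m n _ n])
  also have "\<dots> = mat_adjoint U * A * U" using c U by (intro assoc_mult_mat[symmetric]) auto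
  finally show ?thesis using c U by (auto simp: hermitian_mat_def)
qed

text \<open>
  Deflation: a unitary matrix whose first column is an eigenvector brings the first column into diagonal form, and
  the Hermitian symmetry does the same for the first row.
\<close>

theorem hermitian_spectral:
  assumes "hermitian_mat n A"
  shows "\<exists>U \<Lambda>. unitary_mat n U \<and> mat_adjoint U * A * U = dmat n (\<lambda>i. complex_of_real (\<Lambda> i))"
  using assms
proof (induction n arbitrary: A)
  case 0
  thus ?case
    by (intro exI[of _ "1\<^sub>m 0"] exI[of _ "\<lambda>_. 0"]) (auto simp: unitary_mat_def hermitian_mat_def intro!: eq_matI)
next
  case (Suc m)
  let ?n = "Suc m"
  have A: "A \<in> carrier_mat ?n ?n" "mat_adjoint A = A" using Suc.prems by (auto simp: hermitian_mat_def)
  obtain e where "eigenvalue A e" using spectrum_non_empty[OF A(1)] by (auto simp: spectrum_def)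
  then obtain v where v: "v \<in> carrier_vec ?n" "v \<noteq> 0\<^sub>v ?n" "A *\<^sub>v v = e \<cdot>\<^sub>v v"
    using A unfolding eigenvalue_def eigenvector_def by auto
  obtain U c where U: "unitary_mat ?n U" "col U 0 = c \<cdot>\<^sub>v v" using unitary_completion[OF v(1,2)] by metis
  have Uc: "U \<in> carrier_mat ?n ?n" "mat_adjoint U * U = 1\<^sub>m ?n" "U * mat_adjoint U = 1\<^sub>m ?n"
    using U by (auto simp: unitary_mat_def)
  define B where "B = mat_adjoint U * A * U"
  have Bh: "hermitian_mat ?n B" unfolding B_def by (rule hermitian_unitary_conj[OF Suc.prems Uc(1)])
  hence B: "B \<in> carrier_mat ?n ?n" "mat_adjoint B = B" by (auto simp: hermitian_mat_def)
  have "col B 0 = mat_adjoint U * A *\<^sub>v col U 0"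
    unfolding B_def using Uc A by (intro col_mult2[of _ ?n ?n _ ?n]) auto
  also have "\<dots> = mat_adjoint U *\<^sub>v (A *\<^sub>v col U 0)" using Uc A by (intro assoc_mult_mat_vec) (auto intro!: carrier_vecI)
  also have "A *\<^sub>v col U 0 = e \<cdot>\<^sub>v col U 0"
    unfolding U(2) using v A(1) by (simp add: mult_mat_vec[of _ ?n ?n] smult_smult_assoc mult.commute)
  also have "mat_adjoint U *\<^sub>v (e \<cdot>\<^sub>v col U 0) = e \<cdot>\<^sub>v (mat_adjoint U *\<^sub>v col U 0)"
    using Uc by (intro mult_mat_vec[of _ ?n ?n]) (auto intro!: carrier_vecI)
  also have "mat_adjoint U *\<^sub>v col U 0 = col (mat_adjoint U * U) 0"
    using Uc by (intro col_mult2[symmetric, of _ ?n ?n _ ?n]) auto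
  finally have colB: "col B 0 = e \<cdot>\<^sub>v unit_vec ?n 0" by (simp add: Uc)
  have B0: "B $$ (i, 0) = (if i = 0 then e else 0)" if "i < ?n" for i
  proof -
    have "B $$ (i, 0) = col B 0 $ i" using B that by simp
    thus ?thesis using that by (simp add: colB)
  qed
  have B0': "B $$ (0, i) = (if i = 0 then cnj e else 0)" if "i < ?n" for i
  proof -
    have "B $$ (0, i) = mat_adjoint B $$ (0, i)" using B by simp
    also have "\<dots> = cnj (B $$ (i, 0))" using B that by (intro index_mat_adjoint) auto
    finally show ?thesis using B0[OF that] by simp
  qed
  have er: "e = complex_of_real (Re e)" using B0[of 0] B0'[of 0] by (simp add: complex_eq_iff)
  define B3 where "B3 = mat m m (\<lambda>(i, j). B $$ (Suc i, Suc j))"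
  have B3: "B3 \<in> carrier_mat m m" by (simp add: B3_def)
  have ce: "cnj e = e" by (subst (1 2) er) simp
  have Bblock: "B = four_block_mat (mat 1 1 (\<lambda>_. e)) (0\<^sub>m 1 m) (0\<^sub>m m 1) B3"
    using B B0 B0' ce by (intro eq_matI) (auto simp: B3_def)
  have "mat_adjoint B3 = B3"
  proof (rule eq_matI)
    fix i j assume "i < dim_row B3" "j < dim_col B3"
    hence ij: "i < m" "j < m" using B3 by auto
    have "B $$ (Suc i, Suc j) = mat_adjoint B $$ (Suc i, Suc j)" using B by simp
    also have "\<dots> = cnj (B $$ (Suc j, Suc i))" using B ij by (intro index_mat_adjoint) auto
    finally show "mat_adjoint B3 $$ (i, j) = B3 $$ (i, j)" using ij by (simp add: B3_def)
  qed (use B3 in auto)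
  hence "hermitian_mat m B3" using B3 by (simp add: hermitian_mat_def)
  from Suc.IH[OF this] obtain U3 \<Lambda> where U3: "unitary_mat m U3"
    and d3: "mat_adjoint U3 * B3 * U3 = dmat m (\<lambda>i. complex_of_real (\<Lambda> i))" by blast
  have U3c: "U3 \<in> carrier_mat m m" "mat_adjoint U3 * U3 = 1\<^sub>m m" "U3 * mat_adjoint U3 = 1\<^sub>m m"
    using U3 by (auto simp: unitary_mat_def)
  define V where "V = four_block_mat (1\<^sub>m 1) (0\<^sub>m 1 m) (0\<^sub>m m 1) U3"
  have V: "V \<in> carrier_mat ?n ?n" unfolding V_def using U3c by (metis four_block_carrier_mat one_carrier_mat plus_1_eq_Suc)
  have Va: "mat_adjoint V = four_block_mat (1\<^sub>m 1) (0\<^sub>m 1 m) (0\<^sub>m m 1) (mat_adjoint U3)"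
    unfolding V_def using U3c by (intro eq_matI) auto
  have VV: "mat_adjoint V * V = 1\<^sub>m ?n"
    unfolding Va unfolding V_def using U3c
    by (subst mult_four_block_mat[of _ 1 1 _ m _ m _ _ 1 _ m]) (auto intro!: eq_matI)
  have VV': "V * mat_adjoint V = 1\<^sub>m ?n"
    by (rule mat_mult_left_right_inverse[OF _ V VV]) (use V in simp)
  have VBV: "mat_adjoint V * B * V = dmat ?n (\<lambda>i. complex_of_real (case i of 0 \<Rightarrow> Re e | Suc i \<Rightarrow> \<Lambda> i))"
  proof -
    have "mat_adjoint V * B * V = four_block_mat (mat 1 1 (\<lambda>_. e)) (0\<^sub>m 1 m) (0\<^sub>m m 1) (mat_adjoint U3 * B3 * U3)"
      unfolding Va Bblock unfolding V_def using U3c B3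
      by (simp add: mult_four_block_mat[of _ "Suc 0" "Suc 0" _ m _ m _ _ "Suc 0" _ m]
            left_add_zero_mat[of _ m m] mult_carrier_sq)
    also have "\<dots> = dmat ?n (\<lambda>i. complex_of_real (case i of 0 \<Rightarrow> Re e | Suc i \<Rightarrow> \<Lambda> i))"
      unfolding d3 using er by (intro eq_matI) (auto split: nat.split)
    finally show ?thesis .
  qed
  have UV: "U * V \<in> carrier_mat ?n ?n" using Uc V by auto
  have adj: "mat_adjoint (U * V) = mat_adjoint V * mat_adjoint U" using Uc V by (intro mat_adjoint_mult) auto
  have "mat_adjoint (U * V) * (U * V) = mat_adjoint V * (mat_adjoint U * U) * V"
    unfolding adj using Uc(1) V by (simp add: assoc_mult_mat[of _ ?n ?n _ ?n _ ?n] mult_carrier_sq mat_adjoint_carrier_sq)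
  hence un: "mat_adjoint (U * V) * (U * V) = 1\<^sub>m ?n" using V VV by (simp add: Uc)
  have un': "U * V * mat_adjoint (U * V) = 1\<^sub>m ?n"
    by (rule mat_mult_left_right_inverse[OF _ UV un]) (use UV in simp)
  have "mat_adjoint (U * V) * A * (U * V) = mat_adjoint V * B * V"
    unfolding adj B_def using Uc(1) V A(1) by (simp add: assoc_mult_mat[of _ ?n ?n _ ?n _ ?n] mult_carrier_sq mat_adjoint_carrier_sq)
  thus ?case using VBV un un' UV
    by (intro exI[of _ "U * V"] exI[of _ "\<lambda>i. case i of 0 \<Rightarrow> Re e | Suc i \<Rightarrow> \<Lambda> i"]) (auto simp: unitary_mat_def)
qed

lemma order_prod_linear:
  "Polynomial.order e (\<Prod>i<(n::nat). [:- f i, 1:]) = card {i. i < n \<and> f i = (e :: complex)}"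
proof (induct n)
  case 0
  have "Polynomial.order e (1 :: complex poly) = 0" by (simp add: order_0I)
  thus ?case by simp
next
  case (Suc n)
  have nz: "(\<Prod>i<n. [:- f i, 1:]) * [:- f n, 1:] \<noteq> 0"
    using prod_zero_iff[of "{..<n}" "\<lambda>i. [:- f i, 1:]"] by (simp only: mult_eq_0_iff) simp
  have o: "Polynomial.order e [:- f n, 1:] = (if f n = e then 1 else 0)"
    using order_power_n_n[of e 1] by (auto intro!: order_0I)
  have s: "{i. i < Suc n \<and> f i = e} = {i. i < n \<and> f i = e} \<union> (if f n = e then {n} else {})"
    by (auto simp: less_Suc_eq)
  have "Polynomial.order e (\<Prod>i<Suc n. [:- f i, 1:]) = card {i. i < n \<and> f i = e} + (if f n = e then 1 else 0)"
    unfolding prod.lessThan_Suc order_mult[OF nz] Suc.hyps o ..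
  also have "\<dots> = card {i. i < Suc n \<and> f i = e}" unfolding s by (subst card_Un_disjoint) auto
  finally show ?case .
qed

text \<open>
  Sylvester's normal form on the range of \<open>P\<close>: the columns of \<open>Q\<close> are the eigenvectors for nonzero
  eigenvalues, scaled by the square root of the modulus of the eigenvalue. The left inverse \<open>L\<close> records
  that they are independent.
\<close>

lemma hermitian_inertia:
  assumes "hermitian_mat n P"
  obtains k Q L \<sigma> where "Q \<in> carrier_mat n k" "L \<in> carrier_mat k n" "L * Q = 1\<^sub>m k"
    "\<And>i. i < k \<Longrightarrow> \<sigma> i = 1 \<or> \<sigma> i = -1"
    "P = Q * dmat k \<sigma> * mat_adjoint Q" "card {i. i < k \<and> \<sigma> i = -1} = neg_eigs P"
proof -
  have P: "P \<in> carrier_mat n n" using assms by (simp add: hermitian_mat_def)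
  obtain U \<Lambda> where U: "unitary_mat n U" and d: "mat_adjoint U * P * U = dmat n (\<lambda>i. complex_of_real (\<Lambda> i))"
    using hermitian_spectral[OF assms] by blast
  have Uc: "U \<in> carrier_mat n n" "mat_adjoint U * U = 1\<^sub>m n" "U * mat_adjoint U = 1\<^sub>m n"
    using U by (auto simp: unitary_mat_def)
  define D where "D = dmat n (\<lambda>i. complex_of_real (\<Lambda> i))"
  have PU: "P = U * D * mat_adjoint U"
  proof -
    have "U * D * mat_adjoint U = (U * mat_adjoint U) * P * (U * mat_adjoint U)"
      unfolding D_def d[symmetric] using Uc(1) P by (simp add: assoc_mult_mat[of _ n n _ n _ n] mult_carrier_sq mat_adjoint_carrier_sq)
    thus ?thesis using P by (simp add: Uc)
  qed
  have "similar_mat P D"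
    unfolding similar_mat_def similar_mat_wit_def Let_def
    using PU Uc P by (intro exI[of _ U] exI[of _ "mat_adjoint U"]) (auto simp: D_def)
  hence "char_poly P = char_poly D" by (rule char_poly_similar)
  also have "\<dots> = (\<Prod>a\<leftarrow>diag_mat D. [:- a, 1:])"
    by (rule char_poly_upper_triangular[of D n]) (auto simp: D_def upper_triangular_def)
  also have "\<dots> = (\<Prod>i<n. [:- complex_of_real (\<Lambda> i), 1:])"
    by (simp add: D_def diag_mat_def prod.list_conv_set_nth atLeast0LessThan)
  finally have cp: "char_poly P = (\<Prod>i<n. [:- complex_of_real (\<Lambda> i), 1:])" .
  have ev: "eigenvalue P e \<longleftrightarrow> (\<exists>i<n. e = complex_of_real (\<Lambda> i))" for e
    unfolding eigenvalue_root_char_poly[OF P] cp by (auto simp: poly_prod prod_zero_iff)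
  have neg: "neg_eigs P = card {i. i < n \<and> \<Lambda> i < 0}"
  proof -
    let ?E = "{e. eigenvalue P e \<and> e \<in> \<real> \<and> Re e < 0}"
    have E: "?E = (\<lambda>i. complex_of_real (\<Lambda> i)) ` {i. i < n \<and> \<Lambda> i < 0}" using ev by auto
    have "neg_eigs P = (\<Sum>e\<in>?E. card {i. i < n \<and> complex_of_real (\<Lambda> i) = e})"
      unfolding neg_eigs_def cp order_prod_linear ..
    also have "\<dots> = card (\<Union>e\<in>?E. {i. i < n \<and> complex_of_real (\<Lambda> i) = e})"
      by (rule card_UN_disjoint[symmetric]) (auto simp: E)
    also have "(\<Union>e\<in>?E. {i. i < n \<and> complex_of_real (\<Lambda> i) = e}) = {i. i < n \<and> \<Lambda> i < 0}"
      unfolding E by auto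
    finally show ?thesis .
  qed
  define ix where "ix = filter (\<lambda>i. \<Lambda> i \<noteq> 0) [0..<n]"
  define k where "k = length ix"
  have isn: "ix ! j < n" "\<Lambda> (ix ! j) \<noteq> 0" if "j < k" for j
    using that nth_mem[of j ix] by (auto simp: k_def ix_def)
  have dist: "distinct ix" by (simp add: ix_def)
  have setis: "set ix = {i. i < n \<and> \<Lambda> i \<noteq> 0}" by (auto simp: ix_def)
  define r where "r = (\<lambda>j. complex_of_real (sqrt \<bar>\<Lambda> (ix ! j)\<bar>))"
  have r0: "r j \<noteq> 0" if "j < k" for j using isn[OF that] by (simp add: r_def)
  define Q where "Q = mat n k (\<lambda>(i, j). r j * U $$ (i, ix ! j))"
  define L where "L = mat k n (\<lambda>(j, i). cnj (U $$ (i, ix ! j)) / r j)"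
  define \<sigma> where "\<sigma> = (\<lambda>j. if \<Lambda> (ix ! j) < 0 then -1 else 1 :: complex)"
  have Q: "Q \<in> carrier_mat n k" and L: "L \<in> carrier_mat k n" by (auto simp: Q_def L_def)
  have "L * Q = 1\<^sub>m k"
  proof (rule eq_matI)
    fix i j assume "i < dim_row (1\<^sub>m k :: complex mat)" "j < dim_col (1\<^sub>m k :: complex mat)"
    hence ij: "i < k" "j < k" by auto
    have "(L * Q) $$ (i, j) = (\<Sum>l<n. cnj (U $$ (l, ix ! i)) / r i * (r j * U $$ (l, ix ! j)))"
      using ij by (simp add: scalar_prod_def atLeast0LessThan L_def Q_def)
    also have "\<dots> = r j / r i * (\<Sum>l<n. cnj (U $$ (l, ix ! i)) * U $$ (l, ix ! j))"
      by (simp add: sum_distrib_left mult_ac)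
    also have "(\<Sum>l<n. cnj (U $$ (l, ix ! i)) * U $$ (l, ix ! j)) = (mat_adjoint U * U) $$ (ix ! i, ix ! j)"
      using Uc(1) isn ij by (simp add: scalar_prod_def atLeast0LessThan)
    also have "\<dots> = (if i = j then 1 else 0)"
      unfolding Uc(2) using isn ij dist by (simp add: nth_eq_iff_index_eq k_def)
    finally show "(L * Q) $$ (i, j) = 1\<^sub>m k $$ (i, j)" using ij r0[of i] r0[of j] by auto
  qed (use L Q in auto)
  moreover have "P = Q * dmat k \<sigma> * mat_adjoint Q"
  proof (rule eq_matI)
    fix a b assume "a < dim_row (Q * dmat k \<sigma> * mat_adjoint Q)" "b < dim_col (Q * dmat k \<sigma> * mat_adjoint Q)"
    hence ab: "a < n" "b < n" using Q by auto
    have "P $$ (a, b) = (\<Sum>i<n. U $$ (a, i) * complex_of_real (\<Lambda> i) * cnj (U $$ (b, i)))"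
      unfolding PU D_def dmat_mult_right[OF Uc(1)] using ab Uc(1) by (simp add: scalar_prod_def atLeast0LessThan)
    also have "\<dots> = (\<Sum>i\<in>set ix. U $$ (a, i) * complex_of_real (\<Lambda> i) * cnj (U $$ (b, i)))"
      by (rule sum.mono_neutral_right) (auto simp: setis)
    also have "\<dots> = (\<Sum>j<k. U $$ (a, ix ! j) * complex_of_real (\<Lambda> (ix ! j)) * cnj (U $$ (b, ix ! j)))"
      by (rule sum.reindex_bij_betw[symmetric]) (use bij_betw_nth[OF dist, of "{..<k}"] in \<open>auto simp: k_def\<close>)
    also have "\<dots> = (\<Sum>j<k. Q $$ (a, j) * \<sigma> j * cnj (Q $$ (b, j)))"
    proof (rule sum.cong[OF refl])
      fix j assume "j \<in> {..<k}"
      hence j: "j < k" by simp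
      have "r j * \<sigma> j * cnj (r j) = complex_of_real (\<Lambda> (ix ! j))"
      proof -
        have rr: "r j * cnj (r j) = complex_of_real \<bar>\<Lambda> (ix ! j)\<bar>"
          unfolding r_def by (simp flip: of_real_mult)
        have "r j * \<sigma> j * cnj (r j) = (r j * cnj (r j)) * \<sigma> j" by (simp only: mult_ac)
        also have "\<dots> = complex_of_real \<bar>\<Lambda> (ix ! j)\<bar> * \<sigma> j" unfolding rr ..
        also have "\<dots> = complex_of_real (\<Lambda> (ix ! j))" by (simp add: \<sigma>_def)
        finally show ?thesis .
      qed
      hence "U $$ (a, ix ! j) * complex_of_real (\<Lambda> (ix ! j)) * cnj (U $$ (b, ix ! j))
         = U $$ (a, ix ! j) * (r j * \<sigma> j * cnj (r j)) * cnj (U $$ (b, ix ! j))" by simp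
      thus "U $$ (a, ix ! j) * complex_of_real (\<Lambda> (ix ! j)) * cnj (U $$ (b, ix ! j)) = Q $$ (a, j) * \<sigma> j * cnj (Q $$ (b, j))"
        using j ab by (simp add: Q_def mult_ac)
    qed
    also have "\<dots> = (Q * dmat k \<sigma> * mat_adjoint Q) $$ (a, b)"
      unfolding dmat_mult_right[OF Q] using ab Q by (simp add: scalar_prod_def atLeast0LessThan)
    finally show "P $$ (a, b) = (Q * dmat k \<sigma> * mat_adjoint Q) $$ (a, b)" .
  qed (use P Q in auto)
  moreover have "card {i. i < k \<and> \<sigma> i = -1} = neg_eigs P"
  proof -
    have "bij_betw (\<lambda>j. ix ! j) {i. i < k \<and> \<sigma> i = -1} {i. i < n \<and> \<Lambda> i < 0}"
    proof (rule bij_betwI')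
      fix y assume "y \<in> {i. i < n \<and> \<Lambda> i < 0}"
      hence "y \<in> set ix" "\<Lambda> y < 0" by (auto simp: setis)
      then obtain j where "j < k" "ix ! j = y" by (auto simp: in_set_conv_nth k_def)
      thus "\<exists>x\<in>{i. i < k \<and> \<sigma> i = -1}. y = ix ! x" using \<open>\<Lambda> y < 0\<close> by (auto simp: \<sigma>_def)
    qed (use isn dist in \<open>auto simp: \<sigma>_def nth_eq_iff_index_eq k_def split: if_splits\<close>)
    thus ?thesis unfolding neg by (rule bij_betw_same_card)
  qed
  ultimately show ?thesis using that[of Q k L \<sigma>] Q L by (auto simp: \<sigma>_def)
qed

section \<open>Rank\<close>

lemma mat_mult_unit_vec:
  assumes "A \<in> carrier_mat n m" "i < m"
  shows "A *\<^sub>v unit_vec m i = col (A :: complex mat) i"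
  using assms by (intro eq_vecI) auto

lemma dim_hcat:
  "dim_row (hcat A B) = dim_row A" "dim_col (hcat A B) = dim_col A + dim_col B"
  by (auto simp: hcat_def)

lemma mat_range_col_space:
  assumes "A \<in> carrier_mat nr nc"
  shows "mat_range A = vec_space.col_space nr A"
proof -
  interpret vec_space "TYPE(complex)" nr .
  show ?thesis
    using assms unfolding mat_range_def col_space_eq[OF assms] by auto
qed

text \<open>The columns of \<open>B\<close> are a basis of the range of \<open>A\<close>.\<close>

lemma mat_rank_eqI:
  assumes A: "A \<in> carrier_mat nr nc" and B: "B \<in> carrier_mat nr d"
    and range: "mat_range A = mat_range B"
    and inj: "\<And>c. c \<in> carrier_vec d \<Longrightarrow> B *\<^sub>v c = 0\<^sub>v nr \<Longrightarrow> c = 0\<^sub>v d"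
  shows "mat_rank A = d"
proof -
  interpret vec_space "TYPE(complex)" nr .
  have "span (set (cols A)) = span (set (cols B))"
    using range unfolding mat_range_col_space[OF A] mat_range_col_space[OF B] col_space_def .
  hence "rank A = rank B" by (simp add: rank_def)
  moreover have dist: "distinct (cols B)"
  proof (rule ccontr)
    assume "\<not> distinct (cols B)"
    then obtain i j where ij: "i < d" "j < d" "i \<noteq> j" "col B i = col B j"
      using B by (auto simp: distinct_conv_nth)
    have "B *\<^sub>v (unit_vec d i - unit_vec d j) = col B i - col B j"
      using ij by (simp add: mult_minus_distrib_mat_vec[OF B] mat_mult_unit_vec[OF B])
    also have "\<dots> = 0\<^sub>v nr" using B ij(4) by (intro eq_vecI) auto
    finally have "unit_vec d i - unit_vec d j = (0\<^sub>v d :: complex vec)" by (intro inj) auto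
    hence "(unit_vec d i - unit_vec d j :: complex vec) $ i = 0" using ij by simp
    thus False using ij by (simp add: unit_vec_def)
  qed
  moreover have "rank B = d"
  proof (rule lin_indpt_full_rank[OF B dist])
    show "lin_indpt (set (cols B))"
      using lin_depE[OF B _ dist] inj by metis
  qed
  ultimately show ?thesis using A by (simp add: mat_rank_def)
qed

lemma index_hcat:
  assumes "A \<in> carrier_mat n a" "B \<in> carrier_mat n b" "i < n" "j < a + b"
  shows "hcat A B $$ (i, j) = (if j < a then A $$ (i, j) else B $$ (i, j - a))"
proof -
  have "hcat A B $$ (i, j) = (cols A @ cols B) ! j $ i"
    using assms by (auto simp: hcat_def mat_of_cols_index)
  thus ?thesis using assms by (auto simp: nth_append)
qed

lemma hcat_carrier [simp]:
  "A \<in> carrier_mat n a \<Longrightarrow> B \<in> carrier_mat n b \<Longrightarrow> hcat A B \<in> carrier_mat n (a + b)"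
  by (auto simp: hcat_def)

lemma mult_hcat:
  assumes "U \<in> carrier_mat m n" "A \<in> carrier_mat n a" "B \<in> carrier_mat n b"
  shows "U * hcat A B = hcat (U * A) (U * B)"
proof (rule eq_matI)
  have c: "U * A \<in> carrier_mat m a" "U * B \<in> carrier_mat m b" "hcat A B \<in> carrier_mat n (a + b)"
    using assms by auto
  fix i j assume "i < dim_row (hcat (U * A) (U * B))" "j < dim_col (hcat (U * A) (U * B))"
  hence ij: "i < m" "j < a + b" using hcat_carrier[OF c(1,2)] by auto
  have *: "col (hcat A B) j = (if j < a then col A j else col B (j - a))"
    using assms ij by (intro eq_vecI) (auto simp: index_hcat[of A n a B b] dim_hcat)
  show "(U * hcat A B) $$ (i, j) = hcat (U * A) (U * B) $$ (i, j)"
    using assms ij * by (subst index_hcat[OF c(1,2) ij]) (auto simp: dim_hcat)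
qed (use assms in \<open>auto simp: hcat_def\<close>)

lemma hcat_eqD:
  assumes "hcat A B = hcat A' B'"
    and A: "A \<in> carrier_mat n a" "A' \<in> carrier_mat n a" and B: "B \<in> carrier_mat n b" "B' \<in> carrier_mat n b"
  shows "A = A'" "B = B'"
proof -
  have *: "hcat A B $$ (i, j) = hcat A' B' $$ (i, j)" for i j using assms by simp
  show "A = A'"
  proof (rule eq_matI)
    fix i j assume "i < dim_row A'" "j < dim_col A'"
    thus "A $$ (i, j) = A' $$ (i, j)" using *[of i j] A B by (simp add: index_hcat[of _ n a _ b])
  qed (use A in auto)
  show "B = B'"
  proof (rule eq_matI)
    fix i j assume "i < dim_row B'" "j < dim_col B'"
    thus "B $$ (i, j) = B' $$ (i, j)" using *[of i "a + j"] A B by (simp add: index_hcat[of _ n a _ b])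
  qed (use B in auto)
qed

text \<open>
  The columns of a matrix of full row rank span the whole space, so a vector orthogonal to all of them is
  orthogonal to itself. Every coprimeness assumption enters in this form.
\<close>

lemma full_row_rank_left_kernel:
  assumes A: "A \<in> carrier_mat n a" and B: "B \<in> carrier_mat n b" and r: "mat_rank (hcat A B) = n"
    and u: "u \<in> carrier_vec n" and uA: "mat_adjoint A *\<^sub>v u = 0\<^sub>v a" and uB: "mat_adjoint B *\<^sub>v u = 0\<^sub>v b"
  shows "u = 0\<^sub>v n"
proof -
  interpret vec_space "TYPE(complex)" n .
  let ?H = "hcat A B"
  have H: "?H \<in> carrier_mat n (a + b)" using A B by simp
  have rk: "rank ?H = n" using r H by (simp add: mat_rank_def)
  obtain S where S: "maximal S (\<lambda>T. T \<subseteq> set (cols ?H) \<and> lin_indpt T)"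
    using maximal_exists_superset[of "set (cols ?H)" "\<lambda>T. T \<subseteq> set (cols ?H) \<and> lin_indpt T" "{}"]
    by (metis (no_types, lifting) List.finite_set empty_subsetI fin_dim finite_basis_exists subset_li_is_li vectorspace.basis_def vec_vs)
  have S': "S \<subseteq> set (cols ?H)" "lin_indpt S" using S by (auto simp: maximal_def)
  have card: "card S = n" using rank_card_indpt[OF H S] rk by simp
  have Sc: "S \<subseteq> carrier_vec n" using S'(1) H cols_dim[of ?H] by auto
  have "basis S"
    by (rule dim_li_is_basis) (use S' Sc card dim_is_n finite_subset in auto)
  hence "span S = carrier_vec n" by (auto simp: basis_def)
  moreover have "span S \<subseteq> span (set (cols ?H))" by (rule span_is_monotone[OF S'(1)])
  ultimately have "u \<in> mat_range ?H" using u unfolding mat_range_col_space[OF H] col_space_def by auto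
  then obtain x where x: "x \<in> carrier_vec (a + b)" "u = ?H *\<^sub>v x" using H by (auto simp: mat_range_def)
  have "mat_adjoint ?H *\<^sub>v u = 0\<^sub>v (a + b)"
  proof (rule eq_vecI)
    fix j assume "j < dim_vec (0\<^sub>v (a + b) :: complex vec)"
    hence j: "j < a + b" by simp
    have "(mat_adjoint ?H *\<^sub>v u) $ j = (\<Sum>i<n. cnj (?H $$ (i, j)) * u $ i)"
      using H u j by (simp add: scalar_prod_def atLeast0LessThan)
    also have "\<dots> = 0"
    proof (cases "j < a")
      case True
      have "(\<Sum>i<n. cnj (?H $$ (i, j)) * u $ i) = (mat_adjoint A *\<^sub>v u) $ j"
        using A B True u j by (simp add: scalar_prod_def atLeast0LessThan index_hcat)
      thus ?thesis using uA True by simp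
    next
      case False
      have "(\<Sum>i<n. cnj (?H $$ (i, j)) * u $ i) = (mat_adjoint B *\<^sub>v u) $ (j - a)"
        using A B False u j by (simp add: scalar_prod_def atLeast0LessThan index_hcat)
      thus ?thesis using uB False j by simp
    qed
    finally show "(mat_adjoint ?H *\<^sub>v u) $ j = 0\<^sub>v (a + b) $ j" using j by simp
  qed (use H in auto)
  hence "u \<bullet>c u = 0" using cscalar_adjoint[OF H x(1) u] x by simp
  thus ?thesis using nsq_eq_0[OF u] by (simp add: cscalar_self)
qed

section \<open>Zero multiplicity as the order of the determinant\<close>

text \<open>
  The matrix of multiplication by the power series matrix \<open>K\<close> modulo the \<open>k\<close>-th power of the variable, in the
  ordering of the coefficients that the definition of the pole multiplicity uses.
\<close>

definition toeplitz :: "nat \<Rightarrow> nat \<Rightarrow> (nat \<Rightarrow> nat \<Rightarrow> complex fps) \<Rightarrow> complex mat" where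
  "toeplitz k r K = mat (k * r) (k * r) (\<lambda>(m, m').
     if m' div r \<le> m div r then fps_nth (K (m mod r) (m' mod r)) (m div r - m' div r) else 0)"

lemma fps_shift_decomp: "f = fps_const (fps_nth f 0) + fps_X * fps_shift 1 (f :: complex fps)"
  by (rule fps_ext) (auto split: nat.splits)

text \<open>
  The order of \<open>det G\<close> is the dimension of the cokernel of \<open>G\<close>; the vectors \<open>w l\<close> span a complement of the image
  over the constants. If the order is positive, \<open>G(0)\<close> is singular and some constant combination of the columns of
  \<open>G\<close> is divisible by the variable. Replacing one column by the quotient lowers the order by one and enlarges
  the image by exactly the constant multiples of this quotient.
\<close>

lemma fps_cokernel_complement:
  fixes G :: "complex fps mat"
  assumes "G \<in> carrier_mat r r" "det G \<noteq> 0" "subdegree (det G) = d"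
  shows "\<exists>w. (\<forall>v. \<exists>u c. \<forall>i<r. v i = (\<Sum>j<r. G $$ (i, j) * u j) + (\<Sum>l<d. w l i * fps_const (c l))) \<and>
     (\<forall>u c. (\<forall>i<r. (\<Sum>j<r. G $$ (i, j) * u j) + (\<Sum>l<d. w l i * fps_const (c l)) = 0) \<longrightarrow> (\<forall>l<d. c l = 0))"
  using assms
proof (induct d arbitrary: G)
  case (0 G)
  have nz: "fps_nth (det G) 0 \<noteq> 0" using 0(2,3) by (simp add: subdegree_eq_0_iff)
  have inv: "det G * inverse (det G) = 1" using nz by (simp add: inverse_mult_eq_1')
  have "\<exists>u. \<forall>i<r. v i = (\<Sum>j<r. G $$ (i, j) * u j)" for v
  proof (intro exI allI impI)
    fix i assume i: "i < r"
    define V where "V = vec r v"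
    define u where "u = adj_mat G *\<^sub>v V"
    have a: "adj_mat G \<in> carrier_mat r r" using adj_mat[OF 0(1)] by simp
    have u: "u \<in> carrier_vec r" using a by (simp add: u_def V_def)
    have "G *\<^sub>v u = G * adj_mat G *\<^sub>v V"
      unfolding u_def using 0(1) a by (intro assoc_mult_mat_vec[symmetric]) (auto simp: V_def)
    also have "\<dots> = det G \<cdot>\<^sub>v V" unfolding adj_mat(2)[OF 0(1)] by (intro eq_vecI) (auto simp: V_def)
    finally have Gu: "(G *\<^sub>v u) $ i = det G * v i" using i by (simp add: V_def)
    have "(\<Sum>j<r. G $$ (i, j) * (u $ j * inverse (det G))) = (G *\<^sub>v u) $ i * inverse (det G)"
      using 0(1) i u by (simp add: scalar_prod_def atLeast0LessThan sum_distrib_right mult.assoc)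
    also have "\<dots> = v i * (det G * inverse (det G))" by (simp only: Gu mult_ac)
    finally show "v i = (\<Sum>j<r. G $$ (i, j) * (u $ j * inverse (det G)))"
      using inv by simp
  qed
  thus ?case by simp
next
  case (Suc d G)
  note G = Suc(2)
  interpret c: comm_ring_hom "\<lambda>f :: complex fps. fps_nth f 0" by standard auto
  define G0 where "G0 = map_mat (\<lambda>f. fps_nth f 0) G"
  have G0: "G0 \<in> carrier_mat r r" using G by (simp add: G0_def)
  have "fps_nth (det G) 0 = 0" using Suc(4) by (intro nth_less_subdegree_zero) simp
  hence "det G0 = 0" unfolding G0_def c.hom_det .
  then obtain c0 where c0: "c0 \<in> carrier_vec r" "c0 \<noteq> 0\<^sub>v r" "G0 *\<^sub>v c0 = 0\<^sub>v r"
    using det_0_iff_vec_prod_zero_field[OF G0] by auto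
  obtain J where J: "J < r" "c0 $ J \<noteq> 0" using c0(1,2) by (metis carrier_vecD eq_vecI index_zero_vec)
  define cc where "cc = (\<lambda>j. fps_const (c0 $ j))"
  define g where "g = (\<lambda>i. \<Sum>j<r. G $$ (i, j) * cc j)"
  define g' where "g' = (\<lambda>i. fps_shift 1 (g i))"
  have gX: "g i = fps_X * g' i" if "i < r" for i
  proof -
    have "fps_nth (g i) 0 = (G0 *\<^sub>v c0) $ i"
      using that G c0(1) by (simp add: g_def cc_def G0_def scalar_prod_def atLeast0LessThan fps_sum_nth)
    hence "fps_nth (g i) 0 = 0" using c0(3) that by simp
    thus ?thesis using fps_shift_decomp[of "g i"] by (simp add: g'_def)
  qed
  \<comment> \<open>By the choice of \<open>c0\<close>, the vector \<open>g = G c0\<close> is divisible by the variable; \<open>g'\<close> is the quotient.\<close>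
  define G' where "G' = replace_col G (vec r g') J"
  have G': "G' \<in> carrier_mat r r" using G by (simp add: G'_def replace_col_def)
  have G'i: "G' $$ (i, j) = (if j = J then g' i else G $$ (i, j))" if "i < r" "j < r" for i j
    using that G by (auto simp: G'_def replace_col_def)
  \<comment> \<open>By Cramer's rule both sides are the determinant of \<open>G\<close> with column \<open>J\<close> replaced by \<open>g\<close>.\<close>
  have detrel: "cc J * det G = fps_X * det G'"
  proof -
    have "replace_col G (G *\<^sub>v vec r cc) J = replace_col G' (G' *\<^sub>v (vec r (\<lambda>j. if j = J then fps_X else 0))) J"
    proof (rule eq_matI)
      fix i j assume "i < dim_row (replace_col G' (G' *\<^sub>v (vec r (\<lambda>j. if j = J then fps_X else 0))) J)"
        "j < dim_col (replace_col G' (G' *\<^sub>v (vec r (\<lambda>j. if j = J then fps_X else 0))) J)"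
      hence ij: "i < r" "j < r" using G' by (auto simp: replace_col_def)
      have "(G *\<^sub>v vec r cc) $ i = g i"
        using ij G by (simp add: g_def scalar_prod_def atLeast0LessThan)
      moreover have "(G' *\<^sub>v (vec r (\<lambda>j. if j = J then fps_X else 0))) $ i = (\<Sum>j<r. G' $$ (i, j) * (if j = J then fps_X else 0))"
        using ij G' by (simp add: scalar_prod_def atLeast0LessThan)
      moreover have "\<dots> = (\<Sum>j<r. if j = J then g' i * fps_X else 0)"
        using ij G'i by (intro sum.cong) auto
      moreover have "\<dots> = g i" using J ij gX by (simp add: mult.commute)
      ultimately show "replace_col G (G *\<^sub>v vec r cc) J $$ (i, j) =
          replace_col G' (G' *\<^sub>v (vec r (\<lambda>j. if j = J then fps_X else 0))) J $$ (i, j)"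
        using ij G G' G'i by (auto simp: replace_col_def)
    qed (use G G' in \<open>auto simp: replace_col_def\<close>)
    thus ?thesis using cramer_lemma_mat[OF G _ J(1), of "vec r cc"]
      cramer_lemma_mat[OF G' _ J(1), of "vec r (\<lambda>j. if j = J then fps_X else 0)"] J(1) by simp
  qed
  have ccJ: "cc J \<noteq> 0" "subdegree (cc J) = 0" using J by (auto simp: cc_def)
  have dG': "det G' \<noteq> 0" using detrel Suc(3) ccJ by auto
  have "subdegree (cc J * det G) = Suc d" using Suc(3,4) ccJ by simp
  moreover have "subdegree (fps_X * det G') = Suc (subdegree (det G'))" using dG' by simp
  ultimately have sd: "subdegree (det G') = d" using detrel by simp
  from Suc(1)[OF G' dG' sd] obtain w where
    w1: "\<forall>v. \<exists>u c. \<forall>i<r. v i = (\<Sum>j<r. G' $$ (i, j) * u j) + (\<Sum>l<d. w l i * fps_const (c l))" and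
    w2: "\<forall>u c. (\<forall>i<r. (\<Sum>j<r. G' $$ (i, j) * u j) + (\<Sum>l<d. w l i * fps_const (c l)) = 0) \<longrightarrow> (\<forall>l<d. c l = 0)"
    by blast
  \<comment> \<open>The image of \<open>G'\<close> consists of the image of \<open>G\<close> and the constant multiples of \<open>g'\<close>.\<close>
  have key: "(\<Sum>j<r. G' $$ (i, j) * (if j = J then fps_const s + fps_X * y J else y j)) =
      (\<Sum>j<r. G $$ (i, j) * ((if j = J then 0 else y j) + cc j * y J)) + g' i * fps_const s" if i: "i < r" for i s y
  proof -
    have "(\<Sum>j<r. G' $$ (i, j) * (if j = J then fps_const s + fps_X * y J else y j)) =
      (\<Sum>j<r. G $$ (i, j) * (if j = J then 0 else y j) + (if j = J then g' i * (fps_const s + fps_X * y J) else 0))"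
      using G'i i by (intro sum.cong) auto
    also have "\<dots> = (\<Sum>j<r. G $$ (i, j) * (if j = J then 0 else y j)) + g' i * (fps_const s + fps_X * y J)"
      using J by (simp add: sum.distrib)
    also have "g' i * (fps_const s + fps_X * y J) = g i * y J + g' i * fps_const s"
      by (simp only: gX[OF i] distrib_left mult_ac add_ac)
    also have "g i * y J = (\<Sum>j<r. G $$ (i, j) * (cc j * y J))"
      by (simp add: g_def sum_distrib_right mult.assoc)
    finally show ?thesis by (simp add: sum.distrib distrib_left)
  qed
  define w' where "w' = (\<lambda>l. if l = d then g' else w l)"
  have w': "(\<Sum>l<Suc d. w' l i * fps_const (c l)) = (\<Sum>l<d. w l i * fps_const (c l)) + g' i * fps_const (c d)" for i c
    by (simp add: w'_def)
  show ?case
  proof (intro exI[of _ w'] conjI allI impI)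
    fix v
    obtain u c where uc: "\<And>i. i < r \<Longrightarrow> v i = (\<Sum>j<r. G' $$ (i, j) * u j) + (\<Sum>l<d. w l i * fps_const (c l))"
      using w1 by metis
    define s where "s = fps_nth (u J) 0"
    define y where "y = (\<lambda>j. if j = J then fps_shift 1 (u J) else u j)"
    have uy: "u j = (if j = J then fps_const s + fps_X * y J else y j)" for j
      using fps_shift_decomp[of "u J"] by (simp add: y_def s_def)
    show "\<exists>u c. \<forall>i<r. v i = (\<Sum>j<r. G $$ (i, j) * u j) + (\<Sum>l<Suc d. w' l i * fps_const (c l))"
    proof (intro exI allI impI)
      fix i assume i: "i < r"
      have cs: "(\<Sum>l<d. w l i * fps_const (c l)) = (\<Sum>l<d. w l i * fps_const ((c(d := s)) l))" by (intro sum.cong) auto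
      have "v i = (\<Sum>j<r. G' $$ (i, j) * (if j = J then fps_const s + fps_X * y J else y j)) + (\<Sum>l<d. w l i * fps_const (c l))"
        unfolding uc[OF i] by (simp flip: uy)
      also have "\<dots> = (\<Sum>j<r. G $$ (i, j) * ((if j = J then 0 else y j) + cc j * y J)) + g' i * fps_const s + (\<Sum>l<d. w l i * fps_const (c l))"
        unfolding key[OF i] ..
      finally show "v i = (\<Sum>j<r. G $$ (i, j) * ((if j = J then 0 else y j) + cc j * y J)) + (\<Sum>l<Suc d. w' l i * fps_const ((c(d := s)) l))"
        unfolding w' cs by simp
    qed
  next
    fix u c l
    assume eq: "\<forall>i<r. (\<Sum>j<r. G $$ (i, j) * u j) + (\<Sum>l<Suc d. w' l i * fps_const (c l)) = 0" and l: "l < Suc d"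
    \<comment> \<open>Coordinates of \<open>G u\<close> with respect to \<open>g\<close> and the columns of \<open>G\<close> other than the one of index \<open>J\<close>.\<close>
    define y where "y = (\<lambda>j. if j = J then fps_const (1 / c0 $ J) * u J else u j - cc j * (fps_const (1 / c0 $ J) * u J))"
    have uy: "u j = (if j = J then 0 else y j) + cc j * y J" for j
    proof -
      have "cc J * fps_const (1 / c0 $ J) = 1" using J by (simp add: cc_def)
      hence "cc J * (fps_const (1 / c0 $ J) * u J) = u J" by (metis mult.assoc mult_1)
      thus ?thesis by (simp add: y_def)
    qed
    define u' where "u' = (\<lambda>j. if j = J then fps_const (c d) + fps_X * y J else y j)"
    have z: "(\<Sum>j<r. G' $$ (i, j) * u' j) + (\<Sum>l<d. w l i * fps_const (c l)) = 0" if i: "i < r" for i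
    proof -
      have "(\<Sum>j<r. G' $$ (i, j) * u' j) = (\<Sum>j<r. G $$ (i, j) * u j) + g' i * fps_const (c d)"
        unfolding u'_def key[OF i] by (simp flip: uy)
      thus ?thesis using eq i unfolding w' by (simp add: add_ac)
    qed
    hence c0': "\<forall>l<d. c l = 0" using w2 by blast
    have "G' *\<^sub>v vec r u' = 0\<^sub>v r"
    proof (rule eq_vecI)
      fix i assume "i < dim_vec (0\<^sub>v r :: complex fps vec)"
      hence i: "i < r" by simp
      have "(\<Sum>l<d. w l i * fps_const (c l)) = 0" using c0' by (intro sum.neutral) auto
      thus "(G' *\<^sub>v vec r u') $ i = 0\<^sub>v r $ i" using z[OF i] G' i by (simp add: scalar_prod_def atLeast0LessThan)
    qed (use G' in auto)
    hence "vec r u' = 0\<^sub>v r" using det_0_iff_vec_prod_zero[OF G'] dG' by (metis vec_carrier)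
    hence "vec r u' $ J = 0" using J by simp
    hence "fps_const (c d) + fps_X * y J = 0" using J by (simp add: u'_def)
    hence "fps_nth (fps_const (c d) + fps_X * y J) 0 = 0" by simp
    hence "c d = 0" by simp
    thus "c l = 0" using c0' l by (cases "l = d") auto
  qed
qed

lemma sum_div_mod:
  fixes f :: "nat \<Rightarrow> nat \<Rightarrow> 'a :: comm_monoid_add"
  assumes "0 < r"
  shows "(\<Sum>m<k * r. f (m div r) (m mod r)) = (\<Sum>a<k. \<Sum>j<r. f a j)"
proof -
  have "(\<Sum>a<k. \<Sum>m\<in>{a * r..<a * r + r}. f (m div r) (m mod r)) = (\<Sum>m<k * r. f (m div r) (m mod r))"
    by (rule sum.nat_group)
  moreover have "(\<Sum>m\<in>{a * r..<a * r + r}. f (m div r) (m mod r)) = (\<Sum>j<r. f a j)" for a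
  proof -
    have "(\<Sum>m\<in>{0 + a * r..<r + a * r}. f (m div r) (m mod r)) = (\<Sum>j\<in>{0..<r}. f ((j + a * r) div r) ((j + a * r) mod r))"
      by (rule sum.shift_bounds_nat_ivl)
    also have "\<dots> = (\<Sum>j<r. f a j)" using assms by (intro sum.cong) auto
    finally show ?thesis by (simp add: add.commute)
  qed
  ultimately show ?thesis by simp
qed

lemma toeplitz_mult:
  assumes r: "0 < r"
  shows "toeplitz k r K *\<^sub>v vec (k * r) (\<lambda>m. fps_nth (v (m mod r)) (m div r)) =
     vec (k * r) (\<lambda>m. fps_nth (\<Sum>j<r. K (m mod r) j * v j) (m div r))"
proof (rule eq_vecI)
  fix m assume "m < dim_vec (vec (k * r) (\<lambda>m. fps_nth (\<Sum>j<r. K (m mod r) j * v j) (m div r)))"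
  hence m: "m < k * r" by simp
  define a i where "a = m div r" and "i = m mod r"
  have a: "a < k" using m by (simp add: a_def less_mult_imp_div_less)
  have "(toeplitz k r K *\<^sub>v vec (k * r) (\<lambda>m. fps_nth (v (m mod r)) (m div r))) $ m =
     (\<Sum>m'<k * r. (if m' div r \<le> a then fps_nth (K i (m' mod r)) (a - m' div r) else 0) * fps_nth (v (m' mod r)) (m' div r))"
    using m unfolding a_def i_def by (simp add: toeplitz_def scalar_prod_def atLeast0LessThan)
  also have "\<dots> = (\<Sum>b<k. \<Sum>j<r. (if b \<le> a then fps_nth (K i j) (a - b) else 0) * fps_nth (v j) b)"
    by (rule sum_div_mod[OF r, of "\<lambda>b j. (if b \<le> a then fps_nth (K i j) (a - b) else 0) * fps_nth (v j) b"])
  also have "\<dots> = (\<Sum>j<r. \<Sum>b<k. (if b \<le> a then fps_nth (K i j) (a - b) else 0) * fps_nth (v j) b)"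
    by (rule sum.swap)
  also have "\<dots> = (\<Sum>j<r. fps_nth (K i j * v j) a)"
  proof (rule sum.cong[OF refl])
    fix j
    have "(\<Sum>b<k. (if b \<le> a then fps_nth (K i j) (a - b) else 0) * fps_nth (v j) b) =
       (\<Sum>b\<in>{0..a}. fps_nth (v j) b * fps_nth (K i j) (a - b))"
      using a by (intro sum.mono_neutral_cong_right) auto
    also have "\<dots> = fps_nth (K i j * v j) a" by (subst mult.commute) (simp add: fps_mult_nth)
    finally show "(\<Sum>b<k. (if b \<le> a then fps_nth (K i j) (a - b) else 0) * fps_nth (v j) b) = fps_nth (K i j * v j) a" .
  qed
  finally show "(toeplitz k r K *\<^sub>v vec (k * r) (\<lambda>m. fps_nth (v (m mod r)) (m div r))) $ m =
     vec (k * r) (\<lambda>m. fps_nth (\<Sum>j<r. K (m mod r) j * v j) (m div r)) $ m"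
    using m by (simp add: a_def i_def fps_sum_nth)
qed (simp add: toeplitz_def)

text \<open>
  Here \<open>K\<close> is \<open>x\<^sup>k G\<^sup>-\<^sup>1\<close>. Modulo \<open>x\<^sup>k\<close> it kills the image of \<open>G\<close> by \<open>K G = x\<^sup>k\<close>, and by \<open>G K = x\<^sup>k\<close> it is injective on a
  complement of this image; so its rank is the dimension of the cokernel of \<open>G\<close>.
\<close>

lemma toeplitz_rank:
  fixes G :: "complex fps mat"
  assumes r: "0 < r" and G: "G \<in> carrier_mat r r" and dG: "det G \<noteq> 0"
    and KG: "\<And>i l. i < r \<Longrightarrow> l < r \<Longrightarrow> (\<Sum>j<r. K i j * G $$ (j, l)) = (if i = l then fps_X ^ k else 0)"
    and GK: "\<And>i l. i < r \<Longrightarrow> l < r \<Longrightarrow> (\<Sum>j<r. G $$ (i, j) * K j l) = (if i = l then fps_X ^ k else 0)"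
  shows "mat_rank (toeplitz k r K) = subdegree (det G)"
proof -
  define d where "d = subdegree (det G)"
  obtain w where
    w1: "\<forall>v. \<exists>u c. \<forall>i<r. v i = (\<Sum>j<r. G $$ (i, j) * u j) + (\<Sum>l<d. w l i * fps_const (c l))" and
    w2: "\<forall>u c. (\<forall>i<r. (\<Sum>j<r. G $$ (i, j) * u j) + (\<Sum>l<d. w l i * fps_const (c l)) = 0) \<longrightarrow> (\<forall>l<d. c l = 0)"
    using fps_cokernel_complement[OF G dG d_def[symmetric]] by blast
  \<comment> \<open>The image of the complement under \<open>K\<close>, truncated like the Toeplitz matrix.\<close>
  define B where "B = mat (k * r) d (\<lambda>(m, l). fps_nth (\<Sum>j<r. K (m mod r) j * w l j) (m div r))"
  have B: "B \<in> carrier_mat (k * r) d" by (simp add: B_def)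
  have T: "toeplitz k r K \<in> carrier_mat (k * r) (k * r)" by (simp add: toeplitz_def)
  have KGu: "(\<Sum>j<r. K i j * (\<Sum>l<r. G $$ (j, l) * u l)) = fps_X ^ k * u i" if i: "i < r" for i u
  proof -
    have "(\<Sum>j<r. K i j * (\<Sum>l<r. G $$ (j, l) * u l)) = (\<Sum>j<r. \<Sum>l<r. K i j * G $$ (j, l) * u l)"
      by (simp add: sum_distrib_left mult.assoc)
    also have "\<dots> = (\<Sum>l<r. \<Sum>j<r. K i j * G $$ (j, l) * u l)" by (rule sum.swap)
    also have "\<dots> = (\<Sum>l<r. (\<Sum>j<r. K i j * G $$ (j, l)) * u l)" by (simp add: sum_distrib_right)
    also have "\<dots> = (\<Sum>l<r. if i = l then fps_X ^ k * u i else 0)" using KG i by (intro sum.cong) auto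
    finally show ?thesis using i by simp
  qed
  have GKu: "(\<Sum>j<r. G $$ (i, j) * (\<Sum>l<r. K j l * u l)) = fps_X ^ k * u i" if i: "i < r" for i u
  proof -
    have "(\<Sum>j<r. G $$ (i, j) * (\<Sum>l<r. K j l * u l)) = (\<Sum>j<r. \<Sum>l<r. G $$ (i, j) * K j l * u l)"
      by (simp add: sum_distrib_left mult.assoc)
    also have "\<dots> = (\<Sum>l<r. \<Sum>j<r. G $$ (i, j) * K j l * u l)" by (rule sum.swap)
    also have "\<dots> = (\<Sum>l<r. (\<Sum>j<r. G $$ (i, j) * K j l) * u l)" by (simp add: sum_distrib_right)
    also have "\<dots> = (\<Sum>l<r. if i = l then fps_X ^ k * u i else 0)" using GK i by (intro sum.cong) auto
    finally show ?thesis using i by simp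
  qed
  have Bc: "B *\<^sub>v vec d c = vec (k * r) (\<lambda>m. fps_nth (\<Sum>j<r. K (m mod r) j * (\<Sum>l<d. w l j * fps_const (c l))) (m div r))" for c
  proof (rule eq_vecI)
    fix m assume "m < dim_vec (vec (k * r) (\<lambda>m. fps_nth (\<Sum>j<r. K (m mod r) j * (\<Sum>l<d. w l j * fps_const (c l))) (m div r)))"
    hence m: "m < k * r" by simp
    have "(\<Sum>j<r. K (m mod r) j * (\<Sum>l<d. w l j * fps_const (c l))) = (\<Sum>j<r. \<Sum>l<d. K (m mod r) j * w l j * fps_const (c l))"
      by (simp add: sum_distrib_left mult.assoc)
    also have "\<dots> = (\<Sum>l<d. \<Sum>j<r. K (m mod r) j * w l j * fps_const (c l))" by (rule sum.swap)
    also have "\<dots> = (\<Sum>l<d. (\<Sum>j<r. K (m mod r) j * w l j) * fps_const (c l))" by (simp add: sum_distrib_right)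
    finally have "fps_nth (\<Sum>j<r. K (m mod r) j * (\<Sum>l<d. w l j * fps_const (c l))) (m div r) =
        (\<Sum>l<d. fps_nth (\<Sum>j<r. K (m mod r) j * w l j) (m div r) * c l)"
      by (simp only: fps_sum_nth[of _ "{..<d}"] fps_mult_right_const_nth)
    thus "(B *\<^sub>v vec d c) $ m = vec (k * r) (\<lambda>m. fps_nth (\<Sum>j<r. K (m mod r) j * (\<Sum>l<d. w l j * fps_const (c l))) (m div r)) $ m"
      using m by (simp add: B_def scalar_prod_def atLeast0LessThan)
  qed (simp add: B_def)
  show ?thesis unfolding d_def[symmetric]
  proof (rule mat_rank_eqI[OF T B])
    show "mat_range (toeplitz k r K) = mat_range B"
    proof (intro equalityI subsetI)
      fix y assume "y \<in> mat_range (toeplitz k r K)"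
      then obtain x where x: "x \<in> carrier_vec (k * r)" "y = toeplitz k r K *\<^sub>v x"
        using T by (auto simp: mat_range_def)
      define v where "v = (\<lambda>j. Abs_fps (\<lambda>b. x $ (b * r + j)))"
      have xv: "x = vec (k * r) (\<lambda>m. fps_nth (v (m mod r)) (m div r))"
        using x by (intro eq_vecI) (auto simp: v_def)
      obtain u c where uc: "\<And>i. i < r \<Longrightarrow> v i = (\<Sum>j<r. G $$ (i, j) * u j) + (\<Sum>l<d. w l i * fps_const (c l))"
        using w1 by metis
      have "y = vec (k * r) (\<lambda>m. fps_nth (\<Sum>j<r. K (m mod r) j * v j) (m div r))"
        unfolding x(2) by (subst xv) (rule toeplitz_mult[OF r])
      also have "\<dots> = B *\<^sub>v vec d c"
        unfolding Bc
      proof (rule eq_vecI)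
        fix m assume "m < dim_vec (vec (k * r) (\<lambda>m. fps_nth (\<Sum>j<r. K (m mod r) j * (\<Sum>l<d. w l j * fps_const (c l))) (m div r)))"
        hence m: "m < k * r" by simp
        hence a: "m div r < k" by (simp add: less_mult_imp_div_less)
        have i: "m mod r < r" using r by simp
        have "(\<Sum>j<r. K (m mod r) j * v j) = (\<Sum>j<r. K (m mod r) j * (\<Sum>l<r. G $$ (j, l) * u l))
            + (\<Sum>j<r. K (m mod r) j * (\<Sum>l<d. w l j * fps_const (c l)))"
          unfolding sum.distrib[symmetric] distrib_left[symmetric] using uc by (intro sum.cong) auto
        hence "fps_nth (\<Sum>j<r. K (m mod r) j * v j) (m div r) =
            fps_nth (\<Sum>j<r. K (m mod r) j * (\<Sum>l<d. w l j * fps_const (c l))) (m div r)"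
          unfolding KGu[OF i] using a by (simp add: fps_X_power_mult_nth)
        thus "vec (k * r) (\<lambda>m. fps_nth (\<Sum>j<r. K (m mod r) j * v j) (m div r)) $ m =
          vec (k * r) (\<lambda>m. fps_nth (\<Sum>j<r. K (m mod r) j * (\<Sum>l<d. w l j * fps_const (c l))) (m div r)) $ m"
          using m by simp
      qed simp
      finally show "y \<in> mat_range B" using B by (auto simp: mat_range_def)
    next
      fix y assume "y \<in> mat_range B"
      then obtain c where c: "c \<in> carrier_vec d" "y = B *\<^sub>v c" using B by (auto simp: mat_range_def)
      have "c = vec d (\<lambda>l. c $ l)" using c by auto
      hence "y = toeplitz k r K *\<^sub>v vec (k * r) (\<lambda>m. fps_nth (\<Sum>l<d. w l (m mod r) * fps_const (c $ l)) (m div r))"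
        unfolding c(2) toeplitz_mult[OF r, of k K "\<lambda>j. \<Sum>l<d. w l j * fps_const (c $ l)"]
        using Bc[of "\<lambda>l. c $ l"] by simp
      thus "y \<in> mat_range (toeplitz k r K)" using T by (auto simp: mat_range_def)
    qed
  next
    fix c assume c: "c \<in> carrier_vec d" "B *\<^sub>v c = 0\<^sub>v (k * r)"
    define Wc where "Wc = (\<lambda>j. \<Sum>l<d. w l j * fps_const (c $ l))"
    have cv: "c = vec d (\<lambda>l. c $ l)" using c by auto
    have z: "fps_nth (\<Sum>j<r. K i j * Wc j) a = 0" if "a < k" "i < r" for a i
    proof -
      have m: "a * r + i < k * r"
      proof -
        have "a * r + i < Suc a * r" using that by simp
        also have "\<dots> \<le> k * r" using that by (intro mult_right_mono) auto
        finally show ?thesis .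
      qed
      have "(B *\<^sub>v vec d (\<lambda>l. c $ l)) $ (a * r + i) = 0" using c cv m by simp
      thus ?thesis unfolding Bc using m that by (simp add: Wc_def)
    qed
    \<comment> \<open>As \<open>K Wc\<close> is divisible by \<open>x\<^sup>k\<close>, the vector \<open>Wc\<close> equals \<open>G u\<close> and lies in the image of \<open>G\<close>.\<close>
    define u where "u = (\<lambda>i. fps_shift k (\<Sum>j<r. K i j * Wc j))"
    have u: "(\<Sum>j<r. K i j * Wc j) = fps_X ^ k * u i" if "i < r" for i
      using z[OF _ that] by (intro fps_ext) (auto simp: u_def fps_X_power_mult_nth)
    have "(\<Sum>j<r. G $$ (i, j) * u j) = Wc i" if i: "i < r" for i
    proof -
      have "fps_X ^ k * (\<Sum>j<r. G $$ (i, j) * u j) = (\<Sum>j<r. G $$ (i, j) * (\<Sum>l<r. K j l * Wc l))"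
        using u by (simp add: sum_distrib_left mult_ac)
      also have "\<dots> = fps_X ^ k * Wc i" by (rule GKu[OF i])
      finally show ?thesis by simp
    qed
    hence "\<forall>i<r. (\<Sum>j<r. G $$ (i, j) * (- u j)) + (\<Sum>l<d. w l i * fps_const (c $ l)) = 0"
      by (simp add: Wc_def sum_negf)
    hence "\<forall>l<d. c $ l = 0" using w2[THEN spec[of _ "\<lambda>j. - u j"], THEN spec[of _ "\<lambda>l. c $ l"]] by blast
    thus "c = 0\<^sub>v d" using c by (intro eq_vecI) auto
  qed
qed

section \<open>Matrix-valued functions\<close>

text \<open>
  Holomorphic and continuous matrix functions are closed under the same algebraic operations, which are
  therefore treated for an arbitrary class \<open>A\<close> of scalar functions.
\<close>

definition mat_fun :: "(('a \<Rightarrow> complex) \<Rightarrow> bool) \<Rightarrow> 'a set \<Rightarrow> nat \<Rightarrow> nat \<Rightarrow> ('a \<Rightarrow> complex mat) \<Rightarrow> bool" where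
  "mat_fun A S r c F \<longleftrightarrow> (\<forall>x\<in>S. F x \<in> carrier_mat r c) \<and> (\<forall>i<r. \<forall>j<c. A (\<lambda>x. F x $$ (i, j)))"

lemma mat_funI:
  assumes "\<And>x. x \<in> S \<Longrightarrow> F x \<in> carrier_mat r c" "\<And>i j. i < r \<Longrightarrow> j < c \<Longrightarrow> A (\<lambda>x. F x $$ (i, j))"
  shows "mat_fun A S r c F"
  using assms by (simp add: mat_fun_def)

lemma mat_fun_carrier: "mat_fun A S r c F \<Longrightarrow> x \<in> S \<Longrightarrow> F x \<in> carrier_mat r c"
  by (simp add: mat_fun_def)

lemma mat_fun_entry: "mat_fun A S r c F \<Longrightarrow> i < r \<Longrightarrow> j < c \<Longrightarrow> A (\<lambda>x. F x $$ (i, j))"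
  by (simp add: mat_fun_def)

abbreviation hol_mat :: "complex set \<Rightarrow> nat \<Rightarrow> nat \<Rightarrow> (complex \<Rightarrow> complex mat) \<Rightarrow> bool" where
  "hol_mat S \<equiv> mat_fun (\<lambda>f. f holomorphic_on S) S"

abbreviation cont_mat :: "'a :: topological_space set \<Rightarrow> nat \<Rightarrow> nat \<Rightarrow> ('a \<Rightarrow> complex mat) \<Rightarrow> bool" where
  "cont_mat S \<equiv> mat_fun (\<lambda>f. continuous_on S f) S"

lemma permutes_lt: "p permutes {0..<n} \<Longrightarrow> i < n \<Longrightarrow> p i < (n :: nat)"
  using permutes_in_image[of p "{0..<n}" i] by simp

locale fun_alg =
  fixes S :: "'a set" and A :: "('a \<Rightarrow> complex) \<Rightarrow> bool"
  assumes const: "A (\<lambda>_. c)"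
    and add: "A f \<Longrightarrow> A g \<Longrightarrow> A (\<lambda>x. f x + g x)"
    and mult: "A f \<Longrightarrow> A g \<Longrightarrow> A (\<lambda>x. f x * g x)"
    and cong: "A f \<Longrightarrow> (\<And>x. x \<in> S \<Longrightarrow> f x = g x) \<Longrightarrow> A g"
begin

lemma sum: "(\<And>i. i \<in> I \<Longrightarrow> A (f i)) \<Longrightarrow> A (\<lambda>x. \<Sum>i\<in>I. f i x)"
  by (induct I rule: infinite_finite_induct) (auto intro: const add)

lemma prod: "(\<And>i. i \<in> I \<Longrightarrow> A (f i)) \<Longrightarrow> A (\<lambda>x. \<Prod>i\<in>I. f i x)"
  by (induct I rule: infinite_finite_induct) (auto intro: const mult)

lemma mat_cong:
  assumes "mat_fun A S r c F" "\<And>x. x \<in> S \<Longrightarrow> F x = G x"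
  shows "mat_fun A S r c G"
  using assms by (intro mat_funI) (auto dest: mat_fun_carrier intro: cong[OF mat_fun_entry[of A S r c F]])

lemma mat_const: "M \<in> carrier_mat r c \<Longrightarrow> mat_fun A S r c (\<lambda>_. M)"
  by (intro mat_funI const) auto

lemma mat_mult:
  assumes F: "mat_fun A S r m F" and G: "mat_fun A S m c G"
  shows "mat_fun A S r c (\<lambda>x. F x * G x)"
proof (rule mat_funI)
  fix i j assume ij: "i < r" "j < c"
  have "A (\<lambda>x. \<Sum>k<m. F x $$ (i, k) * G x $$ (k, j))"
    by (intro sum mult mat_fun_entry[OF F] mat_fun_entry[OF G]) (use ij in auto)
  thus "A (\<lambda>x. (F x * G x) $$ (i, j))"
    by (rule cong) (use ij mat_fun_carrier[OF F] mat_fun_carrier[OF G] in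
        \<open>simp add: scalar_prod_def atLeast0LessThan carrier_matD[of _ r m] carrier_matD[of _ m c]\<close>)
qed (use mat_fun_carrier[OF F] mat_fun_carrier[OF G] in \<open>blast intro: mult_carrier_mat\<close>)

lemma mat_add:
  assumes F: "mat_fun A S r c F" and G: "mat_fun A S r c G"
  shows "mat_fun A S r c (\<lambda>x. F x + G x)"
proof (rule mat_funI)
  fix i j assume ij: "i < r" "j < c"
  have "A (\<lambda>x. F x $$ (i, j) + G x $$ (i, j))"
    by (intro add mat_fun_entry[OF F] mat_fun_entry[OF G]) (use ij in auto)
  thus "A (\<lambda>x. (F x + G x) $$ (i, j))"
    by (rule cong) (use ij mat_fun_carrier[OF F] mat_fun_carrier[OF G] in \<open>simp add: carrier_matD[of _ r c]\<close>)
qed (use mat_fun_carrier[OF F] mat_fun_carrier[OF G] in auto)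

lemma mat_smult:
  assumes f: "A f" and G: "mat_fun A S r c G"
  shows "mat_fun A S r c (\<lambda>x. f x \<cdot>\<^sub>m G x)"
proof (rule mat_funI)
  fix i j assume ij: "i < r" "j < c"
  have "A (\<lambda>x. f x * G x $$ (i, j))"
    by (intro mult f mat_fun_entry[OF G]) (use ij in auto)
  thus "A (\<lambda>x. (f x \<cdot>\<^sub>m G x) $$ (i, j))"
    by (rule cong) (use ij mat_fun_carrier[OF G] in \<open>simp add: carrier_matD[of _ r c]\<close>)
qed (use mat_fun_carrier[OF G] in auto)

lemma mat_minus:
  assumes F: "mat_fun A S r c F" and G: "mat_fun A S r c G"
  shows "mat_fun A S r c (\<lambda>x. F x - G x)"
proof -
  have "mat_fun A S r c (\<lambda>x. F x + (-1) \<cdot>\<^sub>m G x)"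
    by (intro mat_add F mat_smult G const)
  thus ?thesis
    by (rule mat_cong) (use mat_fun_carrier[OF F] mat_fun_carrier[OF G] in \<open>fastforce intro!: eq_matI\<close>)
qed

lemma det:
  assumes F: "mat_fun A S n n F"
  shows "A (\<lambda>x. det (F x))"
proof -
  have "A (\<lambda>x. \<Sum>p | p permutes {0..<n}. signof p * (\<Prod>i = 0..<n. F x $$ (i, p i)))"
    by (intro sum mult const prod mat_fun_entry[OF F]) (auto simp: permutes_lt)
  thus ?thesis
    by (rule cong) (simp add: det_def'[OF mat_fun_carrier[OF F]])
qed

lemma adj:
  assumes F: "mat_fun A S n n F"
  shows "mat_fun A S n n (\<lambda>x. adj_mat (F x))"
proof (rule mat_funI)
  fix i j assume ij: "i < n" "j < n"
  have "mat_fun A S (n - 1) (n - 1) (\<lambda>x. mat_delete (F x) j i)"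
  proof (rule mat_funI)
    fix a b assume ab: "a < n - 1" "b < n - 1"
    have "A (\<lambda>x. F x $$ (if a < j then a else Suc a, if b < i then b else Suc b))"
      by (rule mat_fun_entry[OF F]) (use ab in auto)
    thus "A (\<lambda>x. mat_delete (F x) j i $$ (a, b))"
      by (rule cong) (use ab mat_fun_carrier[OF F] in \<open>simp add: mat_delete_def carrier_matD[of _ n n]\<close>)
  qed (use mat_fun_carrier[OF F] in \<open>simp add: mat_delete_def carrier_matD[of _ n n]\<close>)
  hence "A (\<lambda>x. (-1) ^ (j + i) * Determinant.det (mat_delete (F x) j i))" by (intro mult const det)
  thus "A (\<lambda>x. adj_mat (F x) $$ (i, j))"
    by (rule cong) (use ij mat_fun_carrier[OF F] in \<open>simp add: adj_mat_def cofactor_def carrier_matD[of _ n n]\<close>)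
qed (use mat_fun_carrier[OF F] adj_mat in blast)

end

lemma fun_alg_hol: "fun_alg S (\<lambda>f. f holomorphic_on S)"
  by standard (auto intro!: holomorphic_intros intro: holomorphic_transform)

lemma fun_alg_cont: "fun_alg S (\<lambda>f. continuous_on S f)"
  by standard (auto intro!: continuous_intros intro: continuous_on_eq)

lemma mat_fun_sub:
  assumes "mat_fun A S r c F" "T \<subseteq> S" "\<And>f. A f \<Longrightarrow> B f"
  shows "mat_fun B T r c F"
  using assms by (auto simp: mat_fun_def)

lemma hol_mat_sub: "hol_mat S r c F \<Longrightarrow> T \<subseteq> S \<Longrightarrow> hol_mat T r c F"
  by (erule mat_fun_sub) (auto intro: holomorphic_on_subset)

lemma hol_mat_cont: "hol_mat S r c F \<Longrightarrow> T \<subseteq> S \<Longrightarrow> cont_mat T r c F"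
  by (erule mat_fun_sub) (auto intro: holomorphic_on_imp_continuous_on continuous_on_subset)

lemma cont_mat_adjoint:
  assumes F: "cont_mat S r c F"
  shows "cont_mat S c r (\<lambda>x. mat_adjoint (F x))"
proof (rule mat_funI)
  fix i j assume ij: "i < c" "j < r"
  have "continuous_on S (\<lambda>x. cnj (F x $$ (j, i)))"
    by (intro continuous_intros mat_fun_entry[OF F]) (use ij in auto)
  thus "continuous_on S (\<lambda>x. mat_adjoint (F x) $$ (i, j))"
    by (rule continuous_on_eq) (use ij mat_fun_carrier[OF F] in \<open>simp add: carrier_matD[of _ r c]\<close>)
qed (use mat_fun_carrier[OF F] in auto)

lemma hol_mat_inv:
  assumes F: "hol_mat S n n F" and d: "\<And>x. x \<in> S \<Longrightarrow> det (F x) \<noteq> 0"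
  shows "hol_mat S n n (\<lambda>x. mat_inv (F x))"
proof -
  interpret fun_alg S "\<lambda>f. f holomorphic_on S" by (rule fun_alg_hol)
  have "hol_mat S n n (\<lambda>x. (1 / det (F x)) \<cdot>\<^sub>m adj_mat (F x))"
    by (intro mat_smult adj F holomorphic_on_divide det holomorphic_on_const) (use F d in auto)
  thus ?thesis
    by (rule mat_cong) (simp add: mat_inv_adj[OF mat_fun_carrier[OF F] d])
qed

lemma mat_fun_continuous_eq:
  fixes F G :: "complex \<Rightarrow> complex mat"
  assumes F: "cont_mat S r c F" and G: "cont_mat S r c G" and S: "open S" "z \<in> S"
    and ev: "\<forall>\<^sub>F w in at z. F w = G w"
  shows "F z = G z"
proof (rule eq_matI)
  fix i j assume "i < dim_row (G z)" "j < dim_col (G z)"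
  hence ij: "i < r" "j < c" using mat_fun_carrier[OF G S(2)] by auto
  have "isCont (\<lambda>w. F w $$ (i, j)) z"
    using continuous_on_eq_continuous_at[OF S(1)] mat_fun_entry[OF F ij] S(2) by blast
  hence "(\<lambda>w. F w $$ (i, j)) \<midarrow>z\<rightarrow> F z $$ (i, j)" by (rule isContD)
  hence 1: "(\<lambda>w. G w $$ (i, j)) \<midarrow>z\<rightarrow> F z $$ (i, j)"
    by (rule Lim_transform_eventually) (use ev in eventually_elim, simp)
  have "isCont (\<lambda>w. G w $$ (i, j)) z"
    using continuous_on_eq_continuous_at[OF S(1)] mat_fun_entry[OF G ij] S(2) by blast
  hence 2: "(\<lambda>w. G w $$ (i, j)) \<midarrow>z\<rightarrow> G z $$ (i, j)" by (rule isContD)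
  show "F z $$ (i, j) = G z $$ (i, j)" using LIM_unique[OF 1 2] .
qed (use mat_fun_carrier[OF F S(2)] mat_fun_carrier[OF G S(2)] in auto)

text \<open>
  With \<open>k\<close> the order of the pole, the Toeplitz matrix built from the Laurent coefficients of \<open>G\<^sup>-\<^sup>1\<close> is that of the power
  series matrix \<open>x\<^sup>k G\<^sup>-\<^sup>1\<close>, to which \<open>toeplitz_rank\<close> applies.
\<close>

lemma pole_mult_at_mat_inv:
  assumes S: "open S" "z0 \<in> S" and G: "hol_mat S r r G" and r: "0 < r"
    and nz: "\<forall>\<^sub>F z in at z0. det (G z) \<noteq> 0"
  shows "pole_mult_at r r (\<lambda>z. mat_inv (G z)) z0 = nat (zorder (\<lambda>z. det (G z)) z0)"
proof -
  interpret fun_alg S "\<lambda>f. f holomorphic_on S" by (rule fun_alg_hol)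
  interpret h: comm_ring_hom "fps_to_fls :: complex fps \<Rightarrow> complex fls"
    by standard (auto simp: fls_times_fps_to_fls)
  have inS: "\<forall>\<^sub>F w in at 0. z0 + w \<in> S"
  proof -
    have "\<forall>\<^sub>F z in at z0. z \<in> S" using S by (rule eventually_at_in_open')
    thus ?thesis by (simp add: at_to_0[of z0] eventually_filtermap add_ac)
  qed
  have nz0: "\<forall>\<^sub>F w in at 0. det (G (z0 + w)) \<noteq> 0"
    using nz by (simp add: at_to_0[of z0] eventually_filtermap add_ac)
  define Gf where "Gf = mat r r (\<lambda>(i, j). fps_expansion (\<lambda>z. G z $$ (i, j)) z0)"
  have Gf: "Gf \<in> carrier_mat r r" by (simp add: Gf_def)
  have an: "f analytic_on {z0}" if "f holomorphic_on S" for f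
    using that S analytic_at by blast
  have gexp: "(\<lambda>w. G (z0 + w) $$ (i, j)) has_laurent_expansion fps_to_fls (Gf $$ (i, j))" if "i < r" "j < r" for i j
    using analytic_at_imp_has_fps_expansion[OF an[OF mat_fun_entry[OF G that]]] that
    by (auto simp: Gf_def intro: has_laurent_expansion_fps)
  have dexp: "(\<lambda>w. det (G (z0 + w))) has_laurent_expansion fps_to_fls (det Gf)"
  proof -
    have "(\<lambda>w. \<Sum>p | p permutes {0..<r}. signof p * (\<Prod>i = 0..<r. G (z0 + w) $$ (i, p i))) has_laurent_expansion
        (\<Sum>p | p permutes {0..<r}. fls_const (signof p) * (\<Prod>i = 0..<r. fps_to_fls (Gf $$ (i, p i))))"
      by (intro has_laurent_expansion_sum has_laurent_expansion_mult has_laurent_expansion_prod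
          has_laurent_expansion_const gexp) (auto simp: permutes_lt)
    moreover have "(\<Sum>p | p permutes {0..<r}. fls_const (signof p) * (\<Prod>i = 0..<r. fps_to_fls (Gf $$ (i, p i)))) = fps_to_fls (det Gf)"
    proof -
      have "fls_const (signof p) = (signof p :: complex fls)" for p :: "nat \<Rightarrow> nat"
        by (simp add: sign_def)
      hence "(\<Sum>p | p permutes {0..<r}. fls_const (signof p) * (\<Prod>i = 0..<r. fps_to_fls (Gf $$ (i, p i)))) = det (map_mat fps_to_fls Gf)"
        using Gf by (subst det_def'[of _ r]) (auto simp: permutes_lt intro!: sum.cong prod.cong)
      thus ?thesis by simp
    qed
    moreover have "\<forall>\<^sub>F w in at 0. (\<Sum>p | p permutes {0..<r}. signof p * (\<Prod>i = 0..<r. G (z0 + w) $$ (i, p i))) = det (G (z0 + w))"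
      using inS by eventually_elim (simp add: det_def'[OF mat_fun_carrier[OF G]])
    ultimately show ?thesis by (simp add: has_laurent_expansion_cong)
  qed
  have dnz: "det Gf \<noteq> 0"
  proof
    assume "det Gf = 0"
    hence "(\<lambda>w. det (G (z0 + w))) has_laurent_expansion 0" using dexp by simp
    hence "\<forall>\<^sub>F w in at 0. det (G (z0 + w)) = 0" by (simp add: has_laurent_expansion_def)
    with nz0 have "\<forall>\<^sub>F w in at (0 :: complex). False" by eventually_elim auto
    thus False by simp
  qed
  have zo: "zorder (\<lambda>z. det (G z)) z0 = int (subdegree (det Gf))"
    using has_laurent_expansion_zorder[OF dexp] dnz by (simp add: fls_subdegree_fls_to_fps)
  define F where "F = (\<lambda>i j. laurent_expansion (\<lambda>z. mat_inv (G z) $$ (i, j)) z0)"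
  have Fexp: "(\<lambda>w. mat_inv (G (z0 + w)) $$ (i, j)) has_laurent_expansion F i j" if ij: "i < r" "j < r" for i j
  proof -
    have "(\<lambda>z. adj_mat (G z) $$ (i, j)) holomorphic_on S" by (rule mat_fun_entry[OF adj[OF G] ij])
    from analytic_at_imp_has_fps_expansion[OF an[OF this]]
    have "(\<lambda>w. adj_mat (G (z0 + w)) $$ (i, j)) has_laurent_expansion fps_to_fls (fps_expansion (\<lambda>z. adj_mat (G z) $$ (i, j)) z0)"
      by (rule has_laurent_expansion_fps)
    from has_laurent_expansion_divide[OF this dexp]
    have "(\<lambda>w. adj_mat (G (z0 + w)) $$ (i, j) / det (G (z0 + w))) has_laurent_expansion
      fps_to_fls (fps_expansion (\<lambda>z. adj_mat (G z) $$ (i, j)) z0) / fps_to_fls (det Gf)" .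
    moreover have "\<forall>\<^sub>F w in at 0. adj_mat (G (z0 + w)) $$ (i, j) / det (G (z0 + w)) = mat_inv (G (z0 + w)) $$ (i, j)"
      using inS nz0
    proof eventually_elim
      case (elim w)
      have c: "G (z0 + w) \<in> carrier_mat r r" using mat_fun_carrier[OF G] elim by auto
      show ?case using adj_mat(1)[OF c] elim ij by (simp add: mat_inv_adj[OF c])
    qed
    ultimately have "(\<lambda>w. mat_inv (G (z0 + w)) $$ (i, j)) has_laurent_expansion
      fps_to_fls (fps_expansion (\<lambda>z. adj_mat (G z) $$ (i, j)) z0) / fps_to_fls (det Gf)"
      by (simp add: has_laurent_expansion_cong)
    thus ?thesis unfolding F_def by (simp add: laurent_expansion_eqI)
  qed
  have FG: "(\<Sum>j<r. F i j * fps_to_fls (Gf $$ (j, l))) = (if i = l then 1 else 0)" if il: "i < r" "l < r" for i l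
  proof -
    have "(\<lambda>w. \<Sum>j<r. mat_inv (G (z0 + w)) $$ (i, j) * G (z0 + w) $$ (j, l)) has_laurent_expansion
        (\<Sum>j<r. F i j * fps_to_fls (Gf $$ (j, l)))"
      by (intro has_laurent_expansion_sum has_laurent_expansion_mult Fexp gexp) (use il in auto)
    moreover have "\<forall>\<^sub>F w in at 0. (\<Sum>j<r. mat_inv (G (z0 + w)) $$ (i, j) * G (z0 + w) $$ (j, l)) = (if i = l then 1 else 0)"
      using inS nz0
    proof eventually_elim
      case (elim w)
      have c: "G (z0 + w) \<in> carrier_mat r r" using mat_fun_carrier[OF G] elim by auto
      note i = mat_inv_props[OF c elim(2)]
      have "(\<Sum>j<r. mat_inv (G (z0 + w)) $$ (i, j) * G (z0 + w) $$ (j, l)) = (mat_inv (G (z0 + w)) * G (z0 + w)) $$ (i, l)"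
        using i(1) c il by (simp add: scalar_prod_def atLeast0LessThan)
      thus ?case using i(3) il by simp
    qed
    ultimately have "(\<lambda>w. if i = l then 1 else 0) has_laurent_expansion (\<Sum>j<r. F i j * fps_to_fls (Gf $$ (j, l)))"
      by (simp add: has_laurent_expansion_cong)
    moreover have "(\<lambda>w :: complex. if i = l then 1 else 0 :: complex) has_laurent_expansion (if i = l then 1 else 0)" by simp
    ultimately show ?thesis by (rule has_laurent_expansion_unique)
  qed
  have GF: "(\<Sum>j<r. fps_to_fls (Gf $$ (i, j)) * F j l) = (if i = l then 1 else 0)" if il: "i < r" "l < r" for i l
  proof -
    have "(\<lambda>w. \<Sum>j<r. G (z0 + w) $$ (i, j) * mat_inv (G (z0 + w)) $$ (j, l)) has_laurent_expansion
        (\<Sum>j<r. fps_to_fls (Gf $$ (i, j)) * F j l)"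
      by (intro has_laurent_expansion_sum has_laurent_expansion_mult Fexp gexp) (use il in auto)
    moreover have "\<forall>\<^sub>F w in at 0. (\<Sum>j<r. G (z0 + w) $$ (i, j) * mat_inv (G (z0 + w)) $$ (j, l)) = (if i = l then 1 else 0)"
      using inS nz0
    proof eventually_elim
      case (elim w)
      have c: "G (z0 + w) \<in> carrier_mat r r" using mat_fun_carrier[OF G] elim by auto
      note i = mat_inv_props[OF c elim(2)]
      have "(\<Sum>j<r. G (z0 + w) $$ (i, j) * mat_inv (G (z0 + w)) $$ (j, l)) = (G (z0 + w) * mat_inv (G (z0 + w))) $$ (i, l)"
        using i(1) c il by (simp add: scalar_prod_def atLeast0LessThan)
      thus ?case using i(2) il by simp
    qed
    ultimately have "(\<lambda>w. if i = l then 1 else 0) has_laurent_expansion (\<Sum>j<r. fps_to_fls (Gf $$ (i, j)) * F j l)"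
      by (simp add: has_laurent_expansion_cong)
    moreover have "(\<lambda>w :: complex. if i = l then 1 else 0 :: complex) has_laurent_expansion (if i = l then 1 else 0)" by simp
    ultimately show ?thesis by (rule has_laurent_expansion_unique)
  qed
  define k where "k = mvf_pole_order r r (\<lambda>z. mat_inv (G z)) z0"
  have lc: "laurent_coeff r r (\<lambda>z. mat_inv (G z)) z0 l = mat r r (\<lambda>(i, j). fls_nth (F i j) l)" for l
    by (simp add: laurent_coeff_def F_def)
  have k: "fls_nth (F i j) l = 0" if "i < r" "j < r" "l < - int k" for i j l
  proof -
    \<comment> \<open>Any bound for the orders of the poles of the entries shows that the least number in the definition of the pole order exists.\<close>
    define k0 where "k0 = (\<Sum>i<r. \<Sum>j<r. nat (- fls_subdegree (F i j)))"
    have "\<forall>l < - int k0. laurent_coeff r r (\<lambda>z. mat_inv (G z)) z0 l = 0\<^sub>m r r"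
    proof (intro allI impI eq_matI)
      fix l i j assume l: "l < - int k0" and "i < dim_row (0\<^sub>m r r :: complex mat)" "j < dim_col (0\<^sub>m r r :: complex mat)"
      hence ij: "i < r" "j < r" by auto
      have "nat (- fls_subdegree (F i j)) \<le> (\<Sum>j<r. nat (- fls_subdegree (F i j)))"
        using ij by (intro member_le_sum) auto
      also have "\<dots> \<le> k0" unfolding k0_def using ij by (intro member_le_sum[of i "{..<r}" "\<lambda>i. \<Sum>j<r. nat (- fls_subdegree (F i j))"]) auto
      finally have "l < fls_subdegree (F i j)" using l by linarith
      thus "laurent_coeff r r (\<lambda>z. mat_inv (G z)) z0 l $$ (i, j) = 0\<^sub>m r r $$ (i, j)" using ij by (simp add: lc)
    qed (auto simp: lc)
    hence "\<forall>l < - int k. laurent_coeff r r (\<lambda>z. mat_inv (G z)) z0 l = 0\<^sub>m r r"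
      unfolding k_def mvf_pole_order_def by (rule LeastI)
    hence "mat r r (\<lambda>(i, j). fls_nth (F i j) l) = 0\<^sub>m r r" using that lc by metis
    hence "mat r r (\<lambda>(i, j). fls_nth (F i j) l) $$ (i, j) = 0\<^sub>m r r $$ (i, j)" by simp
    thus ?thesis using that by simp
  qed
  define K where "K = (\<lambda>i j. Abs_fps (\<lambda>n. fls_nth (F i j) (int n - int k)))"
  have KF: "fps_to_fls (K i j) = fls_X ^ k * F i j" if "i < r" "j < r" for i j
  proof -
    have "fls_X ^ k * F i j = fls_shift (- int k) (F i j)"
      by (simp add: fls_X_power_times_conv_shift)
    moreover have "fps_to_fls (K i j) = fls_shift (- int k) (F i j)"
      using k[OF that] by (intro fls_eqI) (auto simp: K_def)
    ultimately show ?thesis by simp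
  qed
  have KG: "(\<Sum>j<r. K i j * Gf $$ (j, l)) = (if i = l then fps_X ^ k else 0)" if il: "i < r" "l < r" for i l
  proof -
    have "fps_to_fls (\<Sum>j<r. K i j * Gf $$ (j, l)) = (\<Sum>j<r. fls_X ^ k * F i j * fps_to_fls (Gf $$ (j, l)))"
      using KF il by (simp add: h.hom_sum fls_times_fps_to_fls)
    also have "\<dots> = fls_X ^ k * (\<Sum>j<r. F i j * fps_to_fls (Gf $$ (j, l)))"
      by (simp add: sum_distrib_left mult.assoc)
    also have "\<dots> = fps_to_fls (if i = l then fps_X ^ k else 0)"
      unfolding FG[OF il] by (simp add: fps_to_fls_power)
    finally show ?thesis by (simp only: fps_to_fls_eq_iff)
  qed
  have GK: "(\<Sum>j<r. Gf $$ (i, j) * K j l) = (if i = l then fps_X ^ k else 0)" if il: "i < r" "l < r" for i l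
  proof -
    have "fps_to_fls (\<Sum>j<r. Gf $$ (i, j) * K j l) = (\<Sum>j<r. fps_to_fls (Gf $$ (i, j)) * (fls_X ^ k * F j l))"
      using KF il by (simp add: h.hom_sum fls_times_fps_to_fls)
    also have "\<dots> = fls_X ^ k * (\<Sum>j<r. fps_to_fls (Gf $$ (i, j)) * F j l)"
      by (simp add: sum_distrib_left mult_ac)
    also have "\<dots> = fps_to_fls (if i = l then fps_X ^ k else 0)"
      unfolding GF[OF il] by (simp add: fps_to_fls_power)
    finally show ?thesis by (simp only: fps_to_fls_eq_iff)
  qed
  have "pole_mult_at r r (\<lambda>z. mat_inv (G z)) z0 = mat_rank (toeplitz k r K)"
    unfolding pole_mult_at_def k_def[symmetric] Let_def toeplitz_def
    by (intro arg_cong[of _ _ mat_rank] eq_matI) (auto simp: lc K_def r of_nat_diff algebra_simps)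
  also have "\<dots> = subdegree (det Gf)" by (rule toeplitz_rank[OF r Gf dnz KG GK])
  finally show ?thesis using zo by simp
qed

section \<open>Counting zeros in a disc\<close>

definition zero_count :: "real \<Rightarrow> (complex \<Rightarrow> complex) \<Rightarrow> int" where
  "zero_count r f = (\<Sum>z\<in>{z\<in>ball 0 r. f z = 0}. zorder f z)"

text \<open>The argument principle.\<close>

lemma zero_count_winding_number:
  assumes f: "f holomorphic_on ball 0 R" and r: "0 < r" "r < R"
    and nz: "\<And>z. cmod z = r \<Longrightarrow> f z \<noteq> 0"
  shows "finite {z\<in>ball 0 r. f z = 0}"
    and "winding_number (f \<circ> circlepath 0 r) 0 = of_int (zero_count r f)"
proof -
  define R' where "R' = (r + R) / 2"
  have R': "r < R'" "R' < R" using r by (auto simp: R'_def)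
  have fin: "finite {z\<in>cball 0 R'. f z = 0}"
  proof (cases "f constant_on ball 0 R")
    case True
    then obtain c where c: "\<And>z. z \<in> ball 0 R \<Longrightarrow> f z = c" by (auto simp: constant_on_def)
    have "f (of_real r) \<noteq> 0" using nz r by simp
    hence "c \<noteq> 0" using c[of "of_real r"] r by simp
    hence "{z\<in>cball 0 R'. f z = 0} = {}" using c R' by fastforce
    thus ?thesis by (simp only: finite.emptyI)
  next
    case False
    show ?thesis
      by (rule holomorphic_compact_finite_zeros[OF f]) (use False R' in \<open>auto simp: constant_on_def\<close>)
  qed
  show fin': "finite {z\<in>ball 0 r. f z = 0}"
    by (rule finite_subset[OF _ fin]) (use R' in auto)
  define pz where "pz = {w\<in>ball 0 R'. f w = 0 \<or> w \<in> {}}"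
  have hol': "f holomorphic_on ball 0 R'" using f by (rule holomorphic_on_subset) (use R' in auto)
  have pi: "path_image (circlepath 0 r) = sphere 0 r" using r by simp
  have AP: "contour_integral (circlepath 0 r) (\<lambda>x. deriv f x * 1 / f x) = 2 * pi * \<i> *
      (\<Sum>p\<in>pz. winding_number (circlepath 0 r) p * 1 * zorder f p)"
    unfolding pz_def
  proof (rule argument_principle)
    show "path_image (circlepath 0 r) \<subseteq> ball 0 R' - {w \<in> ball 0 R'. f w = 0 \<or> w \<in> {}}"
      unfolding pi using nz R' by auto
    show "\<forall>z. z \<notin> ball 0 R' \<longrightarrow> winding_number (circlepath 0 r) z = 0"
    proof (intro allI impI)
      fix z :: complex assume "z \<notin> ball 0 R'"
      thus "winding_number (circlepath 0 r) z = 0"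
        by (intro winding_number_zero_outside[of _ "cball 0 r"]) (use r R' pi in auto)
    qed
    show "finite {w \<in> ball 0 R'. f w = 0 \<or> w \<in> {}}" by (rule finite_subset[OF _ fin]) auto
  qed (use hol' in auto)
  have "(\<Sum>p\<in>pz. winding_number (circlepath 0 r) p * 1 * zorder f p) =
      (\<Sum>p\<in>{z\<in>ball 0 r. f z = 0}. of_int (zorder f p))"
  proof (rule sum.mono_neutral_cong_right)
    show "finite pz" unfolding pz_def by (rule finite_subset[OF _ fin]) auto
    show "{z \<in> ball 0 r. f z = 0} \<subseteq> pz" using R' by (auto simp: pz_def)
    show "\<forall>p\<in>pz - {z \<in> ball 0 r. f z = 0}. winding_number (circlepath 0 r) p * 1 * of_int (zorder f p) = 0"
    proof
      fix p assume p: "p \<in> pz - {z \<in> ball 0 r. f z = 0}"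
      hence "cmod p > r" using nz[of p] by (force simp: pz_def)
      hence "winding_number (circlepath 0 r) p = 0"
        by (intro winding_number_zero_outside[of _ "cball 0 r"]) (use r pi in auto)
      thus "winding_number (circlepath 0 r) p * 1 * of_int (zorder f p) = 0" by simp
    qed
    fix p assume "p \<in> {z \<in> ball 0 r. f z = 0}"
    hence "winding_number (circlepath 0 r) p = 1" by (intro winding_number_circlepath) auto
    thus "winding_number (circlepath 0 r) p * 1 * of_int (zorder f p) = of_int (zorder f p)" by simp
  qed
  hence AP': "contour_integral (circlepath 0 r) (\<lambda>x. deriv f x / f x) = 2 * pi * \<i> * of_int (zero_count r f)"
    using AP by (simp add: zero_count_def)
  have an: "f analytic_on ball 0 R" using f by (simp add: analytic_on_open)
  have sub: "path_image (circlepath 0 r) \<subseteq> ball 0 R" using r pi by auto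
  have vp: "valid_path (f \<circ> circlepath 0 r)"
    by (rule valid_path_compose_analytic[OF _ an sub]) simp
  have "winding_number (f \<circ> circlepath 0 r) 0 = 1/(2*pi*\<i>) * contour_integral (f \<circ> circlepath 0 r) (\<lambda>w. 1/(w - 0))"
  proof (rule winding_number_valid_path[OF vp])
    show "0 \<notin> path_image (f \<circ> circlepath 0 r)"
      unfolding path_image_compose pi using nz by auto
  qed
  also have "contour_integral (f \<circ> circlepath 0 r) (\<lambda>w. 1/(w - 0)) = contour_integral (circlepath 0 r) (\<lambda>w. deriv f w * (1/(f w - 0)))"
    by (rule contour_integral_comp_analyticW[OF an _ sub]) simp
  also have "\<dots> = 2 * pi * \<i> * of_int (zero_count r f)" using AP' by simp
  finally show "winding_number (f \<circ> circlepath 0 r) 0 = of_int (zero_count r f)" by (simp add: o_def)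
qed

text \<open>
  Homotopy form of Rouche's theorem: the winding number of the image of the circle does not change as long as
  the image avoids zero.
\<close>

lemma zero_count_homotopy:
  fixes H :: "real \<Rightarrow> complex \<Rightarrow> complex"
  assumes f: "f holomorphic_on ball 0 R" and g: "g holomorphic_on ball 0 R" and r: "0 < r" "r < R"
    and cont: "continuous_on ({0..1} \<times> sphere 0 r) (\<lambda>x. H (fst x) (snd x))"
    and nz: "\<And>t z. 0 \<le> t \<Longrightarrow> t \<le> 1 \<Longrightarrow> cmod z = r \<Longrightarrow> H t z \<noteq> 0"
    and H0: "\<And>z. cmod z = r \<Longrightarrow> H 0 z = f z" and H1: "\<And>z. cmod z = r \<Longrightarrow> H 1 z = g z"
  shows "zero_count r f = zero_count r g"
proof -
  let ?c = "circlepath 0 r"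
  have c: "cmod (?c x) = r" for x using r by (simp add: circlepath norm_mult)
  have "homotopic_loops (-{0}) (f \<circ> ?c) (g \<circ> ?c)"
    unfolding homotopic_loops
  proof (intro exI[of _ "\<lambda>y. H (fst y) (?c (snd y))"] conjI)
    have "continuous_on ({0..1} \<times> {0..1}) (\<lambda>y. (fst y, ?c (snd y)))"
      unfolding circlepath by (intro continuous_intros)
    moreover have "continuous_on ((\<lambda>y. (fst y, ?c (snd y))) ` ({0..1} \<times> {0..1})) (\<lambda>x. H (fst x) (snd x))"
      by (rule continuous_on_subset[OF cont]) (use c in auto)
    ultimately show "continuous_on ({0..1} \<times> {0..1}) (\<lambda>y. H (fst y) (?c (snd y)))"
      using continuous_on_compose[of "{0..1} \<times> {0..1}" "\<lambda>y. (fst y, ?c (snd y))" "\<lambda>x. H (fst x) (snd x)"] by (simp add: o_def)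
    show "(\<lambda>y. H (fst y) (?c (snd y))) \<in> {0..1} \<times> {0..1} \<rightarrow> - {0}" using nz c by auto
  qed (use H0 H1 c in \<open>auto simp: pathfinish_def pathstart_def circlepath\<close>)
  hence "winding_number (f \<circ> ?c) 0 = winding_number (g \<circ> ?c) 0"
    by (rule winding_number_homotopic_loops)
  moreover have "winding_number (f \<circ> ?c) 0 = of_int (zero_count r f)"
    using nz[of 0] H0 by (intro zero_count_winding_number(2)[OF f r]) auto
  moreover have "winding_number (g \<circ> ?c) 0 = of_int (zero_count r g)"
    using nz[of 1] H1 by (intro zero_count_winding_number(2)[OF g r]) auto
  ultimately show ?thesis by simp
qed

lemma eventually_nonzero_of_finite_zeros:
  assumes "finite {z\<in>ball 0 1. f z = 0}" "z \<in> ball (0::complex) 1"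
  shows "\<forall>\<^sub>F w in at z. f w \<noteq> 0"
proof -
  have "open (ball 0 1 - ({z\<in>ball 0 1. f z = 0} - {z}))"
    using assms by (intro open_Diff finite_imp_closed) auto
  hence "\<forall>\<^sub>F w in at z. w \<in> ball 0 1 - ({z\<in>ball 0 1. f z = 0} - {z}) - {z}"
    using assms by (intro eventually_at_in_open) auto
  thus ?thesis by eventually_elim auto
qed

lemma zorder_mult_disc:
  assumes f: "f holomorphic_on ball 0 1" and g: "g holomorphic_on ball 0 1"
    and "finite {z\<in>ball 0 1. f z = 0}" "finite {z\<in>ball 0 1. g z = 0}" and z: "z \<in> ball 0 1"
  shows "zorder (\<lambda>z. f z * g z) z = zorder f z + zorder g z"
proof (rule zorder_times_analytic)
  show "f analytic_on {z}" "g analytic_on {z}" using f g z analytic_at by blast+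
  show "\<forall>\<^sub>F z in at z. f z * g z \<noteq> 0"
    using eventually_nonzero_of_finite_zeros[OF assms(3) z] eventually_nonzero_of_finite_zeros[OF assms(4) z]
    by eventually_elim simp
qed

lemma zorder_nonneg_disc:
  assumes f: "f holomorphic_on ball 0 1" and "finite {z\<in>ball 0 1. f z = 0}" and z: "z \<in> ball 0 1"
  shows "0 \<le> zorder f z" and "0 < zorder f z \<longleftrightarrow> f z = 0"
proof -
  have an: "f analytic_on {z}" using f z analytic_at by blast
  have fr: "\<exists>\<^sub>F w in at z. f w \<noteq> 0"
    using eventually_nonzero_of_finite_zeros[OF assms(2) z] by (intro eventually_frequently) auto
  show "0 \<le> zorder f z" "0 < zorder f z \<longleftrightarrow> f z = 0"
    using zorder_ge_0[OF an fr] zorder_pos_iff'[OF an fr] by auto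
qed

lemma zero_count_superset:
  assumes f: "f holomorphic_on ball 0 1" and "finite {z\<in>ball 0 1. f z = 0}"
    and Z: "finite Z" "{z\<in>ball 0 1. f z = 0} \<subseteq> Z" "Z \<subseteq> ball 0 1"
  shows "zero_count 1 f = (\<Sum>z\<in>Z. zorder f z)"
  unfolding zero_count_def
proof (rule sum.mono_neutral_left[OF Z(1,2)])
  show "\<forall>z\<in>Z - {z \<in> ball 0 1. f z = 0}. zorder f z = 0"
    using zorder_nonneg_disc[OF f assms(2)] Z(3) by force
qed

lemma zero_count_mult:
  assumes f: "f holomorphic_on ball 0 1" and g: "g holomorphic_on ball 0 1"
    and ff: "finite {z\<in>ball 0 1. f z = 0}" and fg: "finite {z\<in>ball 0 1. g z = 0}"
  shows "finite {z\<in>ball 0 1. f z * g z = 0}"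
    and "zero_count 1 (\<lambda>z. f z * g z) = zero_count 1 f + zero_count 1 g"
proof -
  let ?Z = "{z\<in>ball 0 1. f z * g z = 0}"
  have Z: "?Z = {z\<in>ball 0 1. f z = 0} \<union> {z\<in>ball 0 1. g z = 0}" by auto
  show fin: "finite ?Z" unfolding Z using ff fg by simp
  have "zero_count 1 (\<lambda>z. f z * g z) = (\<Sum>z\<in>?Z. zorder f z + zorder g z)"
    unfolding zero_count_def by (intro sum.cong refl zorder_mult_disc f g ff fg) auto
  also have "\<dots> = zero_count 1 f + zero_count 1 g"
  proof -
    have "zero_count 1 f = (\<Sum>z\<in>?Z. zorder f z)" by (rule zero_count_superset[OF f ff fin]) auto
    moreover have "zero_count 1 g = (\<Sum>z\<in>?Z. zorder g z)" by (rule zero_count_superset[OF g fg fin]) auto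
    ultimately show ?thesis by (simp only: sum.distrib)
  qed
  finally show "zero_count 1 (\<lambda>z. f z * g z) = zero_count 1 f + zero_count 1 g" .
qed

lemma zero_count_cong:
  assumes "\<And>z. z \<in> ball 0 1 \<Longrightarrow> f z = g z"
  shows "zero_count 1 f = zero_count 1 g"
proof -
  have "zorder f z = zorder g z" if z: "z \<in> ball 0 1" for z
  proof (rule zorder_cong[OF _ refl])
    have "\<forall>\<^sub>F w in at z. w \<in> ball 0 1" using z by (intro eventually_at_in_open') auto
    thus "\<forall>\<^sub>F w in at z. f w = g w" by eventually_elim (rule assms)
  qed
  thus ?thesis unfolding zero_count_def using assms by (intro sum.cong) auto
qed

lemma zero_count_eqI:
  assumes f: "f holomorphic_on ball 0 1" and g: "g holomorphic_on ball 0 1"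
    and ff: "finite {z\<in>ball 0 1. f z = 0}" and fg: "finite {z\<in>ball 0 1. g z = 0}"
    and eq: "\<And>z. z \<in> ball 0 1 \<Longrightarrow> zorder f z = zorder g z"
  shows "zero_count 1 f = zero_count 1 g"
proof -
  have "{z\<in>ball 0 1. f z = 0} = {z\<in>ball 0 1. g z = 0}"
    using zorder_nonneg_disc(2)[OF f ff] zorder_nonneg_disc(2)[OF g fg] eq by auto
  thus ?thesis unfolding zero_count_def by (intro sum.cong) (auto simp: eq)
qed

lemma zero_count_shrink:
  assumes "r \<le> 1" "\<And>z. r \<le> cmod z \<Longrightarrow> cmod z < 1 \<Longrightarrow> f z \<noteq> 0"
  shows "zero_count 1 f = zero_count r f" "{z\<in>ball 0 1. f z = 0} = {z\<in>ball 0 r. f z = 0}"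
proof -
  show *: "{z\<in>ball 0 1. f z = 0} = {z\<in>ball 0 r. f z = 0}" using assms by force
  show "zero_count 1 f = zero_count r f" unfolding zero_count_def * ..
qed

lemma zero_count_const: "c \<noteq> 0 \<Longrightarrow> zero_count r (\<lambda>_. c) = 0"
  by (simp add: zero_count_def)

text \<open>Each factor has one zero in the disc, which is simple, and its pole lies outside.\<close>

lemma zero_count_blaschke_aux:
  assumes c: "c \<noteq> 0" and a: "\<forall>a\<in>set as. cmod a < 1"
  shows "(\<lambda>z. c * (\<Prod>a\<leftarrow>as. (z - a) / (1 - cnj a * z))) holomorphic_on ball 0 1 \<and>
    finite {z\<in>ball 0 1. c * (\<Prod>a\<leftarrow>as. (z - a) / (1 - cnj a * z)) = 0} \<and>
    zero_count 1 (\<lambda>z. c * (\<Prod>a\<leftarrow>as. (z - a) / (1 - cnj a * z))) = int (length as)"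
  using a
proof (induct as)
  case Nil
  show ?case using c zero_count_const[OF c] by simp
next
  case (Cons b as)
  have b: "cmod b < 1" using Cons(2) by simp
  let ?f = "\<lambda>z. (z - b) / (1 - cnj b * z)" and ?g = "\<lambda>z. c * (\<Prod>a\<leftarrow>as. (z - a) / (1 - cnj a * z))"
  have eq: "(\<lambda>z. c * (\<Prod>a\<leftarrow>b # as. (z - a) / (1 - cnj a * z))) = (\<lambda>z. ?f z * ?g z)" by (simp add: fun_eq_iff)
  have den: "1 - cnj b * z \<noteq> 0" if "z \<in> ball 0 1" for z
  proof
    assume "1 - cnj b * z = 0"
    hence "cmod b * cmod z = 1" by (metis complex_mod_cnj eq_iff_diff_eq_0 norm_mult norm_one)
    moreover have "cmod b * cmod z < 1 * 1" using b that by (intro mult_strict_mono') auto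
    ultimately show False by simp
  qed
  have fh: "?f holomorphic_on ball 0 1" by (intro holomorphic_intros den)
  have zf: "{z\<in>ball 0 1. ?f z = 0} = {b}" using den b by auto
  have "zorder ?f b = 1"
  proof (rule zorder_eqI[of "ball 0 1" _ "\<lambda>z. 1 / (1 - cnj b * z)"])
    show "(\<lambda>z. 1 / (1 - cnj b * z)) holomorphic_on ball 0 1" by (intro holomorphic_intros den)
  qed (use b den[of b] in auto)
  hence zc: "zero_count 1 ?f = 1" unfolding zero_count_def zf by simp
  have IH: "?g holomorphic_on ball 0 1" "finite {z\<in>ball 0 1. ?g z = 0}" "zero_count 1 ?g = int (length as)"
    using Cons(1) Cons(2) by (metis list.set_intros(2))+
  have zff: "finite {z\<in>ball 0 1. ?f z = 0}" unfolding zf by simp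
  show ?case unfolding eq fun_cong[OF eq]
    using zero_count_mult[OF fh IH(1) zff IH(2)] zc IH(3) holomorphic_on_mult[OF fh IH(1)] by (simp only: list.size) simp
qed

lemmas zero_count_blaschke = zero_count_blaschke_aux[THEN conjunct1]
  zero_count_blaschke_aux[THEN conjunct2, THEN conjunct1] zero_count_blaschke_aux[THEN conjunct2, THEN conjunct2]

lemma zero_mult_eq_zero_count:
  assumes G: "hol_mat (ball 0 1) r r G" and r: "0 < r" and fin: "finite {z\<in>ball 0 1. det (G z) = 0}"
  shows "zero_mult r G (ball 0 1) = enat (nat (zero_count 1 (\<lambda>z. det (G z))))"
proof -
  interpret fun_alg "ball 0 1" "\<lambda>f. f holomorphic_on ball (0::complex) 1" by (rule fun_alg_hol)
  let ?Z = "{z\<in>ball 0 1. det (G z) = 0}"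
  have d: "(\<lambda>z. det (G z)) holomorphic_on ball 0 1" by (rule det[OF G])
  have pm: "pole_mult_at r r (\<lambda>z. mat_inv (G z)) z = nat (zorder (\<lambda>z. det (G z)) z)" if "z \<in> ball 0 1" for z
    by (rule pole_mult_at_mat_inv[OF _ that G r eventually_nonzero_of_finite_zeros[OF fin that]]) simp
  have "zero_mult r G (ball 0 1) = (\<Sum>\<^sub>\<infinity>z\<in>ball 0 1. enat (nat (zorder (\<lambda>z. det (G z)) z)))"
    unfolding zero_mult_def pole_mult_def by (intro infsum_cong) (simp add: pm)
  also have "\<dots> = (\<Sum>\<^sub>\<infinity>z\<in>?Z. enat (nat (zorder (\<lambda>z. det (G z)) z)))"
  proof (rule infsum_cong_neutral)
    fix z assume z: "z \<in> ball 0 1 - ?Z"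
    hence "zorder (\<lambda>z. det (G z)) z = 0"
      using zorder_nonneg_disc[OF d fin, of z] by force
    thus "enat (nat (zorder (\<lambda>z. det (G z)) z)) = 0" by (simp add: zero_enat_def)
  qed auto
  also have "\<dots> = (\<Sum>z\<in>?Z. enat (nat (zorder (\<lambda>z. det (G z)) z)))" using fin by (rule infsum_finite)
  also have "\<dots> = enat (\<Sum>z\<in>?Z. nat (zorder (\<lambda>z. det (G z)) z))"
    using fin by (induct rule: finite_induct) (auto simp: zero_enat_def)
  also have "(\<Sum>z\<in>?Z. nat (zorder (\<lambda>z. det (G z)) z)) = nat (zero_count 1 (\<lambda>z. det (G z)))"
  proof -
    have "int (\<Sum>z\<in>?Z. nat (zorder (\<lambda>z. det (G z)) z)) = zero_count 1 (\<lambda>z. det (G z))"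
      unfolding zero_count_def of_nat_sum using zorder_nonneg_disc(1)[OF d fin] by (intro sum.cong) auto
    thus ?thesis by linarith
  qed
  finally show ?thesis .
qed

section \<open>Coprime factorizations\<close>

text \<open>A kernel vector \<open>u\<close> satisfies \<open>|Y\<^sup>* u|\<^sup>2 + |Z\<^sup>* u|\<^sup>2 = 0\<close>.\<close>

lemma gram_sum_invertible:
  fixes Y Z :: "complex mat"
  assumes Y: "Y \<in> carrier_mat n a" and Z: "Z \<in> carrier_mat n b"
    and ker: "\<And>u. u \<in> carrier_vec n \<Longrightarrow> mat_adjoint Y *\<^sub>v u = 0\<^sub>v a \<Longrightarrow> mat_adjoint Z *\<^sub>v u = 0\<^sub>v b \<Longrightarrow> u = 0\<^sub>v n"
  shows "det (Y * mat_adjoint Y + Z * mat_adjoint Z) \<noteq> 0"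
proof -
  let ?K = "Y * mat_adjoint Y + Z * mat_adjoint Z"
  have K: "?K \<in> carrier_mat n n" using Y Z by auto
  show ?thesis unfolding det_nonzero_iff_inj[OF K]
  proof (intro ballI impI)
    fix u assume u: "u \<in> carrier_vec n" and z: "?K *\<^sub>v u = 0\<^sub>v n"
    have cy: "mat_adjoint Y *\<^sub>v u \<in> carrier_vec a" "mat_adjoint Z *\<^sub>v u \<in> carrier_vec b"
      using mult_mat_vec_carrier[OF mat_adjoint_carrier[OF Y] u] mult_mat_vec_carrier[OF mat_adjoint_carrier[OF Z] u] by auto
    have YY: "Y * mat_adjoint Y \<in> carrier_mat n n" "Z * mat_adjoint Z \<in> carrier_mat n n" using Y Z by auto
    have "?K *\<^sub>v u = Y * mat_adjoint Y *\<^sub>v u + Z * mat_adjoint Z *\<^sub>v u"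
      using YY u by (rule add_mult_distrib_mat_vec)
    also have "Y * mat_adjoint Y *\<^sub>v u = Y *\<^sub>v (mat_adjoint Y *\<^sub>v u)" using Y u by (intro assoc_mult_mat_vec) auto
    also have "Z * mat_adjoint Z *\<^sub>v u = Z *\<^sub>v (mat_adjoint Z *\<^sub>v u)" using Z u by (intro assoc_mult_mat_vec) auto
    finally have "Y *\<^sub>v (mat_adjoint Y *\<^sub>v u) + Z *\<^sub>v (mat_adjoint Z *\<^sub>v u) = 0\<^sub>v n" unfolding z by (rule sym)
    hence "0 = (Y *\<^sub>v (mat_adjoint Y *\<^sub>v u) + Z *\<^sub>v (mat_adjoint Z *\<^sub>v u)) \<bullet>c u" using u by simp
    also have "\<dots> = (Y *\<^sub>v (mat_adjoint Y *\<^sub>v u)) \<bullet>c u + (Z *\<^sub>v (mat_adjoint Z *\<^sub>v u)) \<bullet>c u"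
      using Y Z cy u by (intro cscalar_add_left[of _ n]) auto
    also have "(Y *\<^sub>v (mat_adjoint Y *\<^sub>v u)) \<bullet>c u = of_real (nsq (mat_adjoint Y *\<^sub>v u))"
      unfolding cscalar_adjoint[OF Y cy(1) u] by (rule cscalar_self)
    also have "(Z *\<^sub>v (mat_adjoint Z *\<^sub>v u)) \<bullet>c u = of_real (nsq (mat_adjoint Z *\<^sub>v u))"
      unfolding cscalar_adjoint[OF Z cy(2) u] by (rule cscalar_self)
    finally have "nsq (mat_adjoint Y *\<^sub>v u) + nsq (mat_adjoint Z *\<^sub>v u) = 0"
      by (metis of_real_add of_real_eq_0_iff)
    hence "nsq (mat_adjoint Y *\<^sub>v u) = 0" "nsq (mat_adjoint Z *\<^sub>v u) = 0"
      using nsq_nonneg[of "mat_adjoint Y *\<^sub>v u"] nsq_nonneg[of "mat_adjoint Z *\<^sub>v u"] by linarith+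
    thus "u = 0\<^sub>v n" using ker[OF u] nsq_eq_0[OF cy(1)] nsq_eq_0[OF cy(2)] by blast
  qed
qed

lemma zorder_le_of_factor:
  assumes f: "f holomorphic_on ball 0 1" and g: "g holomorphic_on ball 0 1"
    and e: "e holomorphic_on ball 0 1" and h: "h holomorphic_on ball 0 1"
    and ff: "finite {z\<in>ball 0 1. f z = 0}" and fg: "finite {z\<in>ball 0 1. g z = 0}"
    and z: "z \<in> ball 0 1" and ez: "e z \<noteq> 0"
    and eq: "\<And>w. w \<in> ball 0 1 \<Longrightarrow> e w * f w = g w * h w"
  shows "zorder g z \<le> zorder f z"
proof -
  have an: "f analytic_on {z}" "g analytic_on {z}" "e analytic_on {z}" "h analytic_on {z}"
    using f g e h z analytic_at by blast+
  have ev_e: "\<forall>\<^sub>F w in at z. e w \<noteq> 0"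
    using non_zero_neighbour_alt e z ez
    by (metis an(3) analytic_at_imp_isCont isCont_def tendsto_imp_eventually_ne)
  note ev_f = eventually_nonzero_of_finite_zeros[OF ff z]
  have ev_ball: "\<forall>\<^sub>F w in at z. w \<in> ball 0 1" by (rule eventually_at_in_open'[OF _ z]) simp
  have ev1: "\<forall>\<^sub>F w in at z. e w * f w \<noteq> 0" using ev_e ev_f by eventually_elim simp
  have ev2: "\<forall>\<^sub>F w in at z. g w * h w \<noteq> 0" using ev1 ev_ball
  proof eventually_elim
    case (elim w)
    show ?case using elim(1) unfolding eq[OF elim(2)] .
  qed
  have "zorder (\<lambda>w. e w * f w) z = zorder (\<lambda>w. g w * h w) z"
    by (rule zorder_cong) (use ev_ball in \<open>eventually_elim, simp add: eq\<close>, simp)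
  hence "zorder e z + zorder f z = zorder g z + zorder h z"
    using zorder_times_analytic[OF an(3,1) ev1] zorder_times_analytic[OF an(2,4) ev2] by simp
  moreover have "zorder e z = 0" by (rule zorder_eq_0I[OF an(3) ez])
  moreover have "zorder h z \<ge> 0"
  proof (rule zorder_ge_0[OF an(4)])
    have "\<forall>\<^sub>F w in at z. h w \<noteq> 0" using ev2 by eventually_elim simp
    thus "\<exists>\<^sub>F w in at z. h w \<noteq> 0" by (intro eventually_frequently) auto
  qed
  ultimately show ?thesis by linarith
qed

text \<open>
  A left coprime and a right coprime factorization of the same function \<open>b\<^sup>-\<^sup>1 \<psi> = C D\<^sup>-\<^sup>1\<close> have
  denominators with the same zeros. Locally, coprimeness means that \<open>b b(z)\<^sup>* + \<psi> \<psi>(z)\<^sup>*\<close> and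
  \<open>D(z)\<^sup>* D + C\<^sup>* C\<close> are invertible near \<open>z\<close>; two block eliminations then show
  that, up to invertible factors, each of the two determinants divides the other.
\<close>

lemma coprime_zorder_eq:
  assumes b: "hol_mat (ball 0 1) q q b" and \<psi>: "hol_mat (ball 0 1) q k \<psi>"
    and D: "hol_mat (ball 0 1) k k D" and C: "C \<in> carrier_mat q k"
    and eq: "\<And>w. w \<in> ball 0 1 \<Longrightarrow> \<psi> w * D w = b w * C"
    and fb: "finite {z\<in>ball 0 1. det (b z) = 0}" and fD: "finite {z\<in>ball 0 1. det (D z) = 0}"
    and z: "z \<in> ball 0 1"
    and left: "\<And>u. u \<in> carrier_vec q \<Longrightarrow> mat_adjoint (b z) *\<^sub>v u = 0\<^sub>v q \<Longrightarrow> mat_adjoint (\<psi> z) *\<^sub>v u = 0\<^sub>v k \<Longrightarrow> u = 0\<^sub>v q"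
    and right: "\<And>v. v \<in> carrier_vec k \<Longrightarrow> D z *\<^sub>v v = 0\<^sub>v k \<Longrightarrow> C *\<^sub>v v = 0\<^sub>v q \<Longrightarrow> v = 0\<^sub>v k"
  shows "zorder (\<lambda>w. det (b w)) z = zorder (\<lambda>w. det (D w)) z"
proof -
  interpret fun_alg "ball 0 1" "\<lambda>f. f holomorphic_on ball (0::complex) 1" by (rule fun_alg_hol)
  note bc = mat_fun_carrier[OF b] and \<psi>c = mat_fun_carrier[OF \<psi>] and Dc = mat_fun_carrier[OF D]
  define U V where "U = mat_adjoint (b z)" and "V = mat_adjoint (\<psi> z)"
  have U: "U \<in> carrier_mat q q" and V: "V \<in> carrier_mat k q"
    unfolding U_def V_def using bc[OF z] \<psi>c[OF z] by auto
  define S T where "S = mat_adjoint (D z)" and "T = mat_adjoint C"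
  have S: "S \<in> carrier_mat k k" and T: "T \<in> carrier_mat k q"
    unfolding S_def T_def using Dc[OF z] C by auto
  define E where "E = (\<lambda>w. b w * U + \<psi> w * V)"
  define E' where "E' = (\<lambda>w. S * D w + T * C)"
  have E: "hol_mat (ball 0 1) q q E" unfolding E_def
    by (intro mat_add mat_mult[OF b] mat_mult[OF \<psi>] mat_const U V)
  have E': "hol_mat (ball 0 1) k k E'" unfolding E'_def
    by (intro mat_add mat_mult[OF mat_const[OF S] D] mat_const) (use T C in auto)
  have Ez: "det (E z) \<noteq> 0" unfolding E_def U_def V_def
    by (rule gram_sum_invertible[OF bc[OF z] \<psi>c[OF z] left])
  have E'z: "det (E' z) \<noteq> 0"
  proof -
    have "det (S * mat_adjoint S + T * mat_adjoint T) \<noteq> 0"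
      by (rule gram_sum_invertible[OF S T]) (use right in \<open>auto simp: S_def T_def\<close>)
    thus ?thesis by (simp add: E'_def S_def T_def)
  qed
  \<comment> \<open>Multiplication of \<open>?H\<close> from the left by \<open>[I 0; -\<psi> b]\<close> and of \<open>?H'\<close> from the right by \<open>[I C; 0 D]\<close> makes these
    matrices block triangular, since \<open>\<psi> D = b C\<close>.\<close>
  let ?H = "\<lambda>w. four_block_mat (D w) (- V) C U"
  let ?H' = "\<lambda>w. four_block_mat (b w) (- \<psi> w) T S"
  have H: "hol_mat (ball 0 1) (k + q) (k + q) ?H"
  proof (rule mat_funI)
    fix i j assume ij: "i < k + q" "j < k + q"
    have "(\<lambda>w. if i < k then if j < k then D w $$ (i, j) else (- V) $$ (i, j - k)
        else if j < k then C $$ (i - k, j) else U $$ (i - k, j - k)) holomorphic_on ball 0 1"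
      by (cases "i < k"; cases "j < k") (auto intro!: const mat_fun_entry[OF D])
    thus "(\<lambda>w. ?H w $$ (i, j)) holomorphic_on ball 0 1"
      by (rule cong) (use ij in \<open>simp add: carrier_matD[OF Dc] carrier_matD[OF V] carrier_matD[OF C] carrier_matD[OF U]\<close>)
  qed (use four_block_carrier_mat[OF Dc U] in auto)
  have H': "hol_mat (ball 0 1) (q + k) (q + k) ?H'"
  proof (rule mat_funI)
    fix i j assume ij: "i < q + k" "j < q + k"
    have "(\<lambda>w. if i < q then if j < q then b w $$ (i, j) else (-1) * \<psi> w $$ (i, j - q)
        else if j < q then T $$ (i - q, j) else S $$ (i - q, j - q)) holomorphic_on ball 0 1"
      using ij by (cases "i < q"; cases "j < q") (auto intro!: const mult mat_fun_entry[OF b] mat_fun_entry[OF \<psi>] holomorphic_on_minus)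
    thus "(\<lambda>w. ?H' w $$ (i, j)) holomorphic_on ball 0 1"
      by (rule cong) (use ij in \<open>auto simp add: carrier_matD[OF bc] carrier_matD[OF \<psi>c] carrier_matD[OF S] carrier_matD[OF T]\<close>)
  qed (use four_block_carrier_mat[OF bc S] in auto)
  have id1: "det (E w) * det (D w) = det (b w) * det (?H w)" if w: "w \<in> ball 0 1" for w
  proof -
    let ?L = "four_block_mat (1\<^sub>m k) (0\<^sub>m k q) (- \<psi> w) (b w)"
    have c: "D w \<in> carrier_mat k k" "b w \<in> carrier_mat q q" "\<psi> w \<in> carrier_mat q k"
      using Dc bc \<psi>c w by auto
    have e: "- (\<psi> w * D w) + b w * C = 0\<^sub>m q k"
      unfolding eq[OF w] using c C by (intro uminus_l_inv_mat) auto
    have e2: "- (\<psi> w * - V) + b w * U = E w"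
      using c U V by (simp add: E_def comm_add_mat[of _ q q])
    have "?L * ?H w = four_block_mat (D w) (- V) (0\<^sub>m q k) (E w)"
      using c U V C e e2
      by (subst mult_four_block_mat[of _ k k _ q _ q _ _ k _ q])
         (auto simp: right_add_zero_mat[of _ k k] right_add_zero_mat[of _ k q])
    moreover have "E w \<in> carrier_mat q q" using mat_fun_carrier[OF E w] .
    ultimately have "det (?L * ?H w) = det (D w) * det (E w)"
      using c V by (simp add: det_four_block_mat_lower_left_zero[of _ k _ q])
    moreover have "det (?L * ?H w) = det ?L * det (?H w)"
      by (rule det_mult[of _ "k + q"]) (use c U V C in auto)
    moreover have "det ?L = det (b w)"
      using c by (simp add: det_four_block_mat_upper_right_zero[of _ k _ q])
    ultimately show ?thesis by (simp add: mult.commute)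
  qed
  have id2: "det (E' w) * det (b w) = det (D w) * det (?H' w)" if w: "w \<in> ball 0 1" for w
  proof -
    let ?R = "four_block_mat (1\<^sub>m q) C (0\<^sub>m k q) (D w)"
    have c: "D w \<in> carrier_mat k k" "b w \<in> carrier_mat q q" "\<psi> w \<in> carrier_mat q k"
      using Dc bc \<psi>c w by auto
    have e: "b w * C + - (\<psi> w * D w) = 0\<^sub>m q k"
      unfolding eq[OF w] using c C by (simp add: add_uminus_minus_mat[of _ q k] minus_r_inv_mat[of _ q k])
    have e2: "T * C + S * D w = E' w"
      using c S T C by (simp add: E'_def comm_add_mat[of _ k k])
    have "?H' w * ?R = four_block_mat (b w) (0\<^sub>m q k) T (E' w)"
      using c S T C e e2
      by (subst mult_four_block_mat[of _ q q _ k _ k _ _ q _ k])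
         (auto simp: right_add_zero_mat[of _ q q] right_add_zero_mat[of _ k q])
    moreover have "E' w \<in> carrier_mat k k" using mat_fun_carrier[OF E' w] .
    ultimately have "det (?H' w * ?R) = det (b w) * det (E' w)"
      using c T by (simp add: det_four_block_mat_upper_right_zero[of _ q _ k])
    moreover have "det (?H' w * ?R) = det (?H' w) * det ?R"
      by (rule det_mult[of _ "q + k"]) (use c S T C in auto)
    moreover have "det ?R = det (D w)"
      using c C by (simp add: det_four_block_mat_lower_left_zero[of _ q _ k])
    ultimately show ?thesis by (simp add: mult.commute)
  qed
  show ?thesis
  proof (rule antisym)
    show "zorder (\<lambda>w. det (b w)) z \<le> zorder (\<lambda>w. det (D w)) z"
      by (rule zorder_le_of_factor[OF det[OF D] det[OF b] det[OF E] det[OF H] fD fb z Ez id1])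
    show "zorder (\<lambda>w. det (D w)) z \<le> zorder (\<lambda>w. det (b w)) z"
      by (rule zorder_le_of_factor[OF det[OF b] det[OF D] det[OF E'] det[OF H'] fb fD z E'z id2])
  qed
qed

section \<open>Pencils with a signature\<close>

definition jform :: "nat \<Rightarrow> (nat \<Rightarrow> complex) \<Rightarrow> complex vec \<Rightarrow> complex vec \<Rightarrow> complex" where
  "jform k \<sigma> a b = (\<Sum>i<k. \<sigma> i * a $ i * cnj (b $ i))"

text \<open>
  The situation after restriction to the range of \<open>X\<close>, where the form of the Lyapunov identity is diagonal
  with signs \<open>\<sigma>\<close>. Below, \<open>w21\<close> and \<open>w22\<close> are the blocks of the lower row of \<open>W\<close> in these coordinates, and \<open>L\<close> is
  the pencil \<open>D\<close> closed by feedback.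
\<close>

locale signature_pencil =
  fixes k p q :: nat and \<sigma> :: "nat \<Rightarrow> complex" and A B C1 C2 :: "complex mat" and \<mu> :: complex
  assumes A: "A \<in> carrier_mat k k" and B: "B \<in> carrier_mat k k"
    and C1: "C1 \<in> carrier_mat p k" and C2: "C2 \<in> carrier_mat q k"
    and \<sigma>: "\<And>i. i < k \<Longrightarrow> \<sigma> i = 1 \<or> \<sigma> i = -1"
    and lyapunov: "\<And>g h. g \<in> carrier_vec k \<Longrightarrow> h \<in> carrier_vec k \<Longrightarrow>
      jform k \<sigma> (A *\<^sub>v g) (A *\<^sub>v h) - jform k \<sigma> (B *\<^sub>v g) (B *\<^sub>v h) =
      (C1 *\<^sub>v g) \<bullet>c (C1 *\<^sub>v h) - (C2 *\<^sub>v g) \<bullet>c (C2 *\<^sub>v h)"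
    and \<mu>: "cmod \<mu> = 1"
    and regular: "\<And>z. cmod z = 1 \<Longrightarrow> det (A - z \<cdot>\<^sub>m B) \<noteq> 0"
begin

abbreviation "jf \<equiv> jform k \<sigma>"
abbreviation "J \<equiv> dmat k \<sigma>"

definition D where "D z = A - z \<cdot>\<^sub>m B"
definition H where "H z = C2 * mat_inv (D z)"
definition G1 where "G1 = mat_adjoint (C1 * mat_inv (D \<mu>))"
definition G2 where "G2 = mat_adjoint (C2 * mat_inv (D \<mu>))"
definition w21 where "w21 z = (- (1 - z * cnj \<mu>)) \<cdot>\<^sub>m (H z * J * G1)"
definition w22 where "w22 z = 1\<^sub>m q + (1 - z * cnj \<mu>) \<cdot>\<^sub>m (H z * J * G2)"
definition L where "L z = D z + (1 - z * cnj \<mu>) \<cdot>\<^sub>m (J * G2 * C2)"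

lemma D [simp]: "D z \<in> carrier_mat k k" using A B by (simp add: D_def minus_carrier_mat)

lemma D_reg: "cmod z = 1 \<Longrightarrow> det (D z) \<noteq> 0" using regular by (simp add: D_def)

lemma Dinv: "det (D z) \<noteq> 0 \<Longrightarrow> mat_inv (D z) \<in> carrier_mat k k"
  and Dinv1: "det (D z) \<noteq> 0 \<Longrightarrow> D z * mat_inv (D z) = 1\<^sub>m k"
  and Dinv2: "det (D z) \<noteq> 0 \<Longrightarrow> mat_inv (D z) * D z = 1\<^sub>m k"
  using mat_inv_props[OF D] by auto

lemma H: "det (D z) \<noteq> 0 \<Longrightarrow> H z \<in> carrier_mat q k"
  using C2 Dinv by (auto simp: H_def)

lemma G1 [simp]: "G1 \<in> carrier_mat k p" and G2 [simp]: "G2 \<in> carrier_mat k q"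
  unfolding G1_def G2_def using C1 C2 Dinv[OF D_reg[OF \<mu>]] by auto

lemma G1_adj: "mat_adjoint G1 = C1 * mat_inv (D \<mu>)" and G2_adj: "mat_adjoint G2 = C2 * mat_inv (D \<mu>)"
  by (simp_all add: G1_def G2_def)

lemma HD: "det (D z) \<noteq> 0 \<Longrightarrow> H z * D z = C2"
  unfolding H_def using Dinv[of z] Dinv2[of z] C2 by (simp add: assoc_mult_mat[of _ q k _ k _ k])

lemma w21: "det (D z) \<noteq> 0 \<Longrightarrow> w21 z \<in> carrier_mat q p"
  using H[of z] mult_carrier_mat[of "H z" q k J k] mult_carrier_mat[of "H z * J" q k G1 p] by (simp add: w21_def)

lemma HJG: "det (D z) \<noteq> 0 \<Longrightarrow> H z * J * G2 \<in> carrier_mat q q"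
  using H[of z] mult_carrier_mat[of "H z" q k J k] mult_carrier_mat[of "H z * J" q k G2 q] by simp

lemma HJG1: "det (D z) \<noteq> 0 \<Longrightarrow> H z * J * G1 \<in> carrier_mat q p"
  using H[of z] mult_carrier_mat[of "H z" q k J k] mult_carrier_mat[of "H z * J" q k G1 p] by simp

lemma w22: "det (D z) \<noteq> 0 \<Longrightarrow> w22 z \<in> carrier_mat q q"
  using HJG[of z] by (simp add: w22_def)

lemma JGC: "J * G2 * C2 \<in> carrier_mat k k"
  using C2 mult_carrier_mat[of J k k G2 q] mult_carrier_mat[of "J * G2" k q C2 k] by simp

lemma L [simp]: "L z \<in> carrier_mat k k"
  using JGC by (simp add: L_def)

lemma D_vec: "g \<in> carrier_vec k \<Longrightarrow> i < k \<Longrightarrow> (D z *\<^sub>v g) $ i = (A *\<^sub>v g) $ i - z * (B *\<^sub>v g) $ i"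
  using A B by (simp add: D_def scalar_prod_def sum_subtractf sum_distrib_left algebra_simps)

lemma jf_D:
  assumes "g \<in> carrier_vec k" "h \<in> carrier_vec k"
  shows "jf (D z *\<^sub>v g) (D w *\<^sub>v h) = jf (A *\<^sub>v g) (A *\<^sub>v h) - cnj w * jf (A *\<^sub>v g) (B *\<^sub>v h)
     - z * jf (B *\<^sub>v g) (A *\<^sub>v h) + z * cnj w * jf (B *\<^sub>v g) (B *\<^sub>v h)"
  unfolding jform_def using assms
  by (simp add: D_vec sum_distrib_left algebra_simps sum.distrib sum_subtractf)

lemma jf_cnj: "cnj (jf a b) = jf b a"
proof -
  have "cnj (\<sigma> i) = \<sigma> i" if "i < k" for i using \<sigma>[OF that] by auto
  thus ?thesis by (simp add: jform_def mult_ac)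
qed

lemma J_vec: "b \<in> carrier_vec k \<Longrightarrow> i < k \<Longrightarrow> (J *\<^sub>v b) $ i = \<sigma> i * b $ i"
proof -
  assume b: "b \<in> carrier_vec k" and i: "i < k"
  have "(J *\<^sub>v b) $ i = (\<Sum>j<k. (if i = j then \<sigma> i else 0) * b $ j)"
    using b i by (simp add: scalar_prod_def atLeast0LessThan)
  also have "\<dots> = (\<Sum>j<k. if i = j then \<sigma> i * b $ i else 0)" by (intro sum.cong) auto
  also have "\<dots> = \<sigma> i * b $ i" using i by simp
  finally show ?thesis .
qed

lemma J_carrier [simp]: "b \<in> carrier_vec k \<Longrightarrow> J *\<^sub>v b \<in> carrier_vec k"
  by (rule mult_mat_vec_carrier[of _ k k]) auto

lemma jf_J:
  assumes "a \<in> carrier_vec k" "b \<in> carrier_vec k"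
  shows "jf a (J *\<^sub>v b) = a \<bullet>c b"
proof -
  have "jf a (J *\<^sub>v b) = (\<Sum>i<k. a $ i * cnj (b $ i))"
    unfolding jform_def
  proof (rule sum.cong[OF refl])
    fix i assume "i \<in> {..<k}"
    thus "\<sigma> i * a $ i * cnj ((J *\<^sub>v b) $ i) = a $ i * cnj (b $ i)"
      using \<sigma>[of i] J_vec[OF assms(2), of i] by auto
  qed
  thus ?thesis using assms by (simp add: scalar_prod_def atLeast0LessThan)
qed

lemma J_adj [simp]: "mat_adjoint J = J"
  by (rule dmat_adjoint) (use \<sigma> in fastforce)

text \<open>
  Both adjoints act through the single vector \<open>g\<close>, the state that \<open>u\<close> excites; it is to this state that the
  Lyapunov identity is applied.
\<close>

lemma adj_w2:
  fixes u :: "complex vec"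
  assumes z: "det (D z) \<noteq> 0" and u: "u \<in> carrier_vec q"
  defines "g \<equiv> mat_inv (D \<mu>) *\<^sub>v (J *\<^sub>v (mat_adjoint (H z) *\<^sub>v u))"
  shows "g \<in> carrier_vec k" "D \<mu> *\<^sub>v g = J *\<^sub>v (mat_adjoint (H z) *\<^sub>v u)"
    "mat_adjoint (w22 z) *\<^sub>v u = u + (1 - cnj z * \<mu>) \<cdot>\<^sub>v (C2 *\<^sub>v g)"
    "mat_adjoint (w21 z) *\<^sub>v u = (- (1 - cnj z * \<mu>)) \<cdot>\<^sub>v (C1 *\<^sub>v g)"
proof -
  have h: "mat_adjoint (H z) *\<^sub>v u \<in> carrier_vec k"
    by (rule mult_mat_vec_carrier[OF mat_adjoint_carrier[OF H[OF z]] u])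
  note Jh = J_carrier[OF h]
  note D\<mu> = D_reg[OF \<mu>]
  show g: "g \<in> carrier_vec k" unfolding g_def by (rule mult_mat_vec_carrier[OF Dinv[OF D\<mu>] Jh])
  have "D \<mu> *\<^sub>v g = (D \<mu> * mat_inv (D \<mu>)) *\<^sub>v (J *\<^sub>v (mat_adjoint (H z) *\<^sub>v u))"
    unfolding g_def by (rule assoc_mult_mat_vec[symmetric, OF D Dinv[OF D\<mu>] Jh])
  thus "D \<mu> *\<^sub>v g = J *\<^sub>v (mat_adjoint (H z) *\<^sub>v u)"
    unfolding Dinv1[OF D\<mu>] using Jh by simp
  have HJ: "H z * J \<in> carrier_mat q k" using H[OF z] by (rule mult_carrier_mat) simp
  have JH: "J * mat_adjoint (H z) \<in> carrier_mat k q" using mat_adjoint_carrier[OF H[OF z]] by (intro mult_carrier_mat) auto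
  have adjHJ: "mat_adjoint (H z * J) = J * mat_adjoint (H z)"
    using mat_adjoint_mult[OF H[OF z], of J k] by simp
  have gen: "mat_adjoint (H z * J * G) *\<^sub>v u = C *\<^sub>v g"
    if "G \<in> carrier_mat k r" "mat_adjoint G = C * mat_inv (D \<mu>)" "C \<in> carrier_mat r k" for G C r
  proof -
    have CD: "C * mat_inv (D \<mu>) \<in> carrier_mat r k" using that Dinv[OF D\<mu>] by auto
    have "mat_adjoint (H z * J * G) = C * mat_inv (D \<mu>) * (J * mat_adjoint (H z))"
      unfolding mat_adjoint_mult[OF HJ that(1)] adjHJ that(2) ..
    hence "mat_adjoint (H z * J * G) *\<^sub>v u = C * mat_inv (D \<mu>) *\<^sub>v ((J * mat_adjoint (H z)) *\<^sub>v u)"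
      using assoc_mult_mat_vec[OF CD JH u] by simp
    also have "(J * mat_adjoint (H z)) *\<^sub>v u = J *\<^sub>v (mat_adjoint (H z) *\<^sub>v u)"
      by (rule assoc_mult_mat_vec[OF dmat_carrier mat_adjoint_carrier[OF H[OF z]] u])
    also have "C * mat_inv (D \<mu>) *\<^sub>v (J *\<^sub>v (mat_adjoint (H z) *\<^sub>v u)) = C *\<^sub>v g"
      unfolding g_def by (rule assoc_mult_mat_vec[OF that(3) Dinv[OF D\<mu>] Jh])
    finally show ?thesis .
  qed
  have sm: "(c \<cdot>\<^sub>m Y) *\<^sub>v u = c \<cdot>\<^sub>v (Y *\<^sub>v u)" if "Y \<in> carrier_mat r q" for c :: complex and Y r
    using that u by (intro eq_vecI) (auto simp: scalar_prod_def sum_distrib_left mult_ac)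
  have a2: "mat_adjoint (w22 z) = 1\<^sub>m q + (1 - cnj z * \<mu>) \<cdot>\<^sub>m mat_adjoint (H z * J * G2)"
    unfolding w22_def using HJG[OF z] by (simp add: mat_adjoint_add[of _ q q] mat_adjoint_smult)
  show "mat_adjoint (w22 z) *\<^sub>v u = u + (1 - cnj z * \<mu>) \<cdot>\<^sub>v (C2 *\<^sub>v g)"
  proof -
    have "mat_adjoint (w22 z) *\<^sub>v u = 1\<^sub>m q *\<^sub>v u + ((1 - cnj z * \<mu>) \<cdot>\<^sub>m mat_adjoint (H z * J * G2)) *\<^sub>v u"
      unfolding a2 by (rule add_mult_distrib_mat_vec[of _ q q]) (use HJG[OF z] u in auto)
    thus ?thesis using u sm[of "mat_adjoint (H z * J * G2)" q] HJG[OF z] gen[OF G2 G2_adj C2] by simp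
  qed
  have a1: "mat_adjoint (w21 z) = (- (1 - cnj z * \<mu>)) \<cdot>\<^sub>m mat_adjoint (H z * J * G1)"
    unfolding w21_def by (simp add: mat_adjoint_smult)
  show "mat_adjoint (w21 z) *\<^sub>v u = (- (1 - cnj z * \<mu>)) \<cdot>\<^sub>v (C1 *\<^sub>v g)"
    unfolding a1 using sm[of "mat_adjoint (H z * J * G1)" p] HJG1[OF z] gen[OF G1 G1_adj C1] by simp
qed

text \<open>
  The algebra behind the energy balance between two points \<open>z\<close>, \<open>m\<close> of the circle with conjugates \<open>cz\<close>, \<open>cm\<close>; the
  letters \<open>a\<close>, \<open>e\<close>, \<open>f\<close>, \<open>d\<close> stand for the values of the form at the pairs \<open>(A g, A h)\<close>, \<open>(A g, B h)\<close>,
  \<open>(B g, A h)\<close>, \<open>(B g, B h)\<close>.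
\<close>

lemma energy_identity:
  fixes z m cz cm a d e f :: complex
  assumes "z * cz = 1" "m * cm = 1"
  shows "(1 - cz * m) * (a - cm * e - z * f + z * cm * d) + (1 - z * cm) * (a - cz * e - m * f + m * cz * d)
     - (1 - cz * m) * (1 - z * cm) * (a - d) = 0"
proof -
  have "(1 - cz * m) * (a - cm * e - z * f + z * cm * d) + (1 - z * cm) * (a - cz * e - m * f + m * cz * d)
     - (1 - cz * m) * (1 - z * cm) * (a - d) =
    (1 - (z * cz) * (m * cm)) * (a + d) + e * (cz * (m * cm - 1) + cm * (z * cz - 1))
      + f * (m * (z * cz - 1) + z * (m * cm - 1))"
    by (simp add: algebra_simps)
  thus ?thesis by (simp add: assms)
qed

text \<open>
  For states \<open>g\<close>, \<open>h\<close> excited by \<open>u\<close>, \<open>v\<close>, the mixed terms of the left-hand side are values of the form at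
  \<open>D(z)\<close> and \<open>D(\<mu>)\<close>, and the Lyapunov identity expresses the quadratic terms by the form as well. That
  everything except \<open>u \<bullet>c v\<close> cancels is \<open>energy_identity\<close>.
\<close>

lemma circle_identity:
  assumes z: "cmod z = 1"
  shows "w22 z * mat_adjoint (w22 z) - w21 z * mat_adjoint (w21 z) = 1\<^sub>m q"
proof (rule mat_eqI_cscalar[of _ q])
  note Dz = D_reg[OF z]
  note W2 = w22[OF Dz] and W1 = w21[OF Dz]
  have c: "w22 z * mat_adjoint (w22 z) \<in> carrier_mat q q" "w21 z * mat_adjoint (w21 z) \<in> carrier_mat q q"
    using W1 W2 by auto
  show "w22 z * mat_adjoint (w22 z) - w21 z * mat_adjoint (w21 z) \<in> carrier_mat q q" by (rule minus_carrier_mat[OF c(2)])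
  fix u v :: "complex vec" assume u: "u \<in> carrier_vec q" and v: "v \<in> carrier_vec q"
  define g where "g = mat_inv (D \<mu>) *\<^sub>v (J *\<^sub>v (mat_adjoint (H z) *\<^sub>v u))"
  define h where "h = mat_inv (D \<mu>) *\<^sub>v (J *\<^sub>v (mat_adjoint (H z) *\<^sub>v v))"
  note gu = adj_w2[OF Dz u, folded g_def] and hv = adj_w2[OF Dz v, folded h_def]
  let ?c = "1 - cnj z * \<mu>"
  have C2g: "C2 *\<^sub>v g \<in> carrier_vec q" "C2 *\<^sub>v h \<in> carrier_vec q" "C1 *\<^sub>v g \<in> carrier_vec p" "C1 *\<^sub>v h \<in> carrier_vec p"
    using C1 C2 gu(1) hv(1) by auto
  have key: "(C2 *\<^sub>v g') \<bullet>c v' = jf (D z *\<^sub>v g') (D \<mu> *\<^sub>v h')"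
    if g': "g' \<in> carrier_vec k" and v': "v' \<in> carrier_vec q"
      and h': "D \<mu> *\<^sub>v h' = J *\<^sub>v (mat_adjoint (H z) *\<^sub>v v')" for g' v' h'
  proof -
    have x: "mat_adjoint (H z) *\<^sub>v v' \<in> carrier_vec k"
      by (rule mult_mat_vec_carrier[OF mat_adjoint_carrier[OF H[OF Dz]] v'])
    have Dg: "D z *\<^sub>v g' \<in> carrier_vec k" by (rule mult_mat_vec_carrier[OF D g'])
    have "C2 *\<^sub>v g' = (H z * D z) *\<^sub>v g'" unfolding HD[OF Dz] ..
    also have "\<dots> = H z *\<^sub>v (D z *\<^sub>v g')" by (rule assoc_mult_mat_vec[OF H[OF Dz] D g'])
    finally have "(C2 *\<^sub>v g') \<bullet>c v' = (H z *\<^sub>v (D z *\<^sub>v g')) \<bullet>c v'" by simp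
    also have "\<dots> = (D z *\<^sub>v g') \<bullet>c (mat_adjoint (H z) *\<^sub>v v')" by (rule cscalar_adjoint[OF H[OF Dz] Dg v'])
    also have "\<dots> = jf (D z *\<^sub>v g') (D \<mu> *\<^sub>v h')" unfolding h' by (rule jf_J[OF Dg x, symmetric])
    finally show ?thesis .
  qed
  have k1: "(C2 *\<^sub>v g) \<bullet>c v = jf (D z *\<^sub>v g) (D \<mu> *\<^sub>v h)" by (rule key[OF gu(1) v hv(2)])
  have "u \<bullet>c (C2 *\<^sub>v h) = cnj ((C2 *\<^sub>v h) \<bullet>c u)" using cscalar_cnj[of "C2 *\<^sub>v h" q u] C2g u by simp
  hence k2: "u \<bullet>c (C2 *\<^sub>v h) = jf (D \<mu> *\<^sub>v g) (D z *\<^sub>v h)"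
    unfolding key[OF hv(1) u gu(2)] jf_cnj .
  have zz: "z * cnj z = 1" "\<mu> * cnj \<mu> = 1" using z \<mu> by (simp_all add: complex_norm_square[symmetric])
  have "((w22 z * mat_adjoint (w22 z) - w21 z * mat_adjoint (w21 z)) *\<^sub>v u) \<bullet>c v =
     (w22 z *\<^sub>v (mat_adjoint (w22 z) *\<^sub>v u) - w21 z *\<^sub>v (mat_adjoint (w21 z) *\<^sub>v u)) \<bullet>c v"
  proof -
    have "(w22 z * mat_adjoint (w22 z) - w21 z * mat_adjoint (w21 z)) *\<^sub>v u =
        (w22 z * mat_adjoint (w22 z)) *\<^sub>v u - (w21 z * mat_adjoint (w21 z)) *\<^sub>v u"
      using c u by (rule minus_mult_distrib_mat_vec)
    thus ?thesis using assoc_mult_mat_vec[OF W2 mat_adjoint_carrier[OF W2] u]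
      assoc_mult_mat_vec[OF W1 mat_adjoint_carrier[OF W1] u] by simp
  qed
  also have "\<dots> = (w22 z *\<^sub>v (mat_adjoint (w22 z) *\<^sub>v u)) \<bullet>c v - (w21 z *\<^sub>v (mat_adjoint (w21 z) *\<^sub>v u)) \<bullet>c v"
    using W1 W2 u v by (intro cscalar_minus_left[of _ q]) (auto intro!: mult_mat_vec_carrier)
  also have "(w22 z *\<^sub>v (mat_adjoint (w22 z) *\<^sub>v u)) \<bullet>c v = (mat_adjoint (w22 z) *\<^sub>v u) \<bullet>c (mat_adjoint (w22 z) *\<^sub>v v)"
    using W2 u v by (intro cscalar_adjoint[of _ q q]) (auto intro!: mult_mat_vec_carrier)
  also have "(w21 z *\<^sub>v (mat_adjoint (w21 z) *\<^sub>v u)) \<bullet>c v = (mat_adjoint (w21 z) *\<^sub>v u) \<bullet>c (mat_adjoint (w21 z) *\<^sub>v v)"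
    using W1 u v by (intro cscalar_adjoint[of _ q p]) (auto intro!: mult_mat_vec_carrier mat_adjoint_carrier)
  also have "(mat_adjoint (w22 z) *\<^sub>v u) \<bullet>c (mat_adjoint (w22 z) *\<^sub>v v) =
      u \<bullet>c v + ?c * ((C2 *\<^sub>v g) \<bullet>c v) + cnj ?c * (u \<bullet>c (C2 *\<^sub>v h)) + ?c * cnj ?c * ((C2 *\<^sub>v g) \<bullet>c (C2 *\<^sub>v h))"
    unfolding gu(3) hv(3) using u v C2g by (simp add: cscalar_simps[of _ q] algebra_simps)
  also have "(mat_adjoint (w21 z) *\<^sub>v u) \<bullet>c (mat_adjoint (w21 z) *\<^sub>v v) = ?c * cnj ?c * ((C1 *\<^sub>v g) \<bullet>c (C1 *\<^sub>v h))"
    unfolding gu(4) hv(4) using C2g by (simp add: cscalar_simps[of _ p] algebra_simps)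
  also have "u \<bullet>c v + ?c * ((C2 *\<^sub>v g) \<bullet>c v) + cnj ?c * (u \<bullet>c (C2 *\<^sub>v h)) + ?c * cnj ?c * ((C2 *\<^sub>v g) \<bullet>c (C2 *\<^sub>v h))
      - ?c * cnj ?c * ((C1 *\<^sub>v g) \<bullet>c (C1 *\<^sub>v h)) =
    u \<bullet>c v + (?c * ((C2 *\<^sub>v g) \<bullet>c v) + cnj ?c * (u \<bullet>c (C2 *\<^sub>v h))
      - ?c * cnj ?c * ((C1 *\<^sub>v g) \<bullet>c (C1 *\<^sub>v h) - (C2 *\<^sub>v g) \<bullet>c (C2 *\<^sub>v h)))"
    by (simp add: right_diff_distrib)
  also have "?c * ((C2 *\<^sub>v g) \<bullet>c v) + cnj ?c * (u \<bullet>c (C2 *\<^sub>v h))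
      - ?c * cnj ?c * ((C1 *\<^sub>v g) \<bullet>c (C1 *\<^sub>v h) - (C2 *\<^sub>v g) \<bullet>c (C2 *\<^sub>v h)) = 0"
    unfolding lyapunov[OF gu(1) hv(1), symmetric] k1 k2 jf_D[OF gu(1) hv(1)] complex_cnj_diff complex_cnj_mult complex_cnj_cnj complex_cnj_one
    by (rule energy_identity[OF zz])
  finally show "((w22 z * mat_adjoint (w22 z) - w21 z * mat_adjoint (w21 z)) *\<^sub>v u) \<bullet>c v = (1\<^sub>m q *\<^sub>v u) \<bullet>c v"
    using u by simp
qed simp

text \<open>By \<open>circle_identity\<close>, \<open>w22 w22\<^sup>* \<ge> I\<close> on the circle.\<close>

lemma w22_circle_inv:
  assumes z: "cmod z = 1"
  shows "det (w22 z) \<noteq> 0"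
proof -
  note Dz = D_reg[OF z]
  note W2 = w22[OF Dz] and W1 = w21[OF Dz]
  have "det (mat_adjoint (w22 z)) \<noteq> 0"
    unfolding det_nonzero_iff_inj[OF mat_adjoint_carrier[OF W2]]
  proof (intro ballI impI)
    fix u assume u: "u \<in> carrier_vec q" and z0: "mat_adjoint (w22 z) *\<^sub>v u = 0\<^sub>v q"
    have c: "w22 z * mat_adjoint (w22 z) \<in> carrier_mat q q" "w21 z * mat_adjoint (w21 z) \<in> carrier_mat q q"
      using W1 W2 by auto
    have au: "mat_adjoint (w21 z) *\<^sub>v u \<in> carrier_vec p" by (rule mult_mat_vec_carrier[OF mat_adjoint_carrier[OF W1] u])
    have "u = (w22 z * mat_adjoint (w22 z) - w21 z * mat_adjoint (w21 z)) *\<^sub>v u"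
      unfolding circle_identity[OF z] using u by simp
    also have "\<dots> = (w22 z * mat_adjoint (w22 z)) *\<^sub>v u - (w21 z * mat_adjoint (w21 z)) *\<^sub>v u"
      using c u by (rule minus_mult_distrib_mat_vec)
    also have "(w22 z * mat_adjoint (w22 z)) *\<^sub>v u = w22 z *\<^sub>v (0\<^sub>v q)"
      using assoc_mult_mat_vec[OF W2 mat_adjoint_carrier[OF W2] u] z0 by simp
    also have "\<dots> = 0\<^sub>v q" using W2 by (intro eq_vecI) auto
    also have "(w21 z * mat_adjoint (w21 z)) *\<^sub>v u = w21 z *\<^sub>v (mat_adjoint (w21 z) *\<^sub>v u)"
      by (rule assoc_mult_mat_vec[OF W1 mat_adjoint_carrier[OF W1] u])
    finally have ueq: "u = 0\<^sub>v q - w21 z *\<^sub>v (mat_adjoint (w21 z) *\<^sub>v u)" .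
    have wc: "w21 z *\<^sub>v (mat_adjoint (w21 z) *\<^sub>v u) \<in> carrier_vec q" by (rule mult_mat_vec_carrier[OF W1 au])
    have "u \<bullet>c u = (0\<^sub>v q - w21 z *\<^sub>v (mat_adjoint (w21 z) *\<^sub>v u)) \<bullet>c u" using ueq by simp
    also have "\<dots> = - ((w21 z *\<^sub>v (mat_adjoint (w21 z) *\<^sub>v u)) \<bullet>c u)"
      using wc u by (subst cscalar_minus_left[of _ q]) auto
    also have "(w21 z *\<^sub>v (mat_adjoint (w21 z) *\<^sub>v u)) \<bullet>c u = of_real (nsq (mat_adjoint (w21 z) *\<^sub>v u))"
      unfolding cscalar_adjoint[OF W1 au u] by (rule cscalar_self)
    finally have "complex_of_real (nsq u) = complex_of_real (- nsq (mat_adjoint (w21 z) *\<^sub>v u))"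
      by (simp add: cscalar_self)
    hence "nsq u = - nsq (mat_adjoint (w21 z) *\<^sub>v u)" by (simp only: of_real_eq_iff)
    hence "nsq u = 0" using nsq_nonneg[of u] nsq_nonneg[of "mat_adjoint (w21 z) *\<^sub>v u"] by linarith
    thus "u = 0\<^sub>v q" using nsq_eq_0[OF u] by simp
  qed
  thus ?thesis using det_mat_adjoint[OF W2] by simp
qed

text \<open>
  The identity \<open>det (I + Y Z) = det (I + Z Y)\<close> turns \<open>w22\<close> into \<open>I\<close> plus a multiple of \<open>J G2 H\<close>, and \<open>H D = C2\<close>
  cancels the inverse of \<open>D\<close> contained in \<open>H\<close>.
\<close>

lemma det_w22:
  assumes z: "det (D z) \<noteq> 0"
  shows "det (w22 z) * det (D z) = det (L z)"
proof -
  let ?c = "1 - z * cnj \<mu>"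
  have JG: "J * G2 \<in> carrier_mat k q" by (rule mult_carrier_mat) auto
  have cH: "?c \<cdot>\<^sub>m H z \<in> carrier_mat q k" using H[OF z] by simp
  have "w22 z = 1\<^sub>m q + (?c \<cdot>\<^sub>m H z) * (J * G2)"
  proof -
    have "H z * J * G2 = H z * (J * G2)" by (rule assoc_mult_mat[OF H[OF z] dmat_carrier G2])
    thus ?thesis unfolding w22_def using mult_smult_assoc_mat[OF H[OF z] JG] by simp
  qed
  hence "det (w22 z) = det (1\<^sub>m k + (J * G2) * (?c \<cdot>\<^sub>m H z))"
    using det_one_plus_comm[OF cH JG] by simp
  hence "det (w22 z) * det (D z) = det ((1\<^sub>m k + (J * G2) * (?c \<cdot>\<^sub>m H z)) * D z)"
    using det_mult[of "1\<^sub>m k + (J * G2) * (?c \<cdot>\<^sub>m H z)" k "D z"] mult_carrier_mat[OF JG cH] by simp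
  also have "(1\<^sub>m k + (J * G2) * (?c \<cdot>\<^sub>m H z)) * D z = D z + (J * G2) * (?c \<cdot>\<^sub>m H z) * D z"
    using add_mult_distrib_mat[of "1\<^sub>m k" k k "(J * G2) * (?c \<cdot>\<^sub>m H z)" "D z" k] mult_carrier_mat[OF JG cH] left_mult_one_mat[OF D] by simp
  also have "(J * G2) * (?c \<cdot>\<^sub>m H z) * D z = (J * G2) * ((?c \<cdot>\<^sub>m H z) * D z)"
    by (rule assoc_mult_mat[OF JG cH D])
  also have "(?c \<cdot>\<^sub>m H z) * D z = ?c \<cdot>\<^sub>m C2" using mult_smult_assoc_mat[OF H[OF z] D] HD[OF z] by simp
  also have "(J * G2) * (?c \<cdot>\<^sub>m C2) = ?c \<cdot>\<^sub>m (J * G2 * C2)" by (rule mult_smult_distrib[OF JG C2])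
  finally show ?thesis by (simp add: L_def)
qed

lemma L_circle: "cmod z = 1 \<Longrightarrow> det (L z) \<noteq> 0"
  using det_w22[OF D_reg] w22_circle_inv D_reg by (metis mult_eq_0_iff)

definition A' where "A' = A + J * G2 * C2"
definition B' where "B' = B + cnj \<mu> \<cdot>\<^sub>m (J * G2 * C2)"

lemma A' [simp]: "A' \<in> carrier_mat k k" and B' [simp]: "B' \<in> carrier_mat k k"
  using JGC A B by (auto simp: A'_def B'_def)

lemma L_entry: "i < k \<Longrightarrow> j < k \<Longrightarrow> L z $$ (i, j) = A' $$ (i, j) - z * B' $$ (i, j)"
  using JGC A B unfolding L_def D_def A'_def B'_def
  by (simp add: algebra_simps carrier_matD[of _ k k] del: index_mult_mat)

text \<open>
  The feedback \<open>J G2 C2\<close> adds twice the square of \<open>C2 g\<close> to the Lyapunov identity: each of the two mixed terms equals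
  \<open>D(\<mu>) g \<bullet>c G2 C2 g = C2 g \<bullet>c C2 g\<close>, and the terms quadratic in the feedback cancel because \<open>|\<mu>| = 1\<close>.
\<close>

lemma feedback_positive:
  assumes g: "g \<in> carrier_vec k"
  shows "jf (A' *\<^sub>v g) (A' *\<^sub>v g) - jf (B' *\<^sub>v g) (B' *\<^sub>v g) = of_real (nsq (C1 *\<^sub>v g) + nsq (C2 *\<^sub>v g))"
proof -
  define y where "y = G2 *\<^sub>v (C2 *\<^sub>v g)"
  define s where "s = J *\<^sub>v y"
  have C2g: "C2 *\<^sub>v g \<in> carrier_vec q" by (rule mult_mat_vec_carrier[OF C2 g])
  have y: "y \<in> carrier_vec k" unfolding y_def by (rule mult_mat_vec_carrier[OF G2 C2g])
  have s: "s \<in> carrier_vec k" unfolding s_def by (rule J_carrier[OF y])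
  have JG: "J * G2 \<in> carrier_mat k q" by (rule mult_carrier_mat) auto
  have JGCg: "J * G2 * C2 *\<^sub>v g = s"
    unfolding assoc_mult_mat_vec[OF JG C2 g] s_def y_def by (rule assoc_mult_mat_vec[OF dmat_carrier G2 C2g])
  have Ag: "A *\<^sub>v g \<in> carrier_vec k" "B *\<^sub>v g \<in> carrier_vec k" using A B g by (auto intro: mult_mat_vec_carrier)
  have A'g: "A' *\<^sub>v g = A *\<^sub>v g + s"
    unfolding A'_def JGCg[symmetric] by (rule add_mult_distrib_mat_vec[OF A JGC g])
  have B'g: "B' *\<^sub>v g = B *\<^sub>v g + cnj \<mu> \<cdot>\<^sub>v s"
  proof -
    have "B' *\<^sub>v g = B *\<^sub>v g + (cnj \<mu> \<cdot>\<^sub>m (J * G2 * C2)) *\<^sub>v g"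
      unfolding B'_def by (rule add_mult_distrib_mat_vec[OF B _ g]) (use JGC in auto)
    also have "(cnj \<mu> \<cdot>\<^sub>m (J * G2 * C2)) *\<^sub>v g = cnj \<mu> \<cdot>\<^sub>v s"
      unfolding JGCg[symmetric] using JGC g
      by (intro eq_vecI) (auto simp: scalar_prod_def sum_distrib_left mult_ac carrier_matD[of _ k k] simp del: index_mult_mat)
    finally show ?thesis .
  qed
  have jfs: "jf (A *\<^sub>v g) s - \<mu> * jf (B *\<^sub>v g) s = of_real (nsq (C2 *\<^sub>v g))"
  proof -
    have Dg: "D \<mu> *\<^sub>v g \<in> carrier_vec k" by (rule mult_mat_vec_carrier[OF D g])
    have "jf (A *\<^sub>v g) s - \<mu> * jf (B *\<^sub>v g) s = jf (D \<mu> *\<^sub>v g) s"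
      unfolding jform_def using g by (simp add: D_vec sum_distrib_left sum_subtractf algebra_simps)
    also have "\<dots> = (D \<mu> *\<^sub>v g) \<bullet>c y" unfolding s_def by (rule jf_J[OF Dg y])
    also have "\<dots> = (mat_adjoint G2 *\<^sub>v (D \<mu> *\<^sub>v g)) \<bullet>c (C2 *\<^sub>v g)"
      unfolding y_def by (rule cscalar_adjoint'[OF G2 Dg C2g])
    also have "mat_adjoint G2 *\<^sub>v (D \<mu> *\<^sub>v g) = H \<mu> * D \<mu> *\<^sub>v g"
      unfolding G2_adj H_def[symmetric] by (rule assoc_mult_mat_vec[symmetric, OF H[OF D_reg[OF \<mu>]] D g])
    also have "H \<mu> * D \<mu> = C2" by (rule HD[OF D_reg[OF \<mu>]])
    finally show ?thesis by (simp add: cscalar_self)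
  qed
  have "jf (A' *\<^sub>v g) (A' *\<^sub>v g) - jf (B' *\<^sub>v g) (B' *\<^sub>v g) =
     (jf (A *\<^sub>v g) (A *\<^sub>v g) - jf (B *\<^sub>v g) (B *\<^sub>v g)) + (jf (A *\<^sub>v g) s - \<mu> * jf (B *\<^sub>v g) s)
     + (jf s (A *\<^sub>v g) - cnj \<mu> * jf s (B *\<^sub>v g)) + (1 - \<mu> * cnj \<mu>) * jf s s"
    unfolding A'g B'g jform_def using Ag s
    by (simp add: sum.distrib sum_subtractf sum_distrib_left algebra_simps)
  also have "jf s (A *\<^sub>v g) - cnj \<mu> * jf s (B *\<^sub>v g) = cnj (jf (A *\<^sub>v g) s - \<mu> * jf (B *\<^sub>v g) s)"
    by (simp add: jf_cnj)
  also have "1 - \<mu> * cnj \<mu> = 0" using \<mu> by (simp add: complex_norm_square[symmetric])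
  finally show ?thesis unfolding jfs lyapunov[OF g g] by (simp add: cscalar_self)
qed

text \<open>
  Sorting the rows of \<open>A'\<close> and \<open>B'\<close> by signature gives \<open>S\<close> and \<open>R\<close> with
  \<open>|R v| \<le> |S v|\<close>; on the circle, \<open>R\<close> can therefore be deformed to \<open>0\<close> without creating zeros, and what remains of the
  pencil is \<open>S\<close> with the rows of negative signature multiplied by \<open>- z\<close>.
\<close>

lemma zero_count_L:
  "zero_count 1 (\<lambda>z. det (L z)) = int (card {i. i < k \<and> \<sigma> i = -1})"
  "(\<lambda>z. det (L z)) holomorphic_on UNIV" "finite {z\<in>ball 0 1. det (L z) = 0}"
proof -
  define S where "S = mat k k (\<lambda>(i, j). if \<sigma> i = 1 then A' $$ (i, j) else B' $$ (i, j))"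
  define R where "R = mat k k (\<lambda>(i, j). if \<sigma> i = 1 then B' $$ (i, j) else A' $$ (i, j))"
  define K where "K = (\<lambda>(t :: complex) z. mat k k (\<lambda>(i, j). if \<sigma> i = 1 then S $$ (i, j) - t * (z * R $$ (i, j))
     else t * R $$ (i, j) - z * S $$ (i, j)))"
  have S: "S \<in> carrier_mat k k" and R: "R \<in> carrier_mat k k" and K: "K t z \<in> carrier_mat k k" for t z
    by (auto simp: S_def R_def K_def)
  have K1: "K 1 z = L z" for z
    using carrier_matD[OF L[of z]] by (intro eq_matI) (auto simp: K_def S_def R_def L_entry)
  have K0: "det (K 0 z) = ((-1) ^ card {i. i < k \<and> \<sigma> i = -1} * det S) * z ^ card {i. i < k \<and> \<sigma> i = -1}" for z
  proof -
    have "K 0 z = dmat k (\<lambda>i. if \<sigma> i = 1 then 1 else - z) * S"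
      unfolding dmat_mult_left[OF S] by (intro eq_matI) (auto simp: K_def)
    hence "det (K 0 z) = (\<Prod>i<k. if \<sigma> i = 1 then 1 else - z) * det S"
      using S by (simp add: det_mult[of _ k] det_dmat)
    also have "(\<Prod>i<k. if \<sigma> i = 1 then 1 else - z) = (\<Prod>i\<in>{i. i < k \<and> \<sigma> i = -1}. - z)"
    proof (rule prod.mono_neutral_cong_right)
      show "\<forall>i\<in>{..<k} - {i. i < k \<and> \<sigma> i = - 1}. (if \<sigma> i = 1 then 1 else - z) = 1" using \<sigma> by auto
    qed auto
    also have "\<dots> = (-1) ^ card {i. i < k \<and> \<sigma> i = -1} * z ^ card {i. i < k \<and> \<sigma> i = -1}"
      by (simp add: power_mult_distrib[symmetric])
    finally show ?thesis by simp
  qed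
  have Sv: "nsq (R *\<^sub>v v) \<le> nsq (S *\<^sub>v v)" if v: "v \<in> carrier_vec k" for v
  proof -
    have "complex_of_real (nsq (S *\<^sub>v v) - nsq (R *\<^sub>v v)) = (\<Sum>i<k. (S *\<^sub>v v) $ i * cnj ((S *\<^sub>v v) $ i) - (R *\<^sub>v v) $ i * cnj ((R *\<^sub>v v) $ i))"
      using S R by (simp add: nsq_def sum_subtractf complex_norm_square del: index_mult_mat_vec of_real_power)
    also have "\<dots> = (\<Sum>i<k. \<sigma> i * (A' *\<^sub>v v) $ i * cnj ((A' *\<^sub>v v) $ i) - \<sigma> i * (B' *\<^sub>v v) $ i * cnj ((B' *\<^sub>v v) $ i))"
    proof (rule sum.cong[OF refl])
      fix i assume "i \<in> {..<k}"
      hence i: "i < k" by simp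
      have rw: "row S i = (if \<sigma> i = 1 then row A' i else row B' i)" "row R i = (if \<sigma> i = 1 then row B' i else row A' i)"
        using i carrier_matD[OF A'] carrier_matD[OF B'] by (auto simp: S_def R_def intro!: eq_vecI)
      show "(S *\<^sub>v v) $ i * cnj ((S *\<^sub>v v) $ i) - (R *\<^sub>v v) $ i * cnj ((R *\<^sub>v v) $ i) =
        \<sigma> i * (A' *\<^sub>v v) $ i * cnj ((A' *\<^sub>v v) $ i) - \<sigma> i * (B' *\<^sub>v v) $ i * cnj ((B' *\<^sub>v v) $ i)"
        using \<sigma>[OF i] i carrier_matD[OF A'] carrier_matD[OF B'] carrier_matD[OF S] carrier_matD[OF R] by (auto simp: rw)
    qed
    also have "\<dots> = of_real (nsq (C1 *\<^sub>v v) + nsq (C2 *\<^sub>v v))"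
      unfolding feedback_positive[OF v, symmetric] jform_def sum_subtractf ..
    finally have "nsq (S *\<^sub>v v) - nsq (R *\<^sub>v v) = nsq (C1 *\<^sub>v v) + nsq (C2 *\<^sub>v v)" by (simp only: of_real_eq_iff)
    thus ?thesis using nsq_nonneg[of "C1 *\<^sub>v v"] nsq_nonneg[of "C2 *\<^sub>v v"] by linarith
  qed
  \<comment> \<open>For \<open>t = 1\<close> this is \<open>L_circle\<close>. For \<open>t < 1\<close> a kernel vector satisfies \<open>|S v| = t |R v| \<le> t |S v|\<close>, so that
    \<open>S v = R v = 0\<close>, and it is in the kernel of \<open>L\<close> everywhere.\<close>
  have nz: "det (K (of_real t) z) \<noteq> 0" if t: "0 \<le> t" "t \<le> 1" and z: "cmod z = 1" for t z
  proof (cases "t = 1")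
    case True
    thus ?thesis using L_circle[OF z] by (simp add: K1)
  next
    case False
    show ?thesis unfolding det_nonzero_iff_inj[OF K]
    proof (intro ballI impI)
      fix v assume v: "v \<in> carrier_vec k" and Kv: "K (of_real t) z *\<^sub>v v = 0\<^sub>v k"
      have Kvi: "(K (of_real t) z *\<^sub>v v) $ i = (if \<sigma> i = 1 then (S *\<^sub>v v) $ i - t * (z * (R *\<^sub>v v) $ i)
         else t * (R *\<^sub>v v) $ i - z * (S *\<^sub>v v) $ i)" if i: "i < k" for i
        using i v carrier_matD[OF S] carrier_matD[OF R]
        by (auto simp: K_def scalar_prod_def sum_distrib_left algebra_simps sum_subtractf)
      have cm: "cmod ((S *\<^sub>v v) $ i) = t * cmod ((R *\<^sub>v v) $ i)" if i: "i < k" for i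
      proof (cases "\<sigma> i = 1")
        case True
        hence "(S *\<^sub>v v) $ i = t * (z * (R *\<^sub>v v) $ i)" using Kvi[OF i] Kv i by simp
        hence "cmod ((S *\<^sub>v v) $ i) = cmod (t * (z * (R *\<^sub>v v) $ i))" by (rule arg_cong)
        also have "\<dots> = t * cmod ((R *\<^sub>v v) $ i)" using t z by (simp add: norm_mult)
        finally show ?thesis .
      next
        case False
        hence "z * (S *\<^sub>v v) $ i = t * (R *\<^sub>v v) $ i" using Kvi[OF i] Kv i by simp
        hence "cmod (z * (S *\<^sub>v v) $ i) = cmod (t * (R *\<^sub>v v) $ i)" by (rule arg_cong)
        thus ?thesis using t z by (simp add: norm_mult)
      qed
      have "nsq (S *\<^sub>v v) = t\<^sup>2 * nsq (R *\<^sub>v v)"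
        using S R cm by (simp add: nsq_def sum_distrib_left power_mult_distrib del: index_mult_mat_vec)
      moreover have "t\<^sup>2 * nsq (R *\<^sub>v v) \<le> t\<^sup>2 * nsq (S *\<^sub>v v)" using Sv[OF v] by (intro mult_left_mono) auto
      moreover have "t\<^sup>2 < 1" using t False by (simp add: power_less_one_iff abs_square_less_1)
      ultimately have "nsq (S *\<^sub>v v) * (1 - t\<^sup>2) \<le> 0" by (simp add: algebra_simps)
      hence "nsq (S *\<^sub>v v) \<le> 0" using \<open>t\<^sup>2 < 1\<close> by (simp add: mult_le_0_iff)
      hence nS: "nsq (S *\<^sub>v v) = 0" using nsq_nonneg[of "S *\<^sub>v v"] by linarith
      hence nR: "nsq (R *\<^sub>v v) = 0" using Sv[OF v] nsq_nonneg[of "R *\<^sub>v v"] by linarith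
      have Sv0: "S *\<^sub>v v = 0\<^sub>v k" using nS nsq_eq_0[OF mult_mat_vec_carrier[OF S v]] by simp
      have Rv0: "R *\<^sub>v v = 0\<^sub>v k" using nR nsq_eq_0[OF mult_mat_vec_carrier[OF R v]] by simp
      have "K 1 1 *\<^sub>v v = 0\<^sub>v k"
      proof (rule eq_vecI)
        fix i assume "i < dim_vec (0\<^sub>v k :: complex vec)"
        hence i: "i < k" by simp
        have "(K 1 1 *\<^sub>v v) $ i = (if \<sigma> i = 1 then (S *\<^sub>v v) $ i - (R *\<^sub>v v) $ i else (R *\<^sub>v v) $ i - (S *\<^sub>v v) $ i)"
          using i v carrier_matD[OF S] carrier_matD[OF R]
          by (auto simp: K_def scalar_prod_def sum_distrib_left algebra_simps sum_subtractf)
        thus "(K 1 1 *\<^sub>v v) $ i = 0\<^sub>v k $ i" unfolding Sv0 Rv0 using i by simp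
      qed (use K in auto)
      thus "v = 0\<^sub>v k" using L_circle[of 1] v det_nonzero_iff_inj[OF L] by (simp add: K1)
    qed
  qed
  interpret hol: fun_alg UNIV "\<lambda>f. f holomorphic_on UNIV" by (rule fun_alg_hol)
  have "hol_mat UNIV k k L"
  proof (rule mat_funI)
    fix i j assume "i < k" "j < k"
    thus "(\<lambda>z. L z $$ (i, j)) holomorphic_on UNIV" by (simp add: L_entry holomorphic_intros)
  qed simp
  thus Lh: "(\<lambda>z. det (L z)) holomorphic_on UNIV" by (rule hol.det)
  have "hol_mat UNIV k k (K 0)"
  proof (rule mat_funI)
    fix i j assume "i < k" "j < k"
    thus "(\<lambda>z. K 0 z $$ (i, j)) holomorphic_on UNIV"
      by (cases "\<sigma> i = 1") (auto simp: K_def intro!: holomorphic_intros)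
  qed (rule K)
  hence K0h: "(\<lambda>z. det (K 0 z)) holomorphic_on UNIV" by (rule hol.det)
  show "finite {z\<in>ball 0 1. det (L z) = 0}"
    by (rule zero_count_winding_number(1)[of _ 2]) (use Lh L_circle in \<open>auto intro: holomorphic_on_subset\<close>)
  have "zero_count 1 (\<lambda>z. det (K 0 z)) = zero_count 1 (\<lambda>z. det (L z))"
  proof (rule zero_count_homotopy[where R = 2 and H = "\<lambda>t z. det (K (of_real t) z)"])
    let ?X = "{0..1::real} \<times> sphere (0::complex) 1"
    interpret c: fun_alg ?X "\<lambda>f. continuous_on ?X f" by (rule fun_alg_cont)
    have "cont_mat ?X k k (\<lambda>x. K (of_real (fst x)) (snd x))"
    proof (rule mat_funI)
      fix i j assume "i < k" "j < k"
      thus "continuous_on ?X (\<lambda>x. K (of_real (fst x)) (snd x) $$ (i, j))"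
        by (cases "\<sigma> i = 1") (auto simp: K_def intro!: continuous_intros)
    qed (rule K)
    thus "continuous_on ?X (\<lambda>x. det (K (of_real (fst x)) (snd x)))" by (rule c.det)
    show "det (K (of_real 1) z) = det (L z)" for z by (simp add: K1)
  qed (use nz Lh K0h in \<open>auto intro: holomorphic_on_subset\<close>)
  moreover have "det S \<noteq> 0" using nz[of 0 1] K0[of 1] by auto
  hence "zero_count 1 (\<lambda>z. det (K 0 z)) = int (card {i. i < k \<and> \<sigma> i = -1})"
    using zero_count_blaschke(3)[of "(-1) ^ card {i. i < k \<and> \<sigma> i = -1} * det S" "replicate (card {i. i < k \<and> \<sigma> i = -1}) 0"]
    by (simp add: K0 map_replicate)
  ultimately show "zero_count 1 (\<lambda>z. det (L z)) = int (card {i. i < k \<and> \<sigma> i = -1})" by simp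
qed

end

section \<open>Linear fractional expressions near the circle\<close>

lemma open_contains_annulus:
  fixes S :: "complex set"
  assumes S: "open S" "sphere 0 1 \<subseteq> S"
  obtains \<rho> where "0 < \<rho>" "\<rho> < 1" "\<And>z. \<rho> \<le> cmod z \<Longrightarrow> cmod z \<le> 1 \<Longrightarrow> z \<in> S"
proof (cases "cball 0 1 - S = {}")
  case True
  show ?thesis by (rule that[of "1/2"]) (use True in auto)
next
  case False
  have "compact (cball 0 1 - S)" using S by (intro compact_diff) auto
  hence "\<exists>x\<in>cball 0 1 - S. \<forall>y\<in>cball 0 1 - S. cmod y \<le> cmod x"
    by (rule continuous_attains_sup[OF _ False]) (intro continuous_intros)
  then obtain z0 where z0: "z0 \<in> cball 0 1 - S" "\<And>z. z \<in> cball 0 1 - S \<Longrightarrow> cmod z \<le> cmod z0"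
    by blast
  have "cmod z0 < 1" using z0(1) S(2) by (force simp: less_le)
  show ?thesis
  proof (rule that[of "(1 + cmod z0) / 2"])
    fix z assume z: "(1 + cmod z0) / 2 \<le> cmod z" "cmod z \<le> 1"
    show "z \<in> S"
    proof (rule ccontr)
      assume "z \<notin> S"
      hence "cmod z \<le> cmod z0" using z0(2)[of z] z by simp
      thus False using z \<open>cmod z0 < 1\<close> by simp
    qed
  next
    show "0 < (1 + cmod z0) / 2" by (simp add: add_pos_nonneg)
  qed (use \<open>cmod z0 < 1\<close> in auto)
qed

text \<open>
  By the Cauchy--Schwarz inequality, the quadratic form of \<open>K - I\<close>, whose \<open>q\<^sup>2\<close> entries are below \<open>1 / (q + 1)\<close>, is
  smaller than the square of the norm.
\<close>

lemma near_one_positive: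
  assumes K: "K \<in> carrier_mat q q" and u: "u \<in> carrier_vec q" "u \<noteq> 0\<^sub>v q"
    and near: "\<And>i j. i < q \<Longrightarrow> j < q \<Longrightarrow> cmod (K $$ (i, j) - (if i = j then 1 else 0)) < 1 / (real q + 1)"
  shows "0 < Re ((K *\<^sub>v u) \<bullet>c u)"
proof -
  define E where "E = (\<lambda>i j. K $$ (i, j) - (if i = j then 1 else 0))"
  define e where "e = (\<Sum>i<q. \<Sum>j<q. E i j * u $ j * cnj (u $ i))"
  have "(K *\<^sub>v u) \<bullet>c u = (\<Sum>i<q. (\<Sum>j<q. K $$ (i, j) * u $ j) * cnj (u $ i))"
    using K u by (simp add: scalar_prod_def atLeast0LessThan)
  also have "\<dots> = (\<Sum>i<q. u $ i * cnj (u $ i) + (\<Sum>j<q. E i j * u $ j * cnj (u $ i)))"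
  proof (rule sum.cong[OF refl])
    fix i assume "i \<in> {..<q}"
    hence i: "i < q" by simp
    have "(\<Sum>j<q. K $$ (i, j) * u $ j) = (\<Sum>j<q. (if i = j then u $ i else 0) + E i j * u $ j)"
      by (intro sum.cong) (auto simp: E_def algebra_simps)
    also have "\<dots> = u $ i + (\<Sum>j<q. E i j * u $ j)" using i by (simp add: sum.distrib)
    finally show "(\<Sum>j<q. K $$ (i, j) * u $ j) * cnj (u $ i) = u $ i * cnj (u $ i) + (\<Sum>j<q. E i j * u $ j * cnj (u $ i))"
      by (simp add: distrib_right sum_distrib_right)
  qed
  also have "\<dots> = of_real (nsq u) + e"
    using u by (simp add: sum.distrib e_def nsq_def complex_norm_square del: of_real_power)
  finally have eq: "(K *\<^sub>v u) \<bullet>c u = of_real (nsq u) + e" .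
  have "cmod e \<le> (\<Sum>i<q. \<Sum>j<q. 1 / (real q + 1) * cmod (u $ j) * cmod (u $ i))"
    unfolding e_def
  proof (intro order_trans[OF norm_sum] sum_mono)
    fix i j assume "i \<in> {..<q}" "j \<in> {..<q}"
    hence "cmod (E i j) \<le> 1 / (real q + 1)" using near[of i j] by (simp add: E_def)
    hence "cmod (E i j) * cmod (u $ j) * cmod (u $ i) \<le> 1 / (real q + 1) * cmod (u $ j) * cmod (u $ i)"
      by (intro mult_right_mono) auto
    thus "cmod (E i j * u $ j * cnj (u $ i)) \<le> 1 / (real q + 1) * cmod (u $ j) * cmod (u $ i)"
      by (simp add: norm_mult)
  qed
  also have "\<dots> = 1 / (real q + 1) * (\<Sum>i<q. cmod (u $ i))\<^sup>2"
    by (simp add: power2_eq_square sum_product sum_distrib_left mult_ac sum_divide_distrib)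
  also have "\<dots> \<le> 1 / (real q + 1) * (real q * nsq u)"
  proof (intro mult_left_mono)
    have "(\<Sum>i<q. cmod (u $ i))\<^sup>2 \<le> (\<Sum>i<q. (cmod (u $ i))\<^sup>2) * real (card {..<q})"
      using sum_squared_le_sum_of_squares[of "\<lambda>i. cmod (u $ i)" "{..<q}"] by (simp add: mult.commute)
    thus "(\<Sum>i<q. cmod (u $ i))\<^sup>2 \<le> real q * nsq u" using u by (simp add: nsq_def mult.commute)
  qed simp
  also have "\<dots> < nsq u"
    using nsq_pos[OF u] by (simp add: field_simps)
  finally have "cmod e < nsq u" .
  moreover have "- Re e \<le> cmod e" using abs_Re_le_cmod[of e] by linarith
  ultimately show ?thesis unfolding eq by simp
qed

text \<open>
  A vector \<open>u\<close> in the kernel of the adjoint would satisfy \<open>|Z\<^sup>* u| = t |\<epsilon>\<^sup>* Y\<^sup>* u| \<le> |Y\<^sup>* u|\<close>, against the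
  positivity of \<open>Z Z\<^sup>* - Y Y\<^sup>*\<close>.
\<close>

lemma det_perturbation_nonzero:
  fixes Y Z \<epsilon> :: "complex mat"
  assumes Y: "Y \<in> carrier_mat q p" and Z: "Z \<in> carrier_mat q q" and \<epsilon>: "\<epsilon> \<in> carrier_mat p q"
    and contr: "\<And>y. y \<in> carrier_vec p \<Longrightarrow> nsq (mat_adjoint \<epsilon> *\<^sub>v y) \<le> nsq y"
    and pos: "\<And>u. u \<in> carrier_vec q \<Longrightarrow> u \<noteq> 0\<^sub>v q \<Longrightarrow>
       0 < Re (((Z * mat_adjoint Z - Y * mat_adjoint Y) *\<^sub>v u) \<bullet>c u)"
    and t: "0 \<le> t" "t \<le> (1::real)"
  shows "det (complex_of_real t \<cdot>\<^sub>m (Y * \<epsilon>) + Z) \<noteq> 0"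
proof -
  let ?M = "complex_of_real t \<cdot>\<^sub>m (Y * \<epsilon>) + Z"
  have Y\<epsilon>: "Y * \<epsilon> \<in> carrier_mat q q" using Y \<epsilon> by simp
  have M: "?M \<in> carrier_mat q q" using Y\<epsilon> Z by simp
  have "det (mat_adjoint ?M) \<noteq> 0"
    unfolding det_nonzero_iff_inj[OF mat_adjoint_carrier[OF M]]
  proof (intro ballI impI, rule ccontr)
    fix u assume u: "u \<in> carrier_vec q" and z: "mat_adjoint ?M *\<^sub>v u = 0\<^sub>v q" and u0: "u \<noteq> 0\<^sub>v q"
    note a\<epsilon> = mat_adjoint_carrier[OF \<epsilon>] and aY = mat_adjoint_carrier[OF Y] and aZ = mat_adjoint_carrier[OF Z]
    define y where "y = mat_adjoint Y *\<^sub>v u"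
    define x where "x = mat_adjoint Z *\<^sub>v u"
    have y: "y \<in> carrier_vec p" and x: "x \<in> carrier_vec q" unfolding y_def x_def
      using mult_mat_vec_carrier[OF aY u] mult_mat_vec_carrier[OF aZ u] by auto
    have ey: "mat_adjoint \<epsilon> *\<^sub>v y \<in> carrier_vec q" by (rule mult_mat_vec_carrier[OF a\<epsilon> y])
    have aa: "mat_adjoint \<epsilon> * mat_adjoint Y \<in> carrier_mat q q" using a\<epsilon> aY by (rule mult_carrier_mat)
    have "mat_adjoint ?M = complex_of_real t \<cdot>\<^sub>m (mat_adjoint \<epsilon> * mat_adjoint Y) + mat_adjoint Z"
      using Y\<epsilon> Z by (simp add: mat_adjoint_add[of _ q q] mat_adjoint_smult mat_adjoint_mult[OF Y \<epsilon>])
    hence "mat_adjoint ?M *\<^sub>v u = (complex_of_real t \<cdot>\<^sub>m (mat_adjoint \<epsilon> * mat_adjoint Y)) *\<^sub>v u + x"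
      unfolding x_def using add_mult_distrib_mat_vec[OF _ aZ u] aa by simp
    also have "(complex_of_real t \<cdot>\<^sub>m (mat_adjoint \<epsilon> * mat_adjoint Y)) *\<^sub>v u = complex_of_real t \<cdot>\<^sub>v ((mat_adjoint \<epsilon> * mat_adjoint Y) *\<^sub>v u)"
      using aa u by (intro eq_vecI) (auto simp: scalar_prod_def sum_distrib_left mult_ac carrier_matD[OF aa] simp del: index_mult_mat)
    also have "(mat_adjoint \<epsilon> * mat_adjoint Y) *\<^sub>v u = mat_adjoint \<epsilon> *\<^sub>v y"
      unfolding y_def by (rule assoc_mult_mat_vec[OF a\<epsilon> aY u])
    finally have "complex_of_real t \<cdot>\<^sub>v (mat_adjoint \<epsilon> *\<^sub>v y) + x = 0\<^sub>v q" using z by simp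
    then obtain v where v: "v = mat_adjoint \<epsilon> *\<^sub>v y" and eq: "complex_of_real t \<cdot>\<^sub>v v + x = 0\<^sub>v q" by blast
    have vc: "v \<in> carrier_vec q" using ey v by simp
    have "x = complex_of_real (- t) \<cdot>\<^sub>v v"
    proof (rule eq_vecI)
      fix i assume "i < dim_vec (complex_of_real (- t) \<cdot>\<^sub>v v)"
      hence i: "i < q" using vc by simp
      have "(complex_of_real t \<cdot>\<^sub>v v + x) $ i = 0" using eq i by simp
      hence "x $ i = - (complex_of_real t * v $ i)"
        using i vc x by (simp add: add_eq_0_iff)
      thus "x $ i = (complex_of_real (- t) \<cdot>\<^sub>v v) $ i" using i vc by simp
    qed (use x vc in auto)
    hence "nsq x = t\<^sup>2 * nsq v" by (simp only: nsq_smult norm_of_real) simp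
    hence "nsq x = t\<^sup>2 * nsq (mat_adjoint \<epsilon> *\<^sub>v y)" unfolding v .
    also have "\<dots> \<le> 1 * nsq y"
      using contr[OF y] t nsq_nonneg by (intro mult_mono) (auto simp: power_le_one)
    finally have le: "nsq x \<le> nsq y" by simp
    have "((Z * mat_adjoint Z - Y * mat_adjoint Y) *\<^sub>v u) \<bullet>c u = ((Z * mat_adjoint Z) *\<^sub>v u - (Y * mat_adjoint Y) *\<^sub>v u) \<bullet>c u"
      using minus_mult_distrib_mat_vec[OF mult_carrier_mat[OF Z aZ] mult_carrier_mat[OF Y aY] u] by simp
    also have "\<dots> = ((Z * mat_adjoint Z) *\<^sub>v u) \<bullet>c u - ((Y * mat_adjoint Y) *\<^sub>v u) \<bullet>c u"
      by (rule cscalar_minus_left[of _ q]) (use mult_mat_vec_carrier[OF mult_carrier_mat[OF Z aZ] u] mult_mat_vec_carrier[OF mult_carrier_mat[OF Y aY] u] u in auto)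
    also have "((Z * mat_adjoint Z) *\<^sub>v u) \<bullet>c u = of_real (nsq x)"
      unfolding assoc_mult_mat_vec[OF Z aZ u] x_def[symmetric] cscalar_adjoint[OF Z x u] by (simp add: cscalar_self flip: x_def)
    also have "((Y * mat_adjoint Y) *\<^sub>v u) \<bullet>c u = of_real (nsq y)"
      unfolding assoc_mult_mat_vec[OF Y aY u] y_def[symmetric] cscalar_adjoint[OF Y y u] by (simp add: cscalar_self flip: y_def)
    finally have "Re (((Z * mat_adjoint Z - Y * mat_adjoint Y) *\<^sub>v u) \<bullet>c u) = nsq x - nsq y" by simp
    thus False using pos[OF u u0] le by simp
  qed
  thus ?thesis using det_mat_adjoint[OF M] by simp
qed

lemma one_smult_mat_eq: "(1 :: complex) \<cdot>\<^sub>m M = M"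
  by (intro eq_matI) auto

lemma zero_smult_add_mat: "M \<in> carrier_mat r c \<Longrightarrow> N \<in> carrier_mat r c \<Longrightarrow> (0 :: complex) \<cdot>\<^sub>m M + N = N"
  by (intro eq_matI) (auto simp: carrier_matD[of M r c] carrier_matD[of N r c])

lemma holomorphic_eq_off_finite:
  assumes f: "f holomorphic_on ball 0 1" and g: "g holomorphic_on ball 0 1" and Z: "finite Z"
    and eq: "\<And>z. z \<in> ball 0 1 \<Longrightarrow> z \<notin> Z \<Longrightarrow> f z = g z" and z: "z \<in> ball (0::complex) 1"
  shows "f z = g z"
proof -
  have c: "isCont f z" "isCont g z"
    using holomorphic_on_imp_continuous_on[OF f] holomorphic_on_imp_continuous_on[OF g] z
      continuous_on_eq_continuous_at[OF open_ball] by blast+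
  have "\<forall>\<^sub>F w in at z. w \<in> (ball 0 1 - (Z - {z})) - {z}"
    using z Z by (intro eventually_at_in_open) (auto intro!: open_Diff finite_imp_closed)
  hence "\<forall>\<^sub>F w in at z. f w = g w" by eventually_elim (use eq in auto)
  hence "g \<midarrow>z\<rightarrow> f z" by (rule Lim_transform_eventually[OF isContD[OF c(1)]])
  thus ?thesis using LIM_unique isContD[OF c(2)] by blast
qed

context signature_pencil
begin

lemma D_hol: "hol_mat S k k D"
proof (rule mat_funI)
  fix i j assume "i < k" "j < k"
  hence "D z $$ (i, j) = A $$ (i, j) - z * B $$ (i, j)" for z using A B by (simp add: D_def)
  thus "(\<lambda>z. D z $$ (i, j)) holomorphic_on S" by (simp add: holomorphic_intros)
qed simp

lemma det_D_hol: "(\<lambda>z. det (D z)) holomorphic_on S"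
  by (rule fun_alg.det[OF fun_alg_hol D_hol])

lemma det_D_finite: "finite {z\<in>ball 0 1. det (D z) = 0}"
  by (rule zero_count_winding_number(1)[OF det_D_hol, of 1 2]) (use D_reg in auto)

lemma w_hol:
  assumes S: "\<And>z. z \<in> S \<Longrightarrow> det (D z) \<noteq> 0"
  shows "hol_mat S q p w21" "hol_mat S q q w22"
proof -
  interpret fun_alg S "\<lambda>f. f holomorphic_on S" by (rule fun_alg_hol)
  have H: "hol_mat S q k H" unfolding H_def[abs_def]
    by (intro mat_mult[OF mat_const[OF C2]] hol_mat_inv D_hol S)
  have s: "(\<lambda>z. - (1 - z * cnj \<mu>)) holomorphic_on S" "(\<lambda>z. 1 - z * cnj \<mu>) holomorphic_on S"
    by (intro holomorphic_intros)+
  show "hol_mat S q p w21" unfolding w21_def[abs_def]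
    by (intro mat_smult s mat_mult[OF mat_mult[OF H mat_const]] mat_const) auto
  show "hol_mat S q q w22" unfolding w22_def[abs_def]
    by (intro mat_add mat_const mat_smult s mat_mult[OF mat_mult[OF H mat_const]]) auto
qed

text \<open>
  Since \<open>\<phi>22 = b w22\<close> and \<open>det w22 = det L / det D\<close>, the zeros of
  \<open>\<phi>22\<close> are those of \<open>L\<close> once the zeros of \<open>b\<close> cancel those of \<open>D\<close>, which is
  what coprimeness provides.
\<close>

lemma zero_count_\<phi>22:
  assumes obs: "\<And>z v. cmod z < 1 \<Longrightarrow> v \<in> carrier_vec k \<Longrightarrow> D z *\<^sub>v v = 0\<^sub>v k \<Longrightarrow> C2 *\<^sub>v v = 0\<^sub>v q \<Longrightarrow> v = 0\<^sub>v k"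
    and b: "hol_mat (ball 0 1) q q b" and fb: "finite {z\<in>ball 0 1. det (b z) = 0}"
    and \<psi>: "hol_mat (ball 0 1) q k \<psi>" and \<psi>D: "\<And>z. z \<in> ball 0 1 \<Longrightarrow> \<psi> z * D z = b z * C2"
    and left: "\<And>z u. z \<in> ball 0 1 \<Longrightarrow> u \<in> carrier_vec q \<Longrightarrow> mat_adjoint (b z) *\<^sub>v u = 0\<^sub>v q \<Longrightarrow>
        mat_adjoint (\<psi> z) *\<^sub>v u = 0\<^sub>v k \<Longrightarrow> u = 0\<^sub>v q"
    and \<phi>22: "hol_mat (ball 0 1) q q \<phi>22" and \<phi>22b: "\<And>z. z \<in> ball 0 1 \<Longrightarrow> det (D z) \<noteq> 0 \<Longrightarrow> \<phi>22 z = b z * w22 z"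
  shows "zero_count 1 (\<lambda>z. det (\<phi>22 z)) = int (card {i. i < k \<and> \<sigma> i = -1})"
    "finite {z\<in>ball 0 1. det (\<phi>22 z) = 0}"
proof -
  interpret fun_alg "ball 0 1" "\<lambda>f. f holomorphic_on ball (0::complex) 1" by (rule fun_alg_hol)
  note db = det[OF b] and d\<phi> = det[OF \<phi>22]
  have dL: "(\<lambda>z. det (L z)) holomorphic_on ball 0 1" using zero_count_L(2) by (rule holomorphic_on_subset) simp
  note fD = det_D_finite and fL = zero_count_L(3)
  have rel: "det (\<phi>22 z) * det (D z) = det (b z) * det (L z)" if z: "z \<in> ball 0 1" for z
  proof (rule holomorphic_eq_off_finite[OF _ _ fD _ z])
    fix z assume z: "z \<in> ball 0 1" "z \<notin> {z \<in> ball 0 1. det (D z) = 0}"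
    hence dz: "det (D z) \<noteq> 0" by auto
    show "det (\<phi>22 z) * det (D z) = det (b z) * det (L z)"
      unfolding \<phi>22b[OF z(1) dz] det_mult[OF mat_fun_carrier[OF b z(1)] w22[OF dz]] det_w22[OF dz, symmetric] by simp
  qed (intro holomorphic_on_mult d\<phi> db dL det_D_hol)+
  show f\<phi>: "finite {z\<in>ball 0 1. det (\<phi>22 z) = 0}"
  proof (rule finite_subset)
    show "{z\<in>ball 0 1. det (\<phi>22 z) = 0} \<subseteq> {z\<in>ball 0 1. det (b z) = 0} \<union> {z\<in>ball 0 1. det (L z) = 0}"
    proof safe
      fix z assume z: "z \<in> ball 0 1" "det (\<phi>22 z) = 0" "\<not> (cmod z < 1 \<and> det (L z) = 0)"
    qed (use rel in \<open>fastforce+\<close>)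
  qed (use fb fL in auto)
  have "zero_count 1 (\<lambda>z. det (\<phi>22 z)) = zero_count 1 (\<lambda>z. det (L z))"
  proof (rule zero_count_eqI[OF d\<phi> dL f\<phi> fL])
    fix z :: complex assume z: "z \<in> ball 0 1"
    have "zorder (\<lambda>z. det (\<phi>22 z) * det (D z)) z = zorder (\<lambda>z. det (b z) * det (L z)) z"
    proof (rule zorder_cong)
      have "\<forall>\<^sub>F w in at z. w \<in> ball 0 1" using z by (intro eventually_at_in_open') auto
      thus "\<forall>\<^sub>F w in at z. det (\<phi>22 w) * det (D w) = det (b w) * det (L w)" by eventually_elim (rule rel)
    qed simp
    moreover have "zorder (\<lambda>z. det (b z)) z = zorder (\<lambda>z. det (D z)) z"
      by (rule coprime_zorder_eq[OF b \<psi> D_hol C2 \<psi>D fb fD z left[OF z] obs]) (use z in auto)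
    ultimately show "zorder (\<lambda>z. det (\<phi>22 z)) z = zorder (\<lambda>z. det (L z)) z"
      using zorder_mult_disc[OF d\<phi> det_D_hol f\<phi> fD z] zorder_mult_disc[OF db dL fb fL z] by simp
  qed
  thus "zero_count 1 (\<lambda>z. det (\<phi>22 z)) = int (card {i. i < k \<and> \<sigma> i = -1})" using zero_count_L(1) by simp
qed

text \<open>
  On the unit circle, \<open>Z = b w22 \<theta>\<close> and \<open>Y = b w21\<close> satisfy \<open>Z Z\<^sup>* - Y Y\<^sup>* = I\<close>, because \<open>b\<close> and \<open>\<theta>\<close> are unitary. By
  continuity the difference stays positive in an annulus inside the circle, and there \<open>\<phi>21 \<epsilon>\<close> can be
  removed by a homotopy. The zeros are counted in a disc of radius less than one since \<open>\<epsilon>\<close> lives in the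
  open disc.
\<close>

theorem linear_fractional_zero_count:
  assumes obs: "\<And>z v. cmod z < 1 \<Longrightarrow> v \<in> carrier_vec k \<Longrightarrow> D z *\<^sub>v v = 0\<^sub>v k \<Longrightarrow> C2 *\<^sub>v v = 0\<^sub>v q \<Longrightarrow> v = 0\<^sub>v k"
    and R: "1 < R"
    and b: "hol_mat (ball 0 R) q q b" and bu: "\<And>z. cmod z = 1 \<Longrightarrow> b z * mat_adjoint (b z) = 1\<^sub>m q"
    and \<psi>: "hol_mat (ball 0 1) q k \<psi>" and \<psi>D: "\<And>z. z \<in> ball 0 1 \<Longrightarrow> \<psi> z * D z = b z * C2"
    and left: "\<And>z u. z \<in> ball 0 1 \<Longrightarrow> u \<in> carrier_vec q \<Longrightarrow> mat_adjoint (b z) *\<^sub>v u = 0\<^sub>v q \<Longrightarrow>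
        mat_adjoint (\<psi> z) *\<^sub>v u = 0\<^sub>v k \<Longrightarrow> u = 0\<^sub>v q"
    and \<phi>21: "hol_mat (ball 0 1) q p \<phi>21" and \<phi>21b: "\<And>z. z \<in> ball 0 1 \<Longrightarrow> det (D z) \<noteq> 0 \<Longrightarrow> \<phi>21 z = b z * w21 z"
    and \<phi>22: "hol_mat (ball 0 1) q q \<phi>22" and \<phi>22b: "\<And>z. z \<in> ball 0 1 \<Longrightarrow> det (D z) \<noteq> 0 \<Longrightarrow> \<phi>22 z = b z * w22 z"
    and \<theta>: "hol_mat (ball 0 R) q q \<theta>" and \<theta>u: "\<And>z. cmod z = 1 \<Longrightarrow> \<theta> z * mat_adjoint (\<theta> z) = 1\<^sub>m q"
    and \<epsilon>: "hol_mat (ball 0 1) p q \<epsilon>"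
    and contr: "\<And>z y. z \<in> ball 0 1 \<Longrightarrow> y \<in> carrier_vec p \<Longrightarrow> nsq (mat_adjoint (\<epsilon> z) *\<^sub>v y) \<le> nsq y"
  shows "finite {z\<in>ball 0 1. det (\<phi>21 z * \<epsilon> z + \<phi>22 z * \<theta> z) = 0}"
    "zero_count 1 (\<lambda>z. det (\<phi>21 z * \<epsilon> z + \<phi>22 z * \<theta> z)) =
       int (card {i. i < k \<and> \<sigma> i = -1}) + zero_count 1 (\<lambda>z. det (\<theta> z))"
proof -
  interpret fun_alg "ball 0 1" "\<lambda>f. f holomorphic_on ball (0::complex) 1" by (rule fun_alg_hol)
  have unit_det: "det M \<noteq> 0" if "M \<in> carrier_mat q q" "M * mat_adjoint M = 1\<^sub>m q" for M
    using det_mult[OF that(1) mat_adjoint_carrier[OF that(1)]] that(2) by auto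
  have b1: "hol_mat (ball 0 1) q q b" and \<theta>1: "hol_mat (ball 0 1) q q \<theta>"
    using R by (auto intro: hol_mat_sub[OF b] hol_mat_sub[OF \<theta>])
  have fb: "finite {z\<in>ball 0 1. det (b z) = 0}"
    proof (rule zero_count_winding_number(1)[OF fun_alg.det[OF fun_alg_hol b] _ R])
    fix z :: complex assume "cmod z = 1"
    thus "det (b z) \<noteq> 0" using unit_det[OF mat_fun_carrier[OF b] bu] R by simp
  qed simp
  have f\<theta>: "finite {z\<in>ball 0 1. det (\<theta> z) = 0}"
    proof (rule zero_count_winding_number(1)[OF fun_alg.det[OF fun_alg_hol \<theta>] _ R])
    fix z :: complex assume "cmod z = 1"
    thus "det (\<theta> z) \<noteq> 0" using unit_det[OF mat_fun_carrier[OF \<theta>] \<theta>u] R by simp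
  qed simp
  have z22: "zero_count 1 (\<lambda>z. det (\<phi>22 z)) = int (card {i. i < k \<and> \<sigma> i = -1})"
    "finite {z\<in>ball 0 1. det (\<phi>22 z) = 0}"
    by (rule zero_count_\<phi>22[where b = b and \<psi> = \<psi>]; fact assms b1 fb)+
  define S where "S = {z \<in> ball 0 R. det (D z) \<noteq> 0}"
  have S: "open S" "sphere 0 1 \<subseteq> S"
  proof -
    have "continuous_on (ball 0 R) (\<lambda>z. det (D z))" using det_D_hol by (rule holomorphic_on_imp_continuous_on)
    from continuous_open_preimage[OF this _ open_Compl[OF closed_singleton, of 0]]
    show "open S" by (simp add: S_def vimage_def Int_def)
    show "sphere 0 1 \<subseteq> S" using R D_reg by (auto simp: S_def)
  qed
  have SD: "z \<in> S \<Longrightarrow> det (D z) \<noteq> 0" for z by (simp add: S_def)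
  have Sb: "S \<subseteq> ball 0 R" by (auto simp: S_def)
  interpret c: fun_alg S "\<lambda>f. continuous_on S f" by (rule fun_alg_cont)
  have cb: "cont_mat S q q b" and c\<theta>: "cont_mat S q q \<theta>" using hol_mat_cont[OF b Sb] hol_mat_cont[OF \<theta> Sb] .
  have c21: "cont_mat S q p w21" and c22: "cont_mat S q q w22"
    using hol_mat_cont[OF w_hol(1), of S S] hol_mat_cont[OF w_hol(2), of S S] SD by auto
  \<comment> \<open>On \<open>S\<close>, a neighbourhood of the circle, the expressions \<open>Y\<close> and \<open>Z\<close> for \<open>\<phi>21\<close> and \<open>\<phi>22 \<theta>\<close> are continuous.\<close>
  define Z where "Z = (\<lambda>z. b z * w22 z * \<theta> z)"
  define Y where "Y = (\<lambda>z. b z * w21 z)"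
  define K where "K = (\<lambda>z. Z z * mat_adjoint (Z z) - Y z * mat_adjoint (Y z))"
  have cZ: "cont_mat S q q Z" and cY: "cont_mat S q p Y"
    unfolding Z_def Y_def by (intro c.mat_mult[OF c.mat_mult[OF cb c22] c\<theta>] c.mat_mult[OF cb c21])+
  have cK: "cont_mat S q q K" unfolding K_def
    by (intro c.mat_minus c.mat_mult[OF cZ cont_mat_adjoint[OF cZ]] c.mat_mult[OF cY cont_mat_adjoint[OF cY]])
  have K1: "K z = 1\<^sub>m q" if z: "cmod z = 1" for z
  proof -
    have zS: "z \<in> S" using S(2) z by auto
    have cc: "b z \<in> carrier_mat q q" "w22 z \<in> carrier_mat q q" "\<theta> z \<in> carrier_mat q q" "w21 z \<in> carrier_mat q p"
      using mat_fun_carrier[OF cb zS] mat_fun_carrier[OF c22 zS] mat_fun_carrier[OF c\<theta> zS] mat_fun_carrier[OF c21 zS] .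
    note sq = mult_carrier_sq mat_adjoint_carrier_sq assoc_mult_mat[of _ q q _ q _ q]
    have ww: "w21 z * mat_adjoint (w21 z) \<in> carrier_mat q q" using cc(4) by (intro mult_carrier_mat[of _ q p]) auto
    have "Z z * mat_adjoint (Z z) = b z * (w22 z * (\<theta> z * mat_adjoint (\<theta> z)) * mat_adjoint (w22 z)) * mat_adjoint (b z)"
      unfolding Z_def using cc by (simp add: mat_adjoint_mult[of _ q q _ q] sq)
    also have "\<dots> = b z * (w22 z * mat_adjoint (w22 z)) * mat_adjoint (b z)" unfolding \<theta>u[OF z] using cc by simp
    finally have Z1: "Z z * mat_adjoint (Z z) = b z * (w22 z * mat_adjoint (w22 z)) * mat_adjoint (b z)" .
    have "Y z * mat_adjoint (Y z) = b z * w21 z * (mat_adjoint (w21 z) * mat_adjoint (b z))"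
      unfolding Y_def using cc by (simp add: mat_adjoint_mult[of _ q q _ p])
    also have "\<dots> = b z * w21 z * mat_adjoint (w21 z) * mat_adjoint (b z)"
      by (rule assoc_mult_mat[symmetric, of _ q p _ q _ q]) (use cc in \<open>auto intro: mat_adjoint_carrier\<close>)
    also have "b z * w21 z * mat_adjoint (w21 z) = b z * (w21 z * mat_adjoint (w21 z))"
      by (rule assoc_mult_mat[of _ q q _ p _ q]) (use cc in \<open>auto intro: mat_adjoint_carrier\<close>)
    finally have Y1: "Y z * mat_adjoint (Y z) = b z * (w21 z * mat_adjoint (w21 z)) * mat_adjoint (b z)" .
    have "K z = (b z * (w22 z * mat_adjoint (w22 z)) - b z * (w21 z * mat_adjoint (w21 z))) * mat_adjoint (b z)"
      unfolding K_def Z1 Y1 using cc ww by (intro minus_mult_distrib_mat[symmetric, of _ q q _ _ q]) (auto simp: sq)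
    also have "b z * (w22 z * mat_adjoint (w22 z)) - b z * (w21 z * mat_adjoint (w21 z)) =
        b z * (w22 z * mat_adjoint (w22 z) - w21 z * mat_adjoint (w21 z))"
      using cc ww by (intro mult_minus_distrib_mat[symmetric, of _ q q _ q]) (auto simp: sq)
    finally show ?thesis unfolding circle_identity[OF z] using cc bu[OF z] by simp
  qed
  \<comment> \<open>The bound required by \<open>near_one_positive\<close>.\<close>
  define e where "e = 1 / (real q + 1)"
  define S' where "S' = S \<inter> (\<Inter>i\<in>{..<q}. \<Inter>j\<in>{..<q}. {z\<in>S. cmod (K z $$ (i, j) - (if i = j then 1 else 0)) < e})"
  have "open S'" unfolding S'_def
  proof (intro open_Int S(1) open_INT ballI finite_lessThan)
    fix i j assume "i \<in> {..<q}" "j \<in> {..<q}"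
    hence "continuous_on S (\<lambda>z. K z $$ (i, j))" by (intro mat_fun_entry[OF cK]) auto
    hence "continuous_on S (\<lambda>z. cmod (K z $$ (i, j) - (if i = j then 1 else 0)))" by (intro continuous_intros)
    from continuous_open_preimage[OF this S(1) open_lessThan[of e]]
    show "open {z\<in>S. cmod (K z $$ (i, j) - (if i = j then 1 else 0)) < e}" by (simp add: vimage_def Int_def)
  qed
  moreover have "sphere 0 1 \<subseteq> S'" using S(2) K1 by (auto simp: S'_def e_def)
  ultimately obtain \<rho> where \<rho>: "0 < \<rho>" "\<rho> < 1" "\<And>z. \<rho> \<le> cmod z \<Longrightarrow> cmod z \<le> 1 \<Longrightarrow> z \<in> S'"
    using open_contains_annulus by blast
  have nz: "det (complex_of_real t \<cdot>\<^sub>m (\<phi>21 z * \<epsilon> z) + \<phi>22 z * \<theta> z) \<noteq> 0"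
    if t: "0 \<le> t" "t \<le> 1" and z: "\<rho> \<le> cmod z" "cmod z < 1" for t z
  proof -
    have zb: "z \<in> ball 0 1" and zS': "z \<in> S'" using z \<rho>(3)[of z] by auto
    hence zS: "z \<in> S" and near: "\<And>i j. i < q \<Longrightarrow> j < q \<Longrightarrow> cmod (K z $$ (i, j) - (if i = j then 1 else 0)) < 1 / (real q + 1)"
      by (auto simp: S'_def e_def)
    have Zz: "\<phi>22 z * \<theta> z = Z z" and Yz: "\<phi>21 z = Y z"
      using \<phi>22b[OF zb SD[OF zS]] \<phi>21b[OF zb SD[OF zS]] by (simp_all add: Z_def Y_def)
    show ?thesis unfolding Zz Yz
    proof (rule det_perturbation_nonzero[OF mat_fun_carrier[OF cY zS] mat_fun_carrier[OF cZ zS] mat_fun_carrier[OF \<epsilon> zb] contr[OF zb] _ t])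
      fix u :: "complex vec" assume u: "u \<in> carrier_vec q" "u \<noteq> 0\<^sub>v q"
      show "0 < Re (((Z z * mat_adjoint (Z z) - Y z * mat_adjoint (Y z)) *\<^sub>v u) \<bullet>c u)"
        using near_one_positive[OF mat_fun_carrier[OF cK zS] u near] by (simp add: K_def)
    qed
  qed
  have hG: "hol_mat (ball 0 1) q q (\<lambda>z. \<phi>21 z * \<epsilon> z + \<phi>22 z * \<theta> z)"
    and h22: "hol_mat (ball 0 1) q q (\<lambda>z. \<phi>22 z * \<theta> z)" and h21: "hol_mat (ball 0 1) q q (\<lambda>z. \<phi>21 z * \<epsilon> z)"
    by (intro mat_add mat_mult[OF \<phi>21 \<epsilon>] mat_mult[OF \<phi>22 \<theta>1])+
  have nzG: "det (\<phi>21 z * \<epsilon> z + \<phi>22 z * \<theta> z) \<noteq> 0" if z: "\<rho> \<le> cmod z" "cmod z < 1" for z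
    using nz[of 1, OF _ _ z] by (simp add: one_smult_mat_eq)
  have nz22: "det (\<phi>22 z * \<theta> z) \<noteq> 0" if z: "\<rho> \<le> cmod z" "cmod z < 1" for z
  proof -
    have zb: "z \<in> ball 0 1" using z by simp
    have "complex_of_real 0 \<cdot>\<^sub>m (\<phi>21 z * \<epsilon> z) + \<phi>22 z * \<theta> z = \<phi>22 z * \<theta> z"
      by (simp only: of_real_0 zero_smult_add_mat[OF mat_fun_carrier[OF h21 zb] mat_fun_carrier[OF h22 zb]])
    thus ?thesis using nz[of 0, OF _ _ z] by (simp del: of_real_0)
  qed
  show "finite {z\<in>ball 0 1. det (\<phi>21 z * \<epsilon> z + \<phi>22 z * \<theta> z) = 0}"
    using zero_count_shrink(2)[of \<rho> "\<lambda>z. det (\<phi>21 z * \<epsilon> z + \<phi>22 z * \<theta> z)"]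
      zero_count_winding_number(1)[OF det[OF hG], of \<rho>] \<rho> nzG by simp
  have "zero_count \<rho> (\<lambda>z. det (\<phi>22 z * \<theta> z)) = zero_count \<rho> (\<lambda>z. det (\<phi>21 z * \<epsilon> z + \<phi>22 z * \<theta> z))"
  proof (rule zero_count_homotopy[OF det[OF h22] det[OF hG] \<rho>(1,2),
      where H = "\<lambda>t z. det (complex_of_real t \<cdot>\<^sub>m (\<phi>21 z * \<epsilon> z) + \<phi>22 z * \<theta> z)"])
    let ?X = "{0..1::real} \<times> sphere (0::complex) \<rho>"
    interpret x: fun_alg ?X "\<lambda>f. continuous_on ?X f" by (rule fun_alg_cont)
    have snd: "cont_mat ?X q q (\<lambda>x. F (snd x))" if F: "hol_mat (ball 0 1) q q F" for F
    proof (rule mat_funI)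
      fix i j assume ij: "i < q" "j < q"
      have "continuous_on (ball 0 1) (\<lambda>z. F z $$ (i, j))"
        using mat_fun_entry[OF F ij] by (rule holomorphic_on_imp_continuous_on)
      thus "continuous_on ?X (\<lambda>x. F (snd x) $$ (i, j))"
        by (rule continuous_on_compose2) (use \<rho>(2) in \<open>auto intro: continuous_intros\<close>)
    qed (use mat_fun_carrier[OF F] \<rho>(2) in auto)
    have "continuous_on ?X (\<lambda>x. complex_of_real (fst x))" by (intro continuous_intros)
    hence "cont_mat ?X q q (\<lambda>x. complex_of_real (fst x) \<cdot>\<^sub>m (\<phi>21 (snd x) * \<epsilon> (snd x)) + \<phi>22 (snd x) * \<theta> (snd x))"
      by (intro x.mat_add x.mat_smult snd[OF h21] snd[OF h22])
    thus "continuous_on ?X (\<lambda>x. det (complex_of_real (fst x) \<cdot>\<^sub>m (\<phi>21 (snd x) * \<epsilon> (snd x)) + \<phi>22 (snd x) * \<theta> (snd x)))"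
      by (rule x.det)
  next
    fix z :: complex assume "cmod z = \<rho>"
    hence zb: "z \<in> ball 0 1" using \<rho> by simp
    have "complex_of_real 0 \<cdot>\<^sub>m (\<phi>21 z * \<epsilon> z) + \<phi>22 z * \<theta> z = \<phi>22 z * \<theta> z"
      by (simp only: of_real_0 zero_smult_add_mat[OF mat_fun_carrier[OF h21 zb] mat_fun_carrier[OF h22 zb]])
    thus "det (complex_of_real 0 \<cdot>\<^sub>m (\<phi>21 z * \<epsilon> z) + \<phi>22 z * \<theta> z) = det (\<phi>22 z * \<theta> z)" by (rule arg_cong)
  qed (use nz \<rho> in \<open>auto simp: one_smult_mat_eq\<close>)
  hence "zero_count 1 (\<lambda>z. det (\<phi>21 z * \<epsilon> z + \<phi>22 z * \<theta> z)) = zero_count 1 (\<lambda>z. det (\<phi>22 z * \<theta> z))"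
    using zero_count_shrink(1)[of \<rho> "\<lambda>z. det (\<phi>21 z * \<epsilon> z + \<phi>22 z * \<theta> z)"]
      zero_count_shrink(1)[of \<rho> "\<lambda>z. det (\<phi>22 z * \<theta> z)"] \<rho> nzG nz22 by simp
  also have "zero_count 1 (\<lambda>z. det (\<phi>22 z * \<theta> z)) = zero_count 1 (\<lambda>z. det (\<phi>22 z) * det (\<theta> z))"
  proof -
    have eq: "det (\<phi>22 z * \<theta> z) = det (\<phi>22 z) * det (\<theta> z)" if "z \<in> ball 0 1" for z
      using det_mult[OF mat_fun_carrier[OF \<phi>22 that] mat_fun_carrier[OF \<theta>1 that]] .
    show ?thesis by (rule zero_count_cong) (rule eq)
  qed
  also have "\<dots> = zero_count 1 (\<lambda>z. det (\<phi>22 z)) + zero_count 1 (\<lambda>z. det (\<theta> z))"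
    by (rule zero_count_mult(2)[OF det[OF \<phi>22] det[OF \<theta>1] z22(2) f\<theta>])
  finally show "zero_count 1 (\<lambda>z. det (\<phi>21 z * \<epsilon> z + \<phi>22 z * \<theta> z)) =
       int (card {i. i < k \<and> \<sigma> i = -1}) + zero_count 1 (\<lambda>z. det (\<theta> z))"
    unfolding z22(1) .
qed

end

section \<open>Reduction to the range of \<open>X\<close>\<close>

lemma mat_eq_vecI:
  fixes A B :: "complex mat"
  assumes A: "A \<in> carrier_mat n m" and B: "B \<in> carrier_mat n m"
    and eq: "\<And>v. v \<in> carrier_vec m \<Longrightarrow> A *\<^sub>v v = B *\<^sub>v v"
  shows "A = B"
proof (rule mat_col_eqI)
  fix i assume "i < dim_col B"
  hence "i < m" using B by simp
  thus "col A i = col B i" using eq[of "unit_vec m i"] mat_mult_unit_vec[OF A] mat_mult_unit_vec[OF B] by simp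
qed (use A B in auto)

lemma mult_mat_zero_vec: "A \<in> carrier_mat r c \<Longrightarrow> A *\<^sub>v 0\<^sub>v c = (0\<^sub>v r :: complex vec)"
  by (intro eq_vecI) auto

text \<open>
  A factorization \<open>P = Q J Q\<^sup>*\<close> with \<open>Q\<close> injective and \<open>X P X = X\<close>, \<open>P X P = P\<close> yield coordinates on the range of \<open>X\<close>:
  the columns of \<open>V = X Q\<close> form a basis, \<open>T = J Q\<^sup>*\<close> takes coordinates, \<open>P\<close> becomes \<open>J\<close> and \<open>X = V J V\<^sup>*\<close>. The
  matrices \<open>A\<close> and \<open>B\<close> below describe \<open>M\<close> and \<open>N\<close> on the range.
\<close>

locale invariant_range =
  fixes n k :: nat and M N P X Q L :: "complex mat" and \<sigma> :: "nat \<Rightarrow> complex"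
  assumes M: "M \<in> carrier_mat n n" and N: "N \<in> carrier_mat n n"
    and P: "P \<in> carrier_mat n n" "mat_adjoint P = P" and X: "X \<in> carrier_mat n n" "mat_adjoint X = X"
    and XPX: "X * P * X = X" and PXP: "P * X * P = P"
    and invM: "\<And>v. v \<in> mat_range X \<Longrightarrow> M *\<^sub>v v \<in> mat_range X"
    and invN: "\<And>v. v \<in> mat_range X \<Longrightarrow> N *\<^sub>v v \<in> mat_range X"
    and Q: "Q \<in> carrier_mat n k" and L: "L \<in> carrier_mat k n" and LQ: "L * Q = 1\<^sub>m k"
    and \<sigma>: "\<And>i. i < k \<Longrightarrow> \<sigma> i = 1 \<or> \<sigma> i = -1"
    and PQ: "P = Q * dmat k \<sigma> * mat_adjoint Q"
begin

abbreviation "J \<equiv> dmat k \<sigma>"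
definition V where "V = X * Q"
definition T where "T = J * mat_adjoint Q"
definition A where "A = T * M * V"
definition B where "B = T * N * V"

lemma V [simp]: "V \<in> carrier_mat n k" using X(1) Q by (simp add: V_def)
lemma Qa [simp]: "mat_adjoint Q \<in> carrier_mat k n" using Q by simp
lemma Va [simp]: "mat_adjoint V \<in> carrier_mat k n" by (rule mat_adjoint_carrier) simp
lemma La [simp]: "mat_adjoint L \<in> carrier_mat n k" using L by simp
lemma T [simp]: "T \<in> carrier_mat k n" unfolding T_def by (rule mult_carrier_mat[OF dmat_carrier Qa])

lemma JJ: "J * J = 1\<^sub>m k"
  unfolding dmat_mult_dmat by (rule dmat_one) (use \<sigma> in fastforce)

lemma Ja: "mat_adjoint J = J" by (rule dmat_adjoint) (use \<sigma> in fastforce)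

lemma LP: "L * P = T"
proof -
  have "L * P = L * (Q * (J * mat_adjoint Q))"
    unfolding PQ using assoc_mult_mat[OF Q dmat_carrier Qa] by simp
  also have "\<dots> = L * Q * (J * mat_adjoint Q)"
    by (rule assoc_mult_mat[symmetric, OF L Q]) (rule T[unfolded T_def])
  finally show ?thesis unfolding LQ T_def[symmetric] by (simp add: left_mult_one_mat[OF T])
qed

text \<open>The identity \<open>P X P = P\<close> reads \<open>Q J (Q\<^sup>* X Q) J Q\<^sup>* = Q J Q\<^sup>*\<close>, and \<open>Q\<close> can be cancelled by means of \<open>L\<close>.\<close>

lemma TV: "T * V = 1\<^sub>m k" and QV: "mat_adjoint Q * V = J"
proof -
  have LaP: "P * mat_adjoint L = Q * J"
  proof -
    have "P * mat_adjoint L = mat_adjoint (L * P)" using mat_adjoint_mult[OF L P(1)] P(2) by simp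
    thus ?thesis unfolding LP T_def using mat_adjoint_mult[OF dmat_carrier Qa] Ja by simp
  qed
  have QL: "mat_adjoint Q * mat_adjoint L = 1\<^sub>m k"
    using mat_adjoint_mult[OF L Q] LQ by simp
  have XQJ: "X * (Q * J) \<in> carrier_mat n k" using X(1) Q by (auto intro!: mult_carrier_mat)
  have "T * X * (Q * J) = L * P * X * (P * mat_adjoint L)" unfolding LP LaP ..
  also have "\<dots> = L * (P * X) * (P * mat_adjoint L)" unfolding assoc_mult_mat[OF L P(1) X(1)] ..
  also have "\<dots> = L * (P * X * (P * mat_adjoint L))"
    by (rule assoc_mult_mat[OF L mult_carrier_mat[OF P(1) X(1)] mult_carrier_mat[OF P(1) La]])
  also have "P * X * (P * mat_adjoint L) = P * X * P * mat_adjoint L"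
    by (rule assoc_mult_mat[symmetric, OF mult_carrier_mat[OF P(1) X(1)] P(1) La])
  also have "L * (P * X * P * mat_adjoint L) = L * P * mat_adjoint L"
    unfolding PXP by (rule assoc_mult_mat[symmetric, OF L P(1) La])
  also have "\<dots> = J * (mat_adjoint Q * mat_adjoint L)"
    unfolding LP T_def by (rule assoc_mult_mat[OF dmat_carrier Qa La])
  finally have 1: "T * X * (Q * J) = J" unfolding QL by simp
  have TX: "T * X \<in> carrier_mat k n" using T X(1) by (rule mult_carrier_mat)
  have "T * X * (Q * J) = T * X * Q * J" by (rule assoc_mult_mat[symmetric, OF TX Q dmat_carrier])
  also have "T * X * Q = T * V" unfolding V_def by (rule assoc_mult_mat[OF T X(1) Q])
  finally have 2: "T * V * J = J" unfolding 1 by (rule sym)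
  have TVc: "T * V \<in> carrier_mat k k" by (rule mult_carrier_mat[OF T V])
  have "T * V = T * V * (J * J)" unfolding JJ by (rule right_mult_one_mat[OF TVc, symmetric])
  also have "\<dots> = T * V * J * J" by (rule assoc_mult_mat[symmetric, OF TVc dmat_carrier dmat_carrier])
  finally show TV: "T * V = 1\<^sub>m k" unfolding 2 JJ .
  have QVc: "mat_adjoint Q * V \<in> carrier_mat k k" by (rule mult_carrier_mat[OF Qa V])
  have "mat_adjoint Q * V = J * J * (mat_adjoint Q * V)" unfolding JJ by (rule left_mult_one_mat[OF QVc, symmetric])
  also have "\<dots> = J * (J * (mat_adjoint Q * V))" by (rule assoc_mult_mat[OF dmat_carrier dmat_carrier QVc])
  also have "J * (mat_adjoint Q * V) = T * V" unfolding T_def by (rule assoc_mult_mat[symmetric, OF dmat_carrier Qa V])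
  finally show "mat_adjoint Q * V = J" unfolding TV by simp
qed

lemma Va_eq: "mat_adjoint V = mat_adjoint Q * X"
  unfolding V_def using mat_adjoint_mult[OF X(1) Q] X(2) by simp

lemma VaQ: "mat_adjoint V * Q = J"
proof -
  have "mat_adjoint V * Q = mat_adjoint (mat_adjoint Q * V)" using mat_adjoint_mult[OF Qa V] by simp
  thus ?thesis unfolding QV Ja .
qed

lemma PV: "P * V = Q"
proof -
  have QJ: "Q * J \<in> carrier_mat n k" using Q by (rule mult_carrier_mat) simp
  have "P * V = Q * J * (mat_adjoint Q * V)"
    unfolding PQ by (rule assoc_mult_mat[OF QJ Qa V])
  also have "\<dots> = Q * (J * J)" unfolding QV by (rule assoc_mult_mat[OF Q dmat_carrier dmat_carrier])
  finally show ?thesis unfolding JJ using Q by simp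
qed

lemma X_eq: "X = V * J * mat_adjoint V" and VTX: "V * T * X = X"
proof -
  have QJ: "Q * J \<in> carrier_mat n k" using Q by (rule mult_carrier_mat) simp
  have VJ: "V * J \<in> carrier_mat n k" using V by (rule mult_carrier_mat) simp
  have "X = X * (Q * J * mat_adjoint Q) * X" using XPX PQ by simp
  also have "X * (Q * J * mat_adjoint Q) = X * (Q * J) * mat_adjoint Q"
    by (rule assoc_mult_mat[symmetric, OF X(1) QJ Qa])
  also have "X * (Q * J) = V * J" unfolding V_def by (rule assoc_mult_mat[symmetric, OF X(1) Q dmat_carrier])
  also have "V * J * mat_adjoint Q * X = V * J * (mat_adjoint Q * X)" by (rule assoc_mult_mat[OF VJ Qa X(1)])
  finally show *: "X = V * J * mat_adjoint V" unfolding Va_eq .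
  have "V * T = V * J * mat_adjoint Q" unfolding T_def by (rule assoc_mult_mat[symmetric, OF V dmat_carrier Qa])
  hence "V * T * X = V * J * (mat_adjoint Q * X)" using assoc_mult_mat[OF VJ Qa X(1)] by simp
  thus "V * T * X = X" using * by (simp add: Va_eq)
qed

lemma V_range: "a \<in> carrier_vec k \<Longrightarrow> V *\<^sub>v a \<in> mat_range X"
  unfolding V_def mat_range_def using assoc_mult_mat_vec[OF X(1) Q] X(1) Q by auto

lemma VT_range: "x \<in> mat_range X \<Longrightarrow> V *\<^sub>v (T *\<^sub>v x) = x"
proof -
  assume "x \<in> mat_range X"
  then obtain y where y: "y \<in> carrier_vec n" "x = X *\<^sub>v y" using X(1) by (auto simp: mat_range_def)
  have x: "x \<in> carrier_vec n" using X(1) y by auto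
  have VT: "V * T \<in> carrier_mat n n" by (rule mult_carrier_mat[OF V T])
  have "V *\<^sub>v (T *\<^sub>v x) = (V * T) *\<^sub>v x" by (rule assoc_mult_mat_vec[symmetric, OF V T x])
  also have "\<dots> = (V * T * X) *\<^sub>v y" unfolding y(2) by (rule assoc_mult_mat_vec[symmetric, OF VT X(1) y(1)])
  finally show ?thesis unfolding VTX y(2) .
qed

lemma compress:
  assumes Y: "Y \<in> carrier_mat n n" and inv: "\<And>v. v \<in> mat_range X \<Longrightarrow> Y *\<^sub>v v \<in> mat_range X"
  shows "T * Y * V \<in> carrier_mat k k" "V * (T * Y * V) = Y * V"
proof -
  have TM: "T * Y \<in> carrier_mat k n" using T Y by (rule mult_carrier_mat)
  show c: "T * Y * V \<in> carrier_mat k k" by (rule mult_carrier_mat[OF TM V])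
  have YV: "Y * V \<in> carrier_mat n k" using Y V by (rule mult_carrier_mat)
  show "V * (T * Y * V) = Y * V"
  proof (rule mat_eq_vecI[OF mult_carrier_mat[OF V c] YV])
    fix a :: "complex vec" assume a: "a \<in> carrier_vec k"
    have Va: "V *\<^sub>v a \<in> carrier_vec n" by (rule mult_mat_vec_carrier[OF V a])
    have "V * (T * Y * V) *\<^sub>v a = V *\<^sub>v ((T * Y * V) *\<^sub>v a)" by (rule assoc_mult_mat_vec[OF V c a])
    also have "(T * Y * V) *\<^sub>v a = (T * Y) *\<^sub>v (V *\<^sub>v a)" by (rule assoc_mult_mat_vec[OF TM V a])
    also have "\<dots> = T *\<^sub>v (Y *\<^sub>v (V *\<^sub>v a))" by (rule assoc_mult_mat_vec[OF T Y Va])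
    also have "V *\<^sub>v \<dots> = Y *\<^sub>v (V *\<^sub>v a)" by (rule VT_range[OF inv[OF V_range[OF a]]])
    finally show "V * (T * Y * V) *\<^sub>v a = Y * V *\<^sub>v a" unfolding assoc_mult_mat_vec[OF Y V a] .
  qed
qed

lemma A [simp]: "A \<in> carrier_mat k k" and VA: "V * A = M * V"
  unfolding A_def using compress[OF M] invM by blast+

lemma B [simp]: "B \<in> carrier_mat k k" and VB: "V * B = N * V"
  unfolding B_def using compress[OF N] invN by blast+

lemma jform_V:
  assumes a: "a \<in> carrier_vec k" and b: "b \<in> carrier_vec k"
  shows "(P *\<^sub>v (V *\<^sub>v a)) \<bullet>c (V *\<^sub>v b) = jform k \<sigma> a b"
proof -
  have Qa: "Q *\<^sub>v a \<in> carrier_vec n" by (rule mult_mat_vec_carrier[OF Q a])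
  have "P *\<^sub>v (V *\<^sub>v a) = Q *\<^sub>v a" using assoc_mult_mat_vec[OF P(1) V a] PV by simp
  hence "(P *\<^sub>v (V *\<^sub>v a)) \<bullet>c (V *\<^sub>v b) = (mat_adjoint V *\<^sub>v (Q *\<^sub>v a)) \<bullet>c b"
    using cscalar_adjoint'[OF V Qa b] by simp
  also have "mat_adjoint V *\<^sub>v (Q *\<^sub>v a) = J *\<^sub>v a"
    using assoc_mult_mat_vec[OF Va Q a] VaQ by simp
  also have "(J *\<^sub>v a) \<bullet>c b = jform k \<sigma> a b"
  proof -
    have "(J *\<^sub>v a) $ i = \<sigma> i * a $ i" if i: "i < k" for i
    proof -
      have "(J *\<^sub>v a) $ i = (\<Sum>j<k. (if i = j then \<sigma> i else 0) * a $ j)"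
        using a i by (simp add: scalar_prod_def atLeast0LessThan)
      also have "\<dots> = (\<Sum>j<k. if i = j then \<sigma> i * a $ i else 0)" by (intro sum.cong) auto
      finally show ?thesis using i by simp
    qed
    thus ?thesis using a b by (simp add: jform_def scalar_prod_def atLeast0LessThan del: index_mult_mat_vec)
  qed
  finally show ?thesis .
qed

lemma jform_compress:
  assumes Y: "Y \<in> carrier_mat n n" "V * Z = Y * V" "Z \<in> carrier_mat k k"
    and g: "g \<in> carrier_vec k" and h: "h \<in> carrier_vec k"
  shows "jform k \<sigma> (Z *\<^sub>v g) (Z *\<^sub>v h) = ((mat_adjoint Y * P * Y) *\<^sub>v (V *\<^sub>v g)) \<bullet>c (V *\<^sub>v h)"
proof -
  have Zg: "Z *\<^sub>v g \<in> carrier_vec k" "Z *\<^sub>v h \<in> carrier_vec k"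
    using mult_mat_vec_carrier[OF Y(3) g] mult_mat_vec_carrier[OF Y(3) h] .
  have Vg: "V *\<^sub>v g \<in> carrier_vec n" "V *\<^sub>v h \<in> carrier_vec n"
    using mult_mat_vec_carrier[OF V g] mult_mat_vec_carrier[OF V h] .
  have e: "V *\<^sub>v (Z *\<^sub>v x) = Y *\<^sub>v (V *\<^sub>v x)" if "x \<in> carrier_vec k" for x
    using assoc_mult_mat_vec[OF V Y(3) that] assoc_mult_mat_vec[OF Y(1) V that] Y(2) by simp
  have YVg: "Y *\<^sub>v (V *\<^sub>v g) \<in> carrier_vec n" by (rule mult_mat_vec_carrier[OF Y(1) Vg(1)])
  have PYVg: "P *\<^sub>v (Y *\<^sub>v (V *\<^sub>v g)) \<in> carrier_vec n" by (rule mult_mat_vec_carrier[OF P(1) YVg])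
  note Ya = mat_adjoint_carrier[OF Y(1)]
  have "jform k \<sigma> (Z *\<^sub>v g) (Z *\<^sub>v h) = (P *\<^sub>v (Y *\<^sub>v (V *\<^sub>v g))) \<bullet>c (Y *\<^sub>v (V *\<^sub>v h))"
    unfolding jform_V[OF Zg, symmetric] e[OF g] e[OF h] ..
  also have "\<dots> = (mat_adjoint Y *\<^sub>v (P *\<^sub>v (Y *\<^sub>v (V *\<^sub>v g)))) \<bullet>c (V *\<^sub>v h)"
    by (rule cscalar_adjoint'[OF Y(1) PYVg Vg(2)])
  also have "mat_adjoint Y *\<^sub>v (P *\<^sub>v (Y *\<^sub>v (V *\<^sub>v g))) = (mat_adjoint Y * P * Y) *\<^sub>v (V *\<^sub>v g)"
    using assoc_mult_mat_vec[OF mult_carrier_mat[OF Ya P(1)] Y(1) Vg(1)] assoc_mult_mat_vec[OF Ya P(1) YVg] by simp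
  finally show ?thesis .
qed

lemma pencil_V: "(M - z \<cdot>\<^sub>m N) * V = V * (A - z \<cdot>\<^sub>m B)"
proof -
  have zN: "z \<cdot>\<^sub>m N \<in> carrier_mat n n" and zB: "z \<cdot>\<^sub>m B \<in> carrier_mat k k" using N by auto
  have "(M - z \<cdot>\<^sub>m N) * V = M * V - (z \<cdot>\<^sub>m N) * V" by (rule minus_mult_distrib_mat[OF M zN V])
  also have "(z \<cdot>\<^sub>m N) * V = z \<cdot>\<^sub>m (V * B)" unfolding VB by (rule mult_smult_assoc_mat[OF N V])
  also have "\<dots> = V * (z \<cdot>\<^sub>m B)" by (rule mult_smult_distrib[OF V B, symmetric])
  also have "M * V = V * A" by (rule VA[symmetric])
  also have "V * A - V * (z \<cdot>\<^sub>m B) = V * (A - z \<cdot>\<^sub>m B)" by (rule mult_minus_distrib_mat[symmetric, OF V A zB])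
  finally show ?thesis .
qed

lemma V_inj:
  assumes a: "a \<in> carrier_vec k" "V *\<^sub>v a = 0\<^sub>v n" shows "a = 0\<^sub>v k"
proof -
  have "a = (T * V) *\<^sub>v a" unfolding TV using a by simp
  also have "\<dots> = T *\<^sub>v (V *\<^sub>v a)" by (rule assoc_mult_mat_vec[OF T V a(1)])
  also have "\<dots> = 0\<^sub>v k" unfolding a(2) by (rule mult_mat_zero_vec[OF T])
  finally show ?thesis .
qed

lemma pencil_carrier: "M - z \<cdot>\<^sub>m N \<in> carrier_mat n n" "A - z \<cdot>\<^sub>m B \<in> carrier_mat k k"
  using N by (auto intro!: minus_carrier_mat)

lemma pencil_V_vec: "a \<in> carrier_vec k \<Longrightarrow> (M - z \<cdot>\<^sub>m N) *\<^sub>v (V *\<^sub>v a) = V *\<^sub>v ((A - z \<cdot>\<^sub>m B) *\<^sub>v a)"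
  using assoc_mult_mat_vec[OF pencil_carrier(1) V] assoc_mult_mat_vec[OF V pencil_carrier(2)] pencil_V by metis

lemma det_compress:
  assumes d: "det (M - z \<cdot>\<^sub>m N) \<noteq> 0" shows "det (A - z \<cdot>\<^sub>m B) \<noteq> 0"
  unfolding det_nonzero_iff_inj[OF pencil_carrier(2)]
proof (intro ballI impI)
  fix a assume a: "a \<in> carrier_vec k" "(A - z \<cdot>\<^sub>m B) *\<^sub>v a = 0\<^sub>v k"
  have "(M - z \<cdot>\<^sub>m N) *\<^sub>v (V *\<^sub>v a) = V *\<^sub>v 0\<^sub>v k" unfolding pencil_V_vec[OF a(1)] a(2) ..
  also have "\<dots> = 0\<^sub>v n" by (rule mult_mat_zero_vec[OF V])
  finally have "V *\<^sub>v a = 0\<^sub>v n"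
    using d det_nonzero_iff_inj[OF pencil_carrier(1)] mult_mat_vec_carrier[OF V a(1)] by blast
  thus "a = 0\<^sub>v k" by (rule V_inj[OF a(1)])
qed

lemma inv_compress:
  assumes d: "det (M - z \<cdot>\<^sub>m N) \<noteq> 0" and C: "C \<in> carrier_mat r n"
  shows "C * mat_inv (M - z \<cdot>\<^sub>m N) * V = C * V * mat_inv (A - z \<cdot>\<^sub>m B)"
proof -
  let ?E = "M - z \<cdot>\<^sub>m N" and ?D = "A - z \<cdot>\<^sub>m B"
  note E = mat_inv_props[OF pencil_carrier(1) d] and D = mat_inv_props[OF pencil_carrier(2) det_compress[OF d]]
  have VD: "V * mat_inv ?D \<in> carrier_mat n k" by (rule mult_carrier_mat[OF V D(1)])
  have "mat_inv ?E * V = mat_inv ?E * (V * (?D * mat_inv ?D))" unfolding D(2) right_mult_one_mat[OF V] ..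
  also have "V * (?D * mat_inv ?D) = V * ?D * mat_inv ?D" by (rule assoc_mult_mat[symmetric, OF V pencil_carrier(2) D(1)])
  also have "\<dots> = ?E * V * mat_inv ?D" unfolding pencil_V ..
  also have "\<dots> = ?E * (V * mat_inv ?D)" by (rule assoc_mult_mat[OF pencil_carrier(1) V D(1)])
  also have "mat_inv ?E * (?E * (V * mat_inv ?D)) = mat_inv ?E * ?E * (V * mat_inv ?D)"
    by (rule assoc_mult_mat[symmetric, OF E(1) pencil_carrier(1) VD])
  also have "\<dots> = V * mat_inv ?D" unfolding E(3) by (rule left_mult_one_mat[OF VD])
  finally have "mat_inv ?E * V = V * mat_inv ?D" .
  thus ?thesis using assoc_mult_mat[OF C E(1) V] assoc_mult_mat[OF C V D(1)] by simp
qed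

text \<open>The factors of \<open>X = V J V\<^sup>*\<close> restrict the resolvents on either side of \<open>X\<close> to its range.\<close>

lemma transfer_compress:
  assumes d: "det (M - z \<cdot>\<^sub>m N) \<noteq> 0" "det (M - \<mu> \<cdot>\<^sub>m N) \<noteq> 0"
    and C: "C \<in> carrier_mat r n" and C': "C' \<in> carrier_mat s n"
  shows "C * mat_inv (M - z \<cdot>\<^sub>m N) * X * mat_adjoint (C' * mat_inv (M - \<mu> \<cdot>\<^sub>m N)) =
     C * V * mat_inv (A - z \<cdot>\<^sub>m B) * J * mat_adjoint (C' * V * mat_inv (A - \<mu> \<cdot>\<^sub>m B))"
proof -
  define F where "F = C * mat_inv (M - z \<cdot>\<^sub>m N)"
  define F' where "F' = C' * mat_inv (M - \<mu> \<cdot>\<^sub>m N)"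
  have F: "F \<in> carrier_mat r n" and F': "F' \<in> carrier_mat s n" unfolding F_def F'_def
    using mult_carrier_mat[OF C mat_inv_props(1)[OF pencil_carrier(1) d(1)]]
      mult_carrier_mat[OF C' mat_inv_props(1)[OF pencil_carrier(1) d(2)]] .
  note F'a = mat_adjoint_carrier[OF F']
  have VJ: "V * J \<in> carrier_mat n k" using V by (rule mult_carrier_mat) simp
  have FVJ: "F * (V * J) \<in> carrier_mat r k" by (rule mult_carrier_mat[OF F VJ])
  have "F * X * mat_adjoint F' = F * (V * J) * mat_adjoint V * mat_adjoint F'"
    by (subst X_eq) (use assoc_mult_mat[OF F VJ Va] in simp)
  also have "\<dots> = F * (V * J) * (mat_adjoint V * mat_adjoint F')" by (rule assoc_mult_mat[OF FVJ Va F'a])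
  also have "mat_adjoint V * mat_adjoint F' = mat_adjoint (F' * V)" by (rule mat_adjoint_mult[OF F' V, symmetric])
  also have "F * (V * J) = F * V * J" by (rule assoc_mult_mat[symmetric, OF F V dmat_carrier])
  finally show ?thesis unfolding F_def F'_def inv_compress[OF d(1) C] inv_compress[OF d(2) C'] .
qed

end

text \<open>
  For \<open>C\<close> and \<open>C'\<close> equal to the upper or the lower row of the matrix \<open>C\<close> of the theorem, these are the blocks of
  \<open>I - W\<close>, up to the signs of the second block column.
\<close>

definition transfer_block :: "complex mat \<Rightarrow> complex mat \<Rightarrow> complex mat \<Rightarrow> complex mat \<Rightarrow> complex mat \<Rightarrow>
    complex \<Rightarrow> complex \<Rightarrow> complex mat" where
  "transfer_block C C' M N X \<mu> z =
     (1 - z * cnj \<mu>) \<cdot>\<^sub>m (C * mat_inv (M - z \<cdot>\<^sub>m N) * X * mat_adjoint (C' * mat_inv (M - \<mu> \<cdot>\<^sub>m N)))"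

text \<open>
  The functions \<open>\<psi> Q\<close>, \<open>\<phi>21\<close>, \<open>\<phi>22\<close> are related to the pencil restricted to the range of \<open>X\<close> as in
  \<open>linear_fractional_zero_count\<close>. Coprimeness survives the passage from \<open>\<psi>\<close> to \<open>\<psi> Q\<close> because
  \<open>\<psi> = \<psi> Q J V\<^sup>*\<close>, and observability survives because \<open>V\<close> is injective.
\<close>

theorem pencil_zero_count:
  fixes M N P X C1 C2 :: "complex mat"
  assumes M: "M \<in> carrier_mat n n" and N: "N \<in> carrier_mat n n"
    and C1: "C1 \<in> carrier_mat p n" and C2: "C2 \<in> carrier_mat q n"
    and P: "hermitian_mat n P" and X: "hermitian_mat n X"
    and XPX: "X * P * X = X" and PXP: "P * X * P = P"
    and invM: "\<And>v. v \<in> mat_range X \<Longrightarrow> M *\<^sub>v v \<in> mat_range X"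
    and invN: "\<And>v. v \<in> mat_range X \<Longrightarrow> N *\<^sub>v v \<in> mat_range X"
    and lyapunov: "mat_adjoint M * P * M - mat_adjoint N * P * N = mat_adjoint C1 * C1 - mat_adjoint C2 * C2"
    and \<mu>: "cmod \<mu> = 1" and regular: "\<And>z. cmod z = 1 \<Longrightarrow> det (M - z \<cdot>\<^sub>m N) \<noteq> 0"
    and obs: "\<And>z v. cmod z < 1 \<Longrightarrow> v \<in> carrier_vec n \<Longrightarrow> (M - z \<cdot>\<^sub>m N) *\<^sub>v v = 0\<^sub>v n \<Longrightarrow>
        C2 *\<^sub>v v = 0\<^sub>v q \<Longrightarrow> v = 0\<^sub>v n"
    and R: "1 < R"
    and b: "hol_mat (ball 0 R) q q b" and bu: "\<And>z. cmod z = 1 \<Longrightarrow> b z * mat_adjoint (b z) = 1\<^sub>m q"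
    and \<psi>: "hol_mat (ball 0 1) q n \<psi>"
    and \<psi>b: "\<And>z. z \<in> ball 0 1 \<Longrightarrow> det (M - z \<cdot>\<^sub>m N) \<noteq> 0 \<Longrightarrow> \<psi> z = b z * (C2 * mat_inv (M - z \<cdot>\<^sub>m N) * X)"
    and left: "\<And>z u. z \<in> ball 0 1 \<Longrightarrow> u \<in> carrier_vec q \<Longrightarrow> mat_adjoint (b z) *\<^sub>v u = 0\<^sub>v q \<Longrightarrow>
        mat_adjoint (\<psi> z) *\<^sub>v u = 0\<^sub>v n \<Longrightarrow> u = 0\<^sub>v q"
    and \<phi>21: "hol_mat (ball 0 1) q p \<phi>21"
    and \<phi>21b: "\<And>z. z \<in> ball 0 1 \<Longrightarrow> det (M - z \<cdot>\<^sub>m N) \<noteq> 0 \<Longrightarrow> \<phi>21 z = b z * ((-1) \<cdot>\<^sub>m transfer_block C2 C1 M N X \<mu> z)"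
    and \<phi>22: "hol_mat (ball 0 1) q q \<phi>22"
    and \<phi>22b: "\<And>z. z \<in> ball 0 1 \<Longrightarrow> det (M - z \<cdot>\<^sub>m N) \<noteq> 0 \<Longrightarrow> \<phi>22 z = b z * (1\<^sub>m q + transfer_block C2 C2 M N X \<mu> z)"
    and \<theta>: "hol_mat (ball 0 R) q q \<theta>" and \<theta>u: "\<And>z. cmod z = 1 \<Longrightarrow> \<theta> z * mat_adjoint (\<theta> z) = 1\<^sub>m q"
    and \<epsilon>: "hol_mat (ball 0 1) p q \<epsilon>"
    and contr: "\<And>z y. z \<in> ball 0 1 \<Longrightarrow> y \<in> carrier_vec p \<Longrightarrow> nsq (mat_adjoint (\<epsilon> z) *\<^sub>v y) \<le> nsq y"
  shows "finite {z\<in>ball 0 1. det (\<phi>21 z * \<epsilon> z + \<phi>22 z * \<theta> z) = 0}"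
    "zero_count 1 (\<lambda>z. det (\<phi>21 z * \<epsilon> z + \<phi>22 z * \<theta> z)) = int (neg_eigs P) + zero_count 1 (\<lambda>z. det (\<theta> z))"
proof -
  have Pc: "P \<in> carrier_mat n n" "mat_adjoint P = P" and Xc: "X \<in> carrier_mat n n" "mat_adjoint X = X"
    using P X by (auto simp: hermitian_mat_def)
  obtain Q k L \<sigma> where QL: "Q \<in> carrier_mat n k" "L \<in> carrier_mat k n" "L * Q = 1\<^sub>m k"
    "\<And>i. i < k \<Longrightarrow> \<sigma> i = 1 \<or> \<sigma> i = -1"
    "P = Q * dmat k \<sigma> * mat_adjoint Q" "card {i. i < k \<and> \<sigma> i = -1} = neg_eigs P"
    by (rule hermitian_inertia[OF P]) blast
  interpret r: invariant_range n k M N P X Q L \<sigma>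
    by (unfold_locales; fact)
  have C1V: "C1 * r.V \<in> carrier_mat p k" and C2V: "C2 * r.V \<in> carrier_mat q k"
    using mult_carrier_mat[OF C1 r.V] mult_carrier_mat[OF C2 r.V] .
  have CC: "((mat_adjoint C * C) *\<^sub>v x) \<bullet>c y = (C *\<^sub>v x) \<bullet>c (C *\<^sub>v y)"
    if C: "C \<in> carrier_mat m n" and x: "x \<in> carrier_vec n" and y: "y \<in> carrier_vec n" for C :: "complex mat" and m x y
    using assoc_mult_mat_vec[OF mat_adjoint_carrier[OF C] C x]
      cscalar_adjoint'[OF C mult_mat_vec_carrier[OF C x] y] by simp
  interpret s: signature_pencil k p q \<sigma> r.A r.B "C1 * r.V" "C2 * r.V" \<mu>
  proof unfold_locales
    fix g h :: "complex vec" assume g: "g \<in> carrier_vec k" and h: "h \<in> carrier_vec k"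
    have Vg: "r.V *\<^sub>v g \<in> carrier_vec n" "r.V *\<^sub>v h \<in> carrier_vec n"
      using mult_mat_vec_carrier[OF r.V g] mult_mat_vec_carrier[OF r.V h] .
    have YPY: "mat_adjoint Y * P * Y \<in> carrier_mat n n" if "Y \<in> carrier_mat n n" for Y
      using that Pc(1) by (simp add: mult_carrier_sq mat_adjoint_carrier_sq)
    have CCc: "mat_adjoint C * C \<in> carrier_mat n n" if "C \<in> carrier_mat m n" for C :: "complex mat" and m
      using mat_adjoint_carrier[OF that] that by (rule mult_carrier_mat)
    have sub: "(Y *\<^sub>v x) \<bullet>c y - (Z *\<^sub>v x) \<bullet>c y = ((Y - Z) *\<^sub>v x) \<bullet>c y"
      if "Y \<in> carrier_mat n n" "Z \<in> carrier_mat n n" "x \<in> carrier_vec n" "y \<in> carrier_vec n" for Y Z :: "complex mat" and x y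
      using minus_mult_distrib_mat_vec[OF that(1-3)]
        cscalar_minus_left[OF mult_mat_vec_carrier[OF that(1,3)] mult_mat_vec_carrier[OF that(2,3)] that(4)] by simp
    have "jform k \<sigma> (r.A *\<^sub>v g) (r.A *\<^sub>v h) - jform k \<sigma> (r.B *\<^sub>v g) (r.B *\<^sub>v h) =
       ((mat_adjoint M * P * M - mat_adjoint N * P * N) *\<^sub>v (r.V *\<^sub>v g)) \<bullet>c (r.V *\<^sub>v h)"
      unfolding r.jform_compress[OF M r.VA r.A g h] r.jform_compress[OF N r.VB r.B g h]
      by (rule sub[OF YPY[OF M] YPY[OF N] Vg])
    also have "\<dots> = ((mat_adjoint C1 * C1) *\<^sub>v (r.V *\<^sub>v g)) \<bullet>c (r.V *\<^sub>v h) - ((mat_adjoint C2 * C2) *\<^sub>v (r.V *\<^sub>v g)) \<bullet>c (r.V *\<^sub>v h)"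
      unfolding lyapunov by (rule sub[symmetric, OF CCc[OF C1] CCc[OF C2] Vg])
    also have "\<dots> = (C1 * r.V *\<^sub>v g) \<bullet>c (C1 * r.V *\<^sub>v h) - (C2 * r.V *\<^sub>v g) \<bullet>c (C2 * r.V *\<^sub>v h)"
      unfolding CC[OF C1 Vg] CC[OF C2 Vg] assoc_mult_mat_vec[OF C1 r.V g] assoc_mult_mat_vec[OF C1 r.V h]
        assoc_mult_mat_vec[OF C2 r.V g] assoc_mult_mat_vec[OF C2 r.V h] ..
    finally show "jform k \<sigma> (r.A *\<^sub>v g) (r.A *\<^sub>v h) - jform k \<sigma> (r.B *\<^sub>v g) (r.B *\<^sub>v h) =
       (C1 * r.V *\<^sub>v g) \<bullet>c (C1 * r.V *\<^sub>v h) - (C2 * r.V *\<^sub>v g) \<bullet>c (C2 * r.V *\<^sub>v h)" .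
  next
    fix z :: complex assume "cmod z = 1"
    thus "det (r.A - z \<cdot>\<^sub>m r.B) \<noteq> 0" by (intro r.det_compress regular)
  qed (use C1V C2V QL(4) \<mu> in auto)
  interpret fun_alg "ball 0 1" "\<lambda>f. f holomorphic_on ball (0::complex) 1" by (rule fun_alg_hol)
  have Eh: "hol_mat S n n (\<lambda>z. M - z \<cdot>\<^sub>m N)" for S
    by (intro fun_alg.mat_minus[OF fun_alg_hol] fun_alg.mat_smult[OF fun_alg_hol] fun_alg.mat_const[OF fun_alg_hol] M N holomorphic_intros)
  have fE: "finite {z\<in>ball 0 1. det (M - z \<cdot>\<^sub>m N) = 0}"
    by (rule zero_count_winding_number(1)[OF fun_alg.det[OF fun_alg_hol Eh], of 1 2]) (use regular in auto)
  have evE: "\<forall>\<^sub>F w in at z. w \<in> ball 0 1 \<and> det (M - w \<cdot>\<^sub>m N) \<noteq> 0" if z: "z \<in> ball 0 1" for z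
  proof -
    have "\<forall>\<^sub>F w in at z. w \<in> ball 0 1" using z by (intro eventually_at_in_open') auto
    thus ?thesis using eventually_nonzero_of_finite_zeros[OF fE z] by eventually_elim auto
  qed
  have wz: "s.w21 z = (-1) \<cdot>\<^sub>m transfer_block C2 C1 M N X \<mu> z" "s.w22 z = 1\<^sub>m q + transfer_block C2 C2 M N X \<mu> z"
    if d: "det (M - z \<cdot>\<^sub>m N) \<noteq> 0" for z
    unfolding s.w21_def s.w22_def s.H_def s.D_def s.G1_def s.G2_def transfer_block_def
      r.transfer_compress[OF d regular[OF \<mu>] C2 C1] r.transfer_compress[OF d regular[OF \<mu>] C2 C2]
    by (auto intro!: eq_matI simp: left_diff_distrib)
  have b1: "hol_mat (ball 0 1) q q b" using R by (auto intro: hol_mat_sub[OF b])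
  have \<psi>Q: "hol_mat (ball 0 1) q k (\<lambda>z. \<psi> z * Q)" by (rule mat_mult[OF \<psi> mat_const[OF QL(1)]])
  have FXc: "C2 * mat_inv (M - z \<cdot>\<^sub>m N) \<in> carrier_mat q n" if "det (M - z \<cdot>\<^sub>m N) \<noteq> 0" for z
    using mult_carrier_mat[OF C2 mat_inv_props(1)[OF r.pencil_carrier(1) that]] .
  have \<psi>Qeq: "\<psi> z * Q = b z * s.H z" if z: "z \<in> ball 0 1" and d: "det (M - z \<cdot>\<^sub>m N) \<noteq> 0" for z
  proof -
    have FX: "C2 * mat_inv (M - z \<cdot>\<^sub>m N) * X \<in> carrier_mat q n" by (rule mult_carrier_mat[OF FXc[OF d] Xc(1)])
    have "\<psi> z * Q = b z * (C2 * mat_inv (M - z \<cdot>\<^sub>m N) * X * Q)"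
      unfolding \<psi>b[OF z d] by (rule assoc_mult_mat[OF mat_fun_carrier[OF b1 z] FX QL(1)])
    also have "C2 * mat_inv (M - z \<cdot>\<^sub>m N) * X * Q = C2 * mat_inv (M - z \<cdot>\<^sub>m N) * r.V"
      unfolding r.V_def by (rule assoc_mult_mat[OF FXc[OF d] Xc(1) QL(1)])
    also have "\<dots> = s.H z" unfolding s.H_def s.D_def by (rule r.inv_compress[OF d C2])
    finally show ?thesis .
  qed
  have sD: "det (s.D z) \<noteq> 0" if "det (M - z \<cdot>\<^sub>m N) \<noteq> 0" for z
    unfolding s.D_def by (rule r.det_compress[OF that])
  have \<psi>D: "\<psi> z * Q * s.D z = b z * (C2 * r.V)" if z: "z \<in> ball 0 1" for z
  proof (rule mat_fun_continuous_eq[of "ball 0 1" q k _ _ z])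
    show "cont_mat (ball 0 1) q k (\<lambda>z. \<psi> z * Q * s.D z)" by (rule hol_mat_cont[OF mat_mult[OF \<psi>Q s.D_hol]]) simp
    show "cont_mat (ball 0 1) q k (\<lambda>z. b z * (C2 * r.V))" by (rule hol_mat_cont[OF mat_mult[OF b1 mat_const[OF C2V]]]) simp
    show "\<forall>\<^sub>F w in at z. \<psi> w * Q * s.D w = b w * (C2 * r.V)"
      using evE[OF z]
    proof eventually_elim
      case (elim w)
      hence w: "w \<in> ball 0 1" and d: "det (M - w \<cdot>\<^sub>m N) \<noteq> 0" by auto
      show ?case unfolding \<psi>Qeq[OF w d] using assoc_mult_mat[OF mat_fun_carrier[OF b1 w] s.H[OF sD[OF d]] s.D] s.HD[OF sD[OF d]] by simp
    qed
  qed (use z in auto)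
  have JVa: "dmat k \<sigma> * mat_adjoint r.V \<in> carrier_mat k n" by (rule mult_carrier_mat[OF dmat_carrier r.Va])
  \<comment> \<open>Indeed \<open>X Q J V\<^sup>* = V J V\<^sup>* = X\<close>.\<close>
  have \<psi>eq: "\<psi> z = \<psi> z * Q * (dmat k \<sigma> * mat_adjoint r.V)" if z: "z \<in> ball 0 1" for z
  proof (rule mat_fun_continuous_eq[of "ball 0 1" q n _ _ z])
    show "cont_mat (ball 0 1) q n \<psi>" by (rule hol_mat_cont[OF \<psi>]) simp
    show "cont_mat (ball 0 1) q n (\<lambda>z. \<psi> z * Q * (dmat k \<sigma> * mat_adjoint r.V))"
      by (rule hol_mat_cont[OF mat_mult[OF \<psi>Q mat_const[OF JVa]]]) simp
    show "\<forall>\<^sub>F w in at z. \<psi> w = \<psi> w * Q * (dmat k \<sigma> * mat_adjoint r.V)"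
      using evE[OF z]
    proof eventually_elim
      case (elim w)
      hence w: "w \<in> ball 0 1" and d: "det (M - w \<cdot>\<^sub>m N) \<noteq> 0" by auto
      have FX: "C2 * mat_inv (M - w \<cdot>\<^sub>m N) * X \<in> carrier_mat q n" by (rule mult_carrier_mat[OF FXc[OF d] Xc(1)])
      have XQJV: "X * (Q * (dmat k \<sigma> * mat_adjoint r.V)) = X"
      proof -
        have "X * (Q * (dmat k \<sigma> * mat_adjoint r.V)) = r.V * (dmat k \<sigma> * mat_adjoint r.V)"
          unfolding r.V_def by (rule assoc_mult_mat[symmetric, OF Xc(1) QL(1) JVa[unfolded r.V_def]])
        also have "\<dots> = r.V * dmat k \<sigma> * mat_adjoint r.V" by (rule assoc_mult_mat[symmetric, OF r.V dmat_carrier r.Va])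
        finally show ?thesis using r.X_eq by simp
      qed
      have QJV: "Q * (dmat k \<sigma> * mat_adjoint r.V) \<in> carrier_mat n n" by (rule mult_carrier_mat[OF QL(1) JVa])
      have "\<psi> w * Q * (dmat k \<sigma> * mat_adjoint r.V) = \<psi> w * (Q * (dmat k \<sigma> * mat_adjoint r.V))"
        by (rule assoc_mult_mat[OF mat_fun_carrier[OF \<psi> w] QL(1) JVa])
      also have "\<dots> = b w * (C2 * mat_inv (M - w \<cdot>\<^sub>m N) * X * (Q * (dmat k \<sigma> * mat_adjoint r.V)))"
        unfolding \<psi>b[OF w d] by (rule assoc_mult_mat[OF mat_fun_carrier[OF b1 w] FX QJV])
      also have "C2 * mat_inv (M - w \<cdot>\<^sub>m N) * X * (Q * (dmat k \<sigma> * mat_adjoint r.V)) = C2 * mat_inv (M - w \<cdot>\<^sub>m N) * (X * (Q * (dmat k \<sigma> * mat_adjoint r.V)))"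
        by (rule assoc_mult_mat[OF FXc[OF d] Xc(1) QJV])
      finally show ?case unfolding XQJV \<psi>b[OF w d] by simp
    qed
  qed (use z in auto)
  have left': "u = 0\<^sub>v q" if z: "z \<in> ball 0 1" and u: "u \<in> carrier_vec q" and bu0: "mat_adjoint (b z) *\<^sub>v u = 0\<^sub>v q"
    and \<psi>u: "mat_adjoint (\<psi> z * Q) *\<^sub>v u = 0\<^sub>v k" for z u
  proof (rule left[OF z u bu0])
    note \<psi>Qc = mat_fun_carrier[OF \<psi>Q z]
    have "mat_adjoint (\<psi> z) = mat_adjoint (dmat k \<sigma> * mat_adjoint r.V) * mat_adjoint (\<psi> z * Q)"
      by (subst \<psi>eq[OF z]) (rule mat_adjoint_mult[OF \<psi>Qc JVa])
    hence "mat_adjoint (\<psi> z) *\<^sub>v u = mat_adjoint (dmat k \<sigma> * mat_adjoint r.V) *\<^sub>v 0\<^sub>v k"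
      using assoc_mult_mat_vec[OF mat_adjoint_carrier[OF JVa] mat_adjoint_carrier[OF \<psi>Qc] u] \<psi>u by simp
    also have "\<dots> = 0\<^sub>v n" by (rule mult_mat_zero_vec[OF mat_adjoint_carrier[OF JVa]])
    finally show "mat_adjoint (\<psi> z) *\<^sub>v u = 0\<^sub>v n" .
  qed
  have obs': "v = 0\<^sub>v k" if z: "cmod z < 1" and v: "v \<in> carrier_vec k" and Dv: "s.D z *\<^sub>v v = 0\<^sub>v k"
    and Cv: "(C2 * r.V) *\<^sub>v v = 0\<^sub>v q" for z v
  proof (rule r.V_inj[OF v obs[OF z]])
    show "r.V *\<^sub>v v \<in> carrier_vec n" by (rule mult_mat_vec_carrier[OF r.V v])
    have "r.V *\<^sub>v 0\<^sub>v k = 0\<^sub>v n" by (rule mult_mat_zero_vec[OF r.V])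
    thus "(M - z \<cdot>\<^sub>m N) *\<^sub>v (r.V *\<^sub>v v) = 0\<^sub>v n" unfolding r.pencil_V_vec[OF v] using Dv by (simp add: s.D_def)
    show "C2 *\<^sub>v (r.V *\<^sub>v v) = 0\<^sub>v q" using assoc_mult_mat_vec[OF C2 r.V v] Cv by simp
  qed
  define S where "S = {z\<in>ball 0 1. det (s.D z) \<noteq> 0}"
  have oS: "open S"
  proof -
    have "continuous_on (ball 0 1) (\<lambda>z. det (s.D z))" using s.det_D_hol by (rule holomorphic_on_imp_continuous_on)
    from continuous_open_preimage[OF this _ open_Compl[OF closed_singleton, of 0]]
    show ?thesis by (simp add: S_def vimage_def Int_def)
  qed
  have Sb: "S \<subseteq> ball 0 1" by (auto simp: S_def)
  have wS: "hol_mat S q p s.w21" "hol_mat S q q s.w22" by (rule s.w_hol, simp add: S_def)+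
  have bS: "hol_mat S q q b" by (rule hol_mat_sub[OF b1 Sb])
  have \<phi>21s: "\<phi>21 z = b z * s.w21 z" if z: "z \<in> ball 0 1" "det (s.D z) \<noteq> 0" for z
  proof (rule mat_fun_continuous_eq[OF hol_mat_cont[OF \<phi>21 Sb] hol_mat_cont[OF fun_alg.mat_mult[OF fun_alg_hol bS wS(1)] order_refl] oS])
    show "\<forall>\<^sub>F w in at z. \<phi>21 w = b w * s.w21 w"
      using evE[OF z(1)] by eventually_elim (simp add: \<phi>21b wz)
  qed (use z in \<open>simp add: S_def\<close>)
  have \<phi>22s: "\<phi>22 z = b z * s.w22 z" if z: "z \<in> ball 0 1" "det (s.D z) \<noteq> 0" for z
  proof (rule mat_fun_continuous_eq[OF hol_mat_cont[OF \<phi>22 Sb] hol_mat_cont[OF fun_alg.mat_mult[OF fun_alg_hol bS wS(2)] order_refl] oS])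
    show "\<forall>\<^sub>F w in at z. \<phi>22 w = b w * s.w22 w"
      using evE[OF z(1)] by eventually_elim (simp add: \<phi>22b wz)
  qed (use z in \<open>simp add: S_def\<close>)
  show "finite {z\<in>ball 0 1. det (\<phi>21 z * \<epsilon> z + \<phi>22 z * \<theta> z) = 0}"
    by (rule s.linear_fractional_zero_count(1)[where b = b and \<psi> = "\<lambda>z. \<psi> z * Q" and R = R];
        fact obs' assms \<psi>Q \<psi>D left' \<phi>21s \<phi>22s)
  have "zero_count 1 (\<lambda>z. det (\<phi>21 z * \<epsilon> z + \<phi>22 z * \<theta> z)) = int (card {i. i < k \<and> \<sigma> i = -1}) + zero_count 1 (\<lambda>z. det (\<theta> z))"
    by (rule s.linear_fractional_zero_count(2)[where b = b and \<psi> = "\<lambda>z. \<psi> z * Q" and R = R];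
        fact obs' assms \<psi>Q \<psi>D left' \<phi>21s \<phi>22s)
  thus "zero_count 1 (\<lambda>z. det (\<phi>21 z * \<epsilon> z + \<phi>22 z * \<theta> z)) = int (neg_eigs P) + zero_count 1 (\<lambda>z. det (\<theta> z))"
    unfolding QL(6) .
qed

section \<open>Blaschke--Potapov products\<close>

definition blaschke :: "complex \<Rightarrow> complex \<Rightarrow> complex" where
  "blaschke a z = (z - a) / (1 - cnj a * z)"

text \<open>
  The elementary factor as a function of the value \<open>x\<close> of its scalar Blaschke factor. It is multiplicative in \<open>x\<close>, so
  inverses and unitarity of elementary factors reduce to those of scalars.
\<close>

definition projection_factor :: "nat \<Rightarrow> complex mat \<Rightarrow> complex \<Rightarrow> complex mat" where
  "projection_factor n E x = 1\<^sub>m n - E + x \<cdot>\<^sub>m E"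

lemma bp_factor_eq: "bp_factor n a E z = projection_factor n E (blaschke a z)"
  by (simp add: bp_factor_def projection_factor_def blaschke_def)

lemma projection_factor_carrier [simp]: "E \<in> carrier_mat n n \<Longrightarrow> projection_factor n E x \<in> carrier_mat n n"
  by (auto simp: projection_factor_def)

lemma projection_factor_adjoint:
  assumes "hermitian_mat n E"
  shows "mat_adjoint (projection_factor n E x) = projection_factor n E (cnj x)"
proof -
  have E: "E \<in> carrier_mat n n" "mat_adjoint E = E" using assms by (auto simp: hermitian_mat_def)
  have "cnj (E $$ (j, i)) = E $$ (i, j)" if "i < n" "j < n" for i j
    using index_mat_adjoint[of i E j] E that by simp
  thus ?thesis using E(1) by (intro eq_matI) (auto simp: projection_factor_def)
qed

lemma projection_factor_mult:
  assumes E: "E \<in> carrier_mat n n" "E * E = E"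
  shows "projection_factor n E x * projection_factor n E y = projection_factor n E (x * y)"
proof -
  have f: "projection_factor n E t = 1\<^sub>m n + (t - 1) \<cdot>\<^sub>m E" for t
    using E by (intro eq_matI) (auto simp: projection_factor_def algebra_simps)
  have c: "(t - 1) \<cdot>\<^sub>m E \<in> carrier_mat n n" for t using E by simp
  have "(1\<^sub>m n + (x - 1) \<cdot>\<^sub>m E) * (1\<^sub>m n + (y - 1) \<cdot>\<^sub>m E) =
      1\<^sub>m n * (1\<^sub>m n + (y - 1) \<cdot>\<^sub>m E) + (x - 1) \<cdot>\<^sub>m E * (1\<^sub>m n + (y - 1) \<cdot>\<^sub>m E)"
    by (rule add_mult_distrib_mat[of _ n n]) (use E in auto)
  also have "(x - 1) \<cdot>\<^sub>m E * (1\<^sub>m n + (y - 1) \<cdot>\<^sub>m E) = (x - 1) \<cdot>\<^sub>m E * 1\<^sub>m n + (x - 1) \<cdot>\<^sub>m E * ((y - 1) \<cdot>\<^sub>m E)"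
    by (rule mult_add_distrib_mat[of _ n n _ n]) (use E in auto)
  also have "(x - 1) \<cdot>\<^sub>m E * ((y - 1) \<cdot>\<^sub>m E) = ((x - 1) * (y - 1)) \<cdot>\<^sub>m E"
  proof -
    have "(x - 1) \<cdot>\<^sub>m E * ((y - 1) \<cdot>\<^sub>m E) = (x - 1) \<cdot>\<^sub>m (E * ((y - 1) \<cdot>\<^sub>m E))"
      by (rule mult_smult_assoc_mat[OF E(1) c])
    also have "E * ((y - 1) \<cdot>\<^sub>m E) = (y - 1) \<cdot>\<^sub>m E" using mult_smult_distrib[OF E(1) E(1)] E(2) by simp
    finally show ?thesis using E by (intro eq_matI) auto
  qed
  finally show ?thesis unfolding f using E by (intro eq_matI) (auto simp: algebra_simps)
qed

lemma projection_factor_one: "E \<in> carrier_mat n n \<Longrightarrow> projection_factor n E 1 = 1\<^sub>m n"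
  by (intro eq_matI) (auto simp: projection_factor_def)

text \<open>
  Writing \<open>E = Q J Q\<^sup>*\<close>, rank one means that \<open>Q\<close> has one column, and \<open>det (I + (x - 1) Q J Q\<^sup>*)\<close> reduces to a
  determinant of size one.
\<close>

lemma det_projection_factor:
  assumes E: "rank_one_projection n E"
  shows "det (projection_factor n E x) = x"
proof -
  have Eh: "hermitian_mat n E" and EE: "E * E = E" and rk: "mat_rank E = 1" and Ec: "E \<in> carrier_mat n n"
    using E by (auto simp: rank_one_projection_def hermitian_mat_def)
  obtain Q k L \<sigma> where QL: "Q \<in> carrier_mat n k" "L \<in> carrier_mat k n" "L * Q = 1\<^sub>m k"
    "\<And>i. i < k \<Longrightarrow> \<sigma> i = 1 \<or> \<sigma> i = -1" "E = Q * dmat k \<sigma> * mat_adjoint Q"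
    by (rule hermitian_inertia[OF Eh]) blast
  let ?J = "dmat k \<sigma>"
  note Q = QL(1) and L = QL(2)
  note Qa = mat_adjoint_carrier[OF Q] and La = mat_adjoint_carrier[OF L]
  have QJ: "Q * ?J \<in> carrier_mat n k" by (rule mult_carrier_mat[OF Q dmat_carrier])
  have JJ: "?J * ?J = 1\<^sub>m k" unfolding dmat_mult_dmat by (rule dmat_one) (use QL(4) in fastforce)
  have QaLa: "mat_adjoint Q * mat_adjoint L = 1\<^sub>m k" using mat_adjoint_mult[OF L Q] QL(3) by simp
  have LaJ: "mat_adjoint L * ?J \<in> carrier_mat n k" by (rule mult_carrier_mat[OF La dmat_carrier])
  have ELJ: "E * (mat_adjoint L * ?J) = Q"
  proof -
    have "E * (mat_adjoint L * ?J) = Q * ?J * (mat_adjoint Q * (mat_adjoint L * ?J))"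
      unfolding QL(5) by (rule assoc_mult_mat[OF QJ Qa LaJ])
    also have "mat_adjoint Q * (mat_adjoint L * ?J) = ?J"
      using assoc_mult_mat[OF Qa La dmat_carrier[of k \<sigma>]] QaLa by simp
    also have "Q * ?J * ?J = Q * (?J * ?J)" by (rule assoc_mult_mat[OF Q dmat_carrier dmat_carrier])
    finally show ?thesis unfolding JJ right_mult_one_mat[OF Q] .
  qed
  have "mat_rank E = k"
  proof (rule mat_rank_eqI[OF Ec Q])
    show "mat_range E = mat_range Q"
    proof (intro equalityI subsetI)
      fix y assume "y \<in> mat_range E"
      then obtain v where v: "v \<in> carrier_vec n" "y = E *\<^sub>v v" using Ec by (auto simp: mat_range_def)
      have "E = Q * (?J * mat_adjoint Q)" unfolding QL(5) by (rule assoc_mult_mat[OF Q dmat_carrier Qa])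
      hence "y = Q *\<^sub>v ((?J * mat_adjoint Q) *\<^sub>v v)"
        using v assoc_mult_mat_vec[OF Q mult_carrier_mat[OF dmat_carrier[of k \<sigma>] Qa] v(1)] by simp
      thus "y \<in> mat_range Q" using Q mult_mat_vec_carrier[OF mult_carrier_mat[OF dmat_carrier[of k \<sigma>] Qa] v(1)]
        by (auto simp: mat_range_def)
    next
      fix y assume "y \<in> mat_range Q"
      then obtain v where v: "v \<in> carrier_vec k" "y = Q *\<^sub>v v" using Q by (auto simp: mat_range_def)
      have "y = E *\<^sub>v ((mat_adjoint L * ?J) *\<^sub>v v)"
        using assoc_mult_mat_vec[OF Ec LaJ v(1)] ELJ v(2) by simp
      thus "y \<in> mat_range E" using Ec mult_mat_vec_carrier[OF LaJ v(1)] by (auto simp: mat_range_def)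
    qed
    fix v assume v: "v \<in> carrier_vec k" "Q *\<^sub>v v = 0\<^sub>v n"
    have "v = (L * Q) *\<^sub>v v" unfolding QL(3) using v by simp
    also have "\<dots> = L *\<^sub>v 0\<^sub>v n" unfolding assoc_mult_mat_vec[OF L Q v(1)] v(2) ..
    finally show "v = 0\<^sub>v k" unfolding mult_mat_zero_vec[OF L] .
  qed
  hence k: "k = 1" using rk by simp
  have B: "mat_adjoint Q * E = mat_adjoint Q"
  proof -
    have EQ: "E * Q = Q"
    proof -
      have "E * Q = E * (E * (mat_adjoint L * ?J))" unfolding ELJ ..
      also have "\<dots> = E * E * (mat_adjoint L * ?J)" by (rule assoc_mult_mat[symmetric, OF Ec Ec LaJ])
      finally show ?thesis unfolding EE ELJ .
    qed
    have "mat_adjoint (E * Q) = mat_adjoint Q * E" using mat_adjoint_mult[OF Ec Q] Eh by (simp add: hermitian_mat_def)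
    thus ?thesis unfolding EQ by simp
  qed
  have xQJ: "(x - 1) \<cdot>\<^sub>m (Q * ?J) \<in> carrier_mat n k" using QJ by simp
  have QaQJ: "mat_adjoint Q * (Q * ?J) = 1\<^sub>m k"
  proof -
    have "mat_adjoint Q * (Q * ?J) = mat_adjoint Q * (Q * ?J) * (mat_adjoint Q * mat_adjoint L)"
      unfolding QaLa using right_mult_one_mat[OF mult_carrier_mat[OF Qa QJ]] by simp
    also have "\<dots> = mat_adjoint Q * (Q * ?J) * mat_adjoint Q * mat_adjoint L"
      by (rule assoc_mult_mat[symmetric, OF mult_carrier_mat[OF Qa QJ] Qa La])
    also have "mat_adjoint Q * (Q * ?J) * mat_adjoint Q = mat_adjoint Q * E"
      unfolding QL(5) by (rule assoc_mult_mat[OF Qa QJ Qa])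
    finally show ?thesis unfolding B QaLa .
  qed
  have "projection_factor n E x = 1\<^sub>m n + (x - 1) \<cdot>\<^sub>m E"
    using Ec by (intro eq_matI) (auto simp: projection_factor_def algebra_simps)
  also have "(x - 1) \<cdot>\<^sub>m E = ((x - 1) \<cdot>\<^sub>m (Q * ?J)) * mat_adjoint Q"
    unfolding QL(5) by (rule mult_smult_assoc_mat[symmetric, OF QJ Qa])
  finally have "det (projection_factor n E x) = det (1\<^sub>m k + mat_adjoint Q * ((x - 1) \<cdot>\<^sub>m (Q * ?J)))"
    using det_one_plus_comm[OF xQJ Qa] by simp
  also have "mat_adjoint Q * ((x - 1) \<cdot>\<^sub>m (Q * ?J)) = (x - 1) \<cdot>\<^sub>m 1\<^sub>m k"
    unfolding mult_smult_distrib[OF Qa QJ] QaQJ ..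
  also have "1\<^sub>m k + (x - 1) \<cdot>\<^sub>m 1\<^sub>m k = x \<cdot>\<^sub>m (1\<^sub>m k)" by (intro eq_matI) auto
  finally show ?thesis using k by simp
qed

text \<open>
  The properties of a Blaschke--Potapov product of degree \<open>d\<close> that enter the count. They are stable under
  conjugate reflection, and the disc of radius \<open>R\<close>, which extends beyond the unit circle, is free of poles.
\<close>

definition inner_mvf :: "nat \<Rightarrow> nat \<Rightarrow> real \<Rightarrow> (complex \<Rightarrow> complex mat) \<Rightarrow> bool" where
  "inner_mvf n d R B \<longleftrightarrow> 1 < R \<and> hol_mat (ball 0 R) n n B \<and>
     (\<forall>z. cmod z = 1 \<longrightarrow> B z * mat_adjoint (B z) = 1\<^sub>m n) \<and>
     (\<exists>c as. c \<noteq> 0 \<and> length as = d \<and> (\<forall>a\<in>set as. cmod a < 1) \<and>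
        (\<forall>z\<in>ball 0 R. det (B z) = c * (\<Prod>a\<leftarrow>as. (z - a) / (1 - cnj a * z))))"

lemma blaschke_potapov_inner_mvf:
  assumes "blaschke_potapov n d B"
  shows "\<exists>R. inner_mvf n d R B"
    "\<exists>Z. finite Z \<and> (\<forall>z. z \<notin> Z \<longrightarrow> mat_adjoint (B (1 / cnj z)) * B z = 1\<^sub>m n \<and> B z * mat_adjoint (B (1 / cnj z)) = 1\<^sub>m n)"
proof -
  obtain U fs where U: "unitary_mat n U" and len: "length fs = d"
    and fs: "\<forall>(\<alpha>, E)\<in>set fs. \<alpha> \<in> ball 0 1 \<and> rank_one_projection n E"
    and B: "\<And>z. B z = U * foldr (\<lambda>(\<alpha>, E) R. bp_factor n \<alpha> E z * R) fs (1\<^sub>m n)"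
    using assms unfolding blaschke_potapov_def by blast
  define pr where "pr = (\<lambda>z fs. foldr (\<lambda>(\<alpha>, E) R. bp_factor n \<alpha> E z * R) fs (1\<^sub>m n))"
  have pr_Cons: "pr z ((a, E) # fs) = projection_factor n E (blaschke a z) * pr z fs" for z a E fs
    by (simp add: pr_def bp_factor_eq)
  have pr_Nil: "pr z [] = 1\<^sub>m n" for z by (simp add: pr_def)
  have Uc: "U \<in> carrier_mat n n" "mat_adjoint U * U = 1\<^sub>m n" "U * mat_adjoint U = 1\<^sub>m n"
    using U by (auto simp: unitary_mat_def)
  have detU: "det U \<noteq> 0" using mat_inv_unique(1)[OF Uc(1) _ Uc(2)] Uc(1) by simp
  have Bpr: "B z = U * pr z fs" for z by (simp add: B pr_def)
  note assoc = assoc_mult_mat[of _ n n _ n _ n] mult_carrier_sq mat_adjoint_carrier_sq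
  let ?ok = "\<lambda>fs. \<forall>(\<alpha>, E)\<in>set fs. \<alpha> \<in> ball 0 1 \<and> rank_one_projection n E"
  have prc: "pr z fs \<in> carrier_mat n n" if "?ok fs" for z fs
    using that
  proof (induct fs)
    case (Cons x fs)
    obtain a E where x: "x = (a, E)" by force
    have "E \<in> carrier_mat n n" using Cons(2) by (simp add: x rank_one_projection_def hermitian_mat_def)
    thus ?case using Cons unfolding x pr_Cons by (intro mult_carrier_sq projection_factor_carrier) auto
  qed (simp add: pr_Nil)
  have prdet: "det (pr z fs) = (\<Prod>a\<leftarrow>map fst fs. (z - a) / (1 - cnj a * z))" if "?ok fs" for z fs
    using that
  proof (induct fs)
    case (Cons x fs)
    obtain a E where x: "x = (a, E)" by force
    have E: "E \<in> carrier_mat n n" "rank_one_projection n E" using Cons(2) by (auto simp: x rank_one_projection_def hermitian_mat_def)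
    have "det (pr z (x # fs)) = det (projection_factor n E (blaschke a z)) * det (pr z fs)"
      unfolding x pr_Cons by (rule det_mult[of _ n]) (use E prc Cons(2) in auto)
    thus ?case using Cons det_projection_factor[OF E(2)] by (simp add: x blaschke_def)
  qed (simp add: pr_Nil)
  \<comment> \<open>The zeros and poles of the elementary factors, and the origin, where \<open>1 / cnj z\<close> is meaningless.\<close>
  define Z where "Z = insert 0 (fst ` set fs \<union> (\<lambda>a. 1 / cnj a) ` fst ` set fs)"
  have prinv: "mat_adjoint (pr (1 / cnj z) gs) * pr z gs = 1\<^sub>m n" if z: "z \<notin> Z" and "?ok gs" "set gs \<subseteq> set fs" for z gs
    using that(2,3)
  proof (induct gs)
    case (Cons x gs)
    obtain a E where x: "x = (a, E)" by force
    have E: "E \<in> carrier_mat n n" "E * E = E" "hermitian_mat n E"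
      using Cons(2) by (auto simp: x rank_one_projection_def hermitian_mat_def)
    have a: "(a, E) \<in> set fs" using Cons(3) x by auto
    hence "a \<in> fst ` set fs" by force
    hence za: "z \<noteq> a" "z \<noteq> 1 / cnj a" "z \<noteq> 0" using z by (auto simp: Z_def)
    have nz: "1 - cnj a * z \<noteq> 0"
    proof
      assume "1 - cnj a * z = 0"
      hence e: "cnj a * z = 1" by simp
      hence "cnj a \<noteq> 0" by auto
      hence "z = 1 / cnj a" using e by (simp add: eq_divide_eq mult.commute)
      thus False using za by simp
    qed
    have bb: "cnj (blaschke a (1 / cnj z)) * blaschke a z = 1"
    proof -
      have "cnj (blaschke a (1 / cnj z)) = (1 / z - cnj a) / (1 - a * (1 / z))" by (simp add: blaschke_def)
      also have "\<dots> = (1 - cnj a * z) / (z - a)" using za by (simp add: field_simps)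
      finally show ?thesis using nz za by (simp add: blaschke_def)
    qed
    let ?F = "projection_factor n E"
    have okgs: "?ok gs" using Cons(2) by auto
    have c: "pr (1 / cnj z) gs \<in> carrier_mat n n" "pr z gs \<in> carrier_mat n n" using prc[OF okgs] by auto
    have Fc: "?F t \<in> carrier_mat n n" for t using E(1) by simp
    have FF: "mat_adjoint (?F (blaschke a (1 / cnj z))) * ?F (blaschke a z) = 1\<^sub>m n"
      unfolding projection_factor_adjoint[OF E(3)] projection_factor_mult[OF E(1,2)] bb by (rule projection_factor_one[OF E(1)])
    have "mat_adjoint (pr (1 / cnj z) (x # gs)) * pr z (x # gs) =
        mat_adjoint (pr (1 / cnj z) gs) * (mat_adjoint (?F (blaschke a (1 / cnj z))) * ?F (blaschke a z)) * pr z gs"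
      unfolding x pr_Cons mat_adjoint_mult[OF Fc c(1)] using c Fc by (simp add: assoc)
    also have "\<dots> = mat_adjoint (pr (1 / cnj z) gs) * pr z gs" unfolding FF using c by simp
    also have "\<dots> = 1\<^sub>m n" using Cons(1)[OF okgs] Cons(3) by auto
    finally show ?case .
  qed (simp add: pr_Nil)
  have prcz: "pr z fs \<in> carrier_mat n n" for z by (rule prc[OF fs])
  have Bc: "B z \<in> carrier_mat n n" for z unfolding Bpr by (rule mult_carrier_sq[OF Uc(1) prcz])
  have binv: "mat_adjoint (B (1 / cnj z)) * B z = 1\<^sub>m n" if z: "z \<notin> Z" for z
  proof -
    have "mat_adjoint (B (1 / cnj z)) * B z = mat_adjoint (pr (1 / cnj z) fs) * (mat_adjoint U * U) * pr z fs"
      unfolding Bpr mat_adjoint_mult[OF Uc(1) prcz] using prcz Uc(1) by (simp add: assoc)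
    also have "\<dots> = mat_adjoint (pr (1 / cnj z) fs) * pr z fs" unfolding Uc(2)
      using right_mult_one_mat[OF mat_adjoint_carrier[OF prcz]] by simp
    finally show ?thesis using prinv[OF z fs] by simp
  qed
  have binv': "B z * mat_adjoint (B (1 / cnj z)) = 1\<^sub>m n" if z: "z \<notin> Z" for z
    by (rule mat_mult_left_right_inverse[OF mat_adjoint_carrier[OF Bc] Bc binv[OF z]])
  have "finite Z" by (simp add: Z_def)
  thus "\<exists>Z. finite Z \<and> (\<forall>z. z \<notin> Z \<longrightarrow> mat_adjoint (B (1 / cnj z)) * B z = 1\<^sub>m n \<and> B z * mat_adjoint (B (1 / cnj z)) = 1\<^sub>m n)"
    using binv binv' by blast
  define m where "m = Max (insert 0 (cmod ` fst ` set fs))"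
  have m: "0 \<le> m" "m < 1" "\<And>a E. (a, E) \<in> set fs \<Longrightarrow> cmod a \<le> m"
  proof -
    have fin: "finite (insert 0 (cmod ` fst ` set fs))" by simp
    show "0 \<le> m" unfolding m_def by (rule Max_ge[OF fin]) simp
    show "m < 1" unfolding m_def by (subst Max_less_iff[OF fin]) (use fs in auto)
    show "cmod a \<le> m" if "(a, E) \<in> set fs" for a E
      unfolding m_def by (rule Max_ge[OF fin]) (use that in force)
  qed
  \<comment> \<open>Any radius strictly between \<open>1\<close> and \<open>1 / m\<close> keeps the poles \<open>1 / cnj a\<close> outside.\<close>
  define R where "R = 2 / (1 + m)"
  have R: "1 < R" "m * R < 1" using m by (auto simp: R_def field_simps)
  have den: "1 - cnj a * z \<noteq> 0" if "(a, E) \<in> set fs" "z \<in> ball 0 R" for a E z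
  proof
    assume "1 - cnj a * z = 0"
    hence "cmod a * cmod z = 1" by (metis complex_mod_cnj eq_iff_diff_eq_0 norm_mult norm_one)
    moreover have "cmod a * cmod z \<le> m * R" using m(1) m(3)[OF that(1)] that(2) by (intro mult_mono) auto
    ultimately show False using R by simp
  qed
  interpret fun_alg "ball 0 R" "\<lambda>f. f holomorphic_on ball (0::complex) R" by (rule fun_alg_hol)
  have "hol_mat (ball 0 R) n n (\<lambda>z. pr z gs)" if "?ok gs" "set gs \<subseteq> set fs" for gs
    using that
  proof (induct gs)
    case Nil
    show ?case unfolding pr_Nil by (rule mat_const) simp
  next
    case (Cons x gs)
    obtain a E where x: "x = (a, E)" by force
    have E: "E \<in> carrier_mat n n" using Cons(2) by (auto simp: x rank_one_projection_def hermitian_mat_def)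
    have "(\<lambda>z. blaschke a z) holomorphic_on ball 0 R" unfolding blaschke_def
      by (intro holomorphic_intros den) (use Cons(3) x in auto)
    hence "hol_mat (ball 0 R) n n (\<lambda>z. projection_factor n E (blaschke a z))" unfolding projection_factor_def
      by (intro mat_add mat_smult mat_const) (use E in auto)
    thus ?case unfolding x pr_Cons using Cons by (intro mat_mult[where m = n]) auto
  qed
  hence hB: "hol_mat (ball 0 R) n n B"
    unfolding Bpr[abs_def] using fs by (intro mat_mult[OF mat_const[OF Uc(1)]]) auto
  have circ: "B z * mat_adjoint (B z) = 1\<^sub>m n" if z: "cmod z = 1" for z
  proof -
    have zz: "z * cnj z = 1" using z by (simp add: complex_norm_square[symmetric])
    hence zc: "1 / cnj z = z" using z by (metis div_by_1 divide_divide_eq_right mult.commute nonzero_mult_div_cancel_right zero_neq_one mult_zero_left)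
    have "z \<notin> Z"
    proof
      assume "z \<in> Z"
      then consider "z = 0" | a E where "(a, E) \<in> set fs" "z = a" | a E where "(a, E) \<in> set fs" "z = 1 / cnj a"
        by (auto simp: Z_def)
      thus False
      proof cases
        case 2 thus ?thesis using fs z by auto
      next
        case 3
        hence "cmod a = 1" using z by (auto simp: norm_divide)
        thus ?thesis using fs 3 by auto
      qed (use z in auto)
    qed
    thus ?thesis using binv'[of z] zc by simp
  qed
  have "det (B z) = det U * (\<Prod>a\<leftarrow>map fst fs. (z - a) / (1 - cnj a * z))" for z
    unfolding Bpr det_mult[OF Uc(1) prcz] prdet[OF fs] ..
  hence "inner_mvf n d R B" unfolding inner_mvf_def
    using R hB circ detU len fs by (intro conjI exI[of _ "det U"] exI[of _ "map fst fs"]) auto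
  thus "\<exists>R. inner_mvf n d R B" by blast
qed

lemma inner_mvf_zero_count:
  assumes "inner_mvf n d R B"
  shows "zero_count 1 (\<lambda>z. det (B z)) = int d" "finite {z\<in>ball 0 1. det (B z) = 0}"
proof -
  obtain c as where R: "1 < R" and c: "c \<noteq> 0" "length as = d" "\<And>a. a \<in> set as \<Longrightarrow> cmod a < 1"
    and det: "\<And>z. z \<in> ball 0 R \<Longrightarrow> det (B z) = c * (\<Prod>a\<leftarrow>as. (z - a) / (1 - cnj a * z))"
    using assms unfolding inner_mvf_def by blast
  let ?g = "\<lambda>z. c * (\<Prod>a\<leftarrow>as. (z - a) / (1 - cnj a * z))"
  have eq: "det (B z) = ?g z" if "z \<in> ball 0 1" for z using det[of z] that R by simp
  have set: "{z\<in>ball 0 1. det (B z) = 0} = {z\<in>ball 0 1. ?g z = 0}" using eq by auto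
  show "finite {z\<in>ball 0 1. det (B z) = 0}" unfolding set using zero_count_blaschke(2)[OF c(1)] c(3) by blast
  have "zero_count 1 (\<lambda>z. det (B z)) = zero_count 1 ?g"
    by (rule zero_count_cong) (rule eq)
  thus "zero_count 1 (\<lambda>z. det (B z)) = int d" using zero_count_blaschke(3)[OF c(1)] c(2,3) by simp
qed

section \<open>Schur functions\<close>

lemma neg_eigs_1x1:
  assumes "neg_eigs (mat 1 1 (\<lambda>_. complex_of_real x)) = 0"
  shows "0 \<le> x"
proof (rule ccontr)
  assume x: "\<not> 0 \<le> x"
  let ?A = "mat 1 1 (\<lambda>_. complex_of_real x)"
  have A: "?A \<in> carrier_mat 1 1" by simp
  have "char_poly ?A = (\<Prod>a\<leftarrow>diag_mat ?A. [:- a, 1:])"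
    by (rule char_poly_upper_triangular[OF A]) auto
  also have "\<dots> = [:- complex_of_real x, 1:]" by (simp add: diag_mat_def)
  finally have cp: "char_poly ?A = [:- complex_of_real x, 1:]" .
  have set: "{e. eigenvalue ?A e \<and> e \<in> \<real> \<and> Re e < 0} = {complex_of_real x}"
    unfolding eigenvalue_root_char_poly[OF A] cp using x by auto
  have "neg_eigs ?A = Polynomial.order (complex_of_real x) [:- complex_of_real x, 1:]"
    unfolding neg_eigs_def set cp by simp
  also have "\<dots> = 1" using order_power_n_n[of "complex_of_real x" 1] by simp
  finally show False using assms by simp
qed

text \<open>
  The Gram matrices for a single point have size one and show that \<open>s(z)\<^sup>*\<close> is a contraction wherever \<open>s\<close> is
  holomorphic. A function that is bounded off its poles has no poles.
\<close>

lemma schur_holomorphic_contractive: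
  assumes s: "schur p q s"
  shows "hol_mat (ball 0 1) p q s"
    "\<And>z y. z \<in> ball 0 1 \<Longrightarrow> y \<in> carrier_vec p \<Longrightarrow> nsq (mat_adjoint (s z) *\<^sub>v y) \<le> nsq y"
proof -
  define S where "S = holomorphy_domain p q (ball 0 1) s"
  have sc: "\<And>z. z \<in> ball 0 1 \<Longrightarrow> s z \<in> carrier_mat p q"
    and mero: "\<And>i j. i < p \<Longrightarrow> j < q \<Longrightarrow> (\<lambda>z. s z $$ (i, j)) nicely_meromorphic_on ball 0 1"
    and neg: "has_negative_squares p S (schur_kernel p s) 0"
    using s by (auto simp: gen_schur_def S_def)
  have contr: "nsq (mat_adjoint (s z) *\<^sub>v y) \<le> nsq y" if z: "z \<in> S" and y: "y \<in> carrier_vec p" for z y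
  proof -
    have zb: "z \<in> ball 0 1" using z by (simp add: S_def holomorphy_domain_def)
    note c = sc[OF zb] and ca = mat_adjoint_carrier[OF sc[OF zb]]
    have ss: "s z * mat_adjoint (s z) \<in> carrier_mat p p" using c ca by (rule mult_carrier_mat)
    have ay: "mat_adjoint (s z) *\<^sub>v y \<in> carrier_vec q" by (rule mult_mat_vec_carrier[OF ca y])
    define r where "r = 1 - (cmod z)\<^sup>2"
    have r: "0 < r" using zb by (simp add: r_def abs_square_less_1)
    have rz: "1 - z * cnj z = complex_of_real r" by (simp only: r_def complex_norm_square of_real_diff of_real_1)
    have "(schur_kernel p s z z *\<^sub>v y) \<bullet>c y = of_real ((nsq y - nsq (mat_adjoint (s z) *\<^sub>v y)) / r)"
    proof -
      have dc: "1\<^sub>m p - s z * mat_adjoint (s z) \<in> carrier_mat p p" by (rule minus_carrier_mat[OF ss])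
      have "schur_kernel p s z z *\<^sub>v y = (1 / of_real r) \<cdot>\<^sub>v ((1\<^sub>m p - s z * mat_adjoint (s z)) *\<^sub>v y)"
        unfolding schur_kernel_def rz using dc y carrier_matD[OF dc]
        by (intro eq_vecI) (auto simp: scalar_prod_def sum_distrib_left mult_ac simp del: index_minus_mat)
      also have "(1\<^sub>m p - s z * mat_adjoint (s z)) *\<^sub>v y = 1\<^sub>m p *\<^sub>v y - (s z * mat_adjoint (s z)) *\<^sub>v y"
        by (rule minus_mult_distrib_mat_vec[OF one_carrier_mat ss y])
      also have "(s z * mat_adjoint (s z)) *\<^sub>v y = s z *\<^sub>v (mat_adjoint (s z) *\<^sub>v y)"
        by (rule assoc_mult_mat_vec[OF c ca y])
      finally have e: "schur_kernel p s z z *\<^sub>v y = (1 / of_real r) \<cdot>\<^sub>v (y - s z *\<^sub>v (mat_adjoint (s z) *\<^sub>v y))"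
        using y by simp
      have sy: "s z *\<^sub>v (mat_adjoint (s z) *\<^sub>v y) \<in> carrier_vec p" by (rule mult_mat_vec_carrier[OF c ay])
      have "(schur_kernel p s z z *\<^sub>v y) \<bullet>c y = (1 / of_real r) * (y \<bullet>c y - (s z *\<^sub>v (mat_adjoint (s z) *\<^sub>v y)) \<bullet>c y)"
        unfolding e cscalar_smult_left[OF minus_carrier_vec[OF y sy] y] cscalar_minus_left[OF y sy y] by (rule refl)
      also have "(s z *\<^sub>v (mat_adjoint (s z) *\<^sub>v y)) \<bullet>c y = of_real (nsq (mat_adjoint (s z) *\<^sub>v y))"
        unfolding cscalar_adjoint[OF c ay y] by (rule cscalar_self)
      finally show ?thesis unfolding cscalar_self by simp
    qed
    hence "gram_mat (schur_kernel p s) 1 (\<lambda>_. z) (\<lambda>_. y) = mat 1 1 (\<lambda>_. of_real ((nsq y - nsq (mat_adjoint (s z) *\<^sub>v y)) / r))"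
      by (intro eq_matI) (auto simp: gram_mat_def)
    moreover have "neg_eigs (gram_mat (schur_kernel p s) 1 (\<lambda>_. z) (\<lambda>_. y)) = 0"
    proof -
      have "neg_eigs (gram_mat (schur_kernel p s) 1 (\<lambda>_. z) (\<lambda>_. y)) \<le> 0"
        using conjunct1[OF neg[unfolded has_negative_squares_def], rule_format, of 1 "\<lambda>_. z" "\<lambda>_. y"] z y by simp
      thus ?thesis by simp
    qed
    ultimately have "0 \<le> (nsq y - nsq (mat_adjoint (s z) *\<^sub>v y)) / r" by (intro neg_eigs_1x1) simp
    thus ?thesis using r by (simp add: zero_le_divide_iff)
  qed
  have bound: "cmod (s z $$ (i, j)) \<le> 1" if z: "z \<in> S" and ij: "i < p" "j < q" for z i j
  proof -
    have zb: "z \<in> ball 0 1" using z by (simp add: S_def holomorphy_domain_def)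
    note c = sc[OF zb]
    have n1: "nsq (unit_vec p i) = 1"
    proof -
      have "(cmod (unit_vec p i $ l))\<^sup>2 = (if l = i then 1 else 0)" if "l < p" for l using that ij by (simp add: unit_vec_def)
      hence "nsq (unit_vec p i) = (\<Sum>l<p. if l = i then 1 else 0)" unfolding nsq_def by (intro sum.cong) auto
      thus ?thesis using ij by simp
    qed
    have e: "(mat_adjoint (s z) *\<^sub>v unit_vec p i) $ j = cnj (s z $$ (i, j))"
      using mat_mult_unit_vec[OF mat_adjoint_carrier[OF c] ij(1)] c ij by simp
    have "(cmod (s z $$ (i, j)))\<^sup>2 = (cmod ((mat_adjoint (s z) *\<^sub>v unit_vec p i) $ j))\<^sup>2" unfolding e by simp
    also have "\<dots> \<le> nsq (mat_adjoint (s z) *\<^sub>v unit_vec p i)"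
      unfolding nsq_def using c ij by (intro member_le_sum) auto
    also have "\<dots> \<le> 1" using contr[OF z, of "unit_vec p i"] n1 by simp
    finally show ?thesis by (simp add: abs_square_le_1)
  qed
  \<comment> \<open>Points near a given one are in \<open>S\<close>, so the bound excludes a pole.\<close>
  have Sall: "z \<in> S" if z: "z \<in> ball 0 1" for z
  proof -
    have ana: "(\<lambda>w. s w $$ (i, j)) analytic_on {z}" if ij: "i < p" "j < q" for i j
    proof (rule nicely_meromorphic_on_imp_analytic_at[OF mero[OF ij] z])
      have "\<forall>\<^sub>F w in at z. \<forall>i<p. \<forall>j<q. (\<lambda>w. s w $$ (i, j)) analytic_on {w}"
      proof -
        have "\<forall>\<^sub>F w in at z. (\<lambda>w. s w $$ (i, j)) analytic_on {w}" if "i < p" "j < q" for i j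
        proof -
          have "(\<lambda>w. s w $$ (i, j)) meromorphic_on {z}"
            using mero[OF that] z by (auto simp: nicely_meromorphic_on_def intro: meromorphic_on_subset)
          thus ?thesis using meromorphic_on_isolated_singularity isolated_singularity_at_altdef by blast
        qed
        hence "\<forall>\<^sub>F w in at z. \<forall>i\<in>{..<p}. \<forall>j\<in>{..<q}. (\<lambda>w. s w $$ (i, j)) analytic_on {w}"
          by (intro eventually_ball_finite ballI finite_lessThan) auto
        thus ?thesis by (rule eventually_mono) auto
      qed
      moreover have "\<forall>\<^sub>F w in at z. w \<in> ball 0 1" using z by (intro eventually_at_in_open') auto
      ultimately have "\<forall>\<^sub>F w in at z. w \<in> S" by eventually_elim (simp add: S_def holomorphy_domain_def)
      hence ev: "\<forall>\<^sub>F w in at z. cmod (s w $$ (i, j)) \<le> 1" by eventually_elim (rule bound[OF _ ij])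
      show "\<not> is_pole (\<lambda>w. s w $$ (i, j)) z"
      proof
        assume "is_pole (\<lambda>w. s w $$ (i, j)) z"
        hence "\<forall>\<^sub>F w in at z. 2 \<le> cmod (s w $$ (i, j))"
          unfolding is_pole_def using filterlim_at_infinity[of 1 "\<lambda>w. s w $$ (i, j)"] by simp
        hence "\<forall>\<^sub>F w in at z. False" using ev by eventually_elim linarith
        thus False by simp
      qed
    qed
    thus ?thesis using z by (simp add: S_def holomorphy_domain_def)
  qed
  show "hol_mat (ball 0 1) p q s"
  proof (rule mat_funI[OF sc])
    fix i j assume "i < p" "j < q"
    hence "(\<lambda>z. s z $$ (i, j)) analytic_on ball 0 1"
      using Sall by (subst analytic_on_analytic_at) (auto simp: S_def holomorphy_domain_def)
    thus "(\<lambda>z. s z $$ (i, j)) holomorphic_on ball 0 1" by (rule analytic_imp_holomorphic)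
  qed
  show "nsq (mat_adjoint (s z) *\<^sub>v y) \<le> nsq y" if "z \<in> ball 0 1" "y \<in> carrier_vec p" for z y
    by (rule contr[OF Sall[OF that(1)] that(2)])
qed

text \<open>If \<open>A\<^sup>*\<close> is a contraction, then \<open>0 \<le> |x - A\<^sup>* A x|\<^sup>2 = |x|\<^sup>2 - 2 |A x|\<^sup>2 + |A\<^sup>* A x|\<^sup>2 \<le> |x|\<^sup>2 - |A x|\<^sup>2\<close>.\<close>

lemma contractive_adjoint:
  assumes A: "A \<in> carrier_mat p q"
    and contr: "\<And>y. y \<in> carrier_vec p \<Longrightarrow> nsq (mat_adjoint A *\<^sub>v y) \<le> nsq y"
    and x: "x \<in> carrier_vec q"
  shows "nsq (A *\<^sub>v x) \<le> nsq x"
proof -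
  define y where "y = A *\<^sub>v x"
  have y: "y \<in> carrier_vec p" unfolding y_def by (rule mult_mat_vec_carrier[OF A x])
  define w where "w = mat_adjoint A *\<^sub>v y"
  have w: "w \<in> carrier_vec q" unfolding w_def by (rule mult_mat_vec_carrier[OF mat_adjoint_carrier[OF A] y])
  have "x \<bullet>c w = (A *\<^sub>v x) \<bullet>c y" unfolding w_def by (rule cscalar_adjoint[OF A x y, symmetric])
  hence xw: "x \<bullet>c w = of_real (nsq y)" unfolding y_def[symmetric] cscalar_self .
  have wx: "w \<bullet>c x = of_real (nsq y)" using cscalar_cnj[OF x w] xw by (metis complex_cnj_complex_of_real)
  have "complex_of_real (nsq (x - w)) = (x - w) \<bullet>c (x - w)" by (rule cscalar_self[symmetric])
  also have "\<dots> = x \<bullet>c x - x \<bullet>c w - (w \<bullet>c x - w \<bullet>c w)"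
    using x w by (simp add: cscalar_minus_left[of _ q] cscalar_minus_right[of _ q])
  also have "\<dots> = of_real (nsq x - 2 * nsq y + nsq w)" unfolding xw wx by (simp add: cscalar_self)
  finally have "nsq (x - w) = nsq x - 2 * nsq y + nsq w" by (simp only: of_real_eq_iff)
  moreover have "nsq w \<le> nsq y" unfolding w_def by (rule contr[OF y])
  ultimately show ?thesis using nsq_nonneg[of "x - w"] by (simp add: y_def)
qed

section \<open>Reflection\<close>

text \<open>Conjugate reflection preserves the disc; it is the composition of \<open>F \<mapsto> F\<^sup>#\<close> with \<open>z \<mapsto> 1/z\<close>.\<close>

definition reflect :: "(complex \<Rightarrow> complex mat) \<Rightarrow> complex \<Rightarrow> complex mat" where
  "reflect F z = mat_adjoint (F (cnj z))"

lemma cnj_image: "cnj ` S = {z. cnj z \<in> S}"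
  by (force intro: image_eqI[of _ cnj "cnj _"])

lemma hol_mat_reflect:
  assumes F: "hol_mat (ball 0 R) r c F"
  shows "hol_mat (ball 0 R) c r (reflect F)"
proof (rule mat_funI)
  fix z :: complex assume "z \<in> ball 0 R"
  hence "cnj z \<in> ball 0 R" by simp
  thus "reflect F z \<in> carrier_mat c r" using mat_fun_carrier[OF F] by (simp add: reflect_def)
next
  fix i j assume ij: "i < c" "j < r"
  have im: "cnj ` ball 0 R = ball 0 R" by (simp add: cnj_image ball_def)
  have "(cnj \<circ> (\<lambda>z. F z $$ (j, i)) \<circ> cnj) holomorphic_on ball 0 R"
    by (rule holomorphic_on_compose_cnj_cnj) (use mat_fun_entry[OF F ij(2,1)] im in auto)
  thus "(\<lambda>z. reflect F z $$ (i, j)) holomorphic_on ball 0 R"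
  proof (rule holomorphic_transform)
    fix z :: complex assume "z \<in> ball 0 R"
    hence "cnj z \<in> ball 0 R" by simp
    from mat_fun_carrier[OF F this] show "(cnj \<circ> (\<lambda>z. F z $$ (j, i)) \<circ> cnj) z = reflect F z $$ (i, j)"
      using ij by (simp add: reflect_def)
  qed
qed

lemma inner_mvf_reflect:
  assumes "inner_mvf n d R B"
  shows "inner_mvf n d R (reflect B)"
proof -
  obtain c as where R: "1 < R" and hB: "hol_mat (ball 0 R) n n B"
    and un: "\<And>z. cmod z = 1 \<Longrightarrow> B z * mat_adjoint (B z) = 1\<^sub>m n"
    and c: "c \<noteq> 0" "length as = d" "\<And>a. a \<in> set as \<Longrightarrow> cmod a < 1"
    and det: "\<And>z. z \<in> ball 0 R \<Longrightarrow> det (B z) = c * (\<Prod>a\<leftarrow>as. (z - a) / (1 - cnj a * z))"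
    using assms unfolding inner_mvf_def by blast
  have "det (reflect B z) = cnj c * (\<Prod>a\<leftarrow>map cnj as. (z - a) / (1 - cnj a * z))" if z: "z \<in> ball 0 R" for z
  proof -
    have zc: "cnj z \<in> ball 0 R" using z by simp
    have "cnj (\<Prod>a\<leftarrow>as. (cnj z - a) / (1 - cnj a * cnj z)) = (\<Prod>a\<leftarrow>map cnj as. (z - a) / (1 - cnj a * z))"
      by (induct as) auto
    thus ?thesis unfolding reflect_def det_mat_adjoint[OF mat_fun_carrier[OF hB zc]] det[OF zc] by simp
  qed
  moreover have "reflect B z * mat_adjoint (reflect B z) = 1\<^sub>m n" if z: "cmod z = 1" for z
  proof -
    have zc: "cnj z \<in> ball 0 R" "cmod (cnj z) = 1" using z R by auto
    note Bc = mat_fun_carrier[OF hB zc(1)]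
    have "mat_adjoint (B (cnj z)) * B (cnj z) = 1\<^sub>m n"
      by (rule mat_mult_left_right_inverse[OF Bc mat_adjoint_carrier[OF Bc] un[OF zc(2)]])
    thus ?thesis by (simp add: reflect_def)
  qed
  ultimately show ?thesis unfolding inner_mvf_def using R hol_mat_reflect[OF hB] c
    by (intro conjI exI[of _ "cnj c"] exI[of _ "map cnj as"]) auto
qed

lemma zero_count_reflect:
  assumes f: "f holomorphic_on ball 0 1" and fin: "finite {z\<in>ball 0 1. f z = 0}"
  shows "zero_count 1 (\<lambda>z. cnj (f (cnj z))) = zero_count 1 f" "finite {z\<in>ball 0 1. cnj (f (cnj z)) = 0}"
proof -
  have set: "{z\<in>ball 0 1. cnj (f (cnj z)) = 0} = cnj ` {z\<in>ball 0 1. f z = 0}"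
    by (simp add: cnj_image)
  show "finite {z\<in>ball 0 1. cnj (f (cnj z)) = 0}" unfolding set using fin by simp
  have zo: "zorder (\<lambda>z. cnj (f (cnj z))) (cnj z) = zorder f z" if z: "z \<in> ball 0 1" for z
  proof -
    have "\<exists>w\<in>ball 0 1. f w \<noteq> 0"
    proof (rule ccontr)
      assume "\<not> (\<exists>w\<in>ball 0 1. f w \<noteq> 0)"
      hence "{z\<in>ball 0 1. f z = 0} = ball (0::complex) 1" by auto
      hence "finite (ball (0::complex) 1)" using fin by simp
      moreover have "infinite (ball (0::complex) 1)" by (rule uncountable_infinite) (simp add: uncountable_ball)
      ultimately show False by simp
    qed
    from zorder_exist_zero[OF f open_ball connected_ball z this] obtain r where
      ord: "if f z = 0 then 0 < zorder f z else zorder f z = 0" and r: "0 < r" "cball z r \<subseteq> ball 0 1"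
      and g: "zor_poly f z holomorphic_on cball z r"
      and fg: "\<And>w. w \<in> cball z r \<Longrightarrow> f w = zor_poly f z w * (w - z) ^ nat (zorder f z) \<and> zor_poly f z w \<noteq> 0"
      by blast
    have nn: "0 \<le> zorder f z" using ord by (simp split: if_splits)
    have im: "cnj ` ball (cnj z) r = ball z r"
    proof -
      have "dist (cnj z) w < r \<longleftrightarrow> dist z (cnj w) < r" for w
        by (metis complex_cnj_cnj complex_cnj_diff complex_mod_cnj dist_norm)
      thus ?thesis by (simp add: cnj_image ball_def)
    qed
    show ?thesis
    proof (rule zorder_eqI[of "ball (cnj z) r" _ "cnj \<circ> zor_poly f z \<circ> cnj"])
      show "cnj \<circ> zor_poly f z \<circ> cnj holomorphic_on ball (cnj z) r"
        by (rule holomorphic_on_compose_cnj_cnj) (use g im in \<open>auto intro: holomorphic_on_subset\<close>)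
      show "(cnj \<circ> zor_poly f z \<circ> cnj) (cnj z) \<noteq> 0" using fg[of z] r by simp
      fix w assume w: "w \<in> ball (cnj z) r"
      hence "cnj w \<in> ball z r" using im by blast
      hence "f (cnj w) = zor_poly f z (cnj w) * (cnj w - z) ^ nat (zorder f z)" using fg[of "cnj w"] by auto
      thus "cnj (f (cnj w)) = (cnj \<circ> zor_poly f z \<circ> cnj) w * (w - cnj z) powi zorder f z"
        using nn by (simp add: power_int_def)
    qed (use r in auto)
  qed
  have "zero_count 1 (\<lambda>z. cnj (f (cnj z))) = (\<Sum>z\<in>{z\<in>ball 0 1. f z = 0}. zorder (\<lambda>z. cnj (f (cnj z))) (cnj z))"
    unfolding zero_count_def set by (rule sum.reindex[unfolded o_def]) (auto simp: inj_on_def)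
  also have "\<dots> = zero_count 1 f" unfolding zero_count_def by (intro sum.cong) (auto simp: zo)
  finally show "zero_count 1 (\<lambda>z. cnj (f (cnj z))) = zero_count 1 f" .
qed

text \<open>A bounded holomorphic mvf in the exterior of the disc, moved to the disc by \<open>z \<mapsto> 1/z\<close>.\<close>

definition inversion :: "nat \<Rightarrow> nat \<Rightarrow> (complex \<Rightarrow> complex mat) \<Rightarrow> complex \<Rightarrow> complex mat" where
  "inversion r c \<Phi> z = (if z = 0 then mvf_infinity r c \<Phi> else \<Phi> (1 / z))"

text \<open>
  Boundedness makes the singularity at the origin removable, and \<open>mvf_infinity\<close> is the value of the
  extension.
\<close>

lemma hol_mat_inversion:
  assumes "bounded_holomorphic_mvf r c Omega_minus \<Phi>"
  shows "hol_mat (ball 0 1) r c (inversion r c \<Phi>)"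
proof -
  have \<Phi>c: "\<And>z. 1 < cmod z \<Longrightarrow> \<Phi> z \<in> carrier_mat r c"
    and hol: "\<And>i j. i < r \<Longrightarrow> j < c \<Longrightarrow> (\<lambda>z. \<Phi> z $$ (i, j)) holomorphic_on Omega_minus"
    and bdd: "\<And>i j. i < r \<Longrightarrow> j < c \<Longrightarrow> bounded ((\<lambda>z. \<Phi> z $$ (i, j)) ` Omega_minus)"
    using assms by (auto simp: bounded_holomorphic_mvf_def Omega_minus_def)
  have inv: "1 < cmod (1 / z)" if "z \<in> ball 0 1" "z \<noteq> 0" for z :: complex
    using that by (simp add: norm_divide)
  show ?thesis
  proof (rule mat_funI)
    fix z :: complex assume "z \<in> ball 0 1"
    thus "inversion r c \<Phi> z \<in> carrier_mat r c"
      using \<Phi>c[OF inv[of z]] by (auto simp: inversion_def mvf_infinity_def)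
  next
    fix i j assume ij: "i < r" "j < c"
    define f where "f = (\<lambda>z. \<Phi> z $$ (i, j))"
    have fh: "(\<lambda>z. f (1 / z)) holomorphic_on ball 0 1 - {0}"
    proof -
      have "(f \<circ> (\<lambda>z. 1 / z)) holomorphic_on ball 0 1 - {0}"
      proof (rule holomorphic_on_compose)
        show "(\<lambda>z::complex. 1 / z) holomorphic_on ball 0 1 - {0}" by (intro holomorphic_intros) auto
        show "f holomorphic_on (\<lambda>z. 1 / z) ` (ball 0 1 - {0})"
          using hol[OF ij] unfolding f_def by (rule holomorphic_on_subset) (use inv in \<open>auto simp: Omega_minus_def\<close>)
      qed
      thus ?thesis by (simp add: o_def)
    qed
    obtain B where B: "\<And>z. z \<in> Omega_minus \<Longrightarrow> cmod (f z) \<le> B"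
      using bdd[OF ij] unfolding bounded_iff f_def by auto
    have ev: "\<forall>\<^sub>F z in at 0. z \<in> ball 0 1 - {0::complex}" by (rule eventually_at_in_open) auto
    hence "\<forall>\<^sub>F z in at 0. cmod (f (1 / z)) \<le> B"
    proof eventually_elim
      case (elim z)
      thus ?case using inv[of z] by (intro B) (auto simp: Omega_minus_def)
    qed
    moreover have "(0::complex) \<in> interior (ball 0 1)" by simp
    ultimately obtain g where g: "g holomorphic_on ball 0 1" "\<And>z. z \<in> ball 0 1 - {0} \<Longrightarrow> g z = f (1 / z)"
      using holomorphic_on_extend_bounded[OF fh] by blast
    have "isCont g 0" using holomorphic_on_imp_continuous_on[OF g(1)] continuous_on_eq_continuous_at[OF open_ball] by force
    hence "g \<midarrow>0\<rightarrow> g 0" by (rule isContD)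
    moreover have "\<forall>\<^sub>F z in at 0. g z = (f \<circ> inverse) z"
      using ev by eventually_elim (simp add: g(2) inverse_eq_divide)
    ultimately have "((f \<circ> inverse) \<longlongrightarrow> g 0) (at 0)" by (rule Lim_transform_eventually)
    hence "(f \<longlongrightarrow> g 0) at_infinity" unfolding lim_at_infinity_0 .
    hence lim: "Lim at_infinity f = g 0" by (rule tendsto_Lim[rotated]) (simp add: trivial_limit_at_infinity)
    have "inversion r c \<Phi> z $$ (i, j) = g z" if "z \<in> ball 0 1" for z
    proof (cases "z = 0")
      case True thus ?thesis using ij lim by (simp add: inversion_def mvf_infinity_def f_def)
    next
      case False thus ?thesis using g(2)[of z] that by (simp add: inversion_def f_def)
    qed
    thus "(\<lambda>z. inversion r c \<Phi> z $$ (i, j)) holomorphic_on ball 0 1"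
      using g(1) by (auto intro: holomorphic_transform)
  qed
qed

lemma mvf_sharp_eq_reflect: "mvf_sharp r c \<Phi> z = reflect (inversion r c \<Phi>) z"
  by (auto simp: mvf_sharp_def reflect_def inversion_def)

section \<open>Block matrices\<close>

lemma mat_inv_carrier: "A \<in> carrier_mat n n \<Longrightarrow> mat_inv A \<in> carrier_mat n n"
  using mat_inverse(2)[of A n] by (auto simp: mat_inv_def split: option.split)

lemma mat_inv_smult:
  assumes A: "A \<in> carrier_mat n n" and d: "det A \<noteq> 0" and c: "c \<noteq> 0"
  shows "mat_inv (c \<cdot>\<^sub>m A) = (1 / c) \<cdot>\<^sub>m mat_inv A"
proof (rule mat_inv_unique(2))
  note I = mat_inv_props[OF A d]
  show "c \<cdot>\<^sub>m A \<in> carrier_mat n n" "(1 / c) \<cdot>\<^sub>m mat_inv A \<in> carrier_mat n n" using A I by auto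
  have "(1 / c) \<cdot>\<^sub>m mat_inv A * (c \<cdot>\<^sub>m A) = (1 / c) \<cdot>\<^sub>m (mat_inv A * (c \<cdot>\<^sub>m A))"
    using I A by (intro mult_smult_assoc_mat) auto
  also have "mat_inv A * (c \<cdot>\<^sub>m A) = c \<cdot>\<^sub>m 1\<^sub>m n" using mult_smult_distrib[OF I(1) A] I(3) by simp
  also have "(1 / c) \<cdot>\<^sub>m (c \<cdot>\<^sub>m 1\<^sub>m n) = 1\<^sub>m n" using c by (intro eq_matI) auto
  finally show "(1 / c) \<cdot>\<^sub>m mat_inv A * (c \<cdot>\<^sub>m A) = 1\<^sub>m n" .
qed

lemma hcat_four_block:
  assumes "A \<in> carrier_mat n a" "B \<in> carrier_mat n b"
  shows "hcat A B = four_block_mat A B (0\<^sub>m 0 a) (0\<^sub>m 0 b)"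
  using assms carrier_matD[OF hcat_carrier[OF assms]] by (intro eq_matI) (auto simp: index_hcat[of _ n a _ b])

lemma hcat_mult_append:
  assumes A: "A \<in> carrier_mat n a" and B: "B \<in> carrier_mat n b" and x: "x \<in> carrier_vec a" and y: "y \<in> carrier_vec b"
  shows "hcat A B *\<^sub>v (x @\<^sub>v y) = A *\<^sub>v x + B *\<^sub>v y"
proof -
  have "hcat A B *\<^sub>v (x @\<^sub>v y) = (A *\<^sub>v x + B *\<^sub>v y) @\<^sub>v (0\<^sub>m 0 a *\<^sub>v x + 0\<^sub>m 0 b *\<^sub>v y)"
    unfolding hcat_four_block[OF A B] by (rule four_block_mat_mult_vec[OF A B _ _ x y]) auto
  also have "\<dots> = A *\<^sub>v x + B *\<^sub>v y" using A B by (intro eq_vecI) auto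
  finally show ?thesis .
qed

lemma hcat_mult_four_block:
  assumes A: "A \<in> carrier_mat n a" and B: "B \<in> carrier_mat n b"
    and Q: "Q11 \<in> carrier_mat a c" "Q12 \<in> carrier_mat a d" "Q21 \<in> carrier_mat b c" "Q22 \<in> carrier_mat b d"
  shows "hcat A B * four_block_mat Q11 Q12 Q21 Q22 = hcat (A * Q11 + B * Q21) (A * Q12 + B * Q22)"
proof -
  have c: "A * Q11 + B * Q21 \<in> carrier_mat n c" "A * Q12 + B * Q22 \<in> carrier_mat n d"
    using assms by (auto intro!: add_carrier_mat)
  have z: "0\<^sub>m 0 a * Q11 + 0\<^sub>m 0 b * Q21 = 0\<^sub>m 0 c" "0\<^sub>m 0 a * Q12 + 0\<^sub>m 0 b * Q22 = 0\<^sub>m 0 d"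
    using Q by (auto intro!: eq_matI)
  show ?thesis unfolding hcat_four_block[OF A B] hcat_four_block[OF c]
    by (subst mult_four_block_mat[OF A B zero_carrier_mat[of 0 a] zero_carrier_mat[of 0 b] Q]) (simp add: z)
qed

lemma hcat_add:
  assumes "A \<in> carrier_mat n a" "B \<in> carrier_mat n b" "A' \<in> carrier_mat n a" "B' \<in> carrier_mat n b"
  shows "hcat A B + hcat A' B' = hcat (A + A') (B + B')"
proof -
  have c: "A + A' \<in> carrier_mat n a" "B + B' \<in> carrier_mat n b" using assms by auto
  show ?thesis using assms c carrier_matD[OF hcat_carrier[OF assms(1,2)]] carrier_matD[OF hcat_carrier[OF assms(3,4)]]
      carrier_matD[OF hcat_carrier[OF c]]
    by (intro eq_matI) (auto simp: index_hcat[of _ n a _ b])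
qed

lemma block_pencil:
  assumes "A \<in> carrier_mat a a" "B \<in> carrier_mat a a" "C \<in> carrier_mat b b" "D \<in> carrier_mat b b"
  shows "four_block_mat A (0\<^sub>m a b) (0\<^sub>m b a) C - z \<cdot>\<^sub>m four_block_mat B (0\<^sub>m a b) (0\<^sub>m b a) D
    = four_block_mat (A - z \<cdot>\<^sub>m B) (0\<^sub>m a b) (0\<^sub>m b a) (C - z \<cdot>\<^sub>m (D :: complex mat))"
  using assms by (intro eq_matI) auto

lemma block_diag_inverse:
  assumes D1: "D1 \<in> carrier_mat a a" "det D1 \<noteq> 0" and D2: "D2 \<in> carrier_mat b b" "det D2 \<noteq> 0"
  shows "mat_inv (four_block_mat D1 (0\<^sub>m a b) (0\<^sub>m b a) D2)
    = four_block_mat (mat_inv D1) (0\<^sub>m a b) (0\<^sub>m b a) (mat_inv D2)"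
proof (rule mat_inv_unique(2))
  note I1 = mat_inv_props[OF D1] and I2 = mat_inv_props[OF D2]
  show "four_block_mat D1 (0\<^sub>m a b) (0\<^sub>m b a) D2 \<in> carrier_mat (a + b) (a + b)"
    by (rule four_block_carrier_mat[OF D1(1) D2(1)])
  show "four_block_mat (mat_inv D1) (0\<^sub>m a b) (0\<^sub>m b a) (mat_inv D2) \<in> carrier_mat (a + b) (a + b)"
    by (rule four_block_carrier_mat[OF I1(1) I2(1)])
  show "four_block_mat (mat_inv D1) (0\<^sub>m a b) (0\<^sub>m b a) (mat_inv D2) * four_block_mat D1 (0\<^sub>m a b) (0\<^sub>m b a) D2 = 1\<^sub>m (a + b)"
    by (subst mult_four_block_mat[OF I1(1) _ _ I2(1) D1(1) _ _ D2(1)]) (use I1 I2 D1 D2 in \<open>auto intro!: eq_matI\<close>)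
qed

text \<open>
  Of the two summands, one carries the poles in the disc and is subject to a coprime factorization, while the
  other is holomorphic in the disc.
\<close>

lemma block_resolvent:
  assumes Ca: "Ca \<in> carrier_mat q a" and Cb: "Cb \<in> carrier_mat q b"
    and D1: "D1 \<in> carrier_mat a a" "det D1 \<noteq> 0" and D2: "D2 \<in> carrier_mat b b" "det D2 \<noteq> 0"
    and X: "X11 \<in> carrier_mat a c" "X12 \<in> carrier_mat a d" "X21 \<in> carrier_mat b c" "X22 \<in> carrier_mat b d"
  shows "hcat Ca Cb * mat_inv (four_block_mat D1 (0\<^sub>m a b) (0\<^sub>m b a) D2) * four_block_mat X11 X12 X21 X22
    = Ca * mat_inv D1 * hcat X11 X12 + Cb * mat_inv D2 * hcat X21 X22"
proof -
  note I1 = mat_inv_props(1)[OF D1] and I2 = mat_inv_props(1)[OF D2]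
  note C1 = mult_carrier_mat[OF Ca I1] and C2 = mult_carrier_mat[OF Cb I2]
  have e: "Ca * mat_inv D1 + Cb * 0\<^sub>m b a = Ca * mat_inv D1" "Ca * 0\<^sub>m a b + Cb * mat_inv D2 = Cb * mat_inv D2"
    using Ca Cb C1 C2 by auto
  have "hcat Ca Cb * mat_inv (four_block_mat D1 (0\<^sub>m a b) (0\<^sub>m b a) D2) = hcat (Ca * mat_inv D1) (Cb * mat_inv D2)"
    unfolding block_diag_inverse[OF D1 D2]
    by (subst hcat_mult_four_block[OF Ca Cb I1 _ _ I2]) (simp_all add: e)
  thus ?thesis
    by (simp add: hcat_mult_four_block[OF C1 C2 X] mult_hcat[OF C1 X(1,2)] mult_hcat[OF C2 X(3,4)]
        hcat_add[OF mult_carrier_mat[OF C1 X(1)] mult_carrier_mat[OF C1 X(2)] mult_carrier_mat[OF C2 X(3)] mult_carrier_mat[OF C2 X(4)]])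
qed

lemma block_kernel:
  assumes Ca: "Ca \<in> carrier_mat q a" and Cb: "Cb \<in> carrier_mat q b"
    and D1: "D1 \<in> carrier_mat a a" and D2: "D2 \<in> carrier_mat b b"
    and v: "v \<in> carrier_vec (a + b)" and Dv: "four_block_mat D1 (0\<^sub>m a b) (0\<^sub>m b a) D2 *\<^sub>v v = 0\<^sub>v (a + b)"
    and Cv: "hcat Ca Cb *\<^sub>v v = 0\<^sub>v q"
  obtains x y where "x \<in> carrier_vec a" "y \<in> carrier_vec b" "v = x @\<^sub>v y"
    "D1 *\<^sub>v x = 0\<^sub>v a" "D2 *\<^sub>v y = 0\<^sub>v b" "Ca *\<^sub>v x + Cb *\<^sub>v y = 0\<^sub>v q"
proof -
  obtain x y where x: "x \<in> carrier_vec a" and y: "y \<in> carrier_vec b" and vxy: "v = x @\<^sub>v y"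
    using v by (metis vec_first_carrier vec_last_carrier vec_first_last_append)
  have zero: "0\<^sub>v (a + b) = 0\<^sub>v a @\<^sub>v (0\<^sub>v b :: complex vec)" by (intro eq_vecI) auto
  have "D1 *\<^sub>v x @\<^sub>v D2 *\<^sub>v y = 0\<^sub>v a @\<^sub>v 0\<^sub>v b"
    using Dv unfolding vxy mult_mat_vec_split[OF D1 D2 x y] zero .
  hence D: "D1 *\<^sub>v x = 0\<^sub>v a" "D2 *\<^sub>v y = 0\<^sub>v b"
    using append_vec_eq[OF mult_mat_vec_carrier[OF D1 x], of "0\<^sub>v a"] by auto
  have "Ca *\<^sub>v x + Cb *\<^sub>v y = 0\<^sub>v q" using Cv unfolding vxy hcat_mult_append[OF Ca Cb x y] .
  thus ?thesis using that x y vxy D by blast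
qed

lemma shifted_kernel_eigenvector:
  fixes A :: "complex mat"
  assumes A: "A \<in> carrier_mat n n" and x: "x \<in> carrier_vec n" and 0: "(A - z \<cdot>\<^sub>m 1\<^sub>m n) *\<^sub>v x = 0\<^sub>v n"
  shows "A *\<^sub>v x = z \<cdot>\<^sub>v x"
proof (rule eq_vecI)
  have "(A - z \<cdot>\<^sub>m 1\<^sub>m n) *\<^sub>v x = A *\<^sub>v x - (z \<cdot>\<^sub>m 1\<^sub>m n) *\<^sub>v x" using A x by (intro minus_mult_distrib_mat_vec) auto
  also have "(z \<cdot>\<^sub>m 1\<^sub>m n) *\<^sub>v x = z \<cdot>\<^sub>v x" using x by (intro eq_vecI) auto
  finally have e: "A *\<^sub>v x - z \<cdot>\<^sub>v x = 0\<^sub>v n" using 0 by simp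
  fix i assume "i < dim_vec (z \<cdot>\<^sub>v x)"
  hence i: "i < n" using x by simp
  have "(A *\<^sub>v x - z \<cdot>\<^sub>v x) $ i = 0\<^sub>v n $ i" by (simp only: e)
  thus "(A *\<^sub>v x) $ i = (z \<cdot>\<^sub>v x) $ i" using i x A by (simp del: index_mult_mat_vec)
qed (use A x in auto)

text \<open>The part of the Hautus test that is used: an eigenvector in the kernel of \<open>C\<close> lies in the kernel of every \<open>C A\<^sup>j\<close>.\<close>

lemma observable_eigenvector:
  assumes obs: "observable n C A" and C: "C \<in> carrier_mat r n" and A: "A \<in> carrier_mat n n"
    and x: "x \<in> carrier_vec n" and Ax: "A *\<^sub>v x = z \<cdot>\<^sub>v x" and Cx: "C *\<^sub>v x = 0\<^sub>v r"
  shows "x = 0\<^sub>v n"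
proof -
  have pow: "A ^\<^sub>m j *\<^sub>v x = z ^ j \<cdot>\<^sub>v x" for j
  proof (induct j)
    case 0 show ?case using x A by simp
  next
    case (Suc j)
    have "A ^\<^sub>m Suc j *\<^sub>v x = A ^\<^sub>m j *\<^sub>v (A *\<^sub>v x)" using A x by (simp add: assoc_mult_mat_vec[of _ n n _ n])
    also have "\<dots> = z \<cdot>\<^sub>v (A ^\<^sub>m j *\<^sub>v x)" unfolding Ax using A x by (intro mult_mat_vec) auto
    also have "\<dots> = z ^ Suc j \<cdot>\<^sub>v x" unfolding Suc by (simp add: smult_smult_assoc)
    finally show ?case .
  qed
  have "x \<in> mat_kernel (C * A ^\<^sub>m j)" for j
  proof (rule mat_kernelI)
    show "C * A ^\<^sub>m j \<in> carrier_mat r n" using C A by (auto intro: mult_carrier_mat pow_carrier_mat)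
    have "(C * A ^\<^sub>m j) *\<^sub>v x = C *\<^sub>v (A ^\<^sub>m j *\<^sub>v x)" using C A x by (intro assoc_mult_mat_vec) auto
    also have "\<dots> = z ^ j \<cdot>\<^sub>v (C *\<^sub>v x)" unfolding pow using C x by (intro mult_mat_vec) auto
    finally show "(C * A ^\<^sub>m j) *\<^sub>v x = 0\<^sub>v r" unfolding Cx by (auto intro!: eq_vecI)
  qed (rule x)
  thus ?thesis using obs unfolding observable_def by blast
qed

lemma spectrum_disc_nonsingular:
  assumes A: "A \<in> carrier_mat n n" and sp: "spectrum A \<subseteq> ball 0 1"
  shows "1 \<le> cmod z \<Longrightarrow> det (A - z \<cdot>\<^sub>m 1\<^sub>m n) \<noteq> 0" "cmod z \<le> 1 \<Longrightarrow> det (1\<^sub>m n - z \<cdot>\<^sub>m A) \<noteq> 0"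
proof -
  have ev: "cmod e < 1" if "v \<in> carrier_vec n" "v \<noteq> 0\<^sub>v n" "A *\<^sub>v v = e \<cdot>\<^sub>v v" for e v
  proof -
    have "e \<in> spectrum A" using that A by (auto simp: spectrum_def eigenvalue_def eigenvector_def)
    thus ?thesis using sp by auto
  qed
  have c1: "A - z \<cdot>\<^sub>m 1\<^sub>m n \<in> carrier_mat n n" and c2: "1\<^sub>m n - z \<cdot>\<^sub>m A \<in> carrier_mat n n" using A by auto
  show "det (A - z \<cdot>\<^sub>m 1\<^sub>m n) \<noteq> 0" if "1 \<le> cmod z" unfolding det_nonzero_iff_inj[OF c1]
  proof (intro ballI impI)
    fix v :: "complex vec" assume v: "v \<in> carrier_vec n" and 0: "(A - z \<cdot>\<^sub>m 1\<^sub>m n) *\<^sub>v v = 0\<^sub>v n"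
    have "A *\<^sub>v v = z \<cdot>\<^sub>v v" by (rule shifted_kernel_eigenvector[OF A v 0])
    thus "v = 0\<^sub>v n" using ev[OF v] that by force
  qed
  show "det (1\<^sub>m n - z \<cdot>\<^sub>m A) \<noteq> 0" if z: "cmod z \<le> 1" unfolding det_nonzero_iff_inj[OF c2]
  proof (intro ballI impI)
    fix v :: "complex vec" assume v: "v \<in> carrier_vec n" and 0: "(1\<^sub>m n - z \<cdot>\<^sub>m A) *\<^sub>v v = 0\<^sub>v n"
    have Av: "A *\<^sub>v v \<in> carrier_vec n" by (rule mult_mat_vec_carrier[OF A v])
    have "(1\<^sub>m n - z \<cdot>\<^sub>m A) *\<^sub>v v = 1\<^sub>m n *\<^sub>v v - (z \<cdot>\<^sub>m A) *\<^sub>v v" using A v by (intro minus_mult_distrib_mat_vec) auto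
    also have "(z \<cdot>\<^sub>m A) *\<^sub>v v = z \<cdot>\<^sub>v (A *\<^sub>v v)" using A v by (intro eq_vecI) auto
    finally have e: "v - z \<cdot>\<^sub>v (A *\<^sub>v v) = 0\<^sub>v n" using 0 v by simp
    have ei: "v $ i = z * (A *\<^sub>v v) $ i" if "i < n" for i
    proof -
      have "(v - z \<cdot>\<^sub>v (A *\<^sub>v v)) $ i = 0\<^sub>v n $ i" by (simp only: e)
      thus ?thesis using that v Av A by (simp del: index_mult_mat_vec)
    qed
    show "v = 0\<^sub>v n"
    proof (cases "z = 0")
      case True
      thus ?thesis using ei v by (intro eq_vecI) auto
    next
      case False
      hence "A *\<^sub>v v = (1 / z) \<cdot>\<^sub>v v" using ei v Av A by (intro eq_vecI) (auto simp del: index_mult_mat_vec)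
      moreover have "1 \<le> cmod (1 / z)" using z False by (simp add: norm_divide divide_simps)
      ultimately show ?thesis using ev[OF v, of "1 / z"] by force
    qed
  qed
qed

section \<open>Row blocks\<close>

lemma jpq_eq_dmat: "jpq p q = dmat (p + q) (\<lambda>i. if i < p then 1 else -1)"
  by (intro eq_matI) (auto simp: jpq_def)

lemma sum_lessThan_add: "(\<Sum>k<p + q. f k) = (\<Sum>k<p. f k) + (\<Sum>k<q. f (p + k :: nat) :: complex)"
  by (induct q) (auto simp: add_ac)

lemma hcat_rows:
  assumes "C11 \<in> carrier_mat p n1" "C12 \<in> carrier_mat p n2" "C21 \<in> carrier_mat q n1" "C22 \<in> carrier_mat q n2"
    "j < n1 + n2"
  shows "i < p \<Longrightarrow> four_block_mat C11 C12 C21 C22 $$ (i, j) = hcat C11 C12 $$ (i, j)"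
    "i < q \<Longrightarrow> four_block_mat C11 C12 C21 C22 $$ (p + i, j) = hcat C21 C22 $$ (i, j)"
  using assms by (auto simp: index_hcat[of _ p n1 _ n2] index_hcat[of _ q n1 _ n2])

lemma index_mult_adjoint:
  fixes A B :: "complex mat"
  assumes "A \<in> carrier_mat r n" "B \<in> carrier_mat s n" "i < r" "j < s"
  shows "(A * mat_adjoint B) $$ (i, j) = (\<Sum>k<n. A $$ (i, k) * cnj (B $$ (j, k)))"
  using assms by (simp add: scalar_prod_def atLeast0LessThan)

text \<open>The relation \<open>C = [C1; C2]\<close> is stated entrywise, so that it visibly passes to \<open>C K = [C1 K; C2 K]\<close>.\<close>

locale row_blocks =
  fixes p q n :: nat and C C1 C2 :: "complex mat"
  assumes C: "C \<in> carrier_mat (p + q) n" and C1: "C1 \<in> carrier_mat p n" and C2: "C2 \<in> carrier_mat q n"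
    and upper: "\<And>i j. i < p \<Longrightarrow> j < n \<Longrightarrow> C $$ (i, j) = C1 $$ (i, j)"
    and lower: "\<And>i j. i < q \<Longrightarrow> j < n \<Longrightarrow> C $$ (p + i, j) = C2 $$ (i, j)"
begin

lemma mult:
  assumes K: "K \<in> carrier_mat n m"
  shows "row_blocks p q m (C * K) (C1 * K) (C2 * K)"
proof
  show "C * K \<in> carrier_mat (p + q) m" "C1 * K \<in> carrier_mat p m" "C2 * K \<in> carrier_mat q m"
    using C C1 C2 K by (auto intro: mult_carrier_mat)
qed (use C C1 C2 K in \<open>auto simp: scalar_prod_def upper lower intro!: sum.cong\<close>)

lemma signature_gram: "mat_adjoint C * jpq p q * C = mat_adjoint C1 * C1 - mat_adjoint C2 * C2"
proof (rule eq_matI)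
  fix i j assume "i < dim_row (mat_adjoint C1 * C1 - mat_adjoint C2 * C2)"
    "j < dim_col (mat_adjoint C1 * C1 - mat_adjoint C2 * C2)"
  hence ij: "i < n" "j < n" using C2 by auto
  have "(mat_adjoint C * jpq p q * C) $$ (i, j)
      = (\<Sum>k<p + q. cnj (C $$ (k, i)) * (if k < p then 1 else -1) * C $$ (k, j))"
    unfolding jpq_eq_dmat dmat_mult_right[OF mat_adjoint_carrier[OF C]]
    using ij C by (simp add: scalar_prod_def atLeast0LessThan)
  also have "\<dots> = (\<Sum>k<p. cnj (C1 $$ (k, i)) * C1 $$ (k, j)) - (\<Sum>k<q. cnj (C2 $$ (k, i)) * C2 $$ (k, j))"
    unfolding sum_lessThan_add using ij by (simp add: upper lower sum_negf)
  also have "\<dots> = (mat_adjoint C1 * C1 - mat_adjoint C2 * C2) $$ (i, j)"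
    using ij C1 C2 by (simp add: scalar_prod_def atLeast0LessThan)
  finally show "(mat_adjoint C * jpq p q * C) $$ (i, j) = (mat_adjoint C1 * C1 - mat_adjoint C2 * C2) $$ (i, j)" .
qed (use C C1 C2 in auto)

lemma W_blocks:
  assumes M: "M \<in> carrier_mat n n" and N: "N \<in> carrier_mat n n" and X: "X \<in> carrier_mat n n"
    and W: "split_block (W_mvf p q C M N X \<mu> z) p p = (w11, w12, w21, w22)"
  shows "w11 = 1\<^sub>m p - transfer_block C1 C1 M N X \<mu> z" "w12 = transfer_block C1 C2 M N X \<mu> z"
    "w21 = (-1) \<cdot>\<^sub>m transfer_block C2 C1 M N X \<mu> z" "w22 = 1\<^sub>m q + transfer_block C2 C2 M N X \<mu> z"
proof -
  define K where "K = mat_inv (M - z \<cdot>\<^sub>m N) * X"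
  define K' where "K' = mat_inv (M - \<mu> \<cdot>\<^sub>m N)"
  have I: "mat_inv (M - z \<cdot>\<^sub>m N) \<in> carrier_mat n n" using M N by (intro mat_inv_carrier) auto
  have K: "K \<in> carrier_mat n n" using I X unfolding K_def by (rule mult_carrier_mat)
  have K': "K' \<in> carrier_mat n n" using M N unfolding K'_def by (intro mat_inv_carrier) auto
  interpret a: row_blocks p q n "C * K" "C1 * K" "C2 * K" by (rule mult[OF K])
  interpret b: row_blocks p q n "C * K'" "C1 * K'" "C2 * K'" by (rule mult[OF K'])
  define u where "u = (1 - z * cnj \<mu>)"
  have lr: "transfer_block Ca Cb M N X \<mu> z $$ (i, j) = u * (\<Sum>k<n. (Ca * K) $$ (i, k) * cnj ((Cb * K') $$ (j, k)))"
    if "Ca \<in> carrier_mat r n" "Cb \<in> carrier_mat s n" "i < r" "j < s" for Ca Cb r s i j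
  proof -
    have e: "Ca * mat_inv (M - z \<cdot>\<^sub>m N) * X = Ca * K" unfolding K_def by (rule assoc_mult_mat[OF that(1) I X])
    have c: "Ca * K \<in> carrier_mat r n" "Cb * K' \<in> carrier_mat s n" using that K K' by auto
    show "transfer_block Ca Cb M N X \<mu> z $$ (i, j) = u * (\<Sum>k<n. (Ca * K) $$ (i, k) * cnj ((Cb * K') $$ (j, k)))"
      using c that unfolding transfer_block_def e u_def K'_def[symmetric]
      by (simp add: index_mult_adjoint[OF c that(3,4)] del: index_mult_mat(1))
  qed
  have lrd: "dim_row (transfer_block Ca Cb M N X \<mu> z) = r" "dim_col (transfer_block Ca Cb M N X \<mu> z) = s"
    if "Ca \<in> carrier_mat r n" "Cb \<in> carrier_mat s n" for Ca Cb r s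
    using that by (simp_all add: transfer_block_def)
  define s where "s = (\<lambda>j. if j < p then 1 else - 1 :: complex)"
  have Wij: "W_mvf p q C M N X \<mu> z $$ (i, j) = (if i = j then 1 else 0)
      - u * (\<Sum>k<n. (C * K) $$ (i, k) * cnj ((C * K') $$ (j, k))) * s j" if "i < p + q" "j < p + q" for i j
  proof -
    have e: "F_mvf C M N z * X = C * K" unfolding K_def F_mvf_def by (rule assoc_mult_mat[OF C I X])
    have c: "C * K * mat_adjoint (C * K') \<in> carrier_mat (p + q) (p + q)"
      by (rule mult_carrier_mat[OF a.C mat_adjoint_carrier[OF b.C]])
    show ?thesis
      unfolding W_mvf_def e u_def[symmetric] jpq_eq_dmat F_mvf_def[of C M N \<mu>] K'_def[symmetric] dmat_mult_right[OF c]
      using that by (simp add: index_mult_adjoint[OF a.C b.C that] s_def del: index_mult_mat(1))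
  qed
  have Wd: "dim_row (W_mvf p q C M N X \<mu> z) = p + q" "dim_col (W_mvf p q C M N X \<mu> z) = p + q"
    using C by (simp_all add: W_mvf_def jpq_def F_mvf_def)
  have w: "w11 = mat p p (\<lambda>ij. W_mvf p q C M N X \<mu> z $$ ij)"
    "w12 = mat p q (\<lambda>(i, j). W_mvf p q C M N X \<mu> z $$ (i, j + p))"
    "w21 = mat q p (\<lambda>(i, j). W_mvf p q C M N X \<mu> z $$ (i + p, j))"
    "w22 = mat q q (\<lambda>(i, j). W_mvf p q C M N X \<mu> z $$ (i + p, j + p))"
    using W unfolding split_block_def Let_def Wd by auto
  note aa = a.upper b.upper a.lower b.lower
  show "w11 = 1\<^sub>m p - transfer_block C1 C1 M N X \<mu> z"
    using lrd[OF C1 C1] unfolding w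
    by (intro eq_matI) (auto simp: Wij lr[OF C1 C1] aa s_def simp del: index_mult_mat(1))
  show "w12 = transfer_block C1 C2 M N X \<mu> z"
    using lrd[OF C1 C2] unfolding w
    by (intro eq_matI) (auto simp: Wij lr[OF C1 C2] aa s_def add.commute[of _ p] simp del: index_mult_mat(1))
  show "w21 = (-1) \<cdot>\<^sub>m transfer_block C2 C1 M N X \<mu> z"
    using lrd[OF C2 C1] unfolding w
    by (intro eq_matI) (auto simp: Wij lr[OF C2 C1] aa s_def add.commute[of _ p] simp del: index_mult_mat(1))
  show "w22 = 1\<^sub>m q + transfer_block C2 C2 M N X \<mu> z"
    using lrd[OF C2 C2] unfolding w
    by (intro eq_matI) (auto simp: Wij lr[OF C2 C2] aa s_def add.commute[of _ p] simp del: index_mult_mat(1))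
qed

end

section \<open>The zero count for coprime factorizations\<close>

lemma det_smult_nonzero:
  assumes "A \<in> carrier_mat n n" "c \<noteq> 0"
  shows "det (c \<cdot>\<^sub>m A) \<noteq> 0 \<longleftrightarrow> det (A :: complex mat) \<noteq> 0"
  using assms by simp

lemma hol_pencil:
  assumes "M \<in> carrier_mat n n" "N \<in> carrier_mat n n"
  shows "hol_mat S n n (\<lambda>z. M - z \<cdot>\<^sub>m N)"
proof (rule mat_funI)
  fix i j assume "i < n" "j < n"
  hence "(M - z \<cdot>\<^sub>m N) $$ (i, j) = M $$ (i, j) - z * N $$ (i, j)" for z using assms by simp
  thus "(\<lambda>z. (M - z \<cdot>\<^sub>m N) $$ (i, j)) holomorphic_on S" by (simp add: holomorphic_intros)
qed (use assms in auto)

lemma det_pencil_eventually_nonzero: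
  fixes M N :: "complex mat"
  assumes M: "M \<in> carrier_mat n n" and N: "N \<in> carrier_mat n n" and d: "det (M - z \<cdot>\<^sub>m N) \<noteq> 0"
  shows "\<exists>S. open S \<and> z \<in> S \<and> (\<forall>w\<in>S. det (M - w \<cdot>\<^sub>m N) \<noteq> 0)"
proof -
  have "(\<lambda>w. det (M - w \<cdot>\<^sub>m N)) holomorphic_on UNIV" by (rule fun_alg.det[OF fun_alg_hol hol_pencil[OF M N]])
  hence "continuous_on UNIV (\<lambda>w. det (M - w \<cdot>\<^sub>m N))" by (rule holomorphic_on_imp_continuous_on)
  hence "open ((\<lambda>w. det (M - w \<cdot>\<^sub>m N)) -` (- {0}))" by (rule open_vimage[rotated]) auto
  thus ?thesis using d by (intro exI[of _ "(\<lambda>w. det (M - w \<cdot>\<^sub>m N)) -` (- {0})"]) auto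
qed

lemma hol_resolvent:
  assumes M: "M \<in> carrier_mat n n" and N: "N \<in> carrier_mat n n" and Ca: "Ca \<in> carrier_mat r n" and Y: "Y \<in> carrier_mat n m"
    and S: "\<And>z. z \<in> S \<Longrightarrow> det (M - z \<cdot>\<^sub>m N) \<noteq> 0"
  shows "hol_mat S r m (\<lambda>z. Ca * mat_inv (M - z \<cdot>\<^sub>m N) * Y)"
proof -
  interpret fun_alg S "\<lambda>f. f holomorphic_on S" by (rule fun_alg_hol)
  show ?thesis
    by (intro mat_mult[OF mat_mult[OF mat_const[OF Ca] hol_mat_inv[OF hol_pencil[OF M N] S]] mat_const[OF Y]])
qed

lemma hol_transfer_block:
  assumes M: "M \<in> carrier_mat n n" and N: "N \<in> carrier_mat n n" and X: "X \<in> carrier_mat n n"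
    and Ca: "Ca \<in> carrier_mat r n" and Cb: "Cb \<in> carrier_mat s n"
    and S: "\<And>z. z \<in> S \<Longrightarrow> det (M - z \<cdot>\<^sub>m N) \<noteq> 0"
  shows "hol_mat S r s (transfer_block Ca Cb M N X \<mu>)"
proof -
  interpret fun_alg S "\<lambda>f. f holomorphic_on S" by (rule fun_alg_hol)
  have "Cb * mat_inv (M - \<mu> \<cdot>\<^sub>m N) \<in> carrier_mat s n"
    using M N Cb by (intro mult_carrier_mat[OF Cb] mat_inv_carrier) auto
  hence c: "mat_adjoint (Cb * mat_inv (M - \<mu> \<cdot>\<^sub>m N)) \<in> carrier_mat n s" by (rule mat_adjoint_carrier)
  show ?thesis unfolding transfer_block_def[abs_def]
    by (intro mat_smult mat_mult[OF hol_resolvent[OF M N Ca X S] mat_const[OF c]] holomorphic_intros)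
qed

text \<open>
  Identities between meromorphic functions are known away from isolated points; continuity
  carries them to every point where the pencil is invertible. The origin corresponds to the point at infinity in the application to the
  exterior of the disc, where isolated exceptional points may accumulate; it is reached last, by a second passage to
  the limit.
\<close>

lemma continuous_identity:
  fixes F G :: "complex \<Rightarrow> complex mat"
  assumes M: "M \<in> carrier_mat n n" and N: "N \<in> carrier_mat n n"
    and F: "hol_mat (ball 0 1) r c F"
    and G: "\<And>S. S \<subseteq> ball 0 1 \<Longrightarrow> (\<And>z. z \<in> S \<Longrightarrow> det (M - z \<cdot>\<^sub>m N) \<noteq> 0) \<Longrightarrow> hol_mat S r c G"
    and ev: "\<And>z. z \<in> ball 0 1 - {0} \<Longrightarrow> \<forall>\<^sub>F w in at z. det (M - w \<cdot>\<^sub>m N) \<noteq> 0 \<longrightarrow> F w = G w"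
    and z: "z \<in> ball 0 1" "det (M - z \<cdot>\<^sub>m N) \<noteq> 0"
  shows "F z = G z"
proof -
  have step: "F z = G z" if z: "z \<in> ball 0 1" "det (M - z \<cdot>\<^sub>m N) \<noteq> 0"
    and ev: "\<forall>\<^sub>F w in at z. w \<in> ball 0 1 \<longrightarrow> det (M - w \<cdot>\<^sub>m N) \<noteq> 0 \<longrightarrow> F w = G w" for z
  proof -
    obtain S where S: "open S" "z \<in> S" "\<And>w. w \<in> S \<Longrightarrow> det (M - w \<cdot>\<^sub>m N) \<noteq> 0"
      using det_pencil_eventually_nonzero[OF M N z(2)] by blast
    define T where "T = S \<inter> ball 0 1"
    have T: "open T" "z \<in> T" "T \<subseteq> ball 0 1" "\<And>w. w \<in> T \<Longrightarrow> det (M - w \<cdot>\<^sub>m N) \<noteq> 0"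
      using S z by (auto simp: T_def)
    have "\<forall>\<^sub>F w in at z. w \<in> T" using T by (intro eventually_at_in_open')
    hence "\<forall>\<^sub>F w in at z. F w = G w" using ev by eventually_elim (use T in auto)
    moreover have "hol_mat T r c G" by (rule G) (use T in auto)
    ultimately show ?thesis
      by (intro mat_fun_continuous_eq[OF hol_mat_cont[OF F T(3)] hol_mat_cont[OF _ order.refl] T(1,2)])
  qed
  have nz: "F w = G w" if "w \<in> ball 0 1 - {0}" "det (M - w \<cdot>\<^sub>m N) \<noteq> 0" for w
    using that ev[OF that(1)] by (intro step) (auto elim: eventually_mono)
  show ?thesis
  proof (rule step[OF z])
    have "\<forall>\<^sub>F w in at z. w \<noteq> 0" by (rule eventually_neq_at_within)
    thus "\<forall>\<^sub>F w in at z. w \<in> ball 0 1 \<longrightarrow> det (M - w \<cdot>\<^sub>m N) \<noteq> 0 \<longrightarrow> F w = G w"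
      by eventually_elim (use nz in auto)
  qed
qed

text \<open>
  Here \<open>b\<^sup>-\<^sup>1 \<phi>\<close> is the part of \<open>C2 (M - z N)\<^sup>-\<^sup>1 X\<close> with poles in the disc, and \<open>Hr\<close> is the rest. Then \<open>\<psi> = \<phi> + b Hr\<close> is as in
  \<open>pencil_zero_count\<close>, and adding a multiple of \<open>b\<close> to \<open>\<phi>\<close> does not affect coprimeness with \<open>b\<close>.
\<close>

theorem coprime_pencil_zero_count:
  fixes M N P X C1 C2 :: "complex mat"
  assumes M: "M \<in> carrier_mat n n" and N: "N \<in> carrier_mat n n"
    and C1: "C1 \<in> carrier_mat p n" and C2: "C2 \<in> carrier_mat q n"
    and P: "hermitian_mat n P" and X: "hermitian_mat n X"
    and XPX: "X * P * X = X" and PXP: "P * X * P = P"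
    and invM: "\<And>v. v \<in> mat_range X \<Longrightarrow> M *\<^sub>v v \<in> mat_range X"
    and invN: "\<And>v. v \<in> mat_range X \<Longrightarrow> N *\<^sub>v v \<in> mat_range X"
    and lyapunov: "mat_adjoint M * P * M - mat_adjoint N * P * N = mat_adjoint C1 * C1 - mat_adjoint C2 * C2"
    and \<mu>: "cmod \<mu> = 1" and regular: "\<And>z. cmod z = 1 \<Longrightarrow> det (M - z \<cdot>\<^sub>m N) \<noteq> 0"
    and obs: "\<And>z v. cmod z < 1 \<Longrightarrow> v \<in> carrier_vec n \<Longrightarrow> (M - z \<cdot>\<^sub>m N) *\<^sub>v v = 0\<^sub>v n \<Longrightarrow>
        C2 *\<^sub>v v = 0\<^sub>v q \<Longrightarrow> v = 0\<^sub>v n"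
    and b: "inner_mvf q d Rb b" and \<theta>: "inner_mvf q \<kappa> R\<theta> \<theta>"
    and \<phi>: "hol_mat (ball 0 1) q n \<phi>" and Hr: "hol_mat (ball 0 1) q n Hr"
    and \<phi>b: "\<And>z. z \<in> ball 0 1 - {0} \<Longrightarrow> \<forall>\<^sub>F w in at z. det (M - w \<cdot>\<^sub>m N) \<noteq> 0 \<longrightarrow>
        \<phi> w + b w * Hr w = b w * (C2 * mat_inv (M - w \<cdot>\<^sub>m N) * X)"
    and left: "\<And>z u. z \<in> ball 0 1 \<Longrightarrow> u \<in> carrier_vec q \<Longrightarrow> mat_adjoint (b z) *\<^sub>v u = 0\<^sub>v q \<Longrightarrow>
        mat_adjoint (\<phi> z) *\<^sub>v u = 0\<^sub>v n \<Longrightarrow> u = 0\<^sub>v q"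
    and \<phi>21: "hol_mat (ball 0 1) q p \<phi>21" and \<phi>22: "hol_mat (ball 0 1) q q \<phi>22"
    and \<phi>21b: "\<And>z. z \<in> ball 0 1 - {0} \<Longrightarrow> \<forall>\<^sub>F w in at z. det (M - w \<cdot>\<^sub>m N) \<noteq> 0 \<longrightarrow>
        \<phi>21 w = b w * ((-1) \<cdot>\<^sub>m transfer_block C2 C1 M N X \<mu> w)"
    and \<phi>22b: "\<And>z. z \<in> ball 0 1 - {0} \<Longrightarrow> \<forall>\<^sub>F w in at z. det (M - w \<cdot>\<^sub>m N) \<noteq> 0 \<longrightarrow>
        \<phi>22 w = b w * (1\<^sub>m q + transfer_block C2 C2 M N X \<mu> w)"
    and \<epsilon>: "hol_mat (ball 0 1) p q \<epsilon>"
    and contr: "\<And>z y. z \<in> ball 0 1 \<Longrightarrow> y \<in> carrier_vec p \<Longrightarrow> nsq (mat_adjoint (\<epsilon> z) *\<^sub>v y) \<le> nsq y"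
  shows "finite {z\<in>ball 0 1. det (\<phi>21 z * \<epsilon> z + \<phi>22 z * \<theta> z) = 0}"
    "zero_count 1 (\<lambda>z. det (\<phi>21 z * \<epsilon> z + \<phi>22 z * \<theta> z)) = int (neg_eigs P + \<kappa>)"
proof -
  define R where "R = min Rb R\<theta>"
  have R: "1 < R" using b \<theta> by (auto simp: R_def inner_mvf_def)
  have bR: "hol_mat (ball 0 R) q q b" and \<theta>R: "hol_mat (ball 0 R) q q \<theta>"
    using b \<theta> by (auto simp: R_def inner_mvf_def intro: hol_mat_sub)
  have b1: "hol_mat S q q b" if "S \<subseteq> ball 0 1" for S
    by (rule hol_mat_sub[OF bR]) (use R that in auto)
  have Xc: "X \<in> carrier_mat n n" using X by (simp add: hermitian_mat_def)
  note H = hol_transfer_block[OF M N Xc]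
  note fa = fun_alg_hol
  define \<psi> where "\<psi> = (\<lambda>z. \<phi> z + b z * Hr z)"
  have \<psi>: "hol_mat (ball 0 1) q n \<psi>" unfolding \<psi>_def
    by (rule fun_alg.mat_add[OF fa \<phi> fun_alg.mat_mult[OF fa b1[OF order.refl] Hr]])
  have \<psi>b: "\<psi> z = b z * (C2 * mat_inv (M - z \<cdot>\<^sub>m N) * X)" if "z \<in> ball 0 1" "det (M - z \<cdot>\<^sub>m N) \<noteq> 0" for z
    using that by (intro continuous_identity[OF M N \<psi>, where G = "\<lambda>z. b z * (C2 * mat_inv (M - z \<cdot>\<^sub>m N) * X)"])
      (use \<phi>b in \<open>auto simp: \<psi>_def intro!: fun_alg.mat_mult[OF fa b1 hol_resolvent[OF M N C2 Xc]]\<close>)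
  have \<phi>21': "\<phi>21 z = b z * ((-1) \<cdot>\<^sub>m transfer_block C2 C1 M N X \<mu> z)" if "z \<in> ball 0 1" "det (M - z \<cdot>\<^sub>m N) \<noteq> 0" for z
    using that by (intro continuous_identity[OF M N \<phi>21, where G = "\<lambda>z. b z * ((-1) \<cdot>\<^sub>m transfer_block C2 C1 M N X \<mu> z)"] \<phi>21b)
      (auto intro!: fun_alg.mat_mult[OF fa b1 fun_alg.mat_smult[OF fa _ H[OF C2 C1]]])
  have \<phi>22': "\<phi>22 z = b z * (1\<^sub>m q + transfer_block C2 C2 M N X \<mu> z)" if "z \<in> ball 0 1" "det (M - z \<cdot>\<^sub>m N) \<noteq> 0" for z
    using that by (intro continuous_identity[OF M N \<phi>22, where G = "\<lambda>z. b z * (1\<^sub>m q + transfer_block C2 C2 M N X \<mu> z)"] \<phi>22b)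
      (auto intro!: fun_alg.mat_mult[OF fa b1 fun_alg.mat_add[OF fa fun_alg.mat_const[OF fa one_carrier_mat] H[OF C2 C2]]])
  have left': "u = 0\<^sub>v q" if z: "z \<in> ball 0 1" and u: "u \<in> carrier_vec q" and bu: "mat_adjoint (b z) *\<^sub>v u = 0\<^sub>v q"
    and \<psi>u: "mat_adjoint (\<psi> z) *\<^sub>v u = 0\<^sub>v n" for z u
  proof -
    note c = mat_fun_carrier[OF \<phi> z] mat_fun_carrier[OF Hr z] mat_fun_carrier[OF b1[OF order.refl] z]
    have bH: "b z * Hr z \<in> carrier_mat q n" by (rule mult_carrier_mat[OF c(3,2)])
    have "mat_adjoint (\<psi> z) = mat_adjoint (\<phi> z) + mat_adjoint (Hr z) * mat_adjoint (b z)"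
      unfolding \<psi>_def mat_adjoint_add[OF c(1) bH] mat_adjoint_mult[OF c(3,2)] ..
    hence "mat_adjoint (\<psi> z) *\<^sub>v u = mat_adjoint (\<phi> z) *\<^sub>v u + mat_adjoint (Hr z) * mat_adjoint (b z) *\<^sub>v u"
      using add_mult_distrib_mat_vec[OF mat_adjoint_carrier[OF c(1)]
          mult_carrier_mat[OF mat_adjoint_carrier[OF c(2)] mat_adjoint_carrier[OF c(3)]] u] by simp
    also have "mat_adjoint (Hr z) * mat_adjoint (b z) *\<^sub>v u = mat_adjoint (Hr z) *\<^sub>v (mat_adjoint (b z) *\<^sub>v u)"
      by (rule assoc_mult_mat_vec[OF mat_adjoint_carrier[OF c(2)] mat_adjoint_carrier[OF c(3)] u])
    also have "\<dots> = 0\<^sub>v n" unfolding bu by (rule mult_mat_zero_vec[OF mat_adjoint_carrier[OF c(2)]])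
    finally have "mat_adjoint (\<phi> z) *\<^sub>v u = 0\<^sub>v n"
      using \<psi>u mult_mat_vec_carrier[OF mat_adjoint_carrier[OF c(1)] u] by simp
    thus ?thesis by (rule left[OF z u bu])
  qed
  have un: "\<And>z. cmod z = 1 \<Longrightarrow> b z * mat_adjoint (b z) = 1\<^sub>m q" "\<And>z. cmod z = 1 \<Longrightarrow> \<theta> z * mat_adjoint (\<theta> z) = 1\<^sub>m q"
    using b \<theta> by (auto simp: inner_mvf_def)
  show "finite {z\<in>ball 0 1. det (\<phi>21 z * \<epsilon> z + \<phi>22 z * \<theta> z) = 0}"
    by (rule pencil_zero_count(1)[where M = M and N = N and P = P and X = X and ?C1.0 = C1 and ?C2.0 = C2
          and b = b and \<psi> = \<psi> and R = R and \<mu> = \<mu> and n = n and p = p and q = q]; fact)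
  have "zero_count 1 (\<lambda>z. det (\<phi>21 z * \<epsilon> z + \<phi>22 z * \<theta> z)) = int (neg_eigs P) + zero_count 1 (\<lambda>z. det (\<theta> z))"
    by (rule pencil_zero_count(2)[where M = M and N = N and P = P and X = X and ?C1.0 = C1 and ?C2.0 = C2
          and b = b and \<psi> = \<psi> and R = R and \<mu> = \<mu> and n = n and p = p and q = q]; fact)
  thus "zero_count 1 (\<lambda>z. det (\<phi>21 z * \<epsilon> z + \<phi>22 z * \<theta> z)) = int (neg_eigs P + \<kappa>)"
    by (simp add: inner_mvf_zero_count(1)[OF \<theta>])
qed

lemma zero_mult_from_count:
  assumes G: "hol_mat (ball 0 1) r r G" and r: "0 < r" and fin: "finite {z\<in>ball 0 1. det (G z) = 0}"
    and cnt: "zero_count 1 (\<lambda>z. det (G z)) = int k"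
  shows "\<exists>z\<in>ball 0 1. det (G z) \<noteq> 0" "zero_mult r G (ball 0 1) = enat k"
proof -
  show "\<exists>z\<in>ball 0 1. det (G z) \<noteq> 0"
  proof (rule ccontr)
    assume "\<not> (\<exists>z\<in>ball 0 1. det (G z) \<noteq> 0)"
    hence "{z\<in>ball 0 1. det (G z) = 0} = ball (0::complex) 1" by auto
    hence "finite (ball (0::complex) 1)" using fin by simp
    moreover have "infinite (ball (0::complex) 1)" by (rule uncountable_infinite) (simp add: uncountable_ball)
    ultimately show False by simp
  qed
  show "zero_mult r G (ball 0 1) = enat k"
    unfolding zero_mult_eq_zero_count[OF G r fin] cnt by simp
qed

section \<open>The dual pencil\<close>

lemma smult_smult_mat: "a \<cdot>\<^sub>m (b \<cdot>\<^sub>m A) = (a * b) \<cdot>\<^sub>m (A :: complex mat)"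
  by (intro eq_matI) auto

text \<open>This is the inverse of \<open>N - w M = - w (M - (1 / w) N)\<close>.\<close>

lemma mat_inv_pencil_swap:
  assumes M: "M \<in> carrier_mat n n" and N: "N \<in> carrier_mat n n" and w: "w \<noteq> 0"
    and d: "det (N - w \<cdot>\<^sub>m M) \<noteq> 0"
  shows "mat_inv (N - w \<cdot>\<^sub>m M) = (- (1 / w)) \<cdot>\<^sub>m mat_inv (M - (1 / w) \<cdot>\<^sub>m N)"
proof -
  have e: "N - w \<cdot>\<^sub>m M = (- w) \<cdot>\<^sub>m (M - (1 / w) \<cdot>\<^sub>m N)"
    using M N w by (intro eq_matI) (auto simp: algebra_simps)
  have c: "M - (1 / w) \<cdot>\<^sub>m N \<in> carrier_mat n n" using M N by auto
  have "det (M - (1 / w) \<cdot>\<^sub>m N) \<noteq> 0" using d w unfolding e det_smult_nonzero[OF c] by auto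
  from mat_inv_smult[OF c this, of "- w"] show ?thesis unfolding e using w by simp
qed

text \<open>
  The two resolvents contribute the factors \<open>- 1 / w\<close> and, after taking the adjoint, \<open>- cnj \<mu>\<close>; as \<open>|\<mu>| = 1\<close>, together they
  turn \<open>1 - w \<mu>\<close> into \<open>- (1 - (1 / w) cnj \<mu>)\<close>.
\<close>

lemma transfer_block_swap:
  assumes M: "M \<in> carrier_mat n n" and N: "N \<in> carrier_mat n n" and X: "X \<in> carrier_mat n n"
    and Ca: "Ca \<in> carrier_mat r n" and Cb: "Cb \<in> carrier_mat s n"
    and \<mu>: "cmod \<mu> = 1" "det (N - cnj \<mu> \<cdot>\<^sub>m M) \<noteq> 0" and w: "w \<noteq> 0" "det (N - w \<cdot>\<^sub>m M) \<noteq> 0"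
  shows "transfer_block Ca Cb N M X (cnj \<mu>) w = (-1) \<cdot>\<^sub>m transfer_block Ca Cb M N X \<mu> (1 / w)"
proof -
  have mm: "\<mu> * cnj \<mu> = 1" using \<mu>(1) by (metis complex_norm_square of_real_1 power_one)
  have \<mu>0: "cnj \<mu> \<noteq> 0" using \<mu>(1) by auto
  have inv\<mu>: "1 / cnj \<mu> = \<mu>" using mm \<mu>0 by (simp add: divide_eq_eq)
  define I1 where "I1 = mat_inv (M - (1 / w) \<cdot>\<^sub>m N)"
  define I2 where "I2 = mat_inv (M - \<mu> \<cdot>\<^sub>m N)"
  have I: "I1 \<in> carrier_mat n n" "I2 \<in> carrier_mat n n"
    using M N unfolding I1_def I2_def by (auto intro!: mat_inv_carrier)
  note c1 = mult_carrier_mat[OF Ca I(1)] and c2 = mult_carrier_mat[OF Cb I(2)]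
  note c3 = mult_carrier_mat[OF c1 X] and c4 = mat_adjoint_carrier[OF c2]
  have "transfer_block Ca Cb N M X (cnj \<mu>) w
      = (1 - w * \<mu>) \<cdot>\<^sub>m (Ca * ((- (1 / w)) \<cdot>\<^sub>m I1) * X * mat_adjoint (Cb * ((- \<mu>) \<cdot>\<^sub>m I2)))"
    unfolding transfer_block_def I1_def I2_def using mat_inv_pencil_swap[OF M N w] mat_inv_pencil_swap[OF M N \<mu>0 \<mu>(2)]
    by (simp add: inv\<mu>)
  also have "Ca * ((- (1 / w)) \<cdot>\<^sub>m I1) * X = (- (1 / w)) \<cdot>\<^sub>m (Ca * I1 * X)"
    by (simp only: mult_smult_distrib[OF Ca I(1)] mult_smult_assoc_mat[OF c1 X])
  also have "mat_adjoint (Cb * ((- \<mu>) \<cdot>\<^sub>m I2)) = (- cnj \<mu>) \<cdot>\<^sub>m mat_adjoint (Cb * I2)"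
    by (simp only: mult_smult_distrib[OF Cb I(2)] mat_adjoint_smult complex_cnj_minus)
  also have "(- (1 / w)) \<cdot>\<^sub>m (Ca * I1 * X) * ((- cnj \<mu>) \<cdot>\<^sub>m mat_adjoint (Cb * I2))
      = (1 / w * cnj \<mu>) \<cdot>\<^sub>m (Ca * I1 * X * mat_adjoint (Cb * I2))"
    using mult_smult_assoc_mat[OF c3 smult_carrier_mat[OF c4]] mult_smult_distrib[OF c3 c4]
    by (simp add: smult_smult_mat)
  also have "(1 - w * \<mu>) \<cdot>\<^sub>m \<dots> = ((1 - w * \<mu>) * (1 / w * cnj \<mu>)) \<cdot>\<^sub>m (Ca * I1 * X * mat_adjoint (Cb * I2))"
    by (simp only: smult_smult_mat)
  also have "(1 - w * \<mu>) * (1 / w * cnj \<mu>) = - (1 - 1 / w * cnj \<mu>)"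
  proof -
    have "(1 - w * \<mu>) * (1 / w * cnj \<mu>) = 1 / w * cnj \<mu> - (\<mu> * cnj \<mu>)" using w(1) by (simp add: field_simps)
    thus ?thesis unfolding mm by simp
  qed
  also have "(- (1 - 1 / w * cnj \<mu>)) \<cdot>\<^sub>m (Ca * I1 * X * mat_adjoint (Cb * I2)) = (-1) \<cdot>\<^sub>m transfer_block Ca Cb M N X \<mu> (1 / w)"
    unfolding transfer_block_def I1_def I2_def by (simp add: smult_smult_mat)
  finally show ?thesis .
qed

section \<open>Exceptional sets\<close>

lemma cosparse_at:
  assumes "\<forall>\<^sub>\<approx>z. P z"
  shows "eventually P (at (z :: complex))"
  using eventually_cosparse_imp_eventually_at[OF assms, of z UNIV] by simp

lemma cosparse_at_inverse:
  assumes "\<forall>\<^sub>\<approx>z. P z" and z: "z \<noteq> (0 :: complex)"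
  shows "\<forall>\<^sub>F w in at z. P (1 / w)"
proof -
  have "filterlim (\<lambda>w. 1 / w) (at (1 / z)) (at z)"
  proof (rule filterlim_atI)
    show "((\<lambda>w. 1 / w) \<longlongrightarrow> 1 / z) (at z)" using z by (intro tendsto_intros)
    have "\<forall>\<^sub>F w in at z. w \<noteq> z" by (rule eventually_neq_at_within)
    thus "\<forall>\<^sub>F w in at z. 1 / w \<noteq> 1 / z" by eventually_elim auto
  qed
  thus ?thesis using cosparse_at[OF assms(1)] by (rule eventually_compose_filterlim[rotated])
qed

lemma finite_cosparse:
  assumes "finite Z"
  shows "\<forall>\<^sub>\<approx>z :: complex. z \<notin> Z"
  unfolding eventually_cosparse using assms by (auto intro: finite_imp_sparse)

text \<open>
  The matrix \<open>reflect B (1 / z)\<close> is \<open>B\<^sup>#(z)\<close>. The sizes are recorded because \<open>B\<close> is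
  evaluated outside the disc as well.
\<close>

lemma blaschke_potapov_inverse:
  assumes "blaschke_potapov n d B"
  shows "\<forall>\<^sub>\<approx>z. B z \<in> carrier_mat n n \<and> reflect B (1 / z) \<in> carrier_mat n n \<and>
    reflect B (1 / z) * B z = 1\<^sub>m n \<and> B z * reflect B (1 / z) = 1\<^sub>m n"
proof -
  obtain Z where Z: "finite Z" "\<And>z. z \<notin> Z \<Longrightarrow> reflect B (1 / z) * B z = 1\<^sub>m n \<and> B z * reflect B (1 / z) = 1\<^sub>m n"
    using blaschke_potapov_inner_mvf(2)[OF assms] by (auto simp: reflect_def)
  show ?thesis
    using finite_cosparse[OF Z(1)]
  proof eventually_elim
    case (elim z)
    note e = Z(2)[OF elim]
    have "dim_row (reflect B (1 / z)) = n" "dim_col (B z) = n"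
      "dim_row (B z) = n" "dim_col (reflect B (1 / z)) = n"
      using arg_cong[OF conjunct1[OF e], of dim_row] arg_cong[OF conjunct1[OF e], of dim_col]
        arg_cong[OF conjunct2[OF e], of dim_row] arg_cong[OF conjunct2[OF e], of dim_col] by simp_all
    thus ?case using e by auto
  qed
qed

lemma mvf_infinity_eqI:
  assumes F: "hol_mat (ball 0 1) r c F" and eq: "\<And>w. w \<noteq> 0 \<Longrightarrow> \<Phi> (1 / w) = F w"
  shows "mvf_infinity r c \<Phi> = F 0"
proof (rule eq_matI)
  have c: "F 0 \<in> carrier_mat r c" by (rule mat_fun_carrier[OF F]) simp
  show "dim_row (mvf_infinity r c \<Phi>) = dim_row (F 0)" "dim_col (mvf_infinity r c \<Phi>) = dim_col (F 0)"
    using c by (auto simp: mvf_infinity_def)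
  fix i j assume "i < dim_row (F 0)" "j < dim_col (F 0)"
  hence ij: "i < r" "j < c" using c by auto
  let ?f = "\<lambda>z. \<Phi> z $$ (i, j)"
  have "isCont (\<lambda>w. F w $$ (i, j)) 0"
    using holomorphic_on_imp_continuous_on[OF mat_fun_entry[OF F ij]] continuous_on_eq_continuous_at[OF open_ball] by force
  hence "(\<lambda>w. F w $$ (i, j)) \<midarrow>0\<rightarrow> F 0 $$ (i, j)" by (rule isContD)
  moreover have "\<forall>\<^sub>F w in at 0. F w $$ (i, j) = (?f \<circ> inverse) w"
    using eventually_neq_at_within[of 0 0 UNIV] by eventually_elim (simp add: eq[symmetric] inverse_eq_divide)
  ultimately have "((?f \<circ> inverse) \<longlongrightarrow> F 0 $$ (i, j)) (at 0)" by (rule Lim_transform_eventually)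
  hence "(?f \<longlongrightarrow> F 0 $$ (i, j)) at_infinity" unfolding lim_at_infinity_0 .
  hence "Lim at_infinity ?f = F 0 $$ (i, j)" by (rule tendsto_Lim[rotated]) (simp add: trivial_limit_at_infinity)
  thus "mvf_infinity r c \<Phi> $$ (i, j) = F 0 $$ (i, j)" using ij by (simp add: mvf_infinity_def)
qed

lemma bounded_holomorphic_disc:
  "bounded_holomorphic_mvf r c S \<Phi> \<Longrightarrow> hol_mat S r c \<Phi>"
  by (auto simp: bounded_holomorphic_mvf_def intro!: mat_funI)

lemma left_inverse_cancel:
  fixes R B \<Phi> :: "complex mat"
  assumes "R \<in> carrier_mat n n" "B \<in> carrier_mat n n" "R * B = 1\<^sub>m n" "\<Phi> \<in> carrier_mat n c"
  shows "R * (B * \<Phi>) = \<Phi>"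
  using assoc_mult_mat[OF assms(1,2,4)] left_mult_one_mat[OF assms(4)] unfolding assms(3) by simp

lemma inner_mvf_hol: "inner_mvf n d R B \<Longrightarrow> hol_mat (ball 0 1) n n B"
  by (auto simp: inner_mvf_def elim: hol_mat_sub)

section \<open>The two counts\<close>

theorem lemma5p2:
  fixes p q n1 n2 \<kappa>1 \<kappa>2 :: nat
    and A1 A2 C11 C12 C21 C22 C M N P X11 X12 X21 X22 X :: "complex mat"
    and \<mu> :: complex
    and w11 w12 w21 w22 b1 b2 \<phi>t11 \<phi>t12 \<phi>21 \<phi>22 \<epsilon> \<theta>l \<epsilon>l \<epsilon>r \<theta>r :: "complex \<Rightarrow> complex mat"
  assumes "1 \<le> p" and "1 \<le> q" and "1 \<le> n1 + n2"
    and "A1 \<in> carrier_mat n1 n1" and "A2 \<in> carrier_mat n2 n2"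
    and "C11 \<in> carrier_mat p n1" and "C12 \<in> carrier_mat p n2"
    and "C21 \<in> carrier_mat q n1" and "C22 \<in> carrier_mat q n2"
    and "C = four_block_mat C11 C12 C21 C22"
    and "M = four_block_mat A1 (0\<^sub>m n1 n2) (0\<^sub>m n2 n1) (1\<^sub>m n2)"
    and "N = four_block_mat (1\<^sub>m n1) (0\<^sub>m n1 n2) (0\<^sub>m n2 n1) A2"
    and "spectrum A1 \<union> spectrum A2 \<subseteq> ball 0 1"
    and "hermitian_mat (n1 + n2) P"
    and "mat_adjoint M * P * M - mat_adjoint N * P * N = mat_adjoint C * jpq p q * C"
    and "observable n2 C12 A2" and "observable n1 C21 A1"
    and "X11 \<in> carrier_mat n1 n1" and "X12 \<in> carrier_mat n1 n2"
    and "X21 \<in> carrier_mat n2 n1" and "X22 \<in> carrier_mat n2 n2"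
    and "X = four_block_mat X11 X12 X21 X22"
    and "hermitian_mat (n1 + n2) X"
    and "X * P * X = X" and "P * X * P = P"
    and "\<forall>v\<in>mat_range X. M *\<^sub>v v \<in> mat_range X"
    and "\<forall>v\<in>mat_range X. N *\<^sub>v v \<in> mat_range X"
    and "\<kappa>1 = neg_eigs P"
    and "cmod \<mu> = 1"
    and "\<forall>z. split_block (W_mvf p q C M N X \<mu> z) p p = (w11 z, w12 z, w21 z, w22 z)"
    and "exterior_coprime_factor p (n1 + n2)
           (\<lambda>z. z \<cdot>\<^sub>m (C12 * mat_inv (1\<^sub>m n2 - z \<cdot>\<^sub>m A2) * hcat X21 X22)) b1"
    and "disc_coprime_factor q (n1 + n2)
           (\<lambda>z. C21 * mat_inv (A1 - z \<cdot>\<^sub>m 1\<^sub>m n1) * hcat X11 X12) b2"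
    and "rational_mvf p p \<phi>t11" and "bounded_holomorphic_mvf p p Omega_minus \<phi>t11"
    and "rational_mvf p q \<phi>t12" and "bounded_holomorphic_mvf p q Omega_minus \<phi>t12"
    and "rational_mvf q p \<phi>21" and "bounded_holomorphic_mvf q p (ball 0 1) \<phi>21"
    and "rational_mvf q q \<phi>22" and "bounded_holomorphic_mvf q q (ball 0 1) \<phi>22"
    and "\<forall>\<^sub>\<approx>z. hcat (w11 z) (w12 z) = b1 z * hcat (\<phi>t11 z) (\<phi>t12 z)"
    and "\<forall>\<^sub>\<approx>z. hcat (w21 z) (w22 z) = mat_inv (b2 z) * hcat (\<phi>21 z) (\<phi>22 z)"
    and "gen_schur p q \<kappa>2 \<epsilon>"
    and "left_krein_langer p q \<kappa>2 \<epsilon> \<theta>l \<epsilon>l"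
    and "right_krein_langer p q \<kappa>2 \<epsilon> \<epsilon>r \<theta>r"
  shows
    "let G1 = (\<lambda>z. \<phi>21 z * \<epsilon>r z + \<phi>22 z * \<theta>r z);
         G2 = (\<lambda>z. \<theta>l z * mvf_sharp p p \<phi>t11 z + \<epsilon>l z * mvf_sharp p q \<phi>t12 z)
     in (\<exists>z\<in>ball 0 1. det (G1 z) \<noteq> 0) \<and> (\<exists>z\<in>ball 0 1. det (G2 z) \<noteq> 0) \<and>
        zero_mult q G1 (ball 0 1) = zero_mult p G2 (ball 0 1) \<and>
        zero_mult p G2 (ball 0 1) = enat (\<kappa>1 + \<kappa>2)"
proof -
  note as = assms
  define n where "n = n1 + n2"
  define C1 where "C1 = hcat C11 C12"
  define C2 where "C2 = hcat C21 C22"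
  have A1: "A1 \<in> carrier_mat n1 n1" and A2: "A2 \<in> carrier_mat n2 n2"
    and C11: "C11 \<in> carrier_mat p n1" and C12: "C12 \<in> carrier_mat p n2"
    and C21: "C21 \<in> carrier_mat q n1" and C22: "C22 \<in> carrier_mat q n2"
    and Mdef: "M = four_block_mat A1 (0\<^sub>m n1 n2) (0\<^sub>m n2 n1) (1\<^sub>m n2)"
    and Ndef: "N = four_block_mat (1\<^sub>m n1) (0\<^sub>m n1 n2) (0\<^sub>m n2 n1) A2"
    and Cdef: "C = four_block_mat C11 C12 C21 C22"
    and X11: "X11 \<in> carrier_mat n1 n1" and X12: "X12 \<in> carrier_mat n1 n2"
    and X21: "X21 \<in> carrier_mat n2 n1" and X22: "X22 \<in> carrier_mat n2 n2"
    and Xdef: "X = four_block_mat X11 X12 X21 X22"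
    using as(4-12,18-22) by auto
  have P: "hermitian_mat n P" and X: "hermitian_mat n X" using as(14,23) by (simp_all add: n_def)
  have XPX: "X * P * X = X" and PXP: "P * X * P = P" by (fact as)+
  have invM: "\<And>v. v \<in> mat_range X \<Longrightarrow> M *\<^sub>v v \<in> mat_range X" and invN: "\<And>v. v \<in> mat_range X \<Longrightarrow> N *\<^sub>v v \<in> mat_range X"
    using as(26,27) by blast+
  have \<kappa>1: "\<kappa>1 = neg_eigs P" and \<mu>: "cmod \<mu> = 1" by (fact as)+
  have M: "M \<in> carrier_mat n n" and N: "N \<in> carrier_mat n n" and C: "C \<in> carrier_mat (p + q) n"
    unfolding Mdef Ndef Cdef n_def using A1 A2 C11 C22 by (auto intro!: four_block_carrier_mat)
  have Xc: "X \<in> carrier_mat n n" using X by (simp add: hermitian_mat_def)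
  have C1: "C1 \<in> carrier_mat p n" and C2: "C2 \<in> carrier_mat q n"
    unfolding C1_def C2_def n_def using C11 C12 C21 C22 by auto
  interpret rb: row_blocks p q n C C1 C2
    by unfold_locales (use C C1 C2 hcat_rows[OF C11 C12 C21 C22] in \<open>auto simp: C1_def C2_def Cdef n_def\<close>)
  have lyapunov: "mat_adjoint M * P * M - mat_adjoint N * P * N = mat_adjoint C1 * C1 - mat_adjoint C2 * C2"
    using as(15) unfolding rb.signature_gram .
  \<comment> \<open>The pencil \<open>N - z M\<close> satisfies the Lyapunov equation with the two rows of \<open>C\<close> exchanged.\<close>
  have lyapunov': "mat_adjoint N * P * N - mat_adjoint M * P * M = mat_adjoint C2 * C2 - mat_adjoint C1 * C1"
  proof -
    have Pc: "P \<in> carrier_mat n n" using P by (simp add: hermitian_mat_def)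
    have c: "mat_adjoint M * P * M \<in> carrier_mat n n" "mat_adjoint N * P * N \<in> carrier_mat n n"
      "mat_adjoint C1 * C1 \<in> carrier_mat n n" "mat_adjoint C2 * C2 \<in> carrier_mat n n"
      using M N C1 C2 Pc by (auto intro!: mult_carrier_mat)
    have "A - B = D - E" if "B - A = E - D" "A \<in> carrier_mat n n" "B \<in> carrier_mat n n" "D \<in> carrier_mat n n" "E \<in> carrier_mat n n"
      for A B D E :: "complex mat"
    proof (rule eq_matI)
      fix i j assume "i < dim_row (D - E)" "j < dim_col (D - E)"
      moreover have "(B - A) $$ (i, j) = (E - D) $$ (i, j)" by (simp only: that(1))
      ultimately show "(A - B) $$ (i, j) = (D - E) $$ (i, j)" using that(2-) by (auto simp: algebra_simps)
    qed (use that in auto)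
    from this[OF lyapunov c(2,1,4,3)] show ?thesis .
  qed
  have sp1: "spectrum A1 \<subseteq> ball 0 1" and sp2: "spectrum A2 \<subseteq> ball 0 1" using as(13) by auto
  note ns1 = spectrum_disc_nonsingular[OF A1 sp1] and ns2 = spectrum_disc_nonsingular[OF A2 sp2]
  have E: "M - z \<cdot>\<^sub>m N = four_block_mat (A1 - z \<cdot>\<^sub>m 1\<^sub>m n1) (0\<^sub>m n1 n2) (0\<^sub>m n2 n1) (1\<^sub>m n2 - z \<cdot>\<^sub>m A2)" for z
    unfolding Mdef Ndef by (rule block_pencil[OF A1 one_carrier_mat one_carrier_mat A2])
  have E': "N - z \<cdot>\<^sub>m M = four_block_mat (1\<^sub>m n1 - z \<cdot>\<^sub>m A1) (0\<^sub>m n1 n2) (0\<^sub>m n2 n1) (A2 - z \<cdot>\<^sub>m 1\<^sub>m n2)" for z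
    unfolding Mdef Ndef by (rule block_pencil[OF one_carrier_mat A1 A2 one_carrier_mat])
  have c1: "A1 - z \<cdot>\<^sub>m 1\<^sub>m n1 \<in> carrier_mat n1 n1" "1\<^sub>m n1 - z \<cdot>\<^sub>m A1 \<in> carrier_mat n1 n1"
    and c2: "1\<^sub>m n2 - z \<cdot>\<^sub>m A2 \<in> carrier_mat n2 n2" "A2 - z \<cdot>\<^sub>m 1\<^sub>m n2 \<in> carrier_mat n2 n2" for z
    using A1 A2 by auto
  have dE: "det (M - z \<cdot>\<^sub>m N) = det (A1 - z \<cdot>\<^sub>m 1\<^sub>m n1) * det (1\<^sub>m n2 - z \<cdot>\<^sub>m A2)" for z
    unfolding E by (rule det_four_block_mat_lower_left_zero[OF c1(1) _ refl c2(1)]) simp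
  have dE': "det (N - z \<cdot>\<^sub>m M) = det (1\<^sub>m n1 - z \<cdot>\<^sub>m A1) * det (A2 - z \<cdot>\<^sub>m 1\<^sub>m n2)" for z
    unfolding E' by (rule det_four_block_mat_lower_left_zero[OF c1(2) _ refl c2(2)]) simp
  have regular: "det (M - z \<cdot>\<^sub>m N) \<noteq> 0" "det (N - z \<cdot>\<^sub>m M) \<noteq> 0" if "cmod z = 1" for z
    using that ns1[of z] ns2[of z] by (simp_all add: dE dE')
  have zero: "0\<^sub>v n1 @\<^sub>v 0\<^sub>v n2 = (0\<^sub>v n :: complex vec)" unfolding n_def by (intro eq_vecI) auto
  have obs: "v = 0\<^sub>v n" if z: "cmod z < 1" and v: "v \<in> carrier_vec n" and k: "(M - z \<cdot>\<^sub>m N) *\<^sub>v v = 0\<^sub>v n" "C2 *\<^sub>v v = 0\<^sub>v q" for z v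
  proof -
    obtain x y where x: "x \<in> carrier_vec n1" and y: "y \<in> carrier_vec n2" and vxy: "v = x @\<^sub>v y"
      and D: "(A1 - z \<cdot>\<^sub>m 1\<^sub>m n1) *\<^sub>v x = 0\<^sub>v n1" "(1\<^sub>m n2 - z \<cdot>\<^sub>m A2) *\<^sub>v y = 0\<^sub>v n2"
      and Cxy: "C21 *\<^sub>v x + C22 *\<^sub>v y = 0\<^sub>v q"
      using block_kernel[OF C21 C22 c1(1) c2(1) v[unfolded n_def] k(1)[unfolded E n_def] k(2)[unfolded C2_def]] by blast
    have y0: "y = 0\<^sub>v n2" using ns2(2)[of z] z D(2) y unfolding det_nonzero_iff_inj[OF c2(1)] by auto
    have "C21 *\<^sub>v x = 0\<^sub>v q" using Cxy mult_mat_vec_carrier[OF C21 x] by (simp add: y0 mult_mat_zero_vec[OF C22])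
    hence "x = 0\<^sub>v n1"
      by (rule observable_eigenvector[OF as(17) C21 A1 x shifted_kernel_eigenvector[OF A1 x D(1)]])
    thus ?thesis by (simp add: vxy y0 zero)
  qed
  have obs': "v = 0\<^sub>v n" if z: "cmod z < 1" and v: "v \<in> carrier_vec n" and k: "(N - z \<cdot>\<^sub>m M) *\<^sub>v v = 0\<^sub>v n" "C1 *\<^sub>v v = 0\<^sub>v p" for z v
  proof -
    obtain x y where x: "x \<in> carrier_vec n1" and y: "y \<in> carrier_vec n2" and vxy: "v = x @\<^sub>v y"
      and D: "(1\<^sub>m n1 - z \<cdot>\<^sub>m A1) *\<^sub>v x = 0\<^sub>v n1" "(A2 - z \<cdot>\<^sub>m 1\<^sub>m n2) *\<^sub>v y = 0\<^sub>v n2"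
      and Cxy: "C11 *\<^sub>v x + C12 *\<^sub>v y = 0\<^sub>v p"
      using block_kernel[OF C11 C12 c1(2) c2(2) v[unfolded n_def] k(1)[unfolded E' n_def] k(2)[unfolded C1_def]] by blast
    have x0: "x = 0\<^sub>v n1" using ns1(2)[of z] z D(1) x unfolding det_nonzero_iff_inj[OF c1(2)] by auto
    have "C12 *\<^sub>v y = 0\<^sub>v p" using Cxy mult_mat_vec_carrier[OF C12 y] by (simp add: x0 mult_mat_zero_vec[OF C11])
    hence "y = 0\<^sub>v n2"
      by (rule observable_eigenvector[OF as(16) C12 A2 y shifted_kernel_eigenvector[OF A2 y D(2)]])
    thus ?thesis by (simp add: vxy x0 zero)
  qed
  have w: "w11 z = 1\<^sub>m p - transfer_block C1 C1 M N X \<mu> z" "w12 z = transfer_block C1 C2 M N X \<mu> z"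
    "w21 z = (-1) \<cdot>\<^sub>m transfer_block C2 C1 M N X \<mu> z" "w22 z = 1\<^sub>m q + transfer_block C2 C2 M N X \<mu> z" for z
    using rb.W_blocks[OF M N Xc as(30)[rule_format, of z]] .
  have lrc: "transfer_block Ca Cb M' N' X' \<mu>' z \<in> carrier_mat r s"
    if "Ca \<in> carrier_mat r k" "Cb \<in> carrier_mat s k'" for Ca Cb M' N' X' \<mu>' z r s k k'
    using that by (auto simp: transfer_block_def)
  have hX1: "hcat X11 X12 \<in> carrier_mat n1 n" and hX2: "hcat X21 X22 \<in> carrier_mat n2 n"
    unfolding n_def using X11 X12 X21 X22 by auto
  note fa = fun_alg_hol

  define G1 where "G1 = (\<lambda>z. \<phi>21 z * \<epsilon>r z + \<phi>22 z * \<theta>r z)"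
  have count1: "(\<exists>z\<in>ball 0 1. det (G1 z) \<noteq> 0) \<and> zero_mult q G1 (ball 0 1) = enat (\<kappa>1 + \<kappa>2)"
  proof -
    obtain d \<phi> where bp: "blaschke_potapov q d b2" and \<phi>bd: "bounded_holomorphic_mvf q n (ball 0 1) \<phi>"
      and Heq: "\<forall>\<^sub>\<approx>z. C21 * mat_inv (A1 - z \<cdot>\<^sub>m 1\<^sub>m n1) * hcat X11 X12 = mat_inv (b2 z) * \<phi> z"
      and rank: "\<And>z. z \<in> ball 0 1 \<Longrightarrow> mat_rank (hcat (b2 z) (\<phi> z)) = q"
      using as(32) unfolding disc_coprime_factor_def n_def by blast
    obtain Rb where b: "inner_mvf q d Rb b2" using blaschke_potapov_inner_mvf(1)[OF bp] by blast
    have r: "blaschke_potapov q \<kappa>2 \<theta>r" "schur p q \<epsilon>r" using as(45) by (auto simp: right_krein_langer_def)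
    obtain R\<theta> where \<theta>: "inner_mvf q \<kappa>2 R\<theta> \<theta>r" using blaschke_potapov_inner_mvf(1)[OF r(1)] by blast
    note \<epsilon> = schur_holomorphic_contractive[OF r(2)]
    note \<phi> = bounded_holomorphic_disc[OF \<phi>bd] and \<phi>21 = bounded_holomorphic_disc[OF as(38)]
      and \<phi>22 = bounded_holomorphic_disc[OF as(40)]
    \<comment> \<open>The first block of \<open>M - z N\<close> carries the poles in the disc and is treated by \<open>b2\<close>; the second one is invertible there.\<close>
    define Hr where "Hr = (\<lambda>z. C22 * mat_inv (1\<^sub>m n2 - z \<cdot>\<^sub>m A2) * hcat X21 X22)"
    have Hr: "hol_mat (ball 0 1) q n Hr" unfolding Hr_def
      by (rule hol_resolvent[OF one_carrier_mat A2 C22 hX2]) (use ns2(2) in auto)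
    have inb: "\<forall>\<^sub>F w in at z. w \<in> ball 0 1" if "z \<in> ball 0 1 - {0}" for z :: complex
      using that by (intro eventually_at_in_open') auto
    have binv: "\<forall>\<^sub>F w in at z. b2 w \<in> carrier_mat q q \<and> mat_inv (b2 w) \<in> carrier_mat q q \<and> b2 w * mat_inv (b2 w) = 1\<^sub>m q" for z
      using cosparse_at[OF blaschke_potapov_inverse[OF bp], of z]
    proof eventually_elim
      case (elim w)
      thus ?case using mat_inv_unique[of "b2 w" q "reflect b2 (1 / w)"] by auto
    qed
    have \<phi>b: "\<forall>\<^sub>F w in at z. det (M - w \<cdot>\<^sub>m N) \<noteq> 0 \<longrightarrow> \<phi> w + b2 w * Hr w = b2 w * (C2 * mat_inv (M - w \<cdot>\<^sub>m N) * X)"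
      if z: "z \<in> ball 0 1 - {0}" for z
      using inb[OF z] binv[of z] cosparse_at[OF Heq, of z]
    proof eventually_elim
      case (elim w)
      show ?case
      proof
        assume "det (M - w \<cdot>\<^sub>m N) \<noteq> 0"
        hence d: "det (A1 - w \<cdot>\<^sub>m 1\<^sub>m n1) \<noteq> 0" "det (1\<^sub>m n2 - w \<cdot>\<^sub>m A2) \<noteq> 0" by (auto simp: dE)
        have \<phi>c: "\<phi> w \<in> carrier_mat q n" by (rule mat_fun_carrier[OF \<phi> elim(1)])
        have Hc: "Hr w \<in> carrier_mat q n" by (rule mat_fun_carrier[OF Hr elim(1)])
        have e: "C2 * mat_inv (M - w \<cdot>\<^sub>m N) * X = mat_inv (b2 w) * \<phi> w + Hr w"
          unfolding E C2_def Xdef block_resolvent[OF C21 C22 c1(1) d(1) c2(1) d(2) X11 X12 X21 X22] Hr_def elim(3) ..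
        have "b2 w * (C2 * mat_inv (M - w \<cdot>\<^sub>m N) * X) = b2 w * (mat_inv (b2 w) * \<phi> w) + b2 w * Hr w"
          unfolding e using elim(2) \<phi>c Hc by (intro mult_add_distrib_mat[of _ q q]) (auto intro: mult_carrier_mat)
        also have "b2 w * (mat_inv (b2 w) * \<phi> w) = \<phi> w" using elim(2) \<phi>c by (intro left_inverse_cancel[of _ q]) auto
        finally show "\<phi> w + b2 w * Hr w = b2 w * (C2 * mat_inv (M - w \<cdot>\<^sub>m N) * X)" ..
      qed
    qed
    have left: "u = 0\<^sub>v q" if z: "z \<in> ball 0 1" and u: "u \<in> carrier_vec q"
      "mat_adjoint (b2 z) *\<^sub>v u = 0\<^sub>v q" "mat_adjoint (\<phi> z) *\<^sub>v u = 0\<^sub>v n" for z u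
      by (rule full_row_rank_left_kernel[OF mat_fun_carrier[OF inner_mvf_hol[OF b] z] mat_fun_carrier[OF \<phi> z] rank[OF z] u])
    have \<phi>2b: "\<forall>\<^sub>F w in at z. \<phi>21 w = b2 w * w21 w \<and> \<phi>22 w = b2 w * w22 w" if z: "z \<in> ball 0 1 - {0}" for z
      using inb[OF z] binv[of z] cosparse_at[OF as(42), of z]
    proof eventually_elim
      case (elim w)
      note c = mat_fun_carrier[OF \<phi>21 elim(1)] mat_fun_carrier[OF \<phi>22 elim(1)]
      have wc: "w21 w \<in> carrier_mat q p" "w22 w \<in> carrier_mat q q"
        unfolding w using lrc[OF C2 C1] lrc[OF C2 C2] by auto
      have "b2 w * hcat (w21 w) (w22 w) = hcat (\<phi>21 w) (\<phi>22 w)"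
        unfolding elim(3) using elim(2) hcat_carrier[OF c] by (intro left_inverse_cancel[of _ q]) auto
      hence e: "hcat (\<phi>21 w) (\<phi>22 w) = hcat (b2 w * w21 w) (b2 w * w22 w)"
        using mult_hcat[OF _ wc, of "b2 w" q] elim(2) by simp
      show ?case using hcat_eqD[OF e c(1) _ c(2)] wc elim(2) by (meson mult_carrier_mat)
    qed
    have G1: "hol_mat (ball 0 1) q q G1" unfolding G1_def
      by (rule fun_alg.mat_add[OF fa fun_alg.mat_mult[OF fa \<phi>21 \<epsilon>(1)] fun_alg.mat_mult[OF fa \<phi>22 inner_mvf_hol[OF \<theta>]]])
    have \<phi>21b: "\<forall>\<^sub>F w in at z. det (M - w \<cdot>\<^sub>m N) \<noteq> 0 \<longrightarrow> \<phi>21 w = b2 w * ((-1) \<cdot>\<^sub>m transfer_block C2 C1 M N X \<mu> w)"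
      and \<phi>22b: "\<forall>\<^sub>F w in at z. det (M - w \<cdot>\<^sub>m N) \<noteq> 0 \<longrightarrow> \<phi>22 w = b2 w * (1\<^sub>m q + transfer_block C2 C2 M N X \<mu> w)"
      if "z \<in> ball 0 1 - {0}" for z
      using \<phi>2b[OF that] by (auto elim!: eventually_mono simp: w)
    note main = coprime_pencil_zero_count[where M = M and N = N and P = P and X = X and ?C1.0 = C1 and ?C2.0 = C2
          and \<mu> = \<mu> and b = b2 and \<theta> = \<theta>r and \<phi> = \<phi> and Hr = Hr and n = n and p = p and q = q and d = d
          and Rb = Rb and R\<theta> = R\<theta> and \<epsilon> = \<epsilon>r and ?\<phi>21.0 = \<phi>21 and ?\<phi>22.0 = \<phi>22 and \<kappa> = \<kappa>2]
    have fin: "finite {z\<in>ball 0 1. det (G1 z) = 0}" unfolding G1_def by (rule main(1)) (fact | fact regular \<epsilon>)+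
    have cnt: "zero_count 1 (\<lambda>z. det (G1 z)) = int (\<kappa>1 + \<kappa>2)" unfolding G1_def \<kappa>1 by (rule main(2)) (fact | fact regular \<epsilon>)+
    show ?thesis using zero_mult_from_count[OF G1 _ fin cnt] as(2) by simp
  qed

  \<comment> \<open>The counterpart of \<open>G1\<close> for the pencil \<open>N - z M\<close>; the matrix \<open>G2\<close> is its conjugate reflection.\<close>
  define V where "V = (\<lambda>z. inversion p q \<phi>t12 z * reflect \<epsilon>l z + inversion p p \<phi>t11 z * reflect \<theta>l z)"
  define G2 where "G2 = (\<lambda>z. \<theta>l z * mvf_sharp p p \<phi>t11 z + \<epsilon>l z * mvf_sharp p q \<phi>t12 z)"
  have count2: "(\<exists>z\<in>ball 0 1. det (G2 z) \<noteq> 0) \<and> zero_mult p G2 (ball 0 1) = enat (\<kappa>1 + \<kappa>2)"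
  proof -
    obtain d \<phi> where bp: "blaschke_potapov p d b1" and \<phi>bd: "bounded_holomorphic_mvf p n Omega_minus \<phi>"
      and Heq: "\<forall>\<^sub>\<approx>z. z \<cdot>\<^sub>m (C12 * mat_inv (1\<^sub>m n2 - z \<cdot>\<^sub>m A2) * hcat X21 X22) = b1 z * \<phi> z"
      and rank: "\<And>z. z \<in> Omega_minus \<Longrightarrow> mat_rank (hcat (mvf_sharp p p b1 z) (\<phi> z)) = p"
      and rankinf: "mat_rank (hcat (mvf_infinity p p (mvf_sharp p p b1)) (mvf_infinity p n \<phi>)) = p"
      using as(31) unfolding exterior_coprime_factor_def n_def by blast
    obtain Rb where "inner_mvf p d Rb b1" using blaschke_potapov_inner_mvf(1)[OF bp] by blast
    hence b: "inner_mvf p d Rb (reflect b1)" by (rule inner_mvf_reflect)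
    have r: "blaschke_potapov p \<kappa>2 \<theta>l" "schur p q \<epsilon>l" using as(44) by (auto simp: left_krein_langer_def)
    obtain R\<theta> where \<theta>l: "inner_mvf p \<kappa>2 R\<theta> \<theta>l" using blaschke_potapov_inner_mvf(1)[OF r(1)] by blast
    hence \<theta>: "inner_mvf p \<kappa>2 R\<theta> (reflect \<theta>l)" by (rule inner_mvf_reflect)
    note \<epsilon>l = schur_holomorphic_contractive[OF r(2)]
    note \<epsilon> = hol_mat_reflect[OF \<epsilon>l(1)]
    have contr: "nsq (mat_adjoint (reflect \<epsilon>l z) *\<^sub>v y) \<le> nsq y" if z: "z \<in> ball 0 1" and y: "y \<in> carrier_vec q" for z y
    proof -
      have zc: "cnj z \<in> ball 0 1" using z by simp
      show ?thesis unfolding reflect_def mat_adjoint_adjoint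
        by (rule contractive_adjoint[OF mat_fun_carrier[OF \<epsilon>l(1) zc] \<epsilon>l(2)[OF zc] y])
    qed
    note i\<phi> = hol_mat_inversion[OF \<phi>bd] and \<phi>12 = hol_mat_inversion[OF as(36)] and \<phi>11 = hol_mat_inversion[OF as(34)]
    \<comment> \<open>The sign comes from \<open>A2 - w = - w (1 - (1 / w) A2)\<close>.\<close>
    define \<phi>' where "\<phi>' = (\<lambda>z. (-1) \<cdot>\<^sub>m inversion p n \<phi> z)"
    have \<phi>': "hol_mat (ball 0 1) p n \<phi>'" unfolding \<phi>'_def
      by (rule fun_alg.mat_smult[OF fa _ i\<phi>]) simp
    \<comment> \<open>The roles of the two blocks are exchanged: now the first one is invertible in the disc.\<close>
    define Hr where "Hr = (\<lambda>z. C11 * mat_inv (1\<^sub>m n1 - z \<cdot>\<^sub>m A1) * hcat X11 X12)"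
    have Hr: "hol_mat (ball 0 1) p n Hr" unfolding Hr_def
      by (rule hol_resolvent[OF one_carrier_mat A1 C11 hX1]) (use ns1(2) in auto)
    have inb: "\<forall>\<^sub>F w in at z. w \<in> ball 0 1 \<and> w \<noteq> 0" if "z \<in> ball 0 1 - {0}" for z :: complex
    proof -
      have "\<forall>\<^sub>F w in at z. w \<in> ball 0 1 - {0}" using that by (intro eventually_at_in_open') auto
      thus ?thesis by eventually_elim auto
    qed
    have binv: "\<forall>\<^sub>F w in at z. b1 (1 / w) \<in> carrier_mat p p \<and> reflect b1 w \<in> carrier_mat p p \<and> reflect b1 w * b1 (1 / w) = 1\<^sub>m p"
      if "z \<noteq> 0" for z
      using cosparse_at_inverse[OF blaschke_potapov_inverse[OF bp] that] by eventually_elim auto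
    have \<phi>b: "\<forall>\<^sub>F w in at z. det (N - w \<cdot>\<^sub>m M) \<noteq> 0 \<longrightarrow> \<phi>' w + reflect b1 w * Hr w = reflect b1 w * (C1 * mat_inv (N - w \<cdot>\<^sub>m M) * X)"
      if z: "z \<in> ball 0 1 - {0}" for z
    proof -
      have z0: "z \<noteq> 0" using z by simp
      show ?thesis
        using inb[OF z] binv[OF z0] cosparse_at_inverse[OF Heq z0]
      proof eventually_elim
        case (elim w)
        show ?case
        proof
          assume "det (N - w \<cdot>\<^sub>m M) \<noteq> 0"
          hence d: "det (1\<^sub>m n1 - w \<cdot>\<^sub>m A1) \<noteq> 0" "det (A2 - w \<cdot>\<^sub>m 1\<^sub>m n2) \<noteq> 0" by (auto simp: dE')
          have w: "w \<in> ball 0 1" "w \<noteq> 0" using elim by auto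
          have \<phi>w: "\<phi> (1 / w) = inversion p n \<phi> w" using w by (simp add: inversion_def)
          have \<phi>c: "\<phi> (1 / w) \<in> carrier_mat p n" unfolding \<phi>w by (rule mat_fun_carrier[OF i\<phi> w(1)])
          have Hc: "Hr w \<in> carrier_mat p n" by (rule mat_fun_carrier[OF Hr w(1)])
          have Ic: "mat_inv (1\<^sub>m n2 - (1 / w) \<cdot>\<^sub>m A2) \<in> carrier_mat n2 n2" by (intro mat_inv_carrier c2)
          note cc = mult_carrier_mat[OF C12 Ic]
          have "C12 * mat_inv (A2 - w \<cdot>\<^sub>m 1\<^sub>m n2) * hcat X21 X22
              = (- (1 / w)) \<cdot>\<^sub>m (C12 * mat_inv (1\<^sub>m n2 - (1 / w) \<cdot>\<^sub>m A2) * hcat X21 X22)"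
            unfolding mat_inv_pencil_swap[OF one_carrier_mat A2 w(2) d(2)] mult_smult_distrib[OF C12 Ic] mult_smult_assoc_mat[OF cc hX2] ..
          also have "\<dots> = (-1) \<cdot>\<^sub>m (b1 (1 / w) * \<phi> (1 / w))"
            unfolding elim(3)[symmetric] smult_smult_mat by simp
          also have "\<dots> = b1 (1 / w) * \<phi>' w"
            unfolding \<phi>'_def \<phi>w[symmetric] using elim(2) \<phi>c by (intro mult_smult_distrib[symmetric]) auto
          finally have e: "C1 * mat_inv (N - w \<cdot>\<^sub>m M) * X = Hr w + b1 (1 / w) * \<phi>' w"
            unfolding E' C1_def Xdef block_resolvent[OF C11 C12 c1(2) d(1) c2(2) d(2) X11 X12 X21 X22] Hr_def by simp
          have \<phi>'c: "\<phi>' w \<in> carrier_mat p n" by (rule mat_fun_carrier[OF \<phi>' w(1)])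
          have "reflect b1 w * (C1 * mat_inv (N - w \<cdot>\<^sub>m M) * X) = reflect b1 w * Hr w + reflect b1 w * (b1 (1 / w) * \<phi>' w)"
            unfolding e using elim(2) \<phi>'c Hc by (intro mult_add_distrib_mat[of _ p p]) (auto intro: mult_carrier_mat)
          also have "reflect b1 w * (b1 (1 / w) * \<phi>' w) = \<phi>' w" using elim(2) \<phi>'c by (intro left_inverse_cancel[of _ p]) auto
          also have "reflect b1 w * Hr w + \<phi>' w = \<phi>' w + reflect b1 w * Hr w"
            using elim(2) Hc \<phi>'c by (intro comm_add_mat[of _ p n]) (auto intro: mult_carrier_mat)
          finally show "\<phi>' w + reflect b1 w * Hr w = reflect b1 w * (C1 * mat_inv (N - w \<cdot>\<^sub>m M) * X)" ..
        qed
      qed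
    qed
    \<comment> \<open>The origin corresponds to the point at infinity, where coprimeness is a separate assumption.\<close>
    have rank': "mat_rank (hcat (reflect b1 z) (inversion p n \<phi> z)) = p" if z: "z \<in> ball 0 1" for z
    proof -
      have s: "mvf_sharp p p b1 (1 / w) = reflect b1 w" if "w \<noteq> 0" for w
        using that by (simp add: mvf_sharp_def reflect_def)
      show ?thesis
      proof (cases "z = 0")
        case True
        thus ?thesis using rankinf mvf_infinity_eqI[OF inner_mvf_hol[OF b] s] by (simp add: inversion_def)
      next
        case False
        hence "1 / z \<in> Omega_minus" using z by (simp add: Omega_minus_def norm_divide)
        thus ?thesis using rank[of "1 / z"] s[OF False] False by (simp add: inversion_def)
      qed
    qed
    have left: "u = 0\<^sub>v p" if z: "z \<in> ball 0 1" and u: "u \<in> carrier_vec p"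
      "mat_adjoint (reflect b1 z) *\<^sub>v u = 0\<^sub>v p" "mat_adjoint (\<phi>' z) *\<^sub>v u = 0\<^sub>v n" for z u
    proof -
      note c = mat_fun_carrier[OF i\<phi> z]
      have "mat_adjoint (inversion p n \<phi> z) *\<^sub>v u = 0\<^sub>v n"
      proof (rule eq_vecI)
        fix i assume "i < dim_vec (0\<^sub>v n :: complex vec)"
        hence i: "i < n" by simp
        have "(mat_adjoint (\<phi>' z) *\<^sub>v u) $ i = 0" using u(3) i by simp
        thus "(mat_adjoint (inversion p n \<phi> z) *\<^sub>v u) $ i = 0\<^sub>v n $ i"
          using i u(1) c unfolding \<phi>'_def mat_adjoint_smult by simp
      qed (use c in auto)
      thus ?thesis by (rule full_row_rank_left_kernel[OF mat_fun_carrier[OF inner_mvf_hol[OF b] z] c rank'[OF z] u(1,2)])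
    qed
    have mc: "cnj (cnj \<mu>) = \<mu>" "cmod (cnj \<mu>) = 1" using \<mu> by auto
    have \<phi>1b: "\<forall>\<^sub>F w in at z. inversion p p \<phi>t11 w = reflect b1 w * w11 (1 / w) \<and> inversion p q \<phi>t12 w = reflect b1 w * w12 (1 / w)"
      if z: "z \<in> ball 0 1 - {0}" for z
    proof -
      have z0: "z \<noteq> 0" using z by simp
      show ?thesis
        using inb[OF z] binv[OF z0] cosparse_at_inverse[OF as(41) z0]
      proof eventually_elim
        case (elim w)
        have w0: "w \<in> ball 0 1" "w \<noteq> 0" using elim by auto
        have i: "\<phi>t11 (1 / w) = inversion p p \<phi>t11 w" "\<phi>t12 (1 / w) = inversion p q \<phi>t12 w"
          using w0 by (auto simp: inversion_def)
        note c = mat_fun_carrier[OF \<phi>11 w0(1)] mat_fun_carrier[OF \<phi>12 w0(1)]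
        have wc: "w11 (1 / w) \<in> carrier_mat p p" "w12 (1 / w) \<in> carrier_mat p q"
          unfolding w using lrc[OF C1 C1] lrc[OF C1 C2] by (auto intro: minus_carrier_mat)
        have "reflect b1 w * hcat (w11 (1 / w)) (w12 (1 / w)) = hcat (inversion p p \<phi>t11 w) (inversion p q \<phi>t12 w)"
          unfolding elim(3) i using elim(2) hcat_carrier[OF c] by (intro left_inverse_cancel[of _ p]) auto
        hence e: "hcat (inversion p p \<phi>t11 w) (inversion p q \<phi>t12 w) = hcat (reflect b1 w * w11 (1 / w)) (reflect b1 w * w12 (1 / w))"
          using mult_hcat[OF _ wc, of "reflect b1 w" p] elim(2) by simp
        show ?case using hcat_eqD[OF e c(1) _ c(2)] wc elim(2) by (meson mult_carrier_mat)
      qed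
    qed
    have swap: "transfer_block Ca Cb N M X (cnj \<mu>) w = (-1) \<cdot>\<^sub>m transfer_block Ca Cb M N X \<mu> (1 / w)"
      if "Ca \<in> carrier_mat r n" "Cb \<in> carrier_mat s n" "w \<noteq> 0" "det (N - w \<cdot>\<^sub>m M) \<noteq> 0" for Ca Cb r s w
      by (rule transfer_block_swap[OF M N Xc that(1,2) \<mu> regular(2)[OF mc(2)] that(3,4)])
    have \<phi>12b: "\<forall>\<^sub>F w in at z. det (N - w \<cdot>\<^sub>m M) \<noteq> 0 \<longrightarrow>
        inversion p q \<phi>t12 w = reflect b1 w * ((-1) \<cdot>\<^sub>m transfer_block C1 C2 N M X (cnj \<mu>) w)"
      and \<phi>11b: "\<forall>\<^sub>F w in at z. det (N - w \<cdot>\<^sub>m M) \<noteq> 0 \<longrightarrow>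
        inversion p p \<phi>t11 w = reflect b1 w * (1\<^sub>m p + transfer_block C1 C1 N M X (cnj \<mu>) w)"
      if z: "z \<in> ball 0 1 - {0}" for z
    proof -
      have m: "1\<^sub>m p - Y = 1\<^sub>m p + (-1) \<cdot>\<^sub>m Y" "(-1) \<cdot>\<^sub>m ((-1) \<cdot>\<^sub>m Y) = Y" for Y :: "complex mat"
        by (auto intro!: eq_matI)
      show "\<forall>\<^sub>F w in at z. det (N - w \<cdot>\<^sub>m M) \<noteq> 0 \<longrightarrow>
          inversion p q \<phi>t12 w = reflect b1 w * ((-1) \<cdot>\<^sub>m transfer_block C1 C2 N M X (cnj \<mu>) w)"
        using inb[OF z] \<phi>1b[OF z] by eventually_elim (simp add: w swap[OF C1 C2] m)
      show "\<forall>\<^sub>F w in at z. det (N - w \<cdot>\<^sub>m M) \<noteq> 0 \<longrightarrow>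
          inversion p p \<phi>t11 w = reflect b1 w * (1\<^sub>m p + transfer_block C1 C1 N M X (cnj \<mu>) w)"
        using inb[OF z] \<phi>1b[OF z] by eventually_elim (simp add: w swap[OF C1 C1] m)
    qed
    note main = coprime_pencil_zero_count[where M = N and N = M and P = P and X = X and ?C1.0 = C2 and ?C2.0 = C1
          and \<mu> = "cnj \<mu>" and b = "reflect b1" and \<theta> = "reflect \<theta>l" and \<phi> = \<phi>' and Hr = Hr and n = n and p = q and q = p and d = d
          and Rb = Rb and R\<theta> = R\<theta> and \<epsilon> = "reflect \<epsilon>l" and ?\<phi>21.0 = "inversion p q \<phi>t12" and ?\<phi>22.0 = "inversion p p \<phi>t11" and \<kappa> = \<kappa>2]
    have V: "hol_mat (ball 0 1) p p V" unfolding V_def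
      by (rule fun_alg.mat_add[OF fa fun_alg.mat_mult[OF fa \<phi>12 \<epsilon>] fun_alg.mat_mult[OF fa \<phi>11 inner_mvf_hol[OF \<theta>]]])
    have fin: "finite {z\<in>ball 0 1. det (V z) = 0}" unfolding V_def by (rule main(1)) (fact | fact regular mc)+
    have cnt: "zero_count 1 (\<lambda>z. det (V z)) = int (\<kappa>1 + \<kappa>2)" unfolding V_def \<kappa>1 by (rule main(2)) (fact | fact regular mc)+
    have G2V: "G2 z = reflect V z" if z: "z \<in> ball 0 1" for z
    proof -
      have zc: "cnj z \<in> ball 0 1" using z by simp
      note c = mat_fun_carrier[OF \<phi>12 zc] mat_fun_carrier[OF \<epsilon> zc] mat_fun_carrier[OF \<phi>11 zc] mat_fun_carrier[OF inner_mvf_hol[OF \<theta>] zc]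
      have r: "mat_adjoint (reflect \<epsilon>l (cnj z)) = \<epsilon>l z" "mat_adjoint (reflect \<theta>l (cnj z)) = \<theta>l z" by (simp_all add: reflect_def)
      have "reflect V z = \<epsilon>l z * reflect (inversion p q \<phi>t12) z + \<theta>l z * reflect (inversion p p \<phi>t11) z"
        unfolding reflect_def[of V]
        unfolding V_def mat_adjoint_add[OF mult_carrier_mat[OF c(1,2)] mult_carrier_mat[OF c(3,4)]]
          mat_adjoint_mult[OF c(1,2)] mat_adjoint_mult[OF c(3,4)] r by (simp add: reflect_def)
      also have "\<dots> = \<theta>l z * reflect (inversion p p \<phi>t11) z + \<epsilon>l z * reflect (inversion p q \<phi>t12) z"
        using mult_carrier_mat[OF mat_fun_carrier[OF \<epsilon>l(1) z] mat_adjoint_carrier[OF c(1)]]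
          mult_carrier_mat[OF mat_fun_carrier[OF inner_mvf_hol[OF \<theta>l] z] mat_adjoint_carrier[OF c(3)]]
        unfolding reflect_def by (rule comm_add_mat)
      finally show ?thesis by (simp add: G2_def mvf_sharp_eq_reflect)
    qed
    have G2: "hol_mat (ball 0 1) p p G2"
      by (rule fun_alg.mat_cong[OF fa hol_mat_reflect[OF V]]) (simp add: G2V)
    have dV: "det (G2 z) = cnj (det (V (cnj z)))" if z: "z \<in> ball 0 1" for z
      unfolding G2V[OF z] reflect_def by (rule det_mat_adjoint[OF mat_fun_carrier[OF V]]) (use z in simp)
    note zr = zero_count_reflect[OF fun_alg.det[OF fa V] fin]
    have "{z\<in>ball 0 1. det (G2 z) = 0} = {z\<in>ball 0 1. cnj (det (V (cnj z))) = 0}" using dV by auto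
    hence fin2: "finite {z\<in>ball 0 1. det (G2 z) = 0}" using zr(2) by simp
    have cnt2: "zero_count 1 (\<lambda>z. det (G2 z)) = int (\<kappa>1 + \<kappa>2)"
      using zero_count_cong[of "\<lambda>z. det (G2 z)", OF dV] zr(1) cnt by simp
    show ?thesis using zero_mult_from_count[OF G2 _ fin2 cnt2] as(1) by simp
  qed

  show ?thesis using count1 count2 unfolding G1_def G2_def Let_def by simp
qed

end
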